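(* Let $(M,g,J)$ be a compact fiberwise Kähler toric manifold of cohomogeneity one such that $M$ is a $\mathbb CP^{(d_1+2)/2}$-bundle over a product of Kähler–Einstein manifolds $M_2\times\dots\times M_m$ (as described in the context). Every such manifold admits, up to scaling, an $(m-1)$-parameter family of extremal Kähler metrics.
   Context: A Kähler metric is extremal if it is a critical point of $\int S^2\,d\mathrm{vol}$ among Kähler metrics in its Kähler class; equivalently the gradient of the scalar curvature $S$ is a holomorphic vector field. Setting (cohomogeneity-one fiberwise Kähler toric manifolds, "Construction Two"): $(M_i,g_i^* )$, $1\le i\le m$, are compact Kähler–Einstein manifolds of real dimension $d_i$ with Einstein constant $1$ and Kähler forms $\omega_i^*$, with $M_1\cong\mathbb CP^{d_1/2}$. Each principal orbit is a principal $S^1$-bundle $\pi:P\to M_1\times\dots\times M_m$ with connection form $\theta$, $d\theta=\pi^*\sum_i b_i\omega_i^*$, the $b_i$ being constants determined by the bundle, with $b_1=\frac{2}{d_1+2}$. On the open dense union of principal orbits, parametrized by $x\in(0,1)$ (after translation and scaling), the Kähler metric is $$g=\frac1{h}\,dx^2+h\,\theta\otimes\theta+\sum_{i=1}^m A_i\,\pi^*g_i^*,\qquad h=h(x)>0,\quad A_i=b_ix+a_i>0,$$ with $\theta$ dual to the generator $\partial_\phi$ of the $S^1$-fibres, and $J$ mapping the $x$-direction to the $\partial_\phi$-direction and restricting to the lifts of the complex structures of the $M_i$. There are two special orbits: at $x=0$ the $S^1$-fibre collapses together with $M_1$ ($A_1(0)=0$, i.e. $a_1=0$), and at $x=1$ only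 the $S^1$-fibre collapses; $A_i>0$ on $[0,1]$ for $2\le i\le m$; and $h(0)=h(1)=0$, $h'(0)=2$, $h'(1)=-2$. The total space $M$ is then a $\mathbb CP^{(d_1+2)/2}$-bundle over $M_2\times\dots\times M_m$. The $b_i$ are fixed by the manifold, while $h$ and $a_2,\dots,a_m$ vary with the metric. The metrics asserted are of this same form. *)

theory Defs
  imports "HOL-Analysis.Analysis"
begin

section \<open>Smooth and holomorphic maps between coordinate domains\<close>

definition dird :: "('a::real_normed_vector \<Rightarrow> 'b::real_normed_vector) \<Rightarrow> 'a \<Rightarrow> 'a \<Rightarrow> 'b" where
  "dird f u v = vector_derivative (\<lambda>t::real. f (u + t *\<^sub>R v)) (at 0)"

text \<open>\<open>smooth_on V S f\<close> is meant for a linear subspace \<open>V\<close> and a subset \<open>S\<close> that is open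
  relative to \<open>V\<close>: all iterated directional derivatives of \<open>f\<close> along vectors of \<open>V\<close> exist and
  are continuous on \<open>S\<close>.  Working with subspaces of one ambient space allows manifolds of
  different dimensions to share their coordinate type.\<close>

primrec Ck_on :: "nat \<Rightarrow> 'a::real_normed_vector set \<Rightarrow> 'a set \<Rightarrow> ('a \<Rightarrow> 'b::real_normed_vector) \<Rightarrow> bool" where
  "Ck_on 0 V S f \<longleftrightarrow> continuous_on S f"
| "Ck_on (Suc k) V S f \<longleftrightarrow> continuous_on S f \<and>
     (\<forall>v\<in>V. (\<forall>u\<in>S. (\<lambda>t::real. f (u + t *\<^sub>R v)) differentiable (at 0)) \<and>
            Ck_on k V S (\<lambda>u. dird f u v))"

definition smooth_on :: "'a::real_normed_vector set \<Rightarrow> 'a set \<Rightarrow> ('a \<Rightarrow> 'b::real_normed_vector) \<Rightarrow> bool" where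
  "smooth_on V S f \<longleftrightarrow> (\<forall>k. Ck_on k V S f)"

definition cspace :: "'n set \<Rightarrow> (complex^'n) set" where
  "cspace B = {z. \<forall>j. j \<notin> B \<longrightarrow> z $ j = 0}"

text \<open>\<open>J\<close> is multiplication by the imaginary unit on the source.\<close>

definition holo_on :: "('a::real_normed_vector \<Rightarrow> 'a) \<Rightarrow> 'a set \<Rightarrow> 'a set \<Rightarrow> ('a \<Rightarrow> complex^'n) \<Rightarrow> bool" where
  "holo_on J V S f \<longleftrightarrow> smooth_on V S f \<and>
     (\<forall>u\<in>S. \<forall>v\<in>V. dird f u (J v) = \<i> *s dird f u v)"


section \<open>Complex manifolds\<close>

record ('p, 'n) cmanifold =
  mtop :: "'p topology"
  coords :: "'n set"
  charts :: "('p set \<times> ('p \<Rightarrow> complex^'n)) set"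

type_synonym ('p, 'n) chart = "'p set \<times> ('p \<Rightarrow> complex^'n)"

abbreviation pts :: "('p, 'n::finite) cmanifold \<Rightarrow> 'p set" where
  "pts M \<equiv> topspace (mtop M)"

text \<open>The model space of \<open>M\<close>, hence also every tangent space of \<open>M\<close> read in a chart.\<close>

abbreviation model :: "('p, 'n::finite) cmanifold \<Rightarrow> (complex^'n) set" where
  "model M \<equiv> cspace (coords M)"

abbreviation real_dim :: "('p, 'n::finite) cmanifold \<Rightarrow> nat" where
  "real_dim M \<equiv> 2 * card (coords M)"

abbreviation cinv :: "('p, 'n::finite) chart \<Rightarrow> complex^'n \<Rightarrow> 'p" where
  "cinv c \<equiv> inv_into (fst c) (snd c)"

abbreviation img :: "('p, 'n::finite) chart \<Rightarrow> (complex^'n) set" where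
  "img c \<equiv> snd c ` fst c"

text \<open>Second countability is not required because only compact manifolds occur below, where it is
  automatic.\<close>

definition complex_manifold :: "('p, 'n::finite) cmanifold \<Rightarrow> bool" where
  "complex_manifold M \<longleftrightarrow>
     Hausdorff_space (mtop M) \<and>
     pts M = (\<Union>c\<in>charts M. fst c) \<and>
     (\<forall>c\<in>charts M.
        openin (mtop M) (fst c) \<and>
        openin (top_of_set (model M)) (img c) \<and>
        homeomorphic_map (subtopology (mtop M) (fst c)) (top_of_set (img c)) (snd c)) \<and>
     (\<forall>c\<in>charts M. \<forall>c'\<in>charts M.
        holo_on ((*s) \<i>) (model M) (snd c ` (fst c \<inter> fst c')) (snd c' \<circ> cinv c))"

definition closed_complex_manifold :: "('p, 'n::finite) cmanifold \<Rightarrow> bool" where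
  "closed_complex_manifold M \<longleftrightarrow>
     complex_manifold M \<and> compact_space (mtop M) \<and> connected_space (mtop M) \<and>
     pts M \<noteq> {} \<and> coords M \<noteq> {}"

definition smooth_fun :: "('p, 'n::finite) cmanifold \<Rightarrow> 'p set \<Rightarrow> ('p \<Rightarrow> real) \<Rightarrow> bool" where
  "smooth_fun M W f \<longleftrightarrow>
     (\<forall>c\<in>charts M. smooth_on (model M) (snd c ` (fst c \<inter> W)) (f \<circ> cinv c))"

definition holo_map :: "('p, 'n::finite) cmanifold \<Rightarrow> 'p set \<Rightarrow> ('q, 'n) cmanifold \<Rightarrow> ('p \<Rightarrow> 'q) \<Rightarrow> bool" where
  "holo_map M W N f \<longleftrightarrow>
     continuous_map (subtopology (mtop M) W) (mtop N) f \<and>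
     (\<forall>c\<in>charts M. \<forall>c'\<in>charts N.
        holo_on ((*s) \<i>) (model M) (snd c ` (fst c \<inter> W \<inter> f -` fst c')) (snd c' \<circ> f \<circ> cinv c))"

text \<open>Differential of a map, read in a chart of the source and a chart of the target, and
  differential of a function.\<close>

definition dmap :: "('p, 'n::finite) chart \<Rightarrow> ('q, 'n) chart \<Rightarrow> ('p \<Rightarrow> 'q) \<Rightarrow> 'p \<Rightarrow> complex^'n \<Rightarrow> complex^'n" where
  "dmap c c' f p v = dird (snd c' \<circ> f \<circ> cinv c) (snd c p) v"

definition dfun :: "('p, 'n::finite) chart \<Rightarrow> ('p \<Rightarrow> real) \<Rightarrow> 'p \<Rightarrow> complex^'n \<Rightarrow> real" where
  "dfun c f p v = dird (f \<circ> cinv c) (snd c p) v"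

definition chart_at :: "('p, 'n::finite) cmanifold \<Rightarrow> 'p \<Rightarrow> ('p, 'n) chart" where
  "chart_at M p = (SOME c. c \<in> charts M \<and> p \<in> fst c)"


section \<open>Projective spaces and projective bundles\<close>

definition cscale :: "complex \<Rightarrow> complex \<times> (complex^'n) \<Rightarrow> complex \<times> (complex^'n)" where
  "cscale l z = (l * fst z, l *s snd z)"

text \<open>\<open>M\<close> is biholomorphic to the quotient of $C^{k+1} \setminus 0$ by $C^*$, where \<open>k\<close> is the
  complex dimension of \<open>M\<close>; \<open>q\<close> is the quotient map.  The induced map from projective space is a
  holomorphic bijection between manifolds of equal dimension, hence biholomorphic.\<close>

definition projective_space :: "('p, 'n::finite) cmanifold \<Rightarrow> bool" where
  "projective_space M \<longleftrightarrow>
     (let Z = (UNIV \<times> model M) - {0} in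
      \<exists>q :: complex \<times> (complex^'n) \<Rightarrow> 'p.
        q ` Z = pts M \<and>
        (\<forall>z\<in>Z. \<forall>w\<in>Z. q z = q w \<longleftrightarrow> (\<exists>l. l \<noteq> 0 \<and> w = cscale l z)) \<and>
        continuous_map (top_of_set Z) (mtop M) q \<and>
        (\<forall>c\<in>charts M. holo_on (cscale \<i>) (UNIV \<times> model M) (Z \<inter> q -` fst c) (snd c \<circ> q)))"

text \<open>The map \<open>(\<pi> i)\<^sub>i\<close> from \<open>M\<close> to the product of the \<open>N i\<close> is a locally trivial holomorphic
  bundle whose fibre \<open>F\<close> is projective \<open>k\<close>-space; \<open>t\<close> is the fibre component of a local
  trivialization.\<close>

definition projective_bundle ::
    "nat \<Rightarrow> ('p, 'n::finite) cmanifold \<Rightarrow> nat set \<Rightarrow> (nat \<Rightarrow> ('q, 'n) cmanifold) \<Rightarrow> (nat \<Rightarrow> 'p \<Rightarrow> 'q) \<Rightarrow> bool" where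
  "projective_bundle k M I N \<pi> \<longleftrightarrow>
     (\<forall>i\<in>I. holo_map M (pts M) (N i) (\<pi> i)) \<and>
     (\<exists>F :: ('p, 'n) cmanifold.
        complex_manifold F \<and> card (coords F) = k \<and> projective_space F \<and>
        (\<forall>y \<in> (\<Pi>\<^sub>E i\<in>I. pts (N i)). \<exists>W t.
           openin (product_topology (\<lambda>i. mtop (N i)) I) W \<and> y \<in> W \<and>
           (let U = {p \<in> pts M. (\<lambda>i\<in>I. \<pi> i p) \<in> W} in
            holo_map M U F t \<and>
            bij_betw (\<lambda>p. (\<lambda>i\<in>I. \<pi> i p, t p)) U (W \<times> pts F))))"


section \<open>Tensor fields\<close>

text \<open>Tensor fields are given by their components in every chart, subject to the transformation
  rule on overlaps.\<close>

type_synonym ('p, 'n) one_form = "('p, 'n) chart \<Rightarrow> 'p \<Rightarrow> complex^'n \<Rightarrow> real"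
type_synonym ('p, 'n) bilinear_field = "('p, 'n) chart \<Rightarrow> 'p \<Rightarrow> complex^'n \<Rightarrow> complex^'n \<Rightarrow> real"

definition smooth_one_form :: "('p, 'n::finite) cmanifold \<Rightarrow> 'p set \<Rightarrow> ('p, 'n) one_form \<Rightarrow> bool" where
  "smooth_one_form M W \<theta> \<longleftrightarrow>
     (\<forall>c\<in>charts M.
        (\<forall>p \<in> fst c \<inter> W. \<forall>v\<in>model M. \<forall>w\<in>model M. \<forall>r.
           \<theta> c p (v + r *\<^sub>R w) = \<theta> c p v + r * \<theta> c p w) \<and>
        (\<forall>c'\<in>charts M. \<forall>p \<in> fst c \<inter> fst c' \<inter> W. \<forall>v\<in>model M.
           \<theta> c p v = \<theta> c' p (dmap c c' id p v)) \<and>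
        (\<forall>v\<in>model M. smooth_on (model M) (snd c ` (fst c \<inter> W)) (\<lambda>u. \<theta> c (cinv c u) v)))"

definition riemannian_metric :: "('p, 'n::finite) cmanifold \<Rightarrow> ('p, 'n) bilinear_field \<Rightarrow> bool" where
  "riemannian_metric M g \<longleftrightarrow>
     (\<forall>c\<in>charts M.
        (\<forall>p \<in> fst c. \<forall>v\<in>model M. \<forall>w\<in>model M.
           g c p v w = g c p w v \<and>
           (\<forall>z\<in>model M. \<forall>r. g c p (v + r *\<^sub>R w) z = g c p v z + r * g c p w z) \<and>
           (v \<noteq> 0 \<longrightarrow> g c p v v > 0)) \<and>
        (\<forall>c'\<in>charts M. \<forall>p \<in> fst c \<inter> fst c'. \<forall>v\<in>model M. \<forall>w\<in>model M.
           g c p v w = g c' p (dmap c c' id p v) (dmap c c' id p w)) \<and>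
        (\<forall>v\<in>model M. \<forall>w\<in>model M. smooth_on (model M) (img c) (\<lambda>u. g c (cinv c u) v w)))"

definition homothetic :: "('p, 'n::finite) cmanifold \<Rightarrow> ('p, 'n) bilinear_field \<Rightarrow> ('p, 'n) bilinear_field \<Rightarrow> bool" where
  "homothetic M g g' \<longleftrightarrow>
     (\<exists>k>0. \<forall>c\<in>charts M. \<forall>p\<in>fst c. \<forall>v\<in>model M. \<forall>w\<in>model M. g' c p v w = k * g c p v w)"

text \<open>Pullback along \<open>f\<close> of a bilinear tensor field on \<open>N\<close>; by the transformation rule the choice
  made by \<open>chart_at\<close> does not matter.\<close>

definition pullback ::
    "('q, 'n::finite) cmanifold \<Rightarrow> ('p \<Rightarrow> 'q) \<Rightarrow> ('q, 'n) bilinear_field \<Rightarrow> ('p, 'n) bilinear_field" where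
  "pullback N f g = (\<lambda>c p v w.
     let c' = chart_at N (f p) in g c' (f p) (dmap c c' f p v) (dmap c c' f p w))"

definition kahler_form :: "('p, 'n::finite) bilinear_field \<Rightarrow> ('p, 'n) bilinear_field" where
  "kahler_form g = (\<lambda>c p v w. g c p (\<i> *s v) w)"

text \<open>Components of a tensor field as functions on the coordinate domain of a chart.\<close>

definition loc :: "('p, 'n::finite) chart \<Rightarrow> (('p, 'n) chart \<Rightarrow> 'p \<Rightarrow> 'x) \<Rightarrow> complex^'n \<Rightarrow> 'x" where
  "loc c T = (\<lambda>u. T c (cinv c u))"

definition ext_deriv1 :: "(complex^'n \<Rightarrow> complex^'n \<Rightarrow> real) \<Rightarrow> complex^'n \<Rightarrow> complex^'n \<Rightarrow> complex^'n \<Rightarrow> real" where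
  "ext_deriv1 \<alpha> u v w = dird (\<lambda>u. \<alpha> u w) u v - dird (\<lambda>u. \<alpha> u v) u w"

definition ext_deriv2 ::
    "(complex^'n \<Rightarrow> complex^'n \<Rightarrow> complex^'n \<Rightarrow> real) \<Rightarrow> complex^'n \<Rightarrow> complex^'n \<Rightarrow> complex^'n \<Rightarrow> complex^'n \<Rightarrow> real" where
  "ext_deriv2 \<omega> u v w z = dird (\<lambda>u. \<omega> u w z) u v + dird (\<lambda>u. \<omega> u z v) u w + dird (\<lambda>u. \<omega> u v w) u z"

definition kahler_metric :: "('p, 'n::finite) cmanifold \<Rightarrow> ('p, 'n) bilinear_field \<Rightarrow> bool" where
  "kahler_metric M g \<longleftrightarrow>
     riemannian_metric M g \<and>
     (\<forall>c\<in>charts M. \<forall>p\<in>fst c. \<forall>v\<in>model M. \<forall>w\<in>model M. g c p (\<i> *s v) (\<i> *s w) = g c p v w) \<and>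
     (\<forall>c\<in>charts M. \<forall>u\<in>img c. \<forall>v\<in>model M. \<forall>w\<in>model M. \<forall>z\<in>model M.
        ext_deriv2 (loc c (kahler_form g)) u v w z = 0)"


section \<open>Curvature, Einstein and extremal metrics\<close>

text \<open>In this section \<open>G u\<close> is the metric at the coordinate point \<open>u\<close> and \<open>V\<close> the model space.\<close>

definition sharp :: "(complex^'n) set \<Rightarrow> (complex^'n \<Rightarrow> complex^'n \<Rightarrow> real) \<Rightarrow> (complex^'n \<Rightarrow> real) \<Rightarrow> complex^'n" where
  "sharp V b \<alpha> = (THE z. z \<in> V \<and> (\<forall>y\<in>V. b z y = \<alpha> y))"

definition christoffel ::
    "(complex^'n) set \<Rightarrow> (complex^'n \<Rightarrow> complex^'n \<Rightarrow> complex^'n \<Rightarrow> real) \<Rightarrow> complex^'n \<Rightarrow> complex^'n \<Rightarrow> complex^'n \<Rightarrow> complex^'n" where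
  "christoffel V G u v w = sharp V (G u) (\<lambda>y.
     (dird (\<lambda>u. G u w y) u v + dird (\<lambda>u. G u v y) u w - dird (\<lambda>u. G u v w) u y) / 2)"

definition riemann ::
    "(complex^'n) set \<Rightarrow> (complex^'n \<Rightarrow> complex^'n \<Rightarrow> complex^'n \<Rightarrow> real) \<Rightarrow> complex^'n \<Rightarrow> complex^'n \<Rightarrow> complex^'n \<Rightarrow> complex^'n \<Rightarrow> complex^'n" where
  "riemann V G u v w z =
     (let \<Gamma> = christoffel V G in
      dird (\<lambda>u. \<Gamma> u w z) u v - dird (\<lambda>u. \<Gamma> u v z) u w + \<Gamma> u v (\<Gamma> u w z) - \<Gamma> u w (\<Gamma> u v z))"

text \<open>For a coordinate subspace \<open>V\<close>, \<open>Basis \<inter> V\<close> is an orthonormal basis of \<open>V\<close>, so the following two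
  sums are traces of linear maps on \<open>V\<close>.\<close>

definition ricci ::
    "(complex^'n) set \<Rightarrow> (complex^'n \<Rightarrow> complex^'n \<Rightarrow> complex^'n \<Rightarrow> real) \<Rightarrow> complex^'n \<Rightarrow> complex^'n \<Rightarrow> complex^'n \<Rightarrow> real" where
  "ricci V G u w z = (\<Sum>e \<in> Basis \<inter> V. riemann V G u e w z \<bullet> e)"

definition scalar_curvature ::
    "(complex^'n) set \<Rightarrow> (complex^'n \<Rightarrow> complex^'n \<Rightarrow> complex^'n \<Rightarrow> real) \<Rightarrow> complex^'n \<Rightarrow> real" where
  "scalar_curvature V G u = (\<Sum>e \<in> Basis \<inter> V. sharp V (G u) (ricci V G u e) \<bullet> e)"

definition gradient ::
    "(complex^'n) set \<Rightarrow> (complex^'n \<Rightarrow> complex^'n \<Rightarrow> complex^'n \<Rightarrow> real) \<Rightarrow> (complex^'n \<Rightarrow> real) \<Rightarrow> complex^'n \<Rightarrow> complex^'n" where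
  "gradient V G f u = sharp V (G u) (dird f u)"

definition einstein_metric :: "real \<Rightarrow> ('p, 'n::finite) cmanifold \<Rightarrow> ('p, 'n) bilinear_field \<Rightarrow> bool" where
  "einstein_metric l M g \<longleftrightarrow>
     riemannian_metric M g \<and>
     (\<forall>c\<in>charts M. \<forall>u\<in>img c. \<forall>v\<in>model M. \<forall>w\<in>model M.
        ricci (model M) (loc c g) u v w = l * loc c g u v w)"

text \<open>In holomorphic charts a real vector field is holomorphic iff its component map is.\<close>

definition extremal_kahler_metric :: "('p, 'n::finite) cmanifold \<Rightarrow> ('p, 'n) bilinear_field \<Rightarrow> bool" where
  "extremal_kahler_metric M g \<longleftrightarrow>
     kahler_metric M g \<and>
     (\<forall>c\<in>charts M.
        holo_on ((*s) \<i>) (model M) (img c)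
          (gradient (model M) (loc c g) (scalar_curvature (model M) (loc c g))))"


section \<open>Circle actions\<close>

text \<open>The circle is the group of reals modulo $2\pi$; it acts by biholomorphisms.\<close>

definition circle_action :: "('p, 'n::finite) cmanifold \<Rightarrow> (real \<Rightarrow> 'p \<Rightarrow> 'p) \<Rightarrow> bool" where
  "circle_action M \<rho> \<longleftrightarrow>
     (\<forall>p\<in>pts M. \<rho> 0 p = p \<and> \<rho> (2 * pi) p = p \<and> (\<forall>s t. \<rho> (s + t) p = \<rho> s (\<rho> t p))) \<and>
     (\<forall>t. holo_map M (pts M) M (\<rho> t)) \<and>
     continuous_map (prod_topology euclideanreal (mtop M)) (mtop M) (\<lambda>(t, p). \<rho> t p) \<and>
     (\<forall>c\<in>charts M. \<forall>c'\<in>charts M.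
        smooth_on (UNIV \<times> model M) {(t, u). u \<in> img c \<and> \<rho> t (cinv c u) \<in> fst c'}
          (\<lambda>(t, u). snd c' (\<rho> t (cinv c u))))"

definition generator :: "(real \<Rightarrow> 'p \<Rightarrow> 'p) \<Rightarrow> ('p, 'n::finite) chart \<Rightarrow> 'p \<Rightarrow> complex^'n" where
  "generator \<rho> c p = vector_derivative (\<lambda>t. snd c (\<rho> t p)) (at 0)"


section \<open>Cohomogeneity-one fiberwise Kaehler toric manifolds\<close>

text \<open>The part of the structure that does not involve the metric on \<open>M\<close>.  \<open>E0\<close> and \<open>E1\<close> are the special
  orbits; on \<open>E0\<close> the circle and \<open>N 1\<close> collapse, on \<open>E1\<close> only the circle does, so that \<open>E0\<close> and
  \<open>E1\<close> are copies of \<open>N 2 \<times> \<dots> \<times> N m\<close> and \<open>N 1 \<times> \<dots> \<times> N m\<close>.  Accordingly \<open>\<pi> i\<close> is defined on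
  all of \<open>M\<close> for \<open>i \<ge> 2\<close> (in \<open>projective_bundle\<close>), and \<open>\<pi> 1\<close> off \<open>E0\<close>.  \<open>\<rho>\<close> is the circle
  action and \<open>\<theta>\<close> the connection form of the circle bundle formed by the principal orbits.\<close>

definition fiberwise_toric_manifold ::
    "nat \<Rightarrow> (nat \<Rightarrow> ('q, 'n::finite) cmanifold) \<Rightarrow> (nat \<Rightarrow> ('q, 'n) bilinear_field) \<Rightarrow> (nat \<Rightarrow> real) \<Rightarrow>
     ('p, 'n) cmanifold \<Rightarrow> 'p set \<Rightarrow> 'p set \<Rightarrow> (real \<Rightarrow> 'p \<Rightarrow> 'p) \<Rightarrow> (nat \<Rightarrow> 'p \<Rightarrow> 'q) \<Rightarrow> ('p, 'n) one_form \<Rightarrow> bool" where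
  "fiberwise_toric_manifold m N gN b M E0 E1 \<rho> \<pi> \<theta> \<longleftrightarrow>
     (let M0 = pts M - E0 - E1 in
      1 \<le> m \<and>
      (\<forall>i\<in>{1..m}. closed_complex_manifold (N i) \<and> kahler_metric (N i) (gN i) \<and>
                   einstein_metric 1 (N i) (gN i)) \<and>
      projective_space (N 1) \<and>
      b 1 = 2 / (real (real_dim (N 1)) + 2) \<and>
      closed_complex_manifold M \<and>
      coords M = UNIV \<and>
      real_dim M = 2 + (\<Sum>i=1..m. real_dim (N i)) \<and>
      projective_bundle ((real_dim (N 1) + 2) div 2) M {2..m} N \<pi> \<and>
      holo_map M (pts M - E0) (N 1) (\<pi> 1) \<and>
      closedin (mtop M) E0 \<and> closedin (mtop M) E1 \<and> E0 \<inter> E1 = {} \<and>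
      (mtop M) closure_of M0 = pts M \<and>
      bij_betw (\<lambda>p. \<lambda>i\<in>{2..m}. \<pi> i p) E0 (\<Pi>\<^sub>E i\<in>{2..m}. pts (N i)) \<and>
      bij_betw (\<lambda>p. \<lambda>i\<in>{1..m}. \<pi> i p) E1 (\<Pi>\<^sub>E i\<in>{1..m}. pts (N i)) \<and>
      circle_action M \<rho> \<and>
      (\<forall>t. \<forall>p \<in> E0 \<union> E1. \<rho> t p = p) \<and>
      (\<forall>p\<in>M0. \<forall>t. \<rho> t p = p \<longleftrightarrow> (\<exists>k::int. t = 2 * pi * of_int k)) \<and>
      (\<forall>p\<in>M0. \<forall>t. \<forall>i\<in>{1..m}. \<pi> i (\<rho> t p) = \<pi> i p) \<and>
      smooth_one_form M M0 \<theta> \<and>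
      (\<forall>c\<in>charts M. \<forall>p \<in> fst c \<inter> M0. \<theta> c p (generator \<rho> c p) = 1) \<and>
      (\<forall>c\<in>charts M. \<forall>c'\<in>charts M. \<forall>t. \<forall>p \<in> fst c \<inter> M0. \<forall>v\<in>model M.
         \<rho> t p \<in> fst c' \<longrightarrow> \<theta> c' (\<rho> t p) (dmap c c' (\<rho> t) p v) = \<theta> c p v) \<and>
      (\<forall>c\<in>charts M. \<forall>p \<in> fst c \<inter> M0. \<forall>v\<in>model M. \<forall>w\<in>model M.
         ext_deriv1 (loc c \<theta>) (snd c p) v w =
           (\<Sum>i=1..m. b i * pullback (N i) (\<pi> i) (kahler_form (gN i)) c p v w)))"

text \<open>The functions $A_i$; the constant $a_1$ is zero because \<open>N 1\<close> collapses at \<open>x = 0\<close>.\<close>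

definition fibre_scale :: "(nat \<Rightarrow> real) \<Rightarrow> (nat \<Rightarrow> real) \<Rightarrow> nat \<Rightarrow> real \<Rightarrow> real" where
  "fibre_scale b a i s = b i * s + (if i = 1 then 0 else a i)"

definition parameters :: "nat \<Rightarrow> (nat \<Rightarrow> real) \<Rightarrow> (nat \<Rightarrow> real) set" where
  "parameters m b =
     {a \<in> ({2..m} \<rightarrow>\<^sub>E UNIV). \<forall>i\<in>{2..m}. \<forall>s\<in>{0..1}. fibre_scale b a i s > 0}"

text \<open>\<open>g\<close> has the prescribed form, with orbit parameter \<open>x\<close>.  The level sets of \<open>x\<close> in \<open>(0,1)\<close> are the
  principal orbits, circle bundles over the product of the \<open>N i\<close>.  The vector field $\partial_x$ is
  the one with \<open>dx = 1\<close> annihilated by \<open>\<theta>\<close> and all \<open>d(\<pi> i)\<close>; as it has length $h^{-1/2}$ and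
  $\partial_\phi$ has length $h^{1/2}$, \<open>J\<close> maps it to $h^{-1}\partial_\phi$.\<close>

definition fiberwise_toric_metric ::
    "nat \<Rightarrow> (nat \<Rightarrow> ('q, 'n::finite) cmanifold) \<Rightarrow> (nat \<Rightarrow> ('q, 'n) bilinear_field) \<Rightarrow> (nat \<Rightarrow> real) \<Rightarrow>
     ('p, 'n) cmanifold \<Rightarrow> 'p set \<Rightarrow> 'p set \<Rightarrow> (real \<Rightarrow> 'p \<Rightarrow> 'p) \<Rightarrow> (nat \<Rightarrow> 'p \<Rightarrow> 'q) \<Rightarrow> ('p, 'n) one_form \<Rightarrow>
     ('p \<Rightarrow> real) \<Rightarrow> (real \<Rightarrow> real) \<Rightarrow> (nat \<Rightarrow> real) \<Rightarrow> ('p, 'n) bilinear_field \<Rightarrow> bool" where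
  "fiberwise_toric_metric m N gN b M E0 E1 \<rho> \<pi> \<theta> x h a g \<longleftrightarrow>
     (let M0 = pts M - E0 - E1;
          d\<pi> = (\<lambda>i c p v. dmap c (chart_at (N i) (\<pi> i p)) (\<pi> i) p v) in
      kahler_metric M g \<and>
      smooth_fun M (pts M) x \<and>
      (\<forall>p\<in>M0. 0 < x p \<and> x p < 1) \<and> (\<forall>p\<in>E0. x p = 0) \<and> (\<forall>p\<in>E1. x p = 1) \<and>
      (\<forall>s\<in>{0<..<1}. \<forall>y \<in> (\<Pi>\<^sub>E i\<in>{1..m}. pts (N i)). \<exists>p\<in>M0. x p = s \<and> (\<forall>i\<in>{1..m}. \<pi> i p = y i)) \<and>
      (\<forall>p\<in>M0. \<forall>q\<in>M0. (\<exists>t. q = \<rho> t p) \<longleftrightarrow> x p = x q \<and> (\<forall>i\<in>{1..m}. \<pi> i p = \<pi> i q)) \<and>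
      (\<exists>S. open S \<and> {0..1} \<subseteq> S \<and> smooth_on UNIV S h) \<and>
      (\<forall>s\<in>{0<..<1}. h s > 0) \<and>
      h 0 = 0 \<and> h 1 = 0 \<and> deriv h 0 = 2 \<and> deriv h 1 = -2 \<and>
      a \<in> parameters m b \<and>
      (\<forall>c\<in>charts M. \<forall>p \<in> fst c \<inter> M0. \<forall>v\<in>model M.
         (dfun c x p v = 1 \<and> \<theta> c p v = 0 \<and> (\<forall>i\<in>{1..m}. d\<pi> i c p v = 0) \<longrightarrow>
            \<i> *s v = (1 / h (x p)) *\<^sub>R generator \<rho> c p) \<and>
         (dfun c x p v = 0 \<and> \<theta> c p v = 0 \<longrightarrow>
            dfun c x p (\<i> *s v) = 0 \<and> \<theta> c p (\<i> *s v) = 0 \<and>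
            (\<forall>i\<in>{1..m}. d\<pi> i c p (\<i> *s v) = \<i> *s d\<pi> i c p v))) \<and>
      (\<forall>c\<in>charts M. \<forall>p \<in> fst c \<inter> M0. \<forall>v\<in>model M. \<forall>w\<in>model M.
         g c p v w =
           1 / h (x p) * dfun c x p v * dfun c x p w
           + h (x p) * \<theta> c p v * \<theta> c p w
           + (\<Sum>i=1..m. fibre_scale b a i (x p) * pullback (N i) (\<pi> i) (gN i) c p v w)))"

end

theory Submission
  imports Defs
begin

text \<open>By the curvature formula for the Calabi ansatz, the scalar curvature of a metric of the prescribed
  form is a function of \<open>x\<close> alone, determined by \<open>h\<close> and the \<open>A i\<close>.  The gradient of \<open>x\<close> is \<open>-J \<xi>\<close>,
  where the generator \<open>\<xi>\<close> of the circle action is holomorphic, so the metric is extremal as soon as the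
  scalar curvature is \<open>\<alpha> x + \<beta>\<close>.  With \<open>p = \<Prod>i. A i ^ n i\<close>, where \<open>n i\<close> is the complex dimension of
  \<open>N i\<close>, this is a second-order linear equation for \<open>p h\<close>; the boundary conditions at \<open>x = 1\<close> determine
  \<open>\<alpha>\<close> and \<open>\<beta>\<close>, and a convexity argument gives \<open>h > 0\<close>.

  To realize a profile \<open>h\<close> and parameters \<open>a\<close> on the given complex manifold, take \<open>x = F x\<^sub>0\<close> with
  \<open>F' h\<^sub>0 = h(F)\<close>, which makes \<open>h\<^sup>-\<^sup>1 dx\<close> and hence \<open>J\<close> unchanged, and add to the Kaehler form the exact
  form \<open>d((F x\<^sub>0 - x\<^sub>0) \<theta>)\<close> and the multiples \<open>a i - a\<^sub>0 i\<close> of the pullbacks of the Kaehler forms of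
  the \<open>N i\<close>.  As the principal orbits are dense, identities and inequalities between smooth tensors need only
  be checked there.

  A homothety with factor \<open>k\<close> multiplies every \<open>A i\<close> by \<open>k\<close>.  Since \<open>A 1 = b 1 x\<close> and \<open>x\<close> ranges over
  \<open>(0,1)\<close> for both metrics, \<open>k = 1\<close>, and the parameters agree.\<close>

section \<open>Directional derivatives and smooth maps\<close>

text \<open>\<open>\<theta>\<close> is controlled only on the principal orbits and
  \<open>\<pi> 1\<close> only off \<open>E0\<close>, so whatever is built from them must be
  rewritten through \<open>g\<close> and the generator before it extends. This succeeds because the
  slopes 2 and -2 are common to all profiles: \<open>h\<^sub>0\<close> vanishes at the ends to
  exactly first order, so \<open>F\<close> is smooth past both ends and \<open>F s - s\<close> is a
  smooth multiple of \<open>h\<^sub>0\<close>. Density yields only weak inequalities; strict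
  positivity on the special orbits needs a uniform bound \<open>g' \<ge> l g\<close> on the
  principal ones.

  No explicit Christoffel symbols of \<open>M\<close> are computed. The Ricci form is half the
  exterior derivative of a trace of the connection. That trace can be read from any operator with
  the metric identity, and in a frame adapted to the fibration it splits into
  \<open>- \<psi> \<theta>\<close> with \<open>\<psi> = (p h)' / p\<close>, base terms and a closed
  form.

  The equation for \<open>p h\<close> is singular at 0, where \<open>p\<close> vanishes. The value
  of \<open>b 1\<close> makes the slope of \<open>h\<close> there 2 automatically, so only two
  conditions at 1 remain. They are linear in \<alpha> and \<beta>, with a determinant of moments
  that is nonzero by the strict Cauchy-Schwarz inequality.\<close>

definition has_dird :: "('a::real_normed_vector \<Rightarrow> 'b::real_normed_vector) \<Rightarrow> 'a \<Rightarrow> 'a \<Rightarrow> 'b \<Rightarrow> bool" where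
  "has_dird f u v D \<longleftrightarrow> ((\<lambda>t::real. f (u + t *\<^sub>R v)) has_vector_derivative D) (at 0)"

text \<open>The domains on which \<open>smooth_on\<close> behaves well: openness is relative to the
  subspace, because only lines in directions of \<open>V\<close> are followed.\<close>

definition rel_open :: "'a::real_normed_vector set \<Rightarrow> 'a set \<Rightarrow> bool" where
  "rel_open V S \<longleftrightarrow> subspace V \<and> openin (top_of_set V) S"

lemma rel_open_UNIV: "rel_open UNIV S \<longleftrightarrow> open S"
  by (simp add: rel_open_def)

lemma rel_open_subset: "rel_open V S \<Longrightarrow> S \<subseteq> V"
  by (auto simp: rel_open_def openin_subtopology)

lemma rel_open_line:
  assumes "rel_open V S" "u \<in> S" "v \<in> V"
  shows "\<forall>\<^sub>F t::real in nhds 0. u + t *\<^sub>R v \<in> S"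
proof -
  from assms(1) obtain T where T: "open T" "S = T \<inter> V" "subspace V"
    unfolding rel_open_def openin_open by blast
  have "continuous_on UNIV (\<lambda>t::real. u + t *\<^sub>R v)"
    by (intro continuous_intros)
  then have "open ((\<lambda>t::real. u + t *\<^sub>R v) -` T)"
    using T(1) by (simp add: open_vimage)
  moreover have "(0::real) \<in> (\<lambda>t::real. u + t *\<^sub>R v) -` T"
    using assms T by auto
  ultimately have "\<forall>\<^sub>F t::real in nhds 0. u + t *\<^sub>R v \<in> T"
    unfolding eventually_nhds by (intro exI[of _ "(\<lambda>t::real. u + t *\<^sub>R v) -` T"]) auto
  moreover have "u + t *\<^sub>R v \<in> V" for t
    using T assms by (simp add: subspace_add subspace_scale)
  ultimately show ?thesis using T by (auto elim: eventually_mono)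
qed

lemma has_dird_dird: "has_dird f u v D \<Longrightarrow> dird f u v = D"
  unfolding has_dird_def dird_def by (rule vector_derivative_at)

lemma has_dird_iff_differentiable:
  "has_dird f u v (dird f u v) \<longleftrightarrow> (\<lambda>t::real. f (u + t *\<^sub>R v)) differentiable (at 0)"
  unfolding has_dird_def dird_def by (simp add: vector_derivative_works)

lemma has_dird_differentiable:
  "has_dird f u v D \<Longrightarrow> (\<lambda>t::real. f (u + t *\<^sub>R v)) differentiable (at 0)"
  using has_dird_iff_differentiable has_dird_dird by metis

lemma has_dird_cong_imp:
  assumes "rel_open V S" "u \<in> S" "v \<in> V" "\<And>x. x \<in> S \<Longrightarrow> f x = g x" "has_dird f u v D"
  shows "has_dird g u v D"
proof -
  have "\<forall>\<^sub>F t::real in nhds 0. f (u + t *\<^sub>R v) = g (u + t *\<^sub>R v)"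
    using rel_open_line[OF assms(1-3)] by eventually_elim (use assms(4) in auto)
  then have "((\<lambda>t::real. f (u + t *\<^sub>R v)) has_vector_derivative D) (at 0) \<longleftrightarrow>
        ((\<lambda>t::real. g (u + t *\<^sub>R v)) has_vector_derivative D) (at 0)"
    by (intro has_vector_derivative_cong_ev) (auto elim: eventually_mono dest: eventually_nhds_x_imp_x)
  then show ?thesis using assms(5) by (simp add: has_dird_def)
qed

lemma has_dird_cong:
  assumes "rel_open V S" "u \<in> S" "v \<in> V" "\<And>x. x \<in> S \<Longrightarrow> f x = g x"
  shows "has_dird f u v D \<longleftrightarrow> has_dird g u v D"
  using has_dird_cong_imp[OF assms(1-3)] assms(4) by metis

text \<open>Differentiability does not enter: \<open>vector_derivative\<close> is a choice that
  depends only on the set of derivatives, and this set is the same for both functions.\<close>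

lemma dird_cong:
  assumes "rel_open V S" "u \<in> S" "v \<in> V" "\<And>x. x \<in> S \<Longrightarrow> f x = g x"
  shows "dird f u v = dird g u v"
proof -
  have "has_dird f u v = has_dird g u v"
    using has_dird_cong[of V S u v f g] assms by blast
  then have "((\<lambda>t. f (u + t *\<^sub>R v)) has_vector_derivative D) (at 0) \<longleftrightarrow>
      ((\<lambda>t. g (u + t *\<^sub>R v)) has_vector_derivative D) (at 0)" for D
    unfolding has_dird_def fun_eq_iff by blast
  then show ?thesis by (simp add: dird_def vector_derivative_def)
qed

lemma has_dird_const [simp]: "has_dird (\<lambda>_. c) u v 0"
  by (simp add: has_dird_def)

lemma dird_const [simp]: "dird (\<lambda>_. c) u v = 0"
  by (rule has_dird_dird) simp

lemma has_dird_add: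
  "has_dird f u v D \<Longrightarrow> has_dird g u v E \<Longrightarrow> has_dird (\<lambda>x. f x + g x) u v (D + E)"
  unfolding has_dird_def by (rule has_vector_derivative_add)

lemma has_dird_minus: "has_dird f u v D \<Longrightarrow> has_dird (\<lambda>x. - f x) u v (- D)"
  unfolding has_dird_def by (rule has_vector_derivative_minus)

lemma has_dird_diff:
  "has_dird f u v D \<Longrightarrow> has_dird g u v E \<Longrightarrow> has_dird (\<lambda>x. f x - g x) u v (D - E)"
  unfolding has_dird_def by (rule has_vector_derivative_diff)

lemma has_dird_sum:
  assumes "\<And>i. i \<in> I \<Longrightarrow> has_dird (f i) u v (D i)"
  shows "has_dird (\<lambda>x. \<Sum>i\<in>I. f i x) u v (\<Sum>i\<in>I. D i)"
  using assms unfolding has_dird_def by (rule has_vector_derivative_sum)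

lemma has_dird_bounded_linear:
  "bounded_linear L \<Longrightarrow> has_dird f u v D \<Longrightarrow> has_dird (\<lambda>x. L (f x)) u v (L D)"
  unfolding has_dird_def by (rule bounded_linear.has_vector_derivative)

lemma has_dird_bilinear:
  assumes "bounded_bilinear p" "has_dird f u v D" "has_dird g u v E"
  shows "has_dird (\<lambda>x. p (f x) (g x)) u v (p (f u) E + p D (g u))"
  using bounded_bilinear.has_vector_derivative[OF assms(1) assms(2,3)[unfolded has_dird_def]]
  by (simp add: has_dird_def)

lemmas has_dird_scaleR = has_dird_bilinear[OF bounded_bilinear_scaleR]
lemmas has_dird_mult = has_dird_bilinear[OF bounded_bilinear_mult]
lemmas has_dird_inner = has_dird_bilinear[OF bounded_bilinear_inner]

lemma has_dird_scale:
  assumes "has_dird f u v D"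
  shows "has_dird f u (r *\<^sub>R v) (r *\<^sub>R D)"
proof -
  have "((\<lambda>t. r * t) has_vector_derivative r) (at 0)"
    by (auto intro!: derivative_eq_intros)
  moreover have "((\<lambda>t. f (u + t *\<^sub>R v)) has_vector_derivative D) (at (r * 0))"
    using assms by (simp add: has_dird_def)
  ultimately have "(((\<lambda>t. f (u + t *\<^sub>R v)) \<circ> (\<lambda>t. r * t)) has_vector_derivative r *\<^sub>R D) (at 0)"
    by (rule vector_diff_chain_at)
  then show ?thesis by (simp add: has_dird_def o_def mult.commute)
qed

lemma has_dird_line:
  assumes "has_dird f (u + s *\<^sub>R v) v D"
  shows "((\<lambda>t. f (u + t *\<^sub>R v)) has_vector_derivative D) (at s)"
proof -
  have "((\<lambda>t::real. t - s) has_vector_derivative 1) (at s)"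
    by (auto intro!: derivative_eq_intros)
  moreover have "((\<lambda>t. f (u + s *\<^sub>R v + t *\<^sub>R v)) has_vector_derivative D) (at (s - s))"
    using assms by (simp add: has_dird_def)
  ultimately have "(((\<lambda>t. f (u + s *\<^sub>R v + t *\<^sub>R v)) \<circ> (\<lambda>t. t - s)) has_vector_derivative 1 *\<^sub>R D) (at s)"
    by (rule vector_diff_chain_at)
  then show ?thesis by (simp add: o_def algebra_simps)
qed

section \<open>Algebra and locality of C^k functions\<close>

lemma Ck_on_SucD:
  "Ck_on (Suc k) V S f \<Longrightarrow> v \<in> V \<Longrightarrow> u \<in> S \<Longrightarrow> has_dird f u v (dird f u v)"
  "Ck_on (Suc k) V S f \<Longrightarrow> v \<in> V \<Longrightarrow> Ck_on k V S (\<lambda>u. dird f u v)"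
  by (auto simp: has_dird_iff_differentiable)

lemma Ck_on_continuous: "Ck_on k V S f \<Longrightarrow> continuous_on S f"
  by (cases k) auto

lemma Ck_on_Suc_lower: "Ck_on (Suc k) V S f \<Longrightarrow> Ck_on k V S f"
proof (induction k arbitrary: f)
  case 0
  then show ?case by simp
next
  case (Suc k)
  show ?case
    unfolding Ck_on.simps(2)[of k]
    using Suc Ck_on.simps(2)[of "Suc k"] by metis
qed

lemma Ck_on_le: "Ck_on k V S f \<Longrightarrow> j \<le> k \<Longrightarrow> Ck_on j V S f"
  by (induction k) (auto simp: le_Suc_eq dest: Ck_on_Suc_lower simp del: Ck_on.simps)

lemma Ck_on_subset: "Ck_on k V S f \<Longrightarrow> T \<subseteq> S \<Longrightarrow> Ck_on k V T f"
  by (induction k arbitrary: f) (auto intro: continuous_on_subset)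

lemma Ck_on_cong:
  assumes "rel_open V S" "\<And>x. x \<in> S \<Longrightarrow> f x = g x"
  shows "Ck_on k V S f \<longleftrightarrow> Ck_on k V S g"
  using assms(2)
proof (induction k arbitrary: f g)
  case 0
  then show ?case by (simp cong: continuous_on_cong_simp)
next
  case (Suc k)
  have c: "continuous_on S f \<longleftrightarrow> continuous_on S g"
    using Suc.prems by (simp cong: continuous_on_cong_simp)
  have d: "dird f u v = dird g u v" if "u \<in> S" "v \<in> V" for u v
    using dird_cong[OF assms(1) that Suc.prems] .
  have h: "has_dird f u v D \<longleftrightarrow> has_dird g u v D" if "u \<in> S" "v \<in> V" for u v D
    using has_dird_cong[OF assms(1) that Suc.prems] .
  have "Ck_on k V S (\<lambda>u. dird f u v) \<longleftrightarrow> Ck_on k V S (\<lambda>u. dird g u v)" if "v \<in> V" for v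
    by (rule Suc.IH) (use d that in auto)
  then show ?case
    using c d h by (auto simp flip: has_dird_iff_differentiable)
qed

text \<open>Allows the derivative to be given by any formula \<open>D\<close> in place of the term
  \<open>dird f u v\<close>, so that closure proofs can run their induction on the formula for the
  derivative.\<close>

lemma Ck_on_SucI:
  assumes "rel_open V S" "continuous_on S f"
    and "\<And>u v. u \<in> S \<Longrightarrow> v \<in> V \<Longrightarrow> has_dird f u v (D u v)"
    and "\<And>v. v \<in> V \<Longrightarrow> Ck_on k V S (\<lambda>u. D u v)"
  shows "Ck_on (Suc k) V S f"
proof -
  have "Ck_on k V S (\<lambda>u. dird f u v)" if "v \<in> V" for v
    using Ck_on_cong[OF assms(1), of "\<lambda>u. dird f u v" "\<lambda>u. D u v" k] assms(3,4) that
    by (auto simp: has_dird_dird)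
  then show ?thesis
    using assms by (auto intro: has_dird_differentiable)
qed

lemma Ck_on_const: "rel_open V S \<Longrightarrow> Ck_on k V S (\<lambda>_. c)"
  by (induction k arbitrary: c) auto

lemma Ck_on_add:
  assumes "rel_open V S"
  shows "Ck_on k V S f \<Longrightarrow> Ck_on k V S g \<Longrightarrow> Ck_on k V S (\<lambda>x. f x + g x)"
proof (induction k arbitrary: f g)
  case (Suc k)
  show ?case
  proof (rule Ck_on_SucI[OF assms, where D="\<lambda>u v. dird f u v + dird g u v"])
    show "continuous_on S (\<lambda>x. f x + g x)"
      using Suc.prems by (intro continuous_on_add Ck_on_continuous)
    show "has_dird (\<lambda>x. f x + g x) u v (dird f u v + dird g u v)" if "u \<in> S" "v \<in> V" for u v
      by (rule has_dird_add[OF Ck_on_SucD(1)[OF Suc.prems(1) that(2,1)] Ck_on_SucD(1)[OF Suc.prems(2) that(2,1)]])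
    show "Ck_on k V S (\<lambda>u. dird f u v + dird g u v)" if "v \<in> V" for v
      by (rule Suc.IH[OF Ck_on_SucD(2)[OF Suc.prems(1) that] Ck_on_SucD(2)[OF Suc.prems(2) that]])
  qed
qed (auto intro: continuous_intros)

lemma Ck_on_bounded_linear:
  assumes "rel_open V S" "bounded_linear L"
  shows "Ck_on k V S f \<Longrightarrow> Ck_on k V S (\<lambda>x. L (f x))"
proof (induction k arbitrary: f)
  case (Suc k)
  show ?case
  proof (rule Ck_on_SucI[OF assms(1), where D="\<lambda>u v. L (dird f u v)"])
    show "continuous_on S (\<lambda>x. L (f x))"
      using Suc.prems by (intro bounded_linear.continuous_on[OF assms(2)] Ck_on_continuous)
    show "has_dird (\<lambda>x. L (f x)) u v (L (dird f u v))" if "u \<in> S" "v \<in> V" for u v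
      by (rule has_dird_bounded_linear[OF assms(2) Ck_on_SucD(1)[OF Suc.prems that(2,1)]])
    show "Ck_on k V S (\<lambda>u. L (dird f u v))" if "v \<in> V" for v
      by (rule Suc.IH[OF Ck_on_SucD(2)[OF Suc.prems that]])
  qed
qed (auto intro: bounded_linear.continuous_on[OF assms(2)])

lemma Ck_on_bilinear:
  assumes "rel_open V S" "bounded_bilinear p"
  shows "Ck_on k V S f \<Longrightarrow> Ck_on k V S g \<Longrightarrow> Ck_on k V S (\<lambda>x. p (f x) (g x))"
proof (induction k arbitrary: f g)
  case (Suc k)
  show ?case
  proof (rule Ck_on_SucI[OF assms(1), where D="\<lambda>u v. p (f u) (dird g u v) + p (dird f u v) (g u)"])
    show "continuous_on S (\<lambda>x. p (f x) (g x))"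
      using Suc.prems by (intro bounded_bilinear.continuous_on[OF assms(2)] Ck_on_continuous)
    show "has_dird (\<lambda>x. p (f x) (g x)) u v (p (f u) (dird g u v) + p (dird f u v) (g u))"
      if "u \<in> S" "v \<in> V" for u v
      by (rule has_dird_bilinear[OF assms(2) Ck_on_SucD(1)[OF Suc.prems(1) that(2,1)] Ck_on_SucD(1)[OF Suc.prems(2) that(2,1)]])
    show "Ck_on k V S (\<lambda>u. p (f u) (dird g u v) + p (dird f u v) (g u))" if "v \<in> V" for v
      by (rule Ck_on_add[OF assms(1) Suc.IH[OF Ck_on_Suc_lower[OF Suc.prems(1)] Ck_on_SucD(2)[OF Suc.prems(2) that]]
            Suc.IH[OF Ck_on_SucD(2)[OF Suc.prems(1) that] Ck_on_Suc_lower[OF Suc.prems(2)]]])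
  qed
qed (auto intro: bounded_bilinear.continuous_on[OF assms(2)])

lemma rel_open_at_within:
  assumes "rel_open V S" "rel_open V T" "T \<subseteq> S" "u \<in> T"
  shows "at u within S = at u within T"
proof -
  from assms(2) obtain W where W: "open W" "T = W \<inter> V" by (auto simp: rel_open_def openin_open)
  have "S \<inter> W - {u} = T \<inter> W - {u}" using W assms(3) rel_open_subset[OF assms(1)] by blast
  then show ?thesis using at_within_nhd[of u W S T] W assms(4) by blast
qed

lemma continuous_on_locally:
  assumes "rel_open V S" "\<And>u. u \<in> S \<Longrightarrow> \<exists>T. u \<in> T \<and> T \<subseteq> S \<and> rel_open V T \<and> continuous_on T f"
  shows "continuous_on S f"
  unfolding continuous_on_eq_continuous_within
proof
  fix u assume "u \<in> S"
  then obtain T where T: "u \<in> T" "T \<subseteq> S" "rel_open V T" "continuous_on T f"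
    using assms(2) by blast
  then show "continuous (at u within S) f"
    using rel_open_at_within[OF assms(1) T(3,2,1)] by (simp add: continuous_on_eq_continuous_within)
qed

lemma Ck_on_locally:
  assumes "rel_open V S" "\<And>u. u \<in> S \<Longrightarrow> \<exists>T. u \<in> T \<and> T \<subseteq> S \<and> rel_open V T \<and> Ck_on k V T f"
  shows "Ck_on k V S f"
  using assms(2)
proof (induction k arbitrary: f)
  case 0
  show ?case unfolding Ck_on.simps
    by (rule continuous_on_locally[OF assms(1)]) (rule 0[unfolded Ck_on.simps])
next
  case (Suc k)
  have ex: "\<exists>T. u \<in> T \<and> T \<subseteq> S \<and> rel_open V T \<and> continuous_on T f \<and>
      (v \<in> V \<longrightarrow> has_dird f u v (dird f u v) \<and> Ck_on k V T (\<lambda>u. dird f u v))" if u: "u \<in> S" for u v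
  proof -
    obtain T where T: "u \<in> T" "T \<subseteq> S" "rel_open V T" "Ck_on (Suc k) V T f"
      using Suc.prems[OF u] by auto
    show ?thesis
      using T Ck_on_SucD[OF T(4)] Ck_on_continuous[OF T(4)] by (intro exI[of _ T]) simp
  qed
  have "continuous_on S f"
    by (rule continuous_on_locally[OF assms(1)]) (use ex in fast)
  moreover have "has_dird f u v (dird f u v)" if "u \<in> S" "v \<in> V" for u v
    using ex[OF that(1), of v] that by fast
  moreover have "Ck_on k V S (\<lambda>u. dird f u v)" if "v \<in> V" for v
    by (rule Suc.IH) (use ex[of _ v] that in fast)
  ultimately show ?case by (rule Ck_on_SucI[OF assms(1)])
qed

lemma smooth_on_continuous: "smooth_on V S f \<Longrightarrow> continuous_on S f"
  unfolding smooth_on_def using Ck_on_continuous by blast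

lemma smooth_on_has_dird: "smooth_on V S f \<Longrightarrow> u \<in> S \<Longrightarrow> v \<in> V \<Longrightarrow> has_dird f u v (dird f u v)"
  unfolding smooth_on_def using Ck_on_SucD(1) by blast

lemma smooth_on_dird: "smooth_on V S f \<Longrightarrow> v \<in> V \<Longrightarrow> smooth_on V S (\<lambda>u. dird f u v)"
  unfolding smooth_on_def using Ck_on_SucD(2) by blast

lemma smooth_on_subset: "smooth_on V S f \<Longrightarrow> T \<subseteq> S \<Longrightarrow> smooth_on V T f"
  unfolding smooth_on_def using Ck_on_subset by blast

lemma smooth_on_cong:
  assumes "rel_open V S" "\<And>x. x \<in> S \<Longrightarrow> f x = g x"
  shows "smooth_on V S f \<longleftrightarrow> smooth_on V S g"
  unfolding smooth_on_def using Ck_on_cong[OF assms] by simp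

lemma smooth_on_locally:
  assumes "rel_open V S" "\<And>u. u \<in> S \<Longrightarrow> \<exists>T. u \<in> T \<and> T \<subseteq> S \<and> rel_open V T \<and> smooth_on V T f"
  shows "smooth_on V S f"
proof -
  have "Ck_on k V S f" for k
  proof (rule Ck_on_locally[OF assms(1)])
    fix u assume "u \<in> S"
    then obtain T where "u \<in> T" "T \<subseteq> S" "rel_open V T" "smooth_on V T f"
      using assms(2) by auto
    then show "\<exists>T. u \<in> T \<and> T \<subseteq> S \<and> rel_open V T \<and> Ck_on k V T f"
      unfolding smooth_on_def by (intro exI[of _ T]) simp
  qed
  then show ?thesis by (simp add: smooth_on_def)
qed

context
  fixes V S :: "'a::real_normed_vector set"
  assumes VS: "rel_open V S"
begin

lemma smooth_on_const: "smooth_on V S (\<lambda>_. c)"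
  by (simp add: smooth_on_def Ck_on_const[OF VS])

lemma smooth_on_add: "smooth_on V S f \<Longrightarrow> smooth_on V S g \<Longrightarrow> smooth_on V S (\<lambda>x. f x + g x)"
  by (simp add: smooth_on_def Ck_on_add[OF VS])

lemma smooth_on_bounded_linear:
  "bounded_linear L \<Longrightarrow> smooth_on V S f \<Longrightarrow> smooth_on V S (\<lambda>x. L (f x))"
  by (simp add: smooth_on_def Ck_on_bounded_linear[OF VS])

lemma smooth_on_bilinear:
  "bounded_bilinear p \<Longrightarrow> smooth_on V S f \<Longrightarrow> smooth_on V S g \<Longrightarrow> smooth_on V S (\<lambda>x. p (f x) (g x))"
  by (simp add: smooth_on_def Ck_on_bilinear[OF VS])

lemma smooth_on_minus: "smooth_on V S f \<Longrightarrow> smooth_on V S (\<lambda>x. - f x)"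
  by (rule smooth_on_bounded_linear[OF bounded_linear_minus[OF bounded_linear_ident]])

lemma smooth_on_diff: "smooth_on V S f \<Longrightarrow> smooth_on V S g \<Longrightarrow> smooth_on V S (\<lambda>x. f x - g x)"
  using smooth_on_add[of f "\<lambda>x. - g x"] smooth_on_minus[of g] by simp

lemma smooth_on_sum: "(\<And>i. i \<in> I \<Longrightarrow> smooth_on V S (f i)) \<Longrightarrow> smooth_on V S (\<lambda>x. \<Sum>i\<in>I. f i x)"
proof (induction I rule: infinite_finite_induct)
  case (insert i I)
  then show ?case by (auto intro!: smooth_on_add)
qed (auto intro: smooth_on_const)

lemmas smooth_on_scaleR = smooth_on_bilinear[OF bounded_bilinear_scaleR]
lemmas smooth_on_mult = smooth_on_bilinear[OF bounded_bilinear_mult]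
lemma smooth_on_prod:
  fixes f :: "'i \<Rightarrow> 'a \<Rightarrow> 'b::{real_normed_algebra, comm_ring_1}"
  shows "(\<And>i. i \<in> I \<Longrightarrow> smooth_on V S (f i)) \<Longrightarrow> smooth_on V S (\<lambda>x. \<Prod>i\<in>I. f i x)"
proof (induction I rule: infinite_finite_induct)
  case (insert i I)
  then show ?case by (auto intro!: smooth_on_mult)
qed (auto intro: smooth_on_const)

lemma smooth_on_power:
  fixes f :: "'a \<Rightarrow> 'b::{real_normed_algebra, comm_ring_1}"
  assumes "smooth_on V S f"
  shows "smooth_on V S (\<lambda>x. f x ^ n)"
  by (induction n) (auto intro!: smooth_on_const smooth_on_mult assms)

lemma smooth_on_id: "smooth_on V S (\<lambda>x. x)"
proof -
  have "Ck_on k V S (\<lambda>x. x)" for k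
  proof (cases k)
    case (Suc j)
    have h: "has_dird (\<lambda>x. x) u v v" for u v :: 'a
      unfolding has_dird_def by (auto intro!: derivative_eq_intros)
    show ?thesis
      unfolding Suc by (rule Ck_on_SucI[OF VS _ h]) (auto intro: Ck_on_const[OF VS])
  qed auto
  then show ?thesis by (simp add: smooth_on_def)
qed

lemma smooth_on_Pair:
  assumes "smooth_on V S f" "smooth_on V S g"
  shows "smooth_on V S (\<lambda>x. (f x, g x))"
proof -
  have "smooth_on V S (\<lambda>x. (f x, 0) + (0, g x))"
    by (rule smooth_on_add[OF
          smooth_on_bounded_linear[OF bounded_linear_Pair[OF bounded_linear_ident bounded_linear_zero] assms(1)]
          smooth_on_bounded_linear[OF bounded_linear_Pair[OF bounded_linear_zero bounded_linear_ident] assms(2)]])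
  then show ?thesis by simp
qed

end

lemma has_dird_inverse:
  fixes f :: "'a::real_normed_vector \<Rightarrow> 'b::real_normed_field"
  assumes "has_dird f u v D" "f u \<noteq> 0"
  shows "has_dird (\<lambda>x. inverse (f x)) u v (- (inverse (f u) * D * inverse (f u)))"
proof -
  have "((\<lambda>t. f (u + t *\<^sub>R v)) has_derivative (\<lambda>t. t *\<^sub>R D)) (at 0)"
    using assms(1) by (simp add: has_dird_def has_vector_derivative_def)
  from Deriv.has_derivative_inverse[OF _ this] show ?thesis
    using assms(2) by (simp add: has_dird_def has_vector_derivative_def)
qed

lemma smooth_on_inverse:
  fixes f :: "'a::real_normed_vector \<Rightarrow> 'b::real_normed_field"
  assumes VS: "rel_open V S" and f: "smooth_on V S f" and nz: "\<And>x. x \<in> S \<Longrightarrow> f x \<noteq> 0"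
  shows "smooth_on V S (\<lambda>x. inverse (f x))"
proof -
  have "Ck_on k V S (\<lambda>x. inverse (f x))" for k
  proof (induction k)
    case 0
    then show ?case using smooth_on_continuous[OF f] nz by (auto intro!: continuous_intros)
  next
    case (Suc k)
    show ?case
    proof (rule Ck_on_SucI[OF VS])
      show "continuous_on S (\<lambda>x. inverse (f x))"
        using smooth_on_continuous[OF f] nz by (auto intro!: continuous_intros)
      show "has_dird (\<lambda>x. inverse (f x)) u v (- (inverse (f u) * dird f u v * inverse (f u)))"
        if "u \<in> S" "v \<in> V" for u v
        using has_dird_inverse smooth_on_has_dird[OF f that] nz that by blast
      show "Ck_on k V S (\<lambda>u. - (inverse (f u) * dird f u v * inverse (f u)))" if "v \<in> V" for v
        using smooth_on_dird[OF f that]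
        by (intro Ck_on_bounded_linear[OF VS bounded_linear_minus[OF bounded_linear_ident]]
             Ck_on_bilinear[OF VS bounded_bilinear_mult] Suc) (simp add: smooth_on_def)
    qed
  qed
  then show ?thesis by (simp add: smooth_on_def)
qed

lemma smooth_on_divide:
  fixes f g :: "'a::real_normed_vector \<Rightarrow> 'b::real_normed_field"
  assumes "rel_open V S" "smooth_on V S f" "smooth_on V S g" "\<And>x. x \<in> S \<Longrightarrow> g x \<noteq> 0"
  shows "smooth_on V S (\<lambda>x. f x / g x)"
  unfolding divide_inverse
  by (rule smooth_on_mult[OF assms(1,2) smooth_on_inverse[OF assms(1,3,4)]])

text \<open>The coordinates of \<open>w\<close> are switched on one at a time, and \<open>F\<close>
  holds those already moved. Each switch is a one-variable mean value estimate whose error is the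
  oscillation \<open>e\<close> of one partial derivative. All intermediate points stay in the ball
  because their coordinates are bounded by those of \<open>w\<close>.\<close>

lemma Ck_1_linear_approx:
  fixes f :: "'a::euclidean_space \<Rightarrow> 'b::real_normed_vector"
  assumes S: "\<And>y. norm (y - u) < d \<Longrightarrow> y \<in> S" and f: "Ck_on 1 UNIV S f"
    and e: "\<And>y b. norm (y - u) < d \<Longrightarrow> b \<in> Basis \<Longrightarrow> norm (dird f y b - dird f u b) \<le> e"
    and w: "norm w < d" and F: "finite F" "F \<subseteq> Basis"
  shows "norm (f (u + (\<Sum>b\<in>F. (w \<bullet> b) *\<^sub>R b)) - f u - (\<Sum>b\<in>F. (w \<bullet> b) *\<^sub>R dird f u b)) \<le> (\<Sum>b\<in>F. \<bar>w \<bullet> b\<bar> * e)"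
  using F
proof (induction F rule: finite_induct)
  case empty
  then show ?case by simp
next
  case (insert b F)
  define p where "p = u + (\<Sum>b\<in>F. (w \<bullet> b) *\<^sub>R b)"
  have d0: "0 < d" using w norm_ge_zero[of w] by linarith
  have near: "norm (p + t *\<^sub>R ((w \<bullet> b) *\<^sub>R b) - u) < d" if "t \<in> {0..1}" for t
  proof -
    have eq: "p + t *\<^sub>R ((w \<bullet> b) *\<^sub>R b) - u = (\<Sum>c\<in>insert b F. ((if c = b then t else 1) * (w \<bullet> c)) *\<^sub>R c)"
    proof -
      have "(\<Sum>c\<in>F. ((if c = b then t else 1) * (w \<bullet> c)) *\<^sub>R c) = (\<Sum>c\<in>F. (w \<bullet> c) *\<^sub>R c)"
        by (rule sum.cong) (use insert in auto)
      then show ?thesis using insert by (simp add: p_def)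
    qed
    have "norm (p + t *\<^sub>R ((w \<bullet> b) *\<^sub>R b) - u) \<le> norm w"
    proof (rule norm_le_componentwise)
      fix c :: 'a assume c: "c \<in> Basis"
      have "(p + t *\<^sub>R ((w \<bullet> b) *\<^sub>R b) - u) \<bullet> c =
        (\<Sum>c'\<in>insert b F. ((if c' = b then t else 1) * (w \<bullet> c')) * (c' \<bullet> c))"
        unfolding eq by (simp add: inner_sum_left)
      also have "\<dots> = (\<Sum>c'\<in>insert b F. if c' = c then (if c' = b then t else 1) * (w \<bullet> c') else 0)"
        by (rule sum.cong) (use insert.prems c in \<open>auto simp: inner_not_same_Basis\<close>)
      also have "\<dots> = (if c \<in> insert b F then (if c = b then t else 1) * (w \<bullet> c) else 0)"
        using insert.hyps by (simp add: sum.delta)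
      finally have "\<bar>(p + t *\<^sub>R ((w \<bullet> b) *\<^sub>R b) - u) \<bullet> c\<bar> \<le> 1 * \<bar>w \<bullet> c\<bar>"
        using that by (auto simp: abs_mult intro!: mult_left_le_one_le)
      then show "\<bar>(p + t *\<^sub>R ((w \<bullet> b) *\<^sub>R b) - u) \<bullet> c\<bar> \<le> \<bar>w \<bullet> c\<bar>" by simp
    qed
    then show ?thesis using w by linarith
  qed
  have b: "b \<in> Basis" using insert by simp
  \<comment> \<open>Subtracting the expected linear part leaves a function whose derivative is an
    oscillation of the partial derivative, scaled by the coordinate
    \<open>w \<bullet> b\<close>.\<close>
  define \<phi> where "\<phi> = (\<lambda>t::real. f (p + t *\<^sub>R ((w \<bullet> b) *\<^sub>R b)) - t *\<^sub>R ((w \<bullet> b) *\<^sub>R dird f u b))"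
  have der: "(\<phi> has_vector_derivative (w \<bullet> b) *\<^sub>R (dird f (p + t *\<^sub>R ((w \<bullet> b) *\<^sub>R b)) b - dird f u b)) (at t)"
    if t: "t \<in> {0..1}" for t
  proof -
    have "has_dird f (p + t *\<^sub>R ((w \<bullet> b) *\<^sub>R b)) b (dird f (p + t *\<^sub>R ((w \<bullet> b) *\<^sub>R b)) b)"
      using Ck_on_SucD(1)[of 0 UNIV S f] f S[OF near[OF t]] by simp
    then have "has_dird f (p + t *\<^sub>R ((w \<bullet> b) *\<^sub>R b)) ((w \<bullet> b) *\<^sub>R b) ((w \<bullet> b) *\<^sub>R dird f (p + t *\<^sub>R ((w \<bullet> b) *\<^sub>R b)) b)"
      by (rule has_dird_scale)
    then have "((\<lambda>t. f (p + t *\<^sub>R ((w \<bullet> b) *\<^sub>R b))) has_vector_derivative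
       (w \<bullet> b) *\<^sub>R dird f (p + t *\<^sub>R ((w \<bullet> b) *\<^sub>R b)) b) (at t)"
      by (rule has_dird_line)
    moreover have "((\<lambda>t. t *\<^sub>R ((w \<bullet> b) *\<^sub>R dird f u b)) has_vector_derivative ((w \<bullet> b) *\<^sub>R dird f u b)) (at t)"
      by (auto intro!: derivative_eq_intros)
    ultimately show ?thesis
      unfolding \<phi>_def using has_vector_derivative_diff by (fastforce simp: algebra_simps)
  qed
  have "norm (\<phi> 1 - \<phi> 0) \<le> (\<bar>w \<bullet> b\<bar> * e) * norm (1 - 0 :: real)"
  proof (rule differentiable_bound[where S="{0..1::real}" and f'="\<lambda>t h. h *\<^sub>R ((w \<bullet> b) *\<^sub>R (dird f (p + t *\<^sub>R ((w \<bullet> b) *\<^sub>R b)) b - dird f u b))"])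
    show "(\<phi> has_derivative (\<lambda>h. h *\<^sub>R ((w \<bullet> b) *\<^sub>R (dird f (p + t *\<^sub>R ((w \<bullet> b) *\<^sub>R b)) b - dird f u b)))) (at t within {0..1})"
      if "t \<in> {0..1}" for t
      using der[OF that] unfolding has_vector_derivative_def by (rule has_derivative_at_withinI)
    show "onorm (\<lambda>h. h *\<^sub>R ((w \<bullet> b) *\<^sub>R (dird f (p + t *\<^sub>R ((w \<bullet> b) *\<^sub>R b)) b - dird f u b))) \<le> \<bar>w \<bullet> b\<bar> * e"
      if "t \<in> {0..1}" for t
    proof (rule onorm_le)
      fix h :: real
      have "norm (dird f (p + t *\<^sub>R ((w \<bullet> b) *\<^sub>R b)) b - dird f u b) \<le> e"
        by (rule e[OF near[OF that] b])
      then show "norm (h *\<^sub>R ((w \<bullet> b) *\<^sub>R (dird f (p + t *\<^sub>R ((w \<bullet> b) *\<^sub>R b)) b - dird f u b))) \<le> \<bar>w \<bullet> b\<bar> * e * norm h"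
        using mult_left_mono[of _ e "\<bar>h * (w \<bullet> b)\<bar>"] by (fastforce simp: abs_mult mult_ac)
    qed
  qed auto
  then have "norm (f (p + (w \<bullet> b) *\<^sub>R b) - f p - (w \<bullet> b) *\<^sub>R dird f u b) \<le> \<bar>w \<bullet> b\<bar> * e"
    by (simp add: \<phi>_def algebra_simps)
  moreover have "norm (f p - f u - (\<Sum>b\<in>F. (w \<bullet> b) *\<^sub>R dird f u b)) \<le> (\<Sum>b\<in>F. \<bar>w \<bullet> b\<bar> * e)"
    using insert unfolding p_def by simp
  ultimately have "norm ((f (p + (w \<bullet> b) *\<^sub>R b) - f p - (w \<bullet> b) *\<^sub>R dird f u b) +
      (f p - f u - (\<Sum>b\<in>F. (w \<bullet> b) *\<^sub>R dird f u b))) \<le> \<bar>w \<bullet> b\<bar> * e + (\<Sum>b\<in>F. \<bar>w \<bullet> b\<bar> * e)"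
    by (rule norm_triangle_mono)
  then show ?case
    using insert by (simp add: p_def algebra_simps)
qed

text \<open>Continuous partial derivatives give a total derivative. From here on
  \<open>dird f u\<close> is known to be linear and the chain rule for \<open>has_derivative\<close>
  is available.\<close>

lemma Ck_1_has_derivative:
  fixes f :: "'a::euclidean_space \<Rightarrow> 'b::real_normed_vector"
  assumes "open S" "Ck_on 1 UNIV S f" "u \<in> S"
  shows "(f has_derivative dird f u) (at u)"
proof -
  define L where "L = (\<lambda>w. \<Sum>b\<in>Basis. (w \<bullet> b) *\<^sub>R dird f u b)"
  have bl: "bounded_linear L"
    unfolding L_def by (intro bounded_linear_intros)
  have "(f has_derivative L) (at u)"
    unfolding has_derivative_at_alt
  proof (intro conjI bl allI impI)
    fix e :: real assume e: "0 < e"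
    \<comment> \<open>The estimate adds up one error per coordinate, so each coordinate gets an
      equal share of \<open>e\<close>.\<close>
    define e' where "e' = e / DIM('a)"
    have e': "e' > 0" using e by (simp add: e'_def)
    have "\<exists>d>0. \<forall>y. norm (y - u) < d \<longrightarrow> y \<in> S \<and> norm (dird f y b - dird f u b) \<le> e'" if "b \<in> Basis" for b
    proof -
      have "continuous_on S (\<lambda>y. dird f y b)"
        using Ck_on_SucD(2)[of 0 UNIV S f b] assms(2) by simp
      then have "continuous (at u) (\<lambda>y. dird f y b)"
        using assms(1,3) continuous_on_eq_continuous_at by blast
      then obtain d1 where d1: "d1 > 0" "\<And>y. dist y u < d1 \<Longrightarrow> dist (dird f y b) (dird f u b) < e'"
        unfolding continuous_at_eps_delta using e' by blast
      obtain d2 where "d2 > 0" "\<And>y. dist y u < d2 \<Longrightarrow> y \<in> S"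
        using assms(1,3) unfolding open_dist by blast
      then show ?thesis
        using d1 by (intro exI[of _ "min d1 d2"]) (auto simp: dist_norm less_imp_le)
    qed
    then obtain d where d: "\<And>b. b \<in> Basis \<Longrightarrow> d b > 0"
      "\<And>b y. b \<in> Basis \<Longrightarrow> norm (y - u) < d b \<Longrightarrow> y \<in> S \<and> norm (dird f y b - dird f u b) \<le> e'"
      by metis
    define \<delta> where "\<delta> = Min (d ` Basis)"
    have \<delta>: "\<delta> > 0" "\<And>b. b \<in> Basis \<Longrightarrow> \<delta> \<le> d b"
      using d by (auto simp: \<delta>_def)
    show "\<exists>d>0. \<forall>y. norm (y - u) < d \<longrightarrow> norm (f y - f u - L (y - u)) \<le> e * norm (y - u)"
    proof (intro exI[of _ \<delta>] conjI \<delta>(1) allI impI)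
      fix y assume y: "norm (y - u) < \<delta>"
      obtain b0 :: 'a where b0: "b0 \<in> Basis" using nonempty_Basis by blast
      have "norm (f (u + (\<Sum>b\<in>Basis. ((y - u) \<bullet> b) *\<^sub>R b)) - f u - (\<Sum>b\<in>Basis. ((y - u) \<bullet> b) *\<^sub>R dird f u b))
          \<le> (\<Sum>b\<in>(Basis::'a set). \<bar>(y - u) \<bullet> b\<bar> * e')"
      proof (rule Ck_1_linear_approx[where d=\<delta> and S=S])
        show "y \<in> S" if "norm (y - u) < \<delta>" for y
          using d(2)[OF b0, of y] \<delta>(2)[OF b0] that by auto
        show "norm (dird f y b - dird f u b) \<le> e'" if "norm (y - u) < \<delta>" "b \<in> Basis" for y b
          using d(2)[OF that(2), of y] \<delta>(2)[OF that(2)] that by auto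
      qed (use y assms in auto)
      also have "\<dots> \<le> (\<Sum>b\<in>(Basis::'a set). norm (y - u) * e')"
        using e' by (intro sum_mono mult_right_mono) (auto simp: Basis_le_norm)
      also have "\<dots> = e * norm (y - u)" by (simp add: e'_def)
      finally show "norm (f y - f u - L (y - u)) \<le> e * norm (y - u)"
        by (simp add: euclidean_representation L_def)
    qed
  qed
  moreover have "dird f u = L"
  proof
    fix v
    have "((\<lambda>t::real. u + t *\<^sub>R v) has_derivative (\<lambda>t. t *\<^sub>R v)) (at 0)"
      by (auto intro!: derivative_eq_intros)
    then have "((\<lambda>t::real. f (u + t *\<^sub>R v)) has_derivative (\<lambda>t. L (t *\<^sub>R v))) (at 0)"
      using has_derivative_compose[of "\<lambda>t::real. u + t *\<^sub>R v" "\<lambda>t. t *\<^sub>R v" 0 UNIV f L]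
        \<open>(f has_derivative L) (at u)\<close> by simp
    then have "has_dird f u v (L v)"
      using bl by (simp add: has_dird_def has_vector_derivative_def linear_simps)
    then show "dird f u v = L v" by (rule has_dird_dird)
  qed
  ultimately show ?thesis by simp
qed

lemma smooth_on_has_derivative:
  fixes f :: "'a::euclidean_space \<Rightarrow> 'b::real_normed_vector"
  assumes "open S" "smooth_on UNIV S f" "u \<in> S"
  shows "(f has_derivative dird f u) (at u)"
  using assms Ck_1_has_derivative unfolding smooth_on_def by blast

lemma has_dird_chain:
  assumes "(f has_derivative f') (at (z u))" "has_dird z u v w"
  shows "has_dird (\<lambda>x. f (z x)) u v (f' w)"
proof -
  interpret f': bounded_linear f' using assms(1) by (rule has_derivative_bounded_linear)
  have "((\<lambda>t. z (u + t *\<^sub>R v)) has_derivative (\<lambda>t. t *\<^sub>R w)) (at 0)"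
    using assms(2) by (simp add: has_dird_def has_vector_derivative_def)
  then have "((\<lambda>t. f (z (u + t *\<^sub>R v))) has_derivative (\<lambda>t. f' (t *\<^sub>R w))) (at 0)"
    using has_derivative_compose[of "\<lambda>t::real. z (u + t *\<^sub>R v)" "\<lambda>t. t *\<^sub>R w" 0 UNIV f f'] assms(1)
    by simp
  then show ?thesis
    by (simp add: has_dird_def has_vector_derivative_def f'.scaleR)
qed

lemma Ck_on_compose:
  fixes z :: "'c::real_normed_vector \<Rightarrow> 'a::euclidean_space"
  assumes VU: "rel_open V U" and S: "open S" and zS: "z ` U \<subseteq> S"
  shows "Ck_on k UNIV S f \<Longrightarrow> Ck_on k V U z \<Longrightarrow> Ck_on k V U (\<lambda>x. f (z x))"
proof (induction k arbitrary: f)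
  case 0
  then show ?case using continuous_on_compose2[of S f U z] zS by auto
next
  case (Suc k)
  have d: "(f has_derivative dird f (z u)) (at (z u))" if "u \<in> U" for u
    using Ck_1_has_derivative[OF S Ck_on_le[OF Suc.prems(1)], of "z u"] that zS by auto
  \<comment> \<open>\<open>Ck_on\<close> controls derivatives of \<open>f\<close> only in fixed
    directions, whereas the chain rule produces the moving direction \<open>dird z u v\<close>. A
    basis expansion turns it into scalar coefficients times derivatives in fixed directions.\<close>
  have lin: "dird f (z u) w = (\<Sum>b\<in>Basis. (w \<bullet> b) *\<^sub>R dird f (z u) b)" if "u \<in> U" for u w
  proof -
    interpret bounded_linear "dird f (z u)" using d[OF that] by (rule has_derivative_bounded_linear)
    have "dird f (z u) w = dird f (z u) (\<Sum>b\<in>Basis. (w \<bullet> b) *\<^sub>R b)"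
      by (simp add: euclidean_representation)
    then show ?thesis by (simp add: sum scale)
  qed
  show ?case
  proof (rule Ck_on_SucI[OF VU, where D="\<lambda>u v. dird f (z u) (dird z u v)"])
    show "continuous_on U (\<lambda>x. f (z x))"
      using continuous_on_compose2[of S f U z] zS Ck_on_continuous[OF Suc.prems(1)]
        Ck_on_continuous[OF Suc.prems(2)] by auto
    show "has_dird (\<lambda>x. f (z x)) u v (dird f (z u) (dird z u v))" if "u \<in> U" "v \<in> V" for u v
      by (rule has_dird_chain[OF d[OF that(1)] Ck_on_SucD(1)[OF Suc.prems(2) that(2,1)]])
    show "Ck_on k V U (\<lambda>u. dird f (z u) (dird z u v))" if v: "v \<in> V" for v
    proof -
      have *: "Ck_on k V U (\<lambda>u. \<Sum>b\<in>F. (dird z u v \<bullet> b) *\<^sub>R dird f (z u) b)" if "finite F" "F \<subseteq> Basis" for F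
        using that
      proof (induction F rule: finite_induct)
        case empty
        then show ?case by (simp add: Ck_on_const[OF VU])
      next
        case (insert b F)
        have "Ck_on k V U (\<lambda>u. dird f (z u) b)"
          by (rule Suc.IH[OF Ck_on_SucD(2)[OF Suc.prems(1)] Ck_on_Suc_lower[OF Suc.prems(2)]]) simp
        moreover have "Ck_on k V U (\<lambda>u. dird z u v \<bullet> b)"
          by (rule Ck_on_bounded_linear[OF VU bounded_linear_inner_left Ck_on_SucD(2)[OF Suc.prems(2) v]])
        ultimately have "Ck_on k V U (\<lambda>u. (dird z u v \<bullet> b) *\<^sub>R dird f (z u) b)"
          using Ck_on_bilinear[OF VU bounded_bilinear_scaleR] by blast
        with insert show ?case by (simp add: Ck_on_add[OF VU])
      qed
      have "Ck_on k V U (\<lambda>u. \<Sum>b\<in>Basis. (dird z u v \<bullet> b) *\<^sub>R dird f (z u) b)"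
        by (rule *) auto
      then show ?thesis
        using Ck_on_cong[OF VU, of "\<lambda>u. dird f (z u) (dird z u v)" "\<lambda>u. \<Sum>b\<in>Basis. (dird z u v \<bullet> b) *\<^sub>R dird f (z u) b" k]
          lin by blast
    qed
  qed
qed

lemma smooth_on_compose:
  fixes z :: "'c::real_normed_vector \<Rightarrow> 'a::euclidean_space"
  assumes "rel_open V U" "open S" "z ` U \<subseteq> S" "smooth_on UNIV S f" "smooth_on V U z"
  shows "smooth_on V U (\<lambda>x. f (z x))"
  using assms(4,5) Ck_on_compose[OF assms(1-3)] unfolding smooth_on_def by blast

text \<open>Symmetry of second derivatives: both mixed derivatives are limits of the same difference
  quotient.\<close>

lemma mixed_difference:
  fixes f :: "'a::euclidean_space \<Rightarrow> real"
  assumes S: "open S" and f: "Ck_on 2 UNIV S f"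
    and h: "h > 0" and sub: "\<And>s t. 0 \<le> s \<Longrightarrow> s \<le> h \<Longrightarrow> 0 \<le> t \<Longrightarrow> t \<le> h \<Longrightarrow> u + s *\<^sub>R v + t *\<^sub>R w \<in> S"
  shows "\<exists>s t. 0 < s \<and> s < h \<and> 0 < t \<and> t < h \<and>
    f (u + h *\<^sub>R v + h *\<^sub>R w) - f (u + h *\<^sub>R v) - f (u + h *\<^sub>R w) + f u =
      h * h * dird (\<lambda>x. dird f x v) (u + s *\<^sub>R v + t *\<^sub>R w) w"
proof -
  have f1: "has_dird f y a (dird f y a)" if "y \<in> S" for y a
    using Ck_on_SucD(1)[of 1 UNIV S f a y] f that by (simp add: numeral_2_eq_2)
  have f2: "has_dird (\<lambda>x. dird f x a) y b (dird (\<lambda>x. dird f x a) y b)" if "y \<in> S" for y a b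
    using Ck_on_SucD(2)[of 1 UNIV S f a] Ck_on_SucD(1)[of 0 UNIV S "\<lambda>x. dird f x a" b y] f that
    by (simp add: numeral_2_eq_2)
  define \<phi> where "\<phi> = (\<lambda>s. f (u + h *\<^sub>R w + s *\<^sub>R v) - f (u + s *\<^sub>R v))"
  have d\<phi>: "(\<phi> has_real_derivative (dird f (u + h *\<^sub>R w + s *\<^sub>R v) v - dird f (u + s *\<^sub>R v) v)) (at s)"
    if "0 \<le> s" "s \<le> h" for s
    unfolding \<phi>_def has_real_derivative_iff_has_vector_derivative
  proof (intro has_vector_derivative_diff has_dird_line f1)
    show "u + h *\<^sub>R w + s *\<^sub>R v \<in> S" using sub[of s h] that h by (simp add: algebra_simps)
    show "u + s *\<^sub>R v \<in> S" using sub[of s 0] that h by simp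
  qed
  obtain s where s: "0 < s" "s < h" "\<phi> h - \<phi> 0 = (h - 0) * (dird f (u + h *\<^sub>R w + s *\<^sub>R v) v - dird f (u + s *\<^sub>R v) v)"
    using MVT2[of 0 h \<phi> "\<lambda>s. dird f (u + h *\<^sub>R w + s *\<^sub>R v) v - dird f (u + s *\<^sub>R v) v"] h d\<phi> by auto
  define \<psi> where "\<psi> = (\<lambda>t. dird f (u + s *\<^sub>R v + t *\<^sub>R w) v)"
  have d\<psi>: "(\<psi> has_real_derivative dird (\<lambda>x. dird f x v) (u + s *\<^sub>R v + t *\<^sub>R w) w) (at t)"
    if "0 \<le> t" "t \<le> h" for t
    unfolding \<psi>_def has_real_derivative_iff_has_vector_derivative
    by (intro has_dird_line f2 sub) (use s that in auto)
  obtain t where t: "0 < t" "t < h" "\<psi> h - \<psi> 0 = (h - 0) * dird (\<lambda>x. dird f x v) (u + s *\<^sub>R v + t *\<^sub>R w) w"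
    using MVT2[of 0 h \<psi> "\<lambda>t. dird (\<lambda>x. dird f x v) (u + s *\<^sub>R v + t *\<^sub>R w) w"] h d\<psi> by auto
  have "f (u + h *\<^sub>R v + h *\<^sub>R w) - f (u + h *\<^sub>R v) - f (u + h *\<^sub>R w) + f u = \<phi> h - \<phi> 0"
    by (simp add: \<phi>_def algebra_simps)
  also have "\<dots> = h * (\<psi> h - \<psi> 0)"
    using s(3) by (simp add: \<psi>_def algebra_simps)
  finally show ?thesis using s t by (intro exI[of _ s] exI[of _ t]) simp
qed

lemma dird_commute_real:
  fixes f :: "'a::euclidean_space \<Rightarrow> real"
  assumes S: "open S" and f: "Ck_on 2 UNIV S f" and u: "u \<in> S"
  shows "dird (\<lambda>x. dird f x v) u w = dird (\<lambda>x. dird f x w) u v"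
proof (rule ccontr)
  assume ne: "dird (\<lambda>x. dird f x v) u w \<noteq> dird (\<lambda>x. dird f x w) u v"
  define e where "e = \<bar>dird (\<lambda>x. dird f x v) u w - dird (\<lambda>x. dird f x w) u v\<bar> / 2"
  have e: "e > 0" using ne by (simp add: e_def)
  have c: "continuous (at u) (\<lambda>y. dird (\<lambda>x. dird f x a) y b)" for a b
  proof -
    have "Ck_on 0 UNIV S (\<lambda>y. dird (\<lambda>x. dird f x a) y b)"
      using Ck_on_SucD(2)[of 1 UNIV S f a] Ck_on_SucD(2)[of 0 UNIV S "\<lambda>x. dird f x a" b] f
      by (simp add: numeral_2_eq_2)
    then show ?thesis using S u continuous_on_eq_continuous_at by auto
  qed
  obtain d1 where d1: "d1 > 0" "\<And>y. dist y u < d1 \<Longrightarrow> dist (dird (\<lambda>x. dird f x v) y w) (dird (\<lambda>x. dird f x v) u w) < e"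
    using c[of v w] e unfolding continuous_at_eps_delta by blast
  obtain d2 where d2: "d2 > 0" "\<And>y. dist y u < d2 \<Longrightarrow> dist (dird (\<lambda>x. dird f x w) y v) (dird (\<lambda>x. dird f x w) u v) < e"
    using c[of w v] e unfolding continuous_at_eps_delta by blast
  obtain d3 where d3: "d3 > 0" "\<And>y. dist y u < d3 \<Longrightarrow> y \<in> S"
    using S u unfolding open_dist by blast
  define d where "d = Min {d1, d2, d3}"
  have d: "d > 0" "d \<le> d1" "d \<le> d2" "d \<le> d3" using d1 d2 d3 by (auto simp: d_def)
  \<comment> \<open>The summand 1 keeps the denominator positive even for \<open>v = w = 0\<close>,
    and the whole parallelogram of side \<open>h\<close> lies strictly within distance
    \<open>d\<close> of \<open>u\<close>.\<close>
  define h where "h = d / (2 * (norm v + norm w + 1))"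
  have pos: "norm v + norm w + 1 > 0" by (simp add: add_nonneg_pos)
  have h: "h > 0" using d pos by (simp add: h_def)
  have near: "dist (u + s *\<^sub>R a + t *\<^sub>R b) u < d"
    if "0 \<le> s" "s \<le> h" "0 \<le> t" "t \<le> h" "(a = v \<and> b = w) \<or> (a = w \<and> b = v)" for s t a b
  proof -
    have "dist (u + s *\<^sub>R a + t *\<^sub>R b) u = norm (s *\<^sub>R a + t *\<^sub>R b)" by (simp add: dist_norm)
    also have "\<dots> \<le> s * norm a + t * norm b"
      using that norm_triangle_ineq[of "s *\<^sub>R a" "t *\<^sub>R b"] by simp
    also have "\<dots> \<le> h * norm a + h * norm b" using that by (intro add_mono mult_right_mono) auto
    also have "\<dots> = h * (norm v + norm w)" using that(5) by (auto simp: algebra_simps)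
    also have "\<dots> < h * (2 * (norm v + norm w + 1))"
      using h pos by (intro mult_strict_left_mono) (auto simp: add_nonneg_pos intro: add_nonneg_nonneg)
    also have "\<dots> = d" using pos by (simp add: h_def)
    finally show ?thesis .
  qed
  have inS: "u + s *\<^sub>R a + t *\<^sub>R b \<in> S"
    if "0 \<le> s" "s \<le> h" "0 \<le> t" "t \<le> h" "(a = v \<and> b = w) \<or> (a = w \<and> b = v)" for s t a b
    by (rule d3(2), rule order_less_le_trans[OF near[OF that] d(4)])
  obtain s t where st: "0 < s" "s < h" "0 < t" "t < h"
    "f (u + h *\<^sub>R v + h *\<^sub>R w) - f (u + h *\<^sub>R v) - f (u + h *\<^sub>R w) + f u =
      h * h * dird (\<lambda>x. dird f x v) (u + s *\<^sub>R v + t *\<^sub>R w) w"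
    using mixed_difference[OF S f h inS[of _ _ v w]] by auto
  obtain s' t' where st': "0 < s'" "s' < h" "0 < t'" "t' < h"
    "f (u + h *\<^sub>R w + h *\<^sub>R v) - f (u + h *\<^sub>R w) - f (u + h *\<^sub>R v) + f u =
      h * h * dird (\<lambda>x. dird f x w) (u + s' *\<^sub>R w + t' *\<^sub>R v) v"
    using mixed_difference[OF S f h inS[of _ _ w v]] by auto
  have "h * h * dird (\<lambda>x. dird f x v) (u + s *\<^sub>R v + t *\<^sub>R w) w
      = h * h * dird (\<lambda>x. dird f x w) (u + s' *\<^sub>R w + t' *\<^sub>R v) v"
    using st(5) st'(5) by (simp add: algebra_simps)
  then have "dird (\<lambda>x. dird f x v) (u + s *\<^sub>R v + t *\<^sub>R w) w = dird (\<lambda>x. dird f x w) (u + s' *\<^sub>R w + t' *\<^sub>R v) v"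
    using h by simp
  moreover have "\<bar>dird (\<lambda>x. dird f x v) (u + s *\<^sub>R v + t *\<^sub>R w) w - dird (\<lambda>x. dird f x v) u w\<bar> < e"
    using d1(2) near[of s t v w] st d by (simp add: dist_real_def)
  moreover have "\<bar>dird (\<lambda>x. dird f x w) (u + s' *\<^sub>R w + t' *\<^sub>R v) v - dird (\<lambda>x. dird f x w) u v\<bar> < e"
    using d2(2) near[of s' t' w v] st' d by (simp add: dist_real_def)
  ultimately show False unfolding e_def by (simp add: abs_if split: if_splits)
qed

lemma Ck_on_dird_commute:
  fixes f :: "'a::euclidean_space \<Rightarrow> 'b::euclidean_space"
  assumes S: "open S" and f: "Ck_on 2 UNIV S f" and u: "u \<in> S"
  shows "dird (\<lambda>x. dird f x v) u w = dird (\<lambda>x. dird f x w) u v"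
proof (rule euclidean_eqI)
  fix b :: 'b assume "b \<in> Basis"
  have V: "rel_open UNIV S" using S by (simp add: rel_open_UNIV)
  have fb: "Ck_on 2 UNIV S (\<lambda>x. f x \<bullet> b)"
    by (rule Ck_on_bounded_linear[OF V bounded_linear_inner_left f])
  have d1: "dird (\<lambda>x. f x \<bullet> b) y a = dird f y a \<bullet> b" if "y \<in> S" for y a
    by (rule has_dird_dird, rule has_dird_bounded_linear[OF bounded_linear_inner_left])
      (use Ck_on_SucD(1)[of 1 UNIV S f a y] f that in \<open>simp add: numeral_2_eq_2\<close>)
  have d2: "dird (\<lambda>x. dird f x a \<bullet> b) u c = dird (\<lambda>x. dird f x a) u c \<bullet> b" for a c
  proof (rule has_dird_dird, rule has_dird_bounded_linear[OF bounded_linear_inner_left])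
    show "has_dird (\<lambda>x. dird f x a) u c (dird (\<lambda>x. dird f x a) u c)"
      using Ck_on_SucD(2)[of 1 UNIV S f a] Ck_on_SucD(1)[of 0 UNIV S "\<lambda>x. dird f x a" c u] f u
      by (simp add: numeral_2_eq_2)
  qed
  have "dird (\<lambda>x. dird (\<lambda>x. f x \<bullet> b) x a) u c = dird (\<lambda>x. dird f x a \<bullet> b) u c" for a c
    by (rule dird_cong[OF V u]) (use d1 in auto)
  then show "dird (\<lambda>x. dird f x v) u w \<bullet> b = dird (\<lambda>x. dird f x w) u v \<bullet> b"
    using dird_commute_real[OF S fb u, of v w] d2 by simp
qed

section \<open>Coordinate subspaces and linear algebra\<close>

definition proj :: "'a::euclidean_space set \<Rightarrow> 'a \<Rightarrow> 'a" where
  "proj V x = (\<Sum>e\<in>Basis \<inter> V. (x \<bullet> e) *\<^sub>R e)"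

text \<open>Subspaces spanned by the standard basis vectors that they contain, so that
  \<open>Basis \<inter> V\<close> is an orthonormal basis of \<open>V\<close> and
  \<open>proj V\<close> is the orthogonal projection.\<close>

definition coord_subspace :: "'a::euclidean_space set \<Rightarrow> bool" where
  "coord_subspace V \<longleftrightarrow> subspace V \<and> (\<forall>v\<in>V. proj V v = v)"

lemma finite_Basis_Int [simp]: "finite (Basis \<inter> V)"
  by simp

lemma coord_subspace_UNIV [simp]: "coord_subspace UNIV"
  by (simp add: coord_subspace_def proj_def euclidean_representation)

lemma coord_subspace_cspace [simp]: "coord_subspace (cspace B :: (complex^'n::finite) set)"
  unfolding coord_subspace_def
proof (intro conjI ballI)
  show "subspace (cspace B :: (complex^'n) set)"
    by (auto simp: cspace_def subspace_def)
  fix v :: "complex^'n" assume v: "v \<in> cspace B"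
  have "proj (cspace B) v = (\<Sum>e\<in>Basis. (v \<bullet> e) *\<^sub>R e)"
    unfolding proj_def
  proof (rule sum.mono_neutral_left)
    show "\<forall>e\<in>Basis - Basis \<inter> cspace B. (v \<bullet> e) *\<^sub>R e = 0"
    proof
      fix e :: "complex^'n" assume e: "e \<in> Basis - Basis \<inter> cspace B"
      then obtain i a where ia: "e = axis i a" by (auto simp: Basis_vec_def)
      have "i \<notin> B"
      proof
        assume "i \<in> B"
        then have "axis i a \<in> cspace B" by (auto simp: cspace_def axis_def)
        with e ia show False by simp
      qed
      then show "(v \<bullet> e) *\<^sub>R e = 0"
        using v ia by (simp add: inner_axis cspace_def)
    qed
  qed auto
  then show "proj (cspace B) v = v" by (simp add: euclidean_representation)
qed

lemma cspace_UNIV [simp]: "cspace UNIV = UNIV"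
  by (simp add: cspace_def)

lemma coord_subspaceD: "coord_subspace V \<Longrightarrow> subspace V"
  by (simp add: coord_subspace_def)

lemma proj_eq: "coord_subspace V \<Longrightarrow> v \<in> V \<Longrightarrow> proj V v = v"
  by (simp add: coord_subspace_def)

lemma proj_in: "subspace V \<Longrightarrow> proj V x \<in> V"
  unfolding proj_def by (intro subspace_sum subspace_scale) auto

lemma bounded_linear_proj: "bounded_linear (proj V)"
  unfolding proj_def[abs_def] by (intro bounded_linear_intros)

lemma proj_line: "proj V (u + t *\<^sub>R v) = proj V u + t *\<^sub>R proj V v"
  using bounded_linear_proj[of V] by (simp add: linear_simps)

text \<open>Linearity is asked on \<open>V\<close> only, since components of tensors carry no
  meaning outside the model space.\<close>

definition linear_on :: "'a::real_vector set \<Rightarrow> ('a \<Rightarrow> 'b::real_vector) \<Rightarrow> bool" where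
  "linear_on V A \<longleftrightarrow> (\<forall>v\<in>V. \<forall>w\<in>V. \<forall>r. A (v + r *\<^sub>R w) = A v + r *\<^sub>R A w)"

definition endo :: "'a::real_vector set \<Rightarrow> ('a \<Rightarrow> 'a) \<Rightarrow> bool" where
  "endo V A \<longleftrightarrow> linear_on V A \<and> (\<forall>v\<in>V. A v \<in> V)"

definition bilinear_on :: "'a::real_vector set \<Rightarrow> ('a \<Rightarrow> 'a \<Rightarrow> real) \<Rightarrow> bool" where
  "bilinear_on V b \<longleftrightarrow> (\<forall>z\<in>V. linear_on V (\<lambda>v. b v z) \<and> linear_on V (b z))"

definition pos_on :: "'a::real_vector set \<Rightarrow> ('a \<Rightarrow> 'a \<Rightarrow> real) \<Rightarrow> bool" where
  "pos_on V b \<longleftrightarrow> (\<forall>v\<in>V. v \<noteq> 0 \<longrightarrow> b v v > 0)"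

definition tr :: "'a::euclidean_space set \<Rightarrow> ('a \<Rightarrow> 'a) \<Rightarrow> real" where
  "tr V A = (\<Sum>e\<in>Basis \<inter> V. A e \<bullet> e)"

context
  fixes V :: "'a::real_vector set"
  assumes V: "subspace V"
begin

lemma linear_on_zero: "linear_on V A \<Longrightarrow> A 0 = 0"
  unfolding linear_on_def using subspace_0[OF V]
  by (metis add.right_neutral add_left_cancel scaleR_one)

lemma linear_on_add: "linear_on V A \<Longrightarrow> v \<in> V \<Longrightarrow> w \<in> V \<Longrightarrow> A (v + w) = A v + A w"
  unfolding linear_on_def by (metis scaleR_one)

lemma linear_on_scale: "linear_on V A \<Longrightarrow> v \<in> V \<Longrightarrow> A (r *\<^sub>R v) = r *\<^sub>R A v"
  using linear_on_zero[of A] subspace_0[OF V] unfolding linear_on_def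
  by (metis add.left_neutral)

lemma linear_on_minus: "linear_on V A \<Longrightarrow> v \<in> V \<Longrightarrow> A (- v) = - A v"
  using linear_on_scale[of A v "-1"] by simp

lemma linear_on_diff: "linear_on V A \<Longrightarrow> v \<in> V \<Longrightarrow> w \<in> V \<Longrightarrow> A (v - w) = A v - A w"
  unfolding linear_on_def by (metis diff_conv_add_uminus scaleR_minus1_left)

lemma linear_on_sum:
  assumes "linear_on V A" "\<And>i. i \<in> I \<Longrightarrow> x i \<in> V"
  shows "A (\<Sum>i\<in>I. c i *\<^sub>R x i) = (\<Sum>i\<in>I. c i *\<^sub>R A (x i))"
  using assms(2)
proof (induction I rule: infinite_finite_induct)
  case (insert i I)
  then have "(\<Sum>i\<in>I. c i *\<^sub>R x i) \<in> V" by (intro subspace_sum[OF V] subspace_scale[OF V]) auto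
  with insert show ?case
    by (simp add: linear_on_add[OF assms(1)] linear_on_scale[OF assms(1)] subspace_scale[OF V])
qed (auto simp: linear_on_zero[OF assms(1)])

end

lemma linear_on_expand:
  assumes "coord_subspace V" "linear_on V A" "v \<in> V"
  shows "A v = (\<Sum>e\<in>Basis \<inter> V. (v \<bullet> e) *\<^sub>R A e)"
  using linear_on_sum[OF coord_subspaceD[OF assms(1)] assms(2), of "Basis \<inter> V" "\<lambda>e. e" "\<lambda>e. v \<bullet> e"]
    proj_eq[OF assms(1,3)] by (simp add: proj_def)

lemma linear_onI:
  "(\<And>v w r. v \<in> V \<Longrightarrow> w \<in> V \<Longrightarrow> A (v + r *\<^sub>R w) = A v + r *\<^sub>R A w) \<Longrightarrow> linear_on V A"
  by (simp add: linear_on_def)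

lemma linear_onD: "linear_on V A \<Longrightarrow> v \<in> V \<Longrightarrow> w \<in> V \<Longrightarrow> A (v + r *\<^sub>R w) = A v + r *\<^sub>R A w"
  by (simp add: linear_on_def)

lemma linear_on_UNIV: "linear_on UNIV A \<longleftrightarrow> linear A"
proof
  assume "linear_on UNIV A"
  then show "linear A"
    by (intro linearI) (simp_all add: linear_on_add[OF subspace_UNIV] linear_on_scale[OF subspace_UNIV])
qed (simp add: linear_on_def linear_add linear_scale)

lemma bilinear_onD:
  assumes "bilinear_on V b" "z \<in> V"
  shows "linear_on V (\<lambda>v. b v z)" "linear_on V (b z)"
  using assms by (auto simp: bilinear_on_def)

lemma endo_compose: "endo V A \<Longrightarrow> endo V B \<Longrightarrow> endo V (\<lambda>v. A (B v))"
  by (auto simp: endo_def linear_on_def)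

text \<open>Both sides are the double sum of \<open>(A e \<bullet> f) * (B f \<bullet> e)\<close>.
  The two spaces may differ; this is what later moves a trace over the total space to a trace over
  one base factor.\<close>

lemma tr_commute:
  assumes V: "coord_subspace V" and W: "coord_subspace W"
    and A: "linear_on V A" "\<And>v. v \<in> V \<Longrightarrow> A v \<in> W" and B: "linear_on W B" "\<And>w. w \<in> W \<Longrightarrow> B w \<in> V"
  shows "tr V (\<lambda>v. B (A v)) = tr W (\<lambda>w. A (B w))"
proof -
  have "tr V (\<lambda>v. B (A v)) = (\<Sum>e\<in>Basis \<inter> V. (\<Sum>f\<in>Basis \<inter> W. (A e \<bullet> f) *\<^sub>R B f) \<bullet> e)"
    unfolding tr_def by (intro sum.cong refl) (simp add: linear_on_expand[OF W B(1)] A)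
  also have "\<dots> = (\<Sum>f\<in>Basis \<inter> W. \<Sum>e\<in>Basis \<inter> V. (A e \<bullet> f) * (B f \<bullet> e))"
    by (subst sum.swap) (simp add: inner_sum_left)
  also have "\<dots> = (\<Sum>f\<in>Basis \<inter> W. (\<Sum>e\<in>Basis \<inter> V. (B f \<bullet> e) *\<^sub>R A e) \<bullet> f)"
    by (simp add: inner_sum_left mult.commute)
  also have "\<dots> = tr W (\<lambda>w. A (B w))"
    unfolding tr_def by (intro sum.cong refl) (simp add: linear_on_expand[OF V A(1)] B)
  finally show ?thesis .
qed

lemma tr_endo_commute:
  assumes "coord_subspace V" "endo V A" "endo V B"
  shows "tr V (\<lambda>v. B (A v)) = tr V (\<lambda>v. A (B v))"
  using assms by (intro tr_commute) (auto simp: endo_def)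

lemma tr_add: "tr V (\<lambda>v. A v + B v) = tr V A + tr V B"
  by (simp add: tr_def inner_add_left sum.distrib)

lemma tr_diff: "tr V (\<lambda>v. A v - B v) = tr V A - tr V B"
  by (simp add: tr_def inner_diff_left sum_subtractf)

lemma tr_minus: "tr V (\<lambda>v. - A v) = - tr V A"
  by (simp add: tr_def sum_negf)

lemma tr_scale: "tr V (\<lambda>v. c *\<^sub>R A v) = c * tr V A"
  by (simp add: tr_def sum_distrib_left)

lemma tr_sum: "tr V (\<lambda>v. \<Sum>i\<in>I. A i v) = (\<Sum>i\<in>I. tr V (A i))"
  unfolding tr_def inner_sum_left by (rule sum.swap)

lemma tr_cong: "(\<And>v. v \<in> V \<Longrightarrow> A v = B v) \<Longrightarrow> tr V A = tr V B"
  by (simp add: tr_def)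

lemma tr_id: "tr V (\<lambda>v. v) = real (card (Basis \<inter> V))"
  by (simp add: tr_def inner_same_Basis)

context
  fixes V :: "(complex^'n::finite) set" and b :: "complex^'n \<Rightarrow> complex^'n \<Rightarrow> real"
  assumes V: "coord_subspace V" and b: "bilinear_on V b" "pos_on V b"
begin

private lemma sV: "subspace V" using V by (rule coord_subspaceD)

lemma nondegenerate:
  assumes "z \<in> V" "z' \<in> V" "\<And>y. y \<in> V \<Longrightarrow> b z y = b z' y"
  shows "z = z'"
proof (rule ccontr)
  assume "z \<noteq> z'"
  moreover have d: "z - z' \<in> V" using assms sV by (simp add: subspace_diff)
  ultimately have "b (z - z') (z - z') > 0" using b(2) by (auto simp: pos_on_def)
  moreover have "b (z - z') (z - z') = b z (z - z') - b z' (z - z')"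
    using linear_on_diff[OF sV bilinear_onD(1)[OF b(1) d]] assms by simp
  ultimately show False using assms(3)[OF d] by simp
qed

lemma sharp_exists:
  assumes "linear_on V \<alpha>"
  shows "\<exists>z\<in>V. \<forall>y\<in>V. b z y = \<alpha> y"
proof -
  \<comment> \<open>On \<open>V\<close> this represents \<open>z \<mapsto> b z\<close>, and on the
    orthogonal complement it is the identity. It is thus an endomorphism of the whole space, and
    surjectivity follows from injectivity.\<close>
  define L where "L = (\<lambda>z. (\<Sum>e\<in>Basis \<inter> V. b (proj V z) e *\<^sub>R e) + (z - proj V z))"
  have pz: "proj V z \<in> V" for z using sV by (rule proj_in)
  have inner: "L z \<bullet> e = b (proj V z) e" if "e \<in> Basis \<inter> V" for z e
  proof -
    have i: "(\<Sum>x\<in>Basis \<inter> V. c x *\<^sub>R x) \<bullet> e = c e" for c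
    proof -
      have "(\<Sum>x\<in>Basis \<inter> V. c x *\<^sub>R x) \<bullet> e = (\<Sum>x\<in>Basis \<inter> V. if x = e then c x else 0)"
        unfolding inner_sum_left by (rule sum.cong) (use that in \<open>auto simp: inner_Basis\<close>)
      then show ?thesis using that by (simp add: sum.delta)
    qed
    have "proj V z \<bullet> e = z \<bullet> e" unfolding proj_def by (rule i)
    then show ?thesis
      unfolding L_def inner_add_left inner_diff_left i by simp
  qed
  have lin: "linear L"
  proof -
    have "b (proj V (x + r *\<^sub>R y)) e = b (proj V x) e + r * b (proj V y) e" if "e \<in> Basis \<inter> V" for x y r e
      using linear_onD[OF bilinear_onD(1)[OF b(1), of e] pz pz] that by (simp add: proj_line)
    then have "linear_on UNIV L"
      unfolding linear_on_def L_def
      by (simp add: proj_line algebra_simps sum.distrib scaleR_sum_right scaleR_add_left)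
    then show ?thesis by (simp add: linear_on_UNIV)
  qed
  have "inj L"
    unfolding linear_injective_0[OF lin]
  proof (intro allI impI)
    fix z assume z: "L z = 0"
    have "b (proj V z) e = 0" if "e \<in> Basis \<inter> V" for e using inner[OF that, of z] z by simp
    then have "b (proj V z) (proj V z) = 0"
      using linear_on_expand[OF V bilinear_onD(2)[OF b(1) pz] pz, of z z] by simp
    then have p: "proj V z = 0" using b(2) pz unfolding pos_on_def by (metis less_irrefl)
    have "b 0 e = 0" if "e \<in> V" for e
      using linear_on_zero[OF sV bilinear_onD(1)[OF b(1) that]] .
    then have "L z = z" by (simp add: L_def p)
    with z show "z = 0" by simp
  qed
  then have "surj L" by (rule linear_inj_imp_surj[OF lin])
  then obtain z where z: "L z = (\<Sum>e\<in>Basis \<inter> V. \<alpha> e *\<^sub>R e)" by (metis surjD)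
  have "b (proj V z) e = \<alpha> e" if e: "e \<in> Basis \<inter> V" for e
  proof -
    have "L z \<bullet> e = (\<Sum>x\<in>Basis \<inter> V. if x = e then \<alpha> x else 0)"
      unfolding z inner_sum_left by (rule sum.cong) (use e in \<open>auto simp: inner_Basis\<close>)
    then show ?thesis using e inner[OF e, of z] by (simp add: sum.delta)
  qed
  then have "b (proj V z) y = \<alpha> y" if "y \<in> V" for y
    using linear_on_expand[OF V bilinear_onD(2)[OF b(1) pz] that, of z] linear_on_expand[OF V assms that] by simp
  then show ?thesis using pz by blast
qed

lemma sharp_ex1:
  assumes "linear_on V \<alpha>"
  shows "\<exists>!z. z \<in> V \<and> (\<forall>y\<in>V. b z y = \<alpha> y)"
  using sharp_exists[OF assms] nondegenerate by (auto intro!: ex_ex1I)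

lemma sharp_in: "linear_on V \<alpha> \<Longrightarrow> sharp V b \<alpha> \<in> V"
  using theI'[OF sharp_ex1] unfolding sharp_def by blast

lemma sharp_eq: "linear_on V \<alpha> \<Longrightarrow> y \<in> V \<Longrightarrow> b (sharp V b \<alpha>) y = \<alpha> y"
  using theI'[OF sharp_ex1] unfolding sharp_def by blast

lemma sharp_unique:
  assumes "z \<in> V" "\<And>y. y \<in> V \<Longrightarrow> b z y = \<alpha> y"
  shows "sharp V b \<alpha> = z"
  unfolding sharp_def by (rule the_equality) (use assms nondegenerate in auto)

text \<open>The vectors \<open>s e\<close> form the \<open>b\<close>-dual of the standard basis, so
  \<open>tr V C\<close> is both the sum of \<open>b (s e) (C e)\<close> and the sum of
  \<open>b (C (s e)) e\<close>; the adjoint relation exchanges the two expressions.\<close>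

lemma tr_adjoint:
  assumes sym: "\<And>v w. v \<in> V \<Longrightarrow> w \<in> V \<Longrightarrow> b v w = b w v"
    and A: "endo V A" and B: "endo V B"
    and adj: "\<And>v w. v \<in> V \<Longrightarrow> w \<in> V \<Longrightarrow> b (A v) w = b v (B w)"
  shows "tr V A = tr V B"
proof -
  define s where "s e = sharp V b (\<lambda>y. e \<bullet> y)" for e
  have lin: "linear_on V (\<lambda>y. e \<bullet> y)" for e
    by (simp add: linear_on_def inner_add_right)
  have s: "s e \<in> V" "\<And>y. y \<in> V \<Longrightarrow> b (s e) y = e \<bullet> y" for e
    using sharp_in[OF lin] sharp_eq[OF lin] by (auto simp: s_def)
  have 1: "tr V C = (\<Sum>e\<in>Basis \<inter> V. b (s e) (C e))" if "endo V C" for C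
    using that s(2) by (simp add: tr_def endo_def inner_commute)
  have 2: "tr V C = (\<Sum>e\<in>Basis \<inter> V. b (C (s e)) e)" if C: "endo V C" for C
  proof -
    have Ce: "C e \<in> V" if "e \<in> V" for e using C that by (simp add: endo_def)
    have "(\<Sum>e\<in>Basis \<inter> V. b (C (s e)) e) = (\<Sum>e\<in>Basis \<inter> V. \<Sum>f\<in>Basis \<inter> V. (s e \<bullet> f) * b (C f) e)"
    proof (rule sum.cong[OF refl])
      fix e assume e: "e \<in> Basis \<inter> V"
      have "C (s e) = (\<Sum>f\<in>Basis \<inter> V. (s e \<bullet> f) *\<^sub>R C f)"
        using linear_on_expand[OF V _ s(1)] C by (auto simp: endo_def)
      then show "b (C (s e)) e = (\<Sum>f\<in>Basis \<inter> V. (s e \<bullet> f) * b (C f) e)"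
        using linear_on_sum[OF sV bilinear_onD(1)[OF b(1), of e], of "Basis \<inter> V" C "\<lambda>f. s e \<bullet> f"] e Ce by simp
    qed
    also have "\<dots> = (\<Sum>f\<in>Basis \<inter> V. \<Sum>e\<in>Basis \<inter> V. (s e \<bullet> f) * b (C f) e)" by (rule sum.swap)
    also have "\<dots> = (\<Sum>f\<in>Basis \<inter> V. b (C f) (s f))"
    proof (rule sum.cong[OF refl])
      fix f assume f: "f \<in> Basis \<inter> V"
      have "s e \<bullet> f = s f \<bullet> e" if "e \<in> V" for e
        using s(2)[of "s e" f] s(2)[of "s f" e] sym[OF s(1) s(1), of e f] s(1) by (simp add: inner_commute)
      then show "(\<Sum>e\<in>Basis \<inter> V. (s e \<bullet> f) * b (C f) e) = b (C f) (s f)"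
        using linear_on_expand[OF V bilinear_onD(2)[OF b(1)] s(1), of "C f" f] Ce f by simp
    qed
    also have "\<dots> = tr V C"
      unfolding 1[OF C] by (rule sum.cong[OF refl]) (use sym s(1) Ce in auto)
    finally show ?thesis by simp
  qed
  have "tr V A = (\<Sum>e\<in>Basis \<inter> V. b (s e) (A e))" by (rule 1[OF A])
  also have "\<dots> = (\<Sum>e\<in>Basis \<inter> V. b (B (s e)) e)"
  proof (rule sum.cong[OF refl])
    fix e assume "e \<in> Basis \<inter> V"
    then have e: "e \<in> V" by simp
    have "A e \<in> V" "B (s e) \<in> V" using A B e s(1) by (auto simp: endo_def)
    then show "b (s e) (A e) = b (B (s e)) e"
      using sym[of "s e" "A e"] adj[OF e s(1)] sym[of e "B (s e)"] e s(1) by simp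
  qed
  also have "\<dots> = tr V B" by (rule 2[OF B, symmetric])
  finally show ?thesis .
qed

text \<open>\<open>A - B\<close> is skew for \<open>b\<close>, so its adjoint is its negative and
  its trace vanishes.\<close>

lemma tr_skew_eq:
  assumes sym: "\<And>v w. v \<in> V \<Longrightarrow> w \<in> V \<Longrightarrow> b v w = b w v"
    and A: "endo V A" and B: "endo V B"
    and adj: "\<And>v w. v \<in> V \<Longrightarrow> w \<in> V \<Longrightarrow> b (A v) w + b v (A w) = b (B v) w + b v (B w)"
  shows "tr V A = tr V B"
proof -
  have endo: "endo V (\<lambda>v. A v - B v)" "endo V (\<lambda>v. - (A v - B v))"
    using A B sV by (auto simp: endo_def linear_on_def algebra_simps subspace_diff)
  have "tr V (\<lambda>v. A v - B v) = tr V (\<lambda>v. - (A v - B v))"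
  proof (rule tr_adjoint[OF sym endo])
    fix v w assume vw: "v \<in> V" "w \<in> V"
    then have "A v \<in> V" "A w \<in> V" "B v \<in> V" "B w \<in> V" using A B by (auto simp: endo_def)
    moreover have "- (A w - B w) = B w - A w" by simp
    ultimately show "b (A v - B v) w = b v (- (A w - B w))"
      using adj[OF vw] linear_on_diff[OF sV bilinear_onD(1)[OF b(1) vw(2)], of "A v" "B v"]
        linear_on_diff[OF sV bilinear_onD(2)[OF b(1) vw(1)], of "B w" "A w"] by simp
  qed
  then show ?thesis by (simp add: tr_diff tr_minus)
qed

end

section \<open>Calculus on coordinate subspaces\<close>

lemma open_proj_vimage:
  assumes "rel_open V S"
  shows "open (proj V -` S)"
proof -
  obtain T where T: "open T" "S = T \<inter> V" "subspace V"
    using assms by (auto simp: rel_open_def openin_open)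
  have "proj V -` S = proj V -` T" using T by (auto intro: proj_in)
  then show ?thesis
    using T(1) linear_continuous_on[OF bounded_linear_proj] open_vimage by metis
qed

lemma has_dird_proj: "has_dird (\<lambda>x. f (proj V x)) u v D \<longleftrightarrow> has_dird f (proj V u) (proj V v) D"
  by (simp add: has_dird_def proj_line)

lemma dird_proj: "dird (\<lambda>x. f (proj V x)) u v = dird f (proj V u) (proj V v)"
  by (simp add: dird_def proj_line)

text \<open>Composition with \<open>proj V\<close> extends a function constantly across
  \<open>V\<close>, from a relatively open set to an open set of the ambient space. Total
  derivatives, the chain rule and the symmetry of second derivatives are inherited from
  there.\<close>

lemma Ck_on_proj:
  assumes "rel_open V S"
  shows "Ck_on k V S f \<Longrightarrow> Ck_on k UNIV (proj V -` S) (\<lambda>x. f (proj V x))"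
proof (induction k arbitrary: f)
  case 0
  then show ?case
    using continuous_on_compose2[of S f "proj V -` S" "proj V"] linear_continuous_on[OF bounded_linear_proj]
    by auto
next
  case (Suc k)
  have sV: "subspace V" using assms by (simp add: rel_open_def)
  show ?case
  proof (rule Ck_on_SucI[where D="\<lambda>u v. dird f (proj V u) (proj V v)"])
    show "rel_open UNIV (proj V -` S)" using open_proj_vimage[OF assms] by (simp add: rel_open_UNIV)
    show "continuous_on (proj V -` S) (\<lambda>x. f (proj V x))"
      using continuous_on_compose2[of S f "proj V -` S" "proj V"] linear_continuous_on[OF bounded_linear_proj]
        Ck_on_continuous[OF Suc.prems] by auto
    show "has_dird (\<lambda>x. f (proj V x)) u v (dird f (proj V u) (proj V v))" if "u \<in> proj V -` S" for u v
      unfolding has_dird_proj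
      by (rule Ck_on_SucD(1)[OF Suc.prems proj_in[OF sV]]) (use that in simp)
    show "Ck_on k UNIV (proj V -` S) (\<lambda>u. dird f (proj V u) (proj V v))" for v
      by (rule Suc.IH[OF Ck_on_SucD(2)[OF Suc.prems proj_in[OF sV]]])
  qed
qed

context
  fixes V S :: "'a::euclidean_space set"
  assumes V: "coord_subspace V" and VS: "rel_open V S"
begin

private lemma subspaceV: "subspace V" using V by (rule coord_subspaceD)

private lemma SV: "u \<in> S \<Longrightarrow> u \<in> V" using rel_open_subset[OF VS] by blast

lemma smooth_on_proj: "smooth_on V S f \<Longrightarrow> smooth_on UNIV (proj V -` S) (\<lambda>x. f (proj V x))"
  unfolding smooth_on_def using Ck_on_proj[OF VS] by metis

private lemma has_derivative_proj:
  assumes "smooth_on V S f" "u \<in> S"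
  shows "((\<lambda>x. f (proj V x)) has_derivative (\<lambda>v. dird f u (proj V v))) (at u)"
proof -
  have "((\<lambda>x. f (proj V x)) has_derivative dird (\<lambda>x. f (proj V x)) u) (at u)"
    by (rule smooth_on_has_derivative[OF open_proj_vimage[OF VS] smooth_on_proj[OF assms(1)]])
      (use assms(2) SV proj_eq[OF V] in auto)
  then show ?thesis
    using proj_eq[OF V SV[OF assms(2)]] by (simp add: dird_proj[abs_def])
qed

lemma smooth_on_linear_dird:
  assumes "smooth_on V S f" "u \<in> S"
  shows "linear_on V (dird f u)"
proof (rule linear_onI)
  fix v w r assume vw: "v \<in> V" "w \<in> V"
  interpret bounded_linear "\<lambda>v. dird f u (proj V v)"
    using has_derivative_proj[OF assms] by (rule has_derivative_bounded_linear)
  have "dird f u (proj V (v + r *\<^sub>R w)) = dird f u (proj V v) + r *\<^sub>R dird f u (proj V w)"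
    by (simp add: add scale)
  then show "dird f u (v + r *\<^sub>R w) = dird f u v + r *\<^sub>R dird f u w"
    using vw subspaceV by (simp add: proj_eq[OF V] subspace_add subspace_scale)
qed

lemma smooth_on_dird_commute:
  fixes f :: "'a \<Rightarrow> 'b::euclidean_space"
  assumes f: "smooth_on V S f" and u: "u \<in> S" and vw: "v \<in> V" "w \<in> V"
  shows "dird (\<lambda>x. dird f x v) u w = dird (\<lambda>x. dird f x w) u v"
proof -
  define F where "F = (\<lambda>x. f (proj V x))"
  have "Ck_on 2 UNIV (proj V -` S) F"
    using smooth_on_proj[OF f] unfolding F_def smooth_on_def by blast
  moreover have "u \<in> proj V -` S" using u SV proj_eq[OF V] by simp
  ultimately have "dird (\<lambda>x. dird F x v) u w = dird (\<lambda>x. dird F x w) u v"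
    using Ck_on_dird_commute[OF open_proj_vimage[OF VS]] by blast
  then show ?thesis
    using u vw SV by (simp add: F_def dird_proj proj_eq[OF V] dird_proj[of "\<lambda>x. dird f x _"])
qed

lemma has_dird_compose:
  fixes z :: "'c::real_normed_vector \<Rightarrow> 'a"
  assumes f: "smooth_on V S f" and WU: "rel_open W U" and zS: "\<And>x. x \<in> U \<Longrightarrow> z x \<in> S"
    and u: "u \<in> U" and v: "v \<in> W" and z: "has_dird z u v w" and w: "w \<in> V"
  shows "has_dird (\<lambda>x. f (z x)) u v (dird f (z u) w)"
proof -
  have "has_dird (\<lambda>x. f (proj V (z x))) u v (dird f (z u) (proj V w))"
    by (rule has_dird_chain[OF has_derivative_proj[OF f zS[OF u]] z])
  then have "has_dird (\<lambda>x. f (proj V (z x))) u v (dird f (z u) w)" using w by (simp add: proj_eq[OF V])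
  then show ?thesis
    by (rule has_dird_cong_imp[OF WU u v, rotated]) (use zS SV proj_eq[OF V] in simp)
qed

lemma smooth_on_compose_on:
  fixes z :: "'c::real_normed_vector \<Rightarrow> 'a"
  assumes f: "smooth_on V S f" and WU: "rel_open W U" and zS: "\<And>x. x \<in> U \<Longrightarrow> z x \<in> S"
    and z: "smooth_on W U z"
  shows "smooth_on W U (\<lambda>x. f (z x))"
proof -
  have "smooth_on W U (\<lambda>x. f (proj V (z x)))"
    by (rule smooth_on_compose[OF WU open_proj_vimage[OF VS] _ smooth_on_proj[OF f] z])
      (use zS SV proj_eq[OF V] in auto)
  moreover have "f (proj V (z x)) = f (z x)" if "x \<in> U" for x
    using zS[OF that] SV proj_eq[OF V] by simp
  ultimately show ?thesis
    using smooth_on_cong[OF WU, of "\<lambda>x. f (proj V (z x))" "\<lambda>x. f (z x)"] by blast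
qed

end

context
  fixes V :: "'a::euclidean_space set" and D S :: "'c::real_normed_vector set"
  assumes V: "coord_subspace V" and DS: "rel_open D S"
begin

private lemma subV: "subspace V" using V by (rule coord_subspaceD)

text \<open>The projection onto \<open>V\<close> fixes the values of \<open>z\<close> and commutes
  with differentiation.\<close>

lemma has_dird_in:
  assumes z: "\<And>x. x \<in> S \<Longrightarrow> z x \<in> V" and u: "u \<in> S" and v: "v \<in> D" and d: "has_dird z u v w"
  shows "w \<in> V"
proof -
  have "has_dird (\<lambda>x. proj V (z x)) u v (proj V w)"
    by (rule has_dird_bounded_linear[OF bounded_linear_proj d])
  then have "has_dird z u v (proj V w)"
    by (rule has_dird_cong_imp[OF DS u v, rotated]) (use z proj_eq[OF V] in simp)
  then have "w = proj V w" using d has_dird_dird by metis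
  then show ?thesis using proj_in[OF subV] by metis
qed

lemma has_dird_linear_on:
  fixes \<alpha> :: "'c \<Rightarrow> 'a \<Rightarrow> 'b::real_normed_vector"
  assumes lin: "\<And>x. x \<in> S \<Longrightarrow> linear_on V (\<alpha> x)" and d: "\<And>y. y \<in> V \<Longrightarrow> has_dird (\<lambda>x. \<alpha> x y) u v (A y)"
    and u: "u \<in> S" and v: "v \<in> D"
  shows "linear_on V A"
proof (rule linear_onI)
  fix y y' r assume y: "y \<in> V" "y' \<in> V"
  have "has_dird (\<lambda>x. \<alpha> x y + r *\<^sub>R \<alpha> x y') u v (A y + r *\<^sub>R A y')"
    by (intro has_dird_add has_dird_bounded_linear[OF bounded_linear_scaleR_right] d y)
  then have "has_dird (\<lambda>x. \<alpha> x (y + r *\<^sub>R y')) u v (A y + r *\<^sub>R A y')"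
    by (rule has_dird_cong_imp[OF DS u v, rotated]) (use y linear_onD[OF lin] in simp)
  moreover have "y + r *\<^sub>R y' \<in> V" using y subV by (simp add: subspace_add subspace_scale)
  ultimately show "A (y + r *\<^sub>R y') = A y + r *\<^sub>R A y'" using d has_dird_dird by metis
qed

text \<open>The family \<alpha> is differentiable for each fixed vector, so the moving argument
  \<open>f\<close> is first expanded in the basis of \<open>V\<close>. The result is the product
  rule for components of tensors.\<close>

lemma has_dird_apply:
  fixes \<alpha> :: "'c \<Rightarrow> 'a \<Rightarrow> 'b::real_normed_vector"
  assumes lin: "\<And>x. x \<in> S \<Longrightarrow> linear_on V (\<alpha> x)" and d: "\<And>y. y \<in> V \<Longrightarrow> has_dird (\<lambda>x. \<alpha> x y) u v (A y)"
    and f: "\<And>x. x \<in> S \<Longrightarrow> f x \<in> V" "has_dird f u v f'" and u: "u \<in> S" and v: "v \<in> D"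
  shows "has_dird (\<lambda>x. \<alpha> x (f x)) u v (A (f u) + \<alpha> u f')"
proof -
  have f'V: "f' \<in> V" by (rule has_dird_in[OF f(1) u v f(2)])
  have "has_dird (\<lambda>x. \<Sum>e\<in>Basis \<inter> V. (f x \<bullet> e) *\<^sub>R \<alpha> x e) u v (\<Sum>e\<in>Basis \<inter> V. ((f u \<bullet> e) *\<^sub>R A e + (f' \<bullet> e) *\<^sub>R \<alpha> u e))"
    by (intro has_dird_sum has_dird_scaleR d has_dird_bounded_linear[OF bounded_linear_inner_left] f(2)) auto
  moreover have "(\<Sum>e\<in>Basis \<inter> V. (f x \<bullet> e) *\<^sub>R \<alpha> x e) = \<alpha> x (f x)" if "x \<in> S" for x
    using linear_on_expand[OF V lin[OF that] f(1)[OF that]] by simp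
  moreover have "(\<Sum>e\<in>Basis \<inter> V. ((f u \<bullet> e) *\<^sub>R A e + (f' \<bullet> e) *\<^sub>R \<alpha> u e)) = A (f u) + \<alpha> u f'"
  proof -
    have "linear_on V A"
      by (rule has_dird_linear_on[OF lin d u v])
    then show ?thesis
      using linear_on_expand[OF V, of A "f u"] linear_on_expand[OF V lin[OF u] f'V] f(1)[OF u]
      by (simp add: sum.distrib)
  qed
  ultimately show ?thesis
    using has_dird_cong_imp[OF DS u v, of "\<lambda>x. \<Sum>e\<in>Basis \<inter> V. (f x \<bullet> e) *\<^sub>R \<alpha> x e" "\<lambda>x. \<alpha> x (f x)"] by simp
qed

lemma smooth_on_apply:
  fixes \<alpha> :: "'c \<Rightarrow> 'a \<Rightarrow> 'b::real_normed_vector"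
  assumes lin: "\<And>x. x \<in> S \<Longrightarrow> linear_on V (\<alpha> x)" and d: "\<And>y. y \<in> V \<Longrightarrow> smooth_on D S (\<lambda>x. \<alpha> x y)"
    and f: "\<And>x. x \<in> S \<Longrightarrow> f x \<in> V" "smooth_on D S f"
  shows "smooth_on D S (\<lambda>x. \<alpha> x (f x))"
proof -
  have "smooth_on D S (\<lambda>x. \<Sum>e\<in>Basis \<inter> V. (f x \<bullet> e) *\<^sub>R \<alpha> x e)"
    by (intro smooth_on_sum[OF DS] smooth_on_scaleR[OF DS] d
        smooth_on_bounded_linear[OF DS bounded_linear_inner_left] f(2)) auto
  moreover have "(\<Sum>e\<in>Basis \<inter> V. (f x \<bullet> e) *\<^sub>R \<alpha> x e) = \<alpha> x (f x)" if "x \<in> S" for x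
    using linear_on_expand[OF V lin[OF that] f(1)[OF that]] by simp
  ultimately show ?thesis
    using smooth_on_cong[OF DS, of "\<lambda>x. \<Sum>e\<in>Basis \<inter> V. (f x \<bullet> e) *\<^sub>R \<alpha> x e" "\<lambda>x. \<alpha> x (f x)"] by simp
qed

lemma has_dird_apply2:
  assumes bil: "\<And>x. x \<in> S \<Longrightarrow> bilinear_on V (b x)"
    and d: "\<And>y z. y \<in> V \<Longrightarrow> z \<in> V \<Longrightarrow> has_dird (\<lambda>x. b x y z) u v (B y z)"
    and f: "\<And>x. x \<in> S \<Longrightarrow> f x \<in> V" "has_dird f u v f'"
    and g: "\<And>x. x \<in> S \<Longrightarrow> g x \<in> V" "has_dird g u v g'"
    and u: "u \<in> S" and v: "v \<in> D"
  shows "has_dird (\<lambda>x. b x (f x) (g x)) u v (B (f u) (g u) + b u f' (g u) + b u (f u) g')"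
proof -
  have 1: "has_dird (\<lambda>x. b x (f x) y) u v (B (f u) y + b u f' y)" if y: "y \<in> V" for y
    by (rule has_dird_apply[where \<alpha>="\<lambda>x w. b x w y" and A="\<lambda>w. B w y"])
      (use bilinear_onD(1)[OF bil y] d[OF _ y] f u v in auto)
  show ?thesis
    by (rule has_dird_apply[where \<alpha>="\<lambda>x. b x (f x)" and A="\<lambda>y. B (f u) y + b u f' y"])
      (use bilinear_onD(2)[OF bil f(1)] 1 g u v in auto)
qed

lemma smooth_on_apply2:
  assumes bil: "\<And>x. x \<in> S \<Longrightarrow> bilinear_on V (b x)"
    and d: "\<And>y z. y \<in> V \<Longrightarrow> z \<in> V \<Longrightarrow> smooth_on D S (\<lambda>x. b x y z)"
    and f: "\<And>x. x \<in> S \<Longrightarrow> f x \<in> V" "smooth_on D S f"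
    and g: "\<And>x. x \<in> S \<Longrightarrow> g x \<in> V" "smooth_on D S g"
  shows "smooth_on D S (\<lambda>x. b x (f x) (g x))"
proof (rule smooth_on_apply[where \<alpha>="\<lambda>x. b x (f x)"])
  show "smooth_on D S (\<lambda>x. b x (f x) y)" if y: "y \<in> V" for y
    by (rule smooth_on_apply[where \<alpha>="\<lambda>x w. b x w y"])
      (use bilinear_onD(1)[OF bil y] d[OF _ y] f in auto)
qed (use bilinear_onD(2)[OF bil f(1)] g in auto)

lemma tr_has_dird:
  assumes "\<And>y. y \<in> V \<Longrightarrow> has_dird (\<lambda>x. A x y) u v (A' y)"
  shows "has_dird (\<lambda>x. tr V (A x)) u v (tr V A')"
  unfolding tr_def
  by (intro has_dird_sum has_dird_bounded_linear[OF bounded_linear_inner_left] assms) auto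

lemma tr_smooth_on:
  assumes "\<And>y. y \<in> V \<Longrightarrow> smooth_on D S (\<lambda>x. A x y)"
  shows "smooth_on D S (\<lambda>x. tr V (A x))"
  unfolding tr_def
  by (intro smooth_on_sum[OF DS] smooth_on_bounded_linear[OF DS bounded_linear_inner_left] assms) auto

end

lemma has_dird_quotient:
  assumes "((\<lambda>t::real. (f (u + t *\<^sub>R v) - f u) /\<^sub>R t) \<longlongrightarrow> D) (at 0)"
  shows "has_dird f u v D"
  unfolding has_dird_def has_vector_derivative_def has_derivative_at
proof (intro conjI)
  show "bounded_linear (\<lambda>t. t *\<^sub>R D)" by (rule bounded_linear_scaleR_left)
  have "((\<lambda>t::real. norm ((f (u + t *\<^sub>R v) - f u) /\<^sub>R t - D)) \<longlongrightarrow> 0) (at 0)"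
    using assms by (simp add: tendsto_norm_zero_iff LIM_zero_iff)
  moreover have "\<forall>\<^sub>F t in at 0. norm ((f (u + t *\<^sub>R v) - f u) /\<^sub>R t - D) =
      norm (f (u + (0 + t) *\<^sub>R v) - f (u + 0 *\<^sub>R v) - t *\<^sub>R D) / norm t"
  proof (rule eventually_mono[OF eventually_neq_at_within[of 0]])
    fix t :: real assume t: "t \<noteq> 0"
    have "(f (u + t *\<^sub>R v) - f u) /\<^sub>R t - D = (f (u + t *\<^sub>R v) - f u - t *\<^sub>R D) /\<^sub>R t"
      using t by (simp add: scaleR_diff_right)
    then show "norm ((f (u + t *\<^sub>R v) - f u) /\<^sub>R t - D) =
      norm (f (u + (0 + t) *\<^sub>R v) - f (u + 0 *\<^sub>R v) - t *\<^sub>R D) / norm t"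
      by (simp add: divide_inverse_commute)
  qed
  ultimately show "((\<lambda>t. norm (f (u + (0 + t) *\<^sub>R v) - f (u + 0 *\<^sub>R v) - t *\<^sub>R D) / norm t) \<longlongrightarrow> 0) (at 0)"
    by (rule Lim_transform_eventually)
qed

text \<open>A smooth family of positive forms is inverted smoothly: the derivative of \<open>sharp\<close> is again a
  \<open>sharp\<close>, so smoothness is propagated from continuity.\<close>

lemma pos_on_lower_bound:
  fixes V :: "'a::euclidean_space set"
  assumes V: "coord_subspace V" and b: "bilinear_on V b" "pos_on V b"
  shows "\<exists>m>0. \<forall>z\<in>V. b z z \<ge> m * (norm z)\<^sup>2"
proof -
  have sV: "subspace V" using V by (rule coord_subspaceD)
  have eq: "b z z = (\<Sum>e\<in>Basis \<inter> V. \<Sum>f\<in>Basis \<inter> V. (z \<bullet> e) * (z \<bullet> f) * b e f)" if z: "z \<in> V" for z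
  proof -
    have "b z z = (\<Sum>e\<in>Basis \<inter> V. (z \<bullet> e) * b e z)"
      using linear_on_expand[OF V bilinear_onD(1)[OF b(1) z] z] by simp
    also have "\<dots> = (\<Sum>e\<in>Basis \<inter> V. (z \<bullet> e) * (\<Sum>f\<in>Basis \<inter> V. (z \<bullet> f) * b e f))"
      by (intro sum.cong refl) (use linear_on_expand[OF V bilinear_onD(2)[OF b(1)] z] in simp)
    finally show ?thesis by (simp add: sum_distrib_left mult.assoc)
  qed
  define K where "K = sphere 0 1 \<inter> V"
  show ?thesis
  \<comment> \<open>The unit sphere of \<open>V\<close> is empty exactly when \<open>V\<close> is
    zero; then there is nothing to minimize and any \<open>m\<close> serves.\<close>
  proof (cases "K = {}")
    case True
    have "z = 0" if "z \<in> V" for z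
    proof (rule ccontr)
      assume "z \<noteq> 0"
      then have "(1 / norm z) *\<^sub>R z \<in> K" using that sV by (simp add: K_def subspace_scale)
      with True show False by simp
    qed
    then show ?thesis
      using linear_on_zero[OF sV bilinear_onD(1)[OF b(1) subspace_0[OF sV]]]
      by (intro exI[of _ 1]) fastforce
  next
    case False
    have "compact K" unfolding K_def by (intro compact_Int_closed closed_subspace sV) simp
    moreover have "continuous_on K (\<lambda>z. b z z)"
    proof -
      have "continuous_on K (\<lambda>z. \<Sum>e\<in>Basis \<inter> V. \<Sum>f\<in>Basis \<inter> V. (z \<bullet> e) * (z \<bullet> f) * b e f)"
        by (intro continuous_intros)
      then show ?thesis by (rule continuous_on_eq) (simp add: eq K_def)
    qed
    ultimately obtain z0 where z0: "z0 \<in> K" "\<And>z. z \<in> K \<Longrightarrow> b z0 z0 \<le> b z z"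
      using continuous_attains_inf[OF _ False] by blast
    have "b z0 z0 > 0" using z0(1) b(2) by (auto simp: K_def pos_on_def)
    moreover have "b z z \<ge> b z0 z0 * (norm z)\<^sup>2" if z: "z \<in> V" for z
    proof (cases "z = 0")
      case True
      then show ?thesis using linear_on_zero[OF sV bilinear_onD(1)[OF b(1) subspace_0[OF sV]]] by simp
    next
      case False
      define y where "y = (1 / norm z) *\<^sub>R z"
      have y: "y \<in> K" "y \<in> V" "z = norm z *\<^sub>R y" using z False sV by (auto simp: y_def K_def subspace_scale)
      have "b z z = norm z * b y z"
        using linear_on_scale[OF sV bilinear_onD(1)[OF b(1) z] y(2), of "norm z"] y(3) by simp
      also have "\<dots> = norm z * (norm z * b y y)"
        using linear_on_scale[OF sV bilinear_onD(2)[OF b(1) y(2)] y(2), of "norm z"] y(3) by simp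
      finally show ?thesis
        using mult_left_mono[OF z0(2)[OF y(1)], of "norm z * norm z"] by (simp add: power2_eq_square mult_ac)
    qed
    ultimately show ?thesis by blast
  qed
qed

lemma linear_on_bound:
  fixes V :: "'a::euclidean_space set" and \<alpha> :: "'a \<Rightarrow> real"
  assumes V: "coord_subspace V" and \<alpha>: "linear_on V \<alpha>" and z: "z \<in> V"
  shows "\<bar>\<alpha> z\<bar> \<le> norm z * (\<Sum>e\<in>Basis \<inter> V. \<bar>\<alpha> e\<bar>)"
proof -
  have "\<bar>\<alpha> z\<bar> = \<bar>\<Sum>e\<in>Basis \<inter> V. (z \<bullet> e) * \<alpha> e\<bar>" using linear_on_expand[OF V \<alpha> z] by simp
  also have "\<dots> \<le> (\<Sum>e\<in>Basis \<inter> V. \<bar>(z \<bullet> e) * \<alpha> e\<bar>)" by (rule sum_abs)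
  also have "\<dots> \<le> (\<Sum>e\<in>Basis \<inter> V. norm z * \<bar>\<alpha> e\<bar>)"
    by (intro sum_mono) (auto simp: abs_mult intro!: mult_right_mono Basis_le_norm)
  finally show ?thesis by (simp add: sum_distrib_left)
qed

text \<open>For the error \<open>d\<close> one has \<open>b t d d = \<alpha> t d - b t y d\<close>.
  The right side is at most \<open>norm d * R t\<close> with \<open>R t\<close> tending to 0. The
  left side is at least \<open>m / 2\<close> times the square of \<open>norm d\<close> once
  \<open>b t\<close> is close to \<open>b0\<close>. Division by \<open>norm d\<close> gives the
  bound.\<close>

lemma tendsto_sharp:
  fixes V :: "(complex^'n::finite) set"
  assumes V: "coord_subspace V"
    and b: "\<forall>\<^sub>F t in F. bilinear_on V (b t) \<and> pos_on V (b t) \<and> linear_on V (\<alpha> t)"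
    and b0: "bilinear_on V b0" "pos_on V b0" "linear_on V \<alpha>0"
    and lim_b: "\<And>v w. v \<in> V \<Longrightarrow> w \<in> V \<Longrightarrow> ((\<lambda>t. b t v w) \<longlongrightarrow> b0 v w) F"
    and lim_\<alpha>: "\<And>v. v \<in> V \<Longrightarrow> ((\<lambda>t. \<alpha> t v) \<longlongrightarrow> \<alpha>0 v) F"
  shows "((\<lambda>t. sharp V (b t) (\<alpha> t)) \<longlongrightarrow> sharp V b0 \<alpha>0) F"
proof -
  have sV: "subspace V" using V by (rule coord_subspaceD)
  define y where "y = sharp V b0 \<alpha>0"
  have y: "y \<in> V" "\<And>w. w \<in> V \<Longrightarrow> b0 y w = \<alpha>0 w"
    using sharp_in[OF V b0] sharp_eq[OF V b0] by (auto simp: y_def)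
  obtain m where m: "m > 0" "\<And>z. z \<in> V \<Longrightarrow> b0 z z \<ge> m * (norm z)\<^sup>2"
    using pos_on_lower_bound[OF V b0(1,2)] by blast
  define R where "R t = (\<Sum>e\<in>Basis \<inter> V. \<bar>\<alpha> t e - b t y e\<bar>)" for t
  define Q where "Q t = (\<Sum>e\<in>Basis \<inter> V. \<Sum>f\<in>Basis \<inter> V. \<bar>b t e f - b0 e f\<bar>)" for t
  have "(R \<longlongrightarrow> (\<Sum>e\<in>Basis \<inter> V. \<bar>\<alpha>0 e - b0 y e\<bar>)) F"
    unfolding R_def[abs_def] by (intro tendsto_intros lim_\<alpha> lim_b y) auto
  then have R: "(R \<longlongrightarrow> 0) F" using y by simp
  have "(Q \<longlongrightarrow> (\<Sum>e\<in>Basis \<inter> V. \<Sum>f\<in>Basis \<inter> V. \<bar>b0 e f - b0 e f\<bar>)) F"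
    unfolding Q_def[abs_def] by (intro tendsto_intros lim_b) auto
  then have "(Q \<longlongrightarrow> 0) F" by simp
  then have Q: "\<forall>\<^sub>F t in F. Q t < m / 2" using m by (intro order_tendstoD) auto
  have key: "\<forall>\<^sub>F t in F. norm (sharp V (b t) (\<alpha> t) - y) \<le> R t * (2 / m)"
    using b Q
  proof eventually_elim
    case (elim t)
    then have bt: "bilinear_on V (b t)" "pos_on V (b t)" "linear_on V (\<alpha> t)" by auto
    define d where "d = sharp V (b t) (\<alpha> t) - y"
    have d: "d \<in> V" using sharp_in[OF V bt] y sV by (simp add: d_def subspace_diff)
    have "b t d d = b t (sharp V (b t) (\<alpha> t)) d - b t y d"
      unfolding d_def[THEN arg_cong, of "\<lambda>x. b t x d"]
      by (rule linear_on_diff[OF sV bilinear_onD(1)[OF bt(1) d] sharp_in[OF V bt] y(1)])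
    then have bd: "b t d d = \<alpha> t d - b t y d" using sharp_eq[OF V bt d] by simp
    have lin: "linear_on V (\<lambda>w. \<alpha> t w - b t y w)"
      using bt(3) bilinear_onD(2)[OF bt(1) y(1)] by (auto simp: linear_on_def algebra_simps)
    have up: "b t d d \<le> norm d * R t"
      using linear_on_bound[OF V lin d] by (simp add: bd R_def)
    have lin2: "linear_on V (\<lambda>w. b t d w - b0 d w)" "\<And>e. e \<in> V \<Longrightarrow> linear_on V (\<lambda>w. b t w e - b0 w e)"
      using bilinear_onD[OF bt(1)] bilinear_onD[OF b0(1)] d by (auto simp: linear_on_def algebra_simps)
    have "\<bar>b t d d - b0 d d\<bar> \<le> norm d * (\<Sum>f\<in>Basis \<inter> V. \<bar>b t d f - b0 d f\<bar>)"
      by (rule linear_on_bound[OF V lin2(1) d])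
    also have "\<dots> \<le> norm d * (\<Sum>f\<in>Basis \<inter> V. norm d * (\<Sum>e\<in>Basis \<inter> V. \<bar>b t e f - b0 e f\<bar>))"
      by (intro mult_left_mono sum_mono linear_on_bound[OF V lin2(2) d]) auto
    also have "\<dots> = (norm d)\<^sup>2 * Q t"
      unfolding Q_def by (subst sum.swap) (simp add: sum_distrib_left power2_eq_square mult.assoc)
    also have "\<dots> \<le> (norm d)\<^sup>2 * (m / 2)" using elim by (intro mult_left_mono) auto
    finally have "b t d d \<ge> (norm d)\<^sup>2 * (m / 2)" using m(2)[OF d] by (simp add: abs_if field_simps split: if_splits)
    with up have "norm d * (norm d * (m / 2)) \<le> norm d * R t" by (simp add: power2_eq_square mult.assoc)
    moreover have "0 \<le> R t" by (simp add: R_def sum_nonneg)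
    ultimately have "norm d * (m / 2) \<le> R t" by (cases "d = 0") (auto dest: mult_left_le_imp_le)
    then show ?case using m(1) by (simp add: d_def[symmetric] field_simps)
  qed
  have "((\<lambda>t. sharp V (b t) (\<alpha> t) - y) \<longlongrightarrow> 0) F"
    by (rule Lim_null_comparison[OF key]) (use tendsto_mult_right[OF R, of "2/m"] in simp)
  then show ?thesis unfolding y_def by (simp add: LIM_zero_iff)
qed

context
  fixes V :: "(complex^'n::finite) set" and D S :: "'c::real_normed_vector set" and b
  assumes V: "coord_subspace V" and DS: "rel_open D S"
    and b: "\<And>x. x \<in> S \<Longrightarrow> bilinear_on V (b x)" "\<And>x. x \<in> S \<Longrightarrow> pos_on V (b x)"
    and smooth_b: "\<And>v w. v \<in> V \<Longrightarrow> w \<in> V \<Longrightarrow> smooth_on D S (\<lambda>x. b x v w)"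
begin

private lemma sharp_continuous:
  assumes \<alpha>: "\<And>x. x \<in> S \<Longrightarrow> linear_on V (\<alpha> x)" "\<And>y. y \<in> V \<Longrightarrow> continuous_on S (\<lambda>x. \<alpha> x y)"
  shows "continuous_on S (\<lambda>x. sharp V (b x) (\<alpha> x))"
  unfolding continuous_on_def
proof
  fix u assume u: "u \<in> S"
  have ev: "\<forall>\<^sub>F x in at u within S. x \<in> S" by (simp add: eventually_at_filter)
  show "((\<lambda>x. sharp V (b x) (\<alpha> x)) \<longlongrightarrow> sharp V (b u) (\<alpha> u)) (at u within S)"
  proof (rule tendsto_sharp[OF V _ b(1)[OF u] b(2)[OF u] \<alpha>(1)[OF u]])
    show "\<forall>\<^sub>F t in at u within S. bilinear_on V (b t) \<and> pos_on V (b t) \<and> linear_on V (\<alpha> t)"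
      using ev by eventually_elim (use b \<alpha> in auto)
  qed (use smooth_on_continuous[OF smooth_b] \<alpha>(2) u in \<open>auto simp: continuous_on_def\<close>)
qed

text \<open>The formula is implicit differentiation of the equation defining \<open>sharp\<close>.
  The proof observes that a difference quotient of \<open>sharp\<close> is itself the
  \<open>sharp\<close> of the difference quotient of \<open>\<alpha> x y - b x y0 y\<close>, to
  which \<open>tendsto_sharp\<close> applies.\<close>

lemma sharp_has_dird:
  assumes \<alpha>: "\<And>x. x \<in> S \<Longrightarrow> linear_on V (\<alpha> x)" "\<And>y. y \<in> V \<Longrightarrow> has_dird (\<lambda>x. \<alpha> x y) u v (A y)"
    and u: "u \<in> S" and v: "v \<in> D"
  shows "has_dird (\<lambda>x. sharp V (b x) (\<alpha> x)) u v
    (sharp V (b u) (\<lambda>y. A y - (\<Sum>e\<in>Basis \<inter> V. (sharp V (b u) (\<alpha> u) \<bullet> e) * dird (\<lambda>x. b x e y) u v)))"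
proof -
  have sV: "subspace V" using V by (rule coord_subspaceD)
  define y0 where "y0 = sharp V (b u) (\<alpha> u)"
  have y0: "y0 \<in> V" "\<And>y. y \<in> V \<Longrightarrow> b u y0 y = \<alpha> u y"
    using sharp_in[OF V b[OF u] \<alpha>(1)[OF u]] sharp_eq[OF V b[OF u] \<alpha>(1)[OF u]] by (auto simp: y0_def)
  define B where "B y = (\<Sum>e\<in>Basis \<inter> V. (y0 \<bullet> e) * dird (\<lambda>x. b x e y) u v)" for y
  define p where "p t = u + t *\<^sub>R v" for t :: real
  have p: "\<forall>\<^sub>F t in at 0. p t \<in> S"
    using rel_open_line[OF DS u v] unfolding p_def by (simp add: eventually_nhds_conv_at)
  have hb: "has_dird (\<lambda>x. b x y0 y) u v (B y)" if y: "y \<in> V" for y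
  proof -
    have "has_dird (\<lambda>x. \<Sum>e\<in>Basis \<inter> V. (y0 \<bullet> e) * b x e y) u v (B y)"
      unfolding B_def
      by (intro has_dird_sum has_dird_bounded_linear[OF bounded_linear_mult_right]
          smooth_on_has_dird[OF smooth_b u v]) (use y in auto)
    moreover have "(\<Sum>e\<in>Basis \<inter> V. (y0 \<bullet> e) * b x e y) = b x y0 y" if "x \<in> S" for x
      using linear_on_expand[OF V bilinear_onD(1)[OF b(1)[OF that] y] y0(1)] by simp
    ultimately show ?thesis
      using has_dird_cong_imp[OF DS u v, of "\<lambda>x. \<Sum>e\<in>Basis \<inter> V. (y0 \<bullet> e) * b x e y" "\<lambda>x. b x y0 y"] by simp
  qed
  have diff: "has_dird (\<lambda>x. \<alpha> x y - b x y0 y) u v (A y - B y)" if "y \<in> V" for y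
    by (intro has_dird_diff \<alpha>(2) hb that)
  have lin: "linear_on V (\<lambda>y. \<alpha> x y - b x y0 y)" if "x \<in> S" for x
    using \<alpha>(1)[OF that] bilinear_onD(2)[OF b(1)[OF that] y0(1)] by (auto simp: linear_on_def algebra_simps)
  have linAB: "linear_on V (\<lambda>y. A y - B y)"
    by (rule has_dird_linear_on[OF V DS lin diff u v])
  have lin_q: "linear_on V (\<lambda>y. (\<alpha> (p t) y - b (p t) y0 y) / t)" if "p t \<in> S" for t
    using lin[OF that] by (simp add: linear_on_def add_divide_distrib)
  have "((\<lambda>t. sharp V (b (p t)) (\<lambda>y. (\<alpha> (p t) y - b (p t) y0 y) / t)) \<longlongrightarrow> sharp V (b u) (\<lambda>y. A y - B y)) (at 0)"
  proof (rule tendsto_sharp[OF V _ b[OF u] linAB])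
    show "\<forall>\<^sub>F t in at 0. bilinear_on V (b (p t)) \<and> pos_on V (b (p t)) \<and>
        linear_on V (\<lambda>y. (\<alpha> (p t) y - b (p t) y0 y) / t)"
      using p by eventually_elim (use b lin_q in auto)
    show "((\<lambda>t. b (p t) a c) \<longlongrightarrow> b u a c) (at 0)" if "a \<in> V" "c \<in> V" for a c
    proof -
      have "((\<lambda>t. b (p t) a c) has_vector_derivative dird (\<lambda>x. b x a c) u v) (at 0)"
        using smooth_on_has_dird[OF smooth_b[OF that] u v] by (simp add: has_dird_def p_def)
      then have "continuous (at 0) (\<lambda>t. b (p t) a c)" by (rule has_vector_derivative_continuous)
      then show ?thesis by (simp add: continuous_at p_def)
    qed
    show "((\<lambda>t. (\<alpha> (p t) y - b (p t) y0 y) / t) \<longlongrightarrow> A y - B y) (at 0)" if "y \<in> V" for y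
    proof -
      have "((\<lambda>t. \<alpha> (p t) y - b (p t) y0 y) has_real_derivative (A y - B y)) (at 0)"
        using diff[OF that] by (simp add: has_dird_def p_def has_real_derivative_iff_has_vector_derivative)
      then have "((\<lambda>t. ((\<alpha> (p t) y - b (p t) y0 y) - (\<alpha> (p 0) y - b (p 0) y0 y)) / (t - 0)) \<longlongrightarrow> A y - B y) (at 0)"
        by (simp add: has_field_derivative_iff)
      then show ?thesis using y0(2)[OF that] by (simp add: p_def)
    qed
  qed
  moreover have "\<forall>\<^sub>F t in at 0. sharp V (b (p t)) (\<lambda>y. (\<alpha> (p t) y - b (p t) y0 y) / t)
      = (sharp V (b (p t)) (\<alpha> (p t)) - y0) /\<^sub>R t"
    using p eventually_neq_at_within[of 0]
  proof eventually_elim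
    case (elim t)
    then have t: "p t \<in> S" "t \<noteq> 0" by auto
    note s = sharp_in[OF V b[OF t(1)] \<alpha>(1)[OF t(1)]] sharp_eq[OF V b[OF t(1)] \<alpha>(1)[OF t(1)]]
    show ?case
    proof (rule sharp_unique[OF V b[OF t(1)]])
      show "(sharp V (b (p t)) (\<alpha> (p t)) - y0) /\<^sub>R t \<in> V"
        using s y0 sV by (simp add: subspace_diff subspace_scale)
      fix y assume y: "y \<in> V"
      show "b (p t) ((sharp V (b (p t)) (\<alpha> (p t)) - y0) /\<^sub>R t) y = (\<alpha> (p t) y - b (p t) y0 y) / t"
        using linear_on_scale[OF sV bilinear_onD(1)[OF b(1)[OF t(1)] y], of "sharp V (b (p t)) (\<alpha> (p t)) - y0" "inverse t"]
          linear_on_diff[OF sV bilinear_onD(1)[OF b(1)[OF t(1)] y] s(1) y0(1)] s(2)[OF y] s(1) y0 sV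
        by (simp add: subspace_diff divide_inverse_commute)
    qed
  qed
  ultimately have "((\<lambda>t. (sharp V (b (p t)) (\<alpha> (p t)) - y0) /\<^sub>R t) \<longlongrightarrow> sharp V (b u) (\<lambda>y. A y - B y)) (at 0)"
    by (rule Lim_transform_eventually)
  then have "has_dird (\<lambda>x. sharp V (b x) (\<alpha> x)) u v (sharp V (b u) (\<lambda>y. A y - B y))"
    unfolding p_def y0_def by (rule has_dird_quotient)
  then show ?thesis by (simp add: B_def y0_def)
qed

private lemma Ck_on_sharp:
  "(\<And>x. x \<in> S \<Longrightarrow> linear_on V (\<alpha> x)) \<Longrightarrow> (\<And>y. y \<in> V \<Longrightarrow> Ck_on k D S (\<lambda>x. \<alpha> x y)) \<Longrightarrow>
    Ck_on k D S (\<lambda>x. sharp V (b x) (\<alpha> x))"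
proof (induction k arbitrary: \<alpha>)
  case 0
  then show ?case using sharp_continuous by simp
next
  case (Suc k)
  \<comment> \<open>The derivative formula contains \<open>sharp\<close> itself, so its smoothness
    of order \<open>k\<close> is needed before the order can be raised.\<close>
  have IH: "Ck_on k D S (\<lambda>x. sharp V (b x) (\<alpha> x))"
    by (rule Suc.IH[OF Suc.prems(1) Ck_on_Suc_lower[OF Suc.prems(2)]])
  show ?case
  proof (rule Ck_on_SucI[OF DS])
    show "continuous_on S (\<lambda>x. sharp V (b x) (\<alpha> x))" by (rule Ck_on_continuous[OF IH])
    have d: "has_dird (\<lambda>x. \<alpha> x y) u v (dird (\<lambda>x. \<alpha> x y) u v)" if "y \<in> V" "u \<in> S" "v \<in> D" for y u v
      by (rule Ck_on_SucD(1)[OF Suc.prems(2)[OF that(1)] that(3,2)])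
    show "has_dird (\<lambda>x. sharp V (b x) (\<alpha> x)) u v
      (sharp V (b u) (\<lambda>y. dird (\<lambda>x. \<alpha> x y) u v - (\<Sum>e\<in>Basis \<inter> V. (sharp V (b u) (\<alpha> u) \<bullet> e) * dird (\<lambda>x. b x e y) u v)))"
      if "u \<in> S" "v \<in> D" for u v
      by (rule sharp_has_dird[OF Suc.prems(1) d[OF _ that] that])
    fix v assume v: "v \<in> D"
    show "Ck_on k D S (\<lambda>u. sharp V (b u) (\<lambda>y. dird (\<lambda>x. \<alpha> x y) u v -
        (\<Sum>e\<in>Basis \<inter> V. (sharp V (b u) (\<alpha> u) \<bullet> e) * dird (\<lambda>x. b x e y) u v)))"
    proof (rule Suc.IH)
      fix x assume x: "x \<in> S"
      have "linear_on V (\<lambda>y. dird (\<lambda>x. \<alpha> x y) x v)"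
        by (rule has_dird_linear_on[OF V DS Suc.prems(1) d x v]) (use x v in auto)
      moreover have "linear_on V (\<lambda>y. dird (\<lambda>x. b x e y) x v)" if "e \<in> V" for e
        by (rule has_dird_linear_on[OF V DS bilinear_onD(2)[OF b(1) that] smooth_on_has_dird[OF smooth_b[OF that]] x v])
          (use x v in auto)
      then have "linear_on V (\<lambda>y. \<Sum>e\<in>Basis \<inter> V. (sharp V (b x) (\<alpha> x) \<bullet> e) * dird (\<lambda>x. b x e y) x v)"
        by (simp add: linear_on_def algebra_simps sum.distrib sum_distrib_left)
      ultimately show "linear_on V (\<lambda>y. dird (\<lambda>x. \<alpha> x y) x v -
          (\<Sum>e\<in>Basis \<inter> V. (sharp V (b x) (\<alpha> x) \<bullet> e) * dird (\<lambda>x. b x e y) x v))"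
        by (simp add: linear_on_def algebra_simps)
    next
      fix y assume y: "y \<in> V"
      have "Ck_on k D S (\<lambda>u. (sharp V (b u) (\<alpha> u) \<bullet> e) * dird (\<lambda>x. b x e y) u v)" if "e \<in> V" for e
        by (rule Ck_on_bilinear[OF DS bounded_bilinear_mult Ck_on_bounded_linear[OF DS bounded_linear_inner_left IH]])
          (use smooth_on_dird[OF smooth_b[OF that y] v] in \<open>simp add: smooth_on_def\<close>)
      note h = this
      have *: "Ck_on k D S (\<lambda>u. \<Sum>e\<in>F. (sharp V (b u) (\<alpha> u) \<bullet> e) * dird (\<lambda>x. b x e y) u v)"
        if "finite F" "F \<subseteq> V" for F
        using that(1,2) by (induction F rule: finite_induct) (auto simp: Ck_on_const[OF DS] Ck_on_add[OF DS] h)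
      have "Ck_on k D S (\<lambda>u. dird (\<lambda>x. \<alpha> x y) u v + - (\<Sum>e\<in>Basis \<inter> V. (sharp V (b u) (\<alpha> u) \<bullet> e) * dird (\<lambda>x. b x e y) u v))"
        by (rule Ck_on_add[OF DS Ck_on_SucD(2)[OF Suc.prems(2)[OF y] v]
              Ck_on_bounded_linear[OF DS bounded_linear_minus[OF bounded_linear_ident] *]]) auto
      then show "Ck_on k D S (\<lambda>u. dird (\<lambda>x. \<alpha> x y) u v - (\<Sum>e\<in>Basis \<inter> V. (sharp V (b u) (\<alpha> u) \<bullet> e) * dird (\<lambda>x. b x e y) u v))"
        by simp
    qed
  qed
qed

lemma smooth_on_sharp:
  assumes "\<And>x. x \<in> S \<Longrightarrow> linear_on V (\<alpha> x)" "\<And>y. y \<in> V \<Longrightarrow> smooth_on D S (\<lambda>x. \<alpha> x y)"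
  shows "smooth_on D S (\<lambda>x. sharp V (b x) (\<alpha> x))"
  unfolding smooth_on_def
  by (intro allI Ck_on_sharp assms(1)) (use assms(2) in \<open>auto simp: smooth_on_def\<close>)

end

section \<open>Local Kaehler geometry\<close>

abbreviation J :: "complex^'n::finite \<Rightarrow> complex^'n" where "J \<equiv> (*s) \<i>"

lemma J_add: "J (v + w) = J v + J w"
  by (simp add: vec_eq_iff algebra_simps)

lemma J_scaleR: "J (r *\<^sub>R v) = r *\<^sub>R J v"
  by (simp add: vec_eq_iff)

lemma J_minus: "J (- v) = - J v"
  by (simp add: vec_eq_iff)

lemma J_J [simp]: "J (J v) = - v"
  by (simp add: vec_eq_iff)

lemma J_sum: "J (\<Sum>i\<in>I. f i) = (\<Sum>i\<in>I. J (f i))"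
  by (simp add: vec_eq_iff sum_distrib_left)

lemma bounded_linear_J: "bounded_linear (J :: complex^'n::finite \<Rightarrow> complex^'n)"
  using linear_conv_bounded_linear by (intro linear_conv_bounded_linear[THEN iffD1] linearI J_add J_scaleR)

lemma linear_on_J: "linear_on V J"
  by (simp add: linear_on_def J_add J_scaleR)

lemma J_cspace: "v \<in> cspace B \<Longrightarrow> J v \<in> cspace B"
  by (auto simp: cspace_def)

lemma endo_J: "endo (cspace B) J"
  by (simp add: endo_def linear_on_J J_cspace)

locale kahler_chart =
  fixes B :: "'n::finite set" and S :: "(complex^'n) set"
    and G :: "complex^'n \<Rightarrow> complex^'n \<Rightarrow> complex^'n \<Rightarrow> real"
  assumes openS: "rel_open (cspace B) S"
    and bil: "\<And>u. u \<in> S \<Longrightarrow> bilinear_on (cspace B) (G u)"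
    and sym: "\<And>u v w. u \<in> S \<Longrightarrow> v \<in> cspace B \<Longrightarrow> w \<in> cspace B \<Longrightarrow> G u v w = G u w v"
    and pos: "\<And>u. u \<in> S \<Longrightarrow> pos_on (cspace B) (G u)"
    and GJ: "\<And>u v w. u \<in> S \<Longrightarrow> v \<in> cspace B \<Longrightarrow> w \<in> cspace B \<Longrightarrow> G u (J v) (J w) = G u v w"
    and smooth: "\<And>v w. v \<in> cspace B \<Longrightarrow> w \<in> cspace B \<Longrightarrow> smooth_on (cspace B) S (\<lambda>u. G u v w)"
    and closed: "\<And>u v w z. u \<in> S \<Longrightarrow> v \<in> cspace B \<Longrightarrow> w \<in> cspace B \<Longrightarrow> z \<in> cspace B \<Longrightarrow>
       ext_deriv2 (\<lambda>u v w. G u (J v) w) u v w z = 0"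
begin

abbreviation "V \<equiv> cspace B"

definition "D u a v w = dird (\<lambda>x. G x v w) u a"

abbreviation "\<Gamma> \<equiv> christoffel V G"

abbreviation "R \<equiv> riemann V G"

abbreviation "ric \<equiv> ricci V G"

text \<open>The Koszul formula in coordinates, that is, the Christoffel symbols of the first
  kind.\<close>

definition "\<alpha> u v w y = (D u v w y + D u w v y - D u y v w) / 2"

text \<open>The derivative of the logarithm of the volume density in direction \<open>J v\<close>.
  For a Kaehler metric this one-form is a potential of twice the Ricci form.\<close>

definition "\<tau> u v = tr V (\<lambda>z. \<Gamma> u (J v) z)"

lemma V: "coord_subspace V" by simp

lemma sV: "subspace V" using V by (rule coord_subspaceD)

lemma VI [simp]: "v \<in> V \<Longrightarrow> w \<in> V \<Longrightarrow> v + w \<in> V" "v \<in> V \<Longrightarrow> w \<in> V \<Longrightarrow> v - w \<in> V"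
  "v \<in> V \<Longrightarrow> - v \<in> V" "v \<in> V \<Longrightarrow> r *\<^sub>R v \<in> V" "v \<in> V \<Longrightarrow> J v \<in> V" "0 \<in> V"
  using sV J_cspace by (auto simp: subspace_add subspace_diff subspace_neg subspace_scale subspace_0)

context
  fixes u assumes u: "u \<in> S"
begin

lemma G_lin1: "z \<in> V \<Longrightarrow> linear_on V (\<lambda>v. G u v z)"
  and G_lin2: "z \<in> V \<Longrightarrow> linear_on V (G u z)"
  using bilinear_onD[OF bil[OF u]] by auto

lemma G_add1: "v \<in> V \<Longrightarrow> w \<in> V \<Longrightarrow> z \<in> V \<Longrightarrow> G u (v + w) z = G u v z + G u w z"
  and G_add2: "v \<in> V \<Longrightarrow> w \<in> V \<Longrightarrow> z \<in> V \<Longrightarrow> G u z (v + w) = G u z v + G u z w"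
  and G_diff1: "v \<in> V \<Longrightarrow> w \<in> V \<Longrightarrow> z \<in> V \<Longrightarrow> G u (v - w) z = G u v z - G u w z"
  and G_diff2: "v \<in> V \<Longrightarrow> w \<in> V \<Longrightarrow> z \<in> V \<Longrightarrow> G u z (v - w) = G u z v - G u z w"
  and G_minus1: "v \<in> V \<Longrightarrow> z \<in> V \<Longrightarrow> G u (- v) z = - G u v z"
  and G_minus2: "v \<in> V \<Longrightarrow> z \<in> V \<Longrightarrow> G u z (- v) = - G u z v"
  and G_scale1: "v \<in> V \<Longrightarrow> z \<in> V \<Longrightarrow> G u (r *\<^sub>R v) z = r * G u v z"
  and G_scale2: "v \<in> V \<Longrightarrow> z \<in> V \<Longrightarrow> G u z (r *\<^sub>R v) = r * G u z v"
  using linear_on_add[OF sV G_lin1, of z v w] linear_on_add[OF sV G_lin2, of z v w]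
    linear_on_diff[OF sV G_lin1, of z v w] linear_on_diff[OF sV G_lin2, of z v w]
    linear_on_minus[OF sV G_lin1, of z v] linear_on_minus[OF sV G_lin2, of z v]
    linear_on_scale[OF sV G_lin1, of z v r] linear_on_scale[OF sV G_lin2, of z v r] by auto

lemma GJ1: "v \<in> V \<Longrightarrow> w \<in> V \<Longrightarrow> G u (J v) w = - G u v (J w)"
  using GJ[OF u, of v "J w"] by (simp add: G_minus2)

lemma G_eqI: "v \<in> V \<Longrightarrow> w \<in> V \<Longrightarrow> (\<And>y. y \<in> V \<Longrightarrow> G u v y = G u w y) \<Longrightarrow> v = w"
  by (rule nondegenerate[OF V bil[OF u] pos[OF u]])

lemma D_has: "v \<in> V \<Longrightarrow> w \<in> V \<Longrightarrow> a \<in> V \<Longrightarrow> has_dird (\<lambda>x. G x v w) u a (D u a v w)"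
  unfolding D_def by (rule smooth_on_has_dird[OF smooth u])

lemma D_sym: "v \<in> V \<Longrightarrow> w \<in> V \<Longrightarrow> a \<in> V \<Longrightarrow> D u a v w = D u a w v"
  unfolding D_def by (rule dird_cong[OF openS u]) (auto intro: sym)

lemma D_J: "v \<in> V \<Longrightarrow> w \<in> V \<Longrightarrow> a \<in> V \<Longrightarrow> D u a (J v) (J w) = D u a v w"
  unfolding D_def by (rule dird_cong[OF openS u]) (auto intro: GJ)

lemma D_lin1: "v \<in> V \<Longrightarrow> a \<in> V \<Longrightarrow> linear_on V (\<lambda>w. D u a v w)"
  by (rule has_dird_linear_on[OF V openS bilinear_onD(2)[OF bil] D_has u]) auto

lemma D_lin2: "w \<in> V \<Longrightarrow> a \<in> V \<Longrightarrow> linear_on V (\<lambda>v. D u a v w)"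
  by (rule has_dird_linear_on[OF V openS bilinear_onD(1)[OF bil] D_has u]) auto

lemma D_lin3: "v \<in> V \<Longrightarrow> w \<in> V \<Longrightarrow> linear_on V (\<lambda>a. D u a v w)"
  unfolding D_def by (rule smooth_on_linear_dird[OF V openS smooth u])

lemma D_minus: "v \<in> V \<Longrightarrow> w \<in> V \<Longrightarrow> a \<in> V \<Longrightarrow> D u a v (- w) = - D u a v w"
   "v \<in> V \<Longrightarrow> w \<in> V \<Longrightarrow> a \<in> V \<Longrightarrow> D u a (- v) w = - D u a v w"
  using linear_on_minus[OF sV D_lin1] linear_on_minus[OF sV D_lin2] by auto

lemma D_J1: "v \<in> V \<Longrightarrow> w \<in> V \<Longrightarrow> a \<in> V \<Longrightarrow> D u a (J v) w = - D u a v (J w)"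
  using D_J[of v "J w" a] by (simp add: D_minus)

lemma \<alpha>_lin: "v \<in> V \<Longrightarrow> w \<in> V \<Longrightarrow> linear_on V (\<alpha> u v w)"
  using D_lin1[of w v] D_lin1[of v w] D_lin3[of v w]
  by (simp add: linear_on_def \<alpha>_def algebra_simps add_divide_distrib diff_divide_distrib)

lemma \<Gamma>_sharp: "\<Gamma> u v w = sharp V (G u) (\<alpha> u v w)"
  by (simp add: christoffel_def \<alpha>_def[abs_def] D_def)

lemma \<Gamma>_in [simp]: "v \<in> V \<Longrightarrow> w \<in> V \<Longrightarrow> \<Gamma> u v w \<in> V"
  unfolding \<Gamma>_sharp by (rule sharp_in[OF V bil[OF u] pos[OF u] \<alpha>_lin])

lemma \<Gamma>_eq: "v \<in> V \<Longrightarrow> w \<in> V \<Longrightarrow> y \<in> V \<Longrightarrow> G u (\<Gamma> u v w) y = \<alpha> u v w y"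
  unfolding \<Gamma>_sharp by (rule sharp_eq[OF V bil[OF u] pos[OF u] \<alpha>_lin])

lemma \<Gamma>_sym: "v \<in> V \<Longrightarrow> w \<in> V \<Longrightarrow> \<Gamma> u v w = \<Gamma> u w v"
  by (rule G_eqI) (auto simp: \<Gamma>_eq \<alpha>_def D_sym)

lemma \<Gamma>_lin2: 
  assumes v: "v \<in> V"
  shows "linear_on V (\<Gamma> u v)"
proof (rule linear_onI)
  fix w z r assume w: "w \<in> V" "z \<in> V"
  show "\<Gamma> u v (w + r *\<^sub>R z) = \<Gamma> u v w + r *\<^sub>R \<Gamma> u v z"
  proof (rule G_eqI)
    fix y assume y: "y \<in> V"
    show "G u (\<Gamma> u v (w + r *\<^sub>R z)) y = G u (\<Gamma> u v w + r *\<^sub>R \<Gamma> u v z) y"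
      using v w y linear_onD[OF D_lin2 w, of y v r] linear_onD[OF D_lin3 w, of v y r] linear_onD[OF D_lin1 w, of v y r]
      by (simp add: \<Gamma>_eq G_add1 G_scale1 \<alpha>_def field_simps)
  qed (use v w in auto)
qed

lemma \<Gamma>_lin1: "w \<in> V \<Longrightarrow> linear_on V (\<lambda>v. \<Gamma> u v w)"
  using \<Gamma>_lin2[of w] by (auto simp: linear_on_def \<Gamma>_sym[of _ w])

lemma \<Gamma>_metric: "v \<in> V \<Longrightarrow> w \<in> V \<Longrightarrow> y \<in> V \<Longrightarrow> D u v w y = G u (\<Gamma> u v w) y + G u w (\<Gamma> u v y)"
  by (simp add: sym[OF u, of w "\<Gamma> u v y"] \<Gamma>_eq \<alpha>_def D_sym[of w y v] D_sym[of v w y] D_sym[of v y w] field_simps)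

lemma closed_D:
  assumes "a \<in> V" "b \<in> V" "c \<in> V"
  shows "D u a (J b) c + D u b (J c) a + D u c (J a) b = 0"
  using closed[OF u assms] by (simp add: ext_deriv2_def D_def)

text \<open>Closedness is used at \<open>(v, w, y)\<close> and at \<open>(v, J w, J y)\<close>.
  After \<open>J\<close> has been moved between the arguments of \<open>G\<close>, the difference of
  the two identities is the equality of the Koszul expressions for both sides.\<close>

lemma \<Gamma>_J: 
  assumes v: "v \<in> V" and w: "w \<in> V"
  shows "\<Gamma> u v (J w) = J (\<Gamma> u v w)"
proof (rule G_eqI)
  fix y assume y: "y \<in> V"
  have "D u v (J w) y + D u w (J y) v + D u y (J v) w = 0"
    "D u v (J (J w)) (J y) + D u (J w) (J (J y)) v + D u (J y) (J v) (J w) = 0"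
    using closed_D[of v w y] closed_D[of v "J w" "J y"] v w y by auto
  moreover have "D u v (J w) y = - D u v w (J y)" "D u w (J y) v = D u w v (J y)"
    "D u y (J v) w = - D u y v (J w)" "D u v (J (J w)) (J y) = - D u v w (J y)"
    "D u (J w) (J (J y)) v = - D u (J w) v y" "D u (J y) (J v) (J w) = D u (J y) v w"
    using v w y D_sym[of "J y" v w] D_sym[of y v "J w"]
    by (simp_all only: D_J D_J1 D_minus J_J VI)
  ultimately have "D u v (J w) y + D u (J w) v y - D u y v (J w) = - (D u v w (J y) + D u w v (J y) - D u (J y) v w)"
    by linarith
  then show "G u (\<Gamma> u v (J w)) y = G u (J (\<Gamma> u v w)) y"
    using v w y by (simp add: GJ1 \<Gamma>_eq \<alpha>_def) (simp add: field_simps)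
qed (use v w in auto)

end

lemma \<Gamma>_smooth: 
  assumes v: "v \<in> V" and w: "w \<in> V"
  shows "smooth_on V S (\<lambda>u. \<Gamma> u v w)"
proof -
  have "smooth_on V S (\<lambda>u. sharp V (G u) (\<alpha> u v w))"
  proof (rule smooth_on_sharp[OF V openS bil pos smooth])
    show "linear_on V (\<alpha> u v w)" if "u \<in> S" for u using \<alpha>_lin that v w by simp
    show "smooth_on V S (\<lambda>u. \<alpha> u v w y)" if y: "y \<in> V" for y
        unfolding \<alpha>_def D_def divide_inverse
      by (intro smooth_on_mult[OF openS] smooth_on_const[OF openS] smooth_on_add[OF openS] smooth_on_diff[OF openS]
          smooth_on_dird smooth v w y)
  qed
  then show ?thesis
    using smooth_on_cong[OF openS, of "\<lambda>u. \<Gamma> u v w" "\<lambda>u. sharp V (G u) (\<alpha> u v w)"] \<Gamma>_sharp by simp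
qed

section \<open>Symmetries of the curvature tensor\<close>

definition "D\<Gamma> u a v w = dird (\<lambda>x. \<Gamma> x v w) u a"

lemma R_def: "R u v w z = D\<Gamma> u v w z - D\<Gamma> u w v z + \<Gamma> u v (\<Gamma> u w z) - \<Gamma> u w (\<Gamma> u v z)"
  by (simp add: riemann_def D\<Gamma>_def Let_def)

context
  fixes u assumes u: "u \<in> S"
begin

lemma D\<Gamma>_has: "v \<in> V \<Longrightarrow> w \<in> V \<Longrightarrow> a \<in> V \<Longrightarrow> has_dird (\<lambda>x. \<Gamma> x v w) u a (D\<Gamma> u a v w)"
  unfolding D\<Gamma>_def by (rule smooth_on_has_dird[OF \<Gamma>_smooth u])

lemma D\<Gamma>_in [simp]: "v \<in> V \<Longrightarrow> w \<in> V \<Longrightarrow> a \<in> V \<Longrightarrow> D\<Gamma> u a v w \<in> V"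
  by (rule has_dird_in[OF V openS _ u _ D\<Gamma>_has]) auto

lemma D\<Gamma>_sym: "v \<in> V \<Longrightarrow> w \<in> V \<Longrightarrow> a \<in> V \<Longrightarrow> D\<Gamma> u a v w = D\<Gamma> u a w v"
  unfolding D\<Gamma>_def by (rule dird_cong[OF openS u]) (auto intro: \<Gamma>_sym)

lemma D\<Gamma>_J:
  assumes "v \<in> V" "w \<in> V" "a \<in> V"
  shows "D\<Gamma> u a v (J w) = J (D\<Gamma> u a v w)"
proof -
  have "has_dird (\<lambda>x. J (\<Gamma> x v w)) u a (J (D\<Gamma> u a v w))"
    by (rule has_dird_bounded_linear[OF bounded_linear_J D\<Gamma>_has]) (use assms in auto)
  then have "has_dird (\<lambda>x. \<Gamma> x v (J w)) u a (J (D\<Gamma> u a v w))"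
    by (rule has_dird_cong_imp[OF openS u assms(3), rotated]) (use \<Gamma>_J assms in simp)
  then show ?thesis unfolding D\<Gamma>_def by (rule has_dird_dird)
qed

lemma D\<Gamma>_lin1: "v \<in> V \<Longrightarrow> a \<in> V \<Longrightarrow> linear_on V (\<lambda>w. D\<Gamma> u a v w)"
  by (rule has_dird_linear_on[OF V openS \<Gamma>_lin2 D\<Gamma>_has u]) auto

lemma D\<Gamma>_lin3: "v \<in> V \<Longrightarrow> w \<in> V \<Longrightarrow> linear_on V (\<lambda>a. D\<Gamma> u a v w)"
  unfolding D\<Gamma>_def by (rule smooth_on_linear_dird[OF V openS \<Gamma>_smooth u])

lemma R_in [simp]: "v \<in> V \<Longrightarrow> w \<in> V \<Longrightarrow> z \<in> V \<Longrightarrow> R u v w z \<in> V"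
  by (simp add: R_def u)

lemma R_anti: "R u v w z = - R u w v z"
  by (simp add: R_def)

lemma R_lin1: "w \<in> V \<Longrightarrow> z \<in> V \<Longrightarrow> linear_on V (\<lambda>v. R u v w z)"
  using D\<Gamma>_lin3[of w z] linear_on_add[OF sV \<Gamma>_lin2[OF u]] linear_on_scale[OF sV \<Gamma>_lin2[OF u]]
    linear_onD[OF D\<Gamma>_lin1[of z w]] linear_onD[OF \<Gamma>_lin1[OF u]]
  by (auto simp: linear_on_def R_def D\<Gamma>_sym[of _ z w] algebra_simps u)

lemma R_lin3: "v \<in> V \<Longrightarrow> w \<in> V \<Longrightarrow> linear_on V (\<lambda>z. R u v w z)"
  using linear_on_add[OF sV \<Gamma>_lin2[OF u]] linear_on_scale[OF sV \<Gamma>_lin2[OF u]]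
    linear_onD[OF D\<Gamma>_lin1[of w v]] linear_onD[OF D\<Gamma>_lin1[of v w]]
  by (auto simp: linear_on_def R_def algebra_simps u)

lemma R_minus2: "v \<in> V \<Longrightarrow> w \<in> V \<Longrightarrow> z \<in> V \<Longrightarrow> R u v (- w) z = - R u v w z"
  using R_anti[of v "- w" z] R_anti[of w v z] linear_on_minus[OF sV R_lin1[of v z], of w] by simp

lemma R_J: "v \<in> V \<Longrightarrow> w \<in> V \<Longrightarrow> z \<in> V \<Longrightarrow> R u v w (J z) = J (R u v w z)"
  by (simp add: R_def D\<Gamma>_J \<Gamma>_J u J_add)

lemma R_bianchi: "v \<in> V \<Longrightarrow> w \<in> V \<Longrightarrow> z \<in> V \<Longrightarrow> R u v w z + R u w z v + R u z v w = 0"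
  by (simp add: R_def D\<Gamma>_sym[of w v z] D\<Gamma>_sym[of z v w] D\<Gamma>_sym[of w z v]
      \<Gamma>_sym[OF u, of w v] \<Gamma>_sym[OF u, of z v] \<Gamma>_sym[OF u, of w z])

text \<open>Both orders of differentiating \<open>G u z y\<close> twice are expanded with the metric
  identity; equality of the mixed derivatives leaves exactly the curvature terms.\<close>

lemma R_skew:
  assumes v: "v \<in> V" and w: "w \<in> V" and z: "z \<in> V" and y: "y \<in> V"
  shows "G u (R u v w z) y = - G u z (R u v w y)"
proof -
  have D2: "dird (\<lambda>x. dird (\<lambda>x. G x z y) x w) u v =
      G u (\<Gamma> u v (\<Gamma> u w z)) y + G u (\<Gamma> u w z) (\<Gamma> u v y) + G u (D\<Gamma> u v w z) y +
      G u (\<Gamma> u v z) (\<Gamma> u w y) + G u z (\<Gamma> u v (\<Gamma> u w y)) + G u z (D\<Gamma> u v w y)"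
    if v: "v \<in> V" and w: "w \<in> V" for v w
  proof -
    have 1: "has_dird (\<lambda>x. G x (\<Gamma> x w z) y) u v (D u v (\<Gamma> u w z) y + G u (D\<Gamma> u v w z) y + G u (\<Gamma> u w z) 0)"
      by (rule has_dird_apply2[OF V openS bil D_has[OF u] _ D\<Gamma>_has _ has_dird_const u v]) (use v w z y in auto)
    have 2: "has_dird (\<lambda>x. G x z (\<Gamma> x w y)) u v (D u v z (\<Gamma> u w y) + G u 0 (\<Gamma> u w y) + G u z (D\<Gamma> u v w y))"
      by (rule has_dird_apply2[OF V openS bil D_has[OF u] _ has_dird_const _ D\<Gamma>_has u v]) (use v w z y in auto)
    have 0: "G u a 0 = 0" "G u 0 a = 0" if "a \<in> V" for a
      using linear_on_zero[OF sV G_lin1[OF u that]] linear_on_zero[OF sV G_lin2[OF u that]] by auto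
    have "dird (\<lambda>x. dird (\<lambda>x. G x z y) x w) u v = dird (\<lambda>x. G x (\<Gamma> x w z) y + G x z (\<Gamma> x w y)) u v"
      by (rule dird_cong[OF openS u v]) (use \<Gamma>_metric w z y in \<open>simp add: D_def\<close>)
    also have "\<dots> = D u v (\<Gamma> u w z) y + G u (D\<Gamma> u v w z) y + D u v z (\<Gamma> u w y) + G u z (D\<Gamma> u v w y)"
      using has_dird_dird[OF has_dird_add[OF 1 2]] 0 u v w z y by simp
    finally show ?thesis using u v w z y by (simp add: \<Gamma>_metric)
  qed
  have "dird (\<lambda>x. dird (\<lambda>x. G x z y) x w) u v = dird (\<lambda>x. dird (\<lambda>x. G x z y) x v) u w"
    by (rule smooth_on_dird_commute[OF V openS smooth[OF z y] u w v])
  then show ?thesis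
    unfolding D2[OF v w] D2[OF w v] R_def using u v w z y
    by (simp add: G_add1 G_add2 G_diff1 G_diff2)
qed

text \<open>The classical octahedron argument: the first Bianchi identity for the four cyclic shifts
  of \<open>(v, w, z, y)\<close>, combined with the two skew symmetries.\<close>

lemma R_pair:
  assumes v: "v \<in> V" "w \<in> V" "z \<in> V" "y \<in> V"
  shows "G u (R u v w z) y = G u (R u z y v) w"
proof -
  define K where "K a b c d = G u (R u a b c) d" for a b c d
  have 1: "K a b c d = - K b a c d" if "a \<in> V" "b \<in> V" "c \<in> V" "d \<in> V" for a b c d
    using that R_anti[of a b c] by (simp add: K_def G_minus1 u)
  have 2: "K a b c d = - K a b d c" if "a \<in> V" "b \<in> V" "c \<in> V" "d \<in> V" for a b c d
    using that R_skew[of a b c d] sym[OF u, of c "R u a b d"] by (simp add: K_def)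
  have 3: "K a b c d + K b c a d + K c a b d = 0" if "a \<in> V" "b \<in> V" "c \<in> V" "d \<in> V" for a b c d
  proof -
    have "G u (R u a b c + R u b c a + R u c a b) d = 0"
      using R_bianchi[OF that(1-3)] linear_on_zero[OF sV G_lin1[OF u that(4)]] by simp
    then show ?thesis using that by (simp add: K_def G_add1 u)
  qed
  have "K v w z y = K z y v w"
    using 3[of v w z y] 3[of w z y v] 3[of z y v w] 3[of y v w z]
      2[of w z y v] 2[of z y v w] 1[of v z y w] 2[of z v y w] 2[of y v w z] 2[of v w y z] 1[of w y v z] 2[of y w v z] v
    by simp
  then show ?thesis by (simp add: K_def)
qed

text \<open>Pair symmetry brings both \<open>J\<close> to the outside, where \<open>R_J\<close> and
  the invariance of \<open>G\<close> remove them.\<close>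

lemma R_JJ:
  assumes "v \<in> V" "w \<in> V" "z \<in> V"
  shows "R u (J v) (J w) z = R u v w z"
proof (rule G_eqI[OF u])
  fix y assume y: "y \<in> V"
  have "G u (R u (J v) (J w) z) y = G u (J (R u z y v)) (J w)"
    using R_pair[of "J v" "J w" z y] assms y by (simp add: R_J)
  also have "\<dots> = G u (R u v w z) y"
    using R_pair[of v w z y] assms y by (simp add: GJ u)
  finally show "G u (R u (J v) (J w) z) y = G u (R u v w z) y" .
qed (use assms in auto)

lemma ric_tr: "ric u w z = tr V (\<lambda>e. R u e w z)"
  by (simp add: ricci_def tr_def)

lemma R_endo1: "w \<in> V \<Longrightarrow> z \<in> V \<Longrightarrow> endo V (\<lambda>e. R u e w z)"
  by (simp add: endo_def R_lin1)

lemma ric_sym: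
  assumes "w \<in> V" "z \<in> V"
  shows "ric u w z = ric u z w"
  unfolding ric_tr
proof (rule tr_adjoint[OF V bil[OF u] pos[OF u] sym[OF u] R_endo1 R_endo1])
  fix e y assume ey: "e \<in> V" "y \<in> V"
  have "G u (R u e w z) y = G u (R u z y e) w" using R_pair ey assms by simp
  also have "\<dots> = - G u e (R u z y w)" using R_skew ey assms by simp
  also have "\<dots> = G u e (R u y z w)" using R_anti[of z y w] ey assms by (simp add: G_minus2 u)
  finally show "G u (R u e w z) y = G u e (R u y z w)" .
qed (use assms in auto)

text \<open>The map \<open>e \<mapsto> - J (R u (J e) w z)\<close> is the conjugate by
  \<open>J\<close> of the map traced in \<open>ric u w z\<close>.\<close>

lemma ric_J:
  assumes "w \<in> V" "z \<in> V"
  shows "ric u (J w) (J z) = ric u w z"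
proof -
  have "ric u (J w) (J z) = tr V (\<lambda>e. - J (R u (J e) w z))"
    unfolding ric_tr
  proof (rule tr_cong)
    fix e assume e: "e \<in> V"
    have "R u e (J w) (J z) = J (R u e (J w) z)" using e assms by (simp add: R_J)
    also have "R u e (J w) z = - R u (J e) w z"
      using R_JJ[of e "J w" z] R_minus2[of "J e" w z] e assms by simp
    finally show "R u e (J w) (J z) = - J (R u (J e) w z)" by (simp add: J_minus)
  qed
  also have "\<dots> = - tr V (\<lambda>e. J (R u (J e) w z))" by (rule tr_minus)
  also have "tr V (\<lambda>e. J (R u (J e) w z)) = tr V (\<lambda>e. R u (J (J e)) w z)"
    by (rule tr_endo_commute[OF V endo_compose[OF R_endo1[OF assms] endo_J] endo_J])
  also have "\<dots> = tr V (\<lambda>e. - R u e w z)"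
    by (rule tr_cong) (use linear_on_minus[OF sV R_lin1[OF assms]] in simp)
  finally show ?thesis by (simp add: tr_minus ric_tr)
qed

text \<open>The Bianchi identity writes \<open>R u w z e\<close> as
  \<open>R u e z w - R u e w z\<close>. After applying \<open>J\<close>, both terms are traced over
  the first argument, which gives Ricci components, and the invariance of Ricci under
  \<open>J\<close> merges them.\<close>

lemma tr_JR:
  assumes "w \<in> V" "z \<in> V"
  shows "tr V (\<lambda>e. J (R u w z e)) = - 2 * ric u w (J z)"
proof -
  have "tr V (\<lambda>e. J (R u w z e)) = tr V (\<lambda>e. R u e z (J w) - R u e w (J z))"
  proof (rule tr_cong)
    fix e assume e: "e \<in> V"
    have "R u w z e = - (R u z e w + R u e w z)"
      unfolding eq_neg_iff_add_eq_0 using R_bianchi[of w z e] e assms by (simp add: add.assoc)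
    then have "R u w z e = R u e z w - R u e w z"
      using R_anti[of z e w] by simp
    then show "J (R u w z e) = R u e z (J w) - R u e w (J z)"
      using e assms by (simp add: R_J)
  qed
  also have "\<dots> = ric u z (J w) - ric u w (J z)" by (simp add: tr_diff ric_tr)
  also have "ric u z (J w) = ric u (J z) (- w)"
    using ric_J[of z "J w"] assms by simp
  also have "\<dots> = - ric u (J z) w"
    unfolding ric_tr using R_lin3[of _ "J z"] linear_on_minus[OF sV] assms
    by (subst tr_minus[symmetric], intro tr_cong) auto
  finally show ?thesis using ric_sym[of w "J z"] assms by simp
qed

lemma \<tau>_eq: "v \<in> V \<Longrightarrow> \<tau> u v = tr V (\<lambda>z. J (\<Gamma> u v z))"
  unfolding \<tau>_def by (rule tr_cong) (use \<Gamma>_sym \<Gamma>_J u in simp)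

end

lemma \<tau>_has:
  assumes "u \<in> S" "v \<in> V" "w \<in> V"
  shows "has_dird (\<lambda>x. \<tau> x v) u w (tr V (\<lambda>z. J (D\<Gamma> u w v z)))"
proof -
  have "has_dird (\<lambda>x. tr V (\<lambda>z. J (\<Gamma> x v z))) u w (tr V (\<lambda>z. J (D\<Gamma> u w v z)))"
    by (rule tr_has_dird[OF V openS], rule has_dird_bounded_linear[OF bounded_linear_J D\<Gamma>_has]) (use assms in auto)
  then show ?thesis
    by (rule has_dird_cong_imp[OF openS assms(1,3), rotated]) (use \<tau>_eq assms in simp)
qed

lemma \<tau>_smooth: "v \<in> V \<Longrightarrow> smooth_on V S (\<lambda>u. \<tau> u v)"
  unfolding \<tau>_def by (rule tr_smooth_on[OF V openS]) (auto intro: \<Gamma>_smooth)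

lemma \<tau>_lin: "u \<in> S \<Longrightarrow> linear_on V (\<tau> u)"
  using \<Gamma>_lin1
  by (auto simp: \<tau>_def linear_on_def J_add J_scaleR simp flip: tr_add tr_scale intro!: tr_cong)

text \<open>The Ricci form of a Kaehler metric is the curvature of the canonical bundle.\<close>

lemma ext_deriv_\<tau>:
  assumes u: "u \<in> S" and v: "v \<in> V" and w: "w \<in> V"
  shows "ext_deriv1 \<tau> u v w = - 2 * ric u v (J w)"
proof -
  have "ext_deriv1 \<tau> u v w = tr V (\<lambda>z. J (D\<Gamma> u v w z)) - tr V (\<lambda>z. J (D\<Gamma> u w v z))"
    unfolding ext_deriv1_def using has_dird_dird[OF \<tau>_has[OF u w v]] has_dird_dird[OF \<tau>_has[OF u v w]] by simp
  moreover have "tr V (\<lambda>z. J (R u v w z)) = tr V (\<lambda>z. J (D\<Gamma> u v w z)) - tr V (\<lambda>z. J (D\<Gamma> u w v z))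
      + tr V (\<lambda>z. J (\<Gamma> u v (\<Gamma> u w z))) - tr V (\<lambda>z. J (\<Gamma> u w (\<Gamma> u v z)))"
    by (simp add: R_def J_add tr_add tr_diff)
  \<comment> \<open>The quadratic terms of the curvature cancel by cyclicity of the trace, since
    \<open>J\<close> commutes with \<Gamma>.\<close>
  moreover have "tr V (\<lambda>z. J (\<Gamma> u v (\<Gamma> u w z))) = tr V (\<lambda>z. J (\<Gamma> u w (\<Gamma> u v z)))"
  proof -
    have endo: "endo V (\<Gamma> u v)" if "v \<in> V" for v using \<Gamma>_lin2[OF u that] u that by (simp add: endo_def)
    have "tr V (\<lambda>z. J (\<Gamma> u v (\<Gamma> u w z))) = tr V (\<lambda>z. \<Gamma> u w (J (\<Gamma> u v z)))"
      by (rule tr_endo_commute[OF V endo[OF w] endo_compose[OF endo_J endo[OF v]]])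
    also have "\<dots> = tr V (\<lambda>z. J (\<Gamma> u w (\<Gamma> u v z)))"
      by (rule tr_cong) (use \<Gamma>_J u v w in simp)
    finally show ?thesis .
  qed
  ultimately show ?thesis using tr_JR[OF u v w] by simp
qed

lemma ric_eq:
  assumes u: "u \<in> S" and v: "v \<in> V" and w: "w \<in> V"
  shows "ric u v w = ext_deriv1 \<tau> u v (J w) / 2"
proof -
  have "ric u v (- w) = - ric u v w"
    unfolding ric_tr[OF u] using R_lin3[OF u _ v] linear_on_minus[OF sV] w
    by (subst tr_minus[symmetric], intro tr_cong) auto
  then show ?thesis using ext_deriv_\<tau>[OF u v, of "J w"] w by simp
qed

text \<open>The trace of the connection can be computed from any operator that satisfies the metric
  identity, because two such operators differ by a skew one.\<close>

lemma \<tau>_eqI: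
  assumes u: "u \<in> S" and v: "v \<in> V" and A: "endo V A"
    and eq: "\<And>w y. w \<in> V \<Longrightarrow> y \<in> V \<Longrightarrow> D u (J v) w y = G u (A w) y + G u w (A y)"
  shows "\<tau> u v = tr V A"
  unfolding \<tau>_def
proof (rule tr_skew_eq[OF V bil[OF u] pos[OF u] sym[OF u] _ A])
  show "endo V (\<Gamma> u (J v))" using \<Gamma>_lin2[OF u, of "J v"] u v by (simp add: endo_def)
  show "G u (\<Gamma> u (J v) w) y + G u w (\<Gamma> u (J v) y) = G u (A w) y + G u w (A y)" if "w \<in> V" "y \<in> V" for w y
    using eq[OF that] \<Gamma>_metric[OF u, of "J v" w y] v that by simp
qed auto

end

section \<open>Block decompositions\<close>

text \<open>The orthogonal complement of the kernel inside \<open>K\<close> is mapped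
  injectively.\<close>

lemma dim_kernel_image:
  fixes f :: "'a::euclidean_space \<Rightarrow> 'b::euclidean_space"
  assumes f: "linear f" and K: "subspace K"
  shows "dim K \<le> dim {v \<in> K. f v = 0} + dim (f ` K)"
proof -
  define N where "N = {v \<in> K. f v = 0}"
  have N: "subspace N" "N \<subseteq> K"
    unfolding N_def using K linear_0[OF f] by (auto simp: subspace_def linear_add[OF f] linear_scale[OF f])
  define C where "C = {y \<in> K. \<forall>x\<in>N. orthogonal x y}"
  have C: "subspace C" "C \<subseteq> K"
    unfolding C_def using K by (auto simp: subspace_def orthogonal_def inner_add_right)
  have "inj_on f (span C)"
  proof (rule inj_onI)
    fix x y assume "x \<in> span C" "y \<in> span C" and eq: "f x = f y"
    moreover have "span C = C" using C(1) by (rule span_eq_iff[THEN iffD2])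
    ultimately have xy: "x \<in> C" "y \<in> C" by auto
    then have d: "x - y \<in> C" using C(1) by (simp add: subspace_diff)
    then have "x - y \<in> N" using eq C(2) by (auto simp: N_def linear_diff[OF f])
    then have "orthogonal (x - y) (x - y)" using d by (auto simp: C_def)
    then show "x = y" by (simp add: orthogonal_def)
  qed
  then have "dim (f ` C) = dim C" using f by (intro dim_image_eq) auto
  moreover have "dim (f ` C) \<le> dim (f ` K)" using C by (intro dim_subset) auto
  moreover have "dim C + dim N = dim K"
    unfolding C_def by (rule dim_subspace_orthogonal_to_vectors[OF N(1) K N(2)])
  ultimately show ?thesis by (simp add: N_def)
qed

lemma joint_kernel:
  fixes f :: "'i \<Rightarrow> 'a::euclidean_space \<Rightarrow> 'b::euclidean_space"
  assumes "finite I" "\<And>i. i \<in> I \<Longrightarrow> linear (f i)" "\<And>i v. i \<in> I \<Longrightarrow> f i v \<in> W i" "subspace K"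
  shows "subspace {v \<in> K. \<forall>i\<in>I. f i v = 0} \<and> dim K \<le> dim {v \<in> K. \<forall>i\<in>I. f i v = 0} + (\<Sum>i\<in>I. dim (W i))"
  using assms
proof (induction I rule: finite_induct)
  case empty
  then show ?case by simp
next
  case (insert i I)
  define L where "L = {v \<in> K. \<forall>i\<in>I. f i v = 0}"
  have L: "subspace L" "dim K \<le> dim L + (\<Sum>i\<in>I. dim (W i))" using insert unfolding L_def by auto
  have fi: "linear (f i)" using insert by simp
  have eq: "{v \<in> K. \<forall>i\<in>insert i I. f i v = 0} = {v \<in> L. f i v = 0}" by (auto simp: L_def)
  have "subspace {v \<in> L. f i v = 0}"
    using L(1) linear_0[OF fi] by (auto simp: subspace_def linear_add[OF fi] linear_scale[OF fi])
  moreover have "dim L \<le> dim {v \<in> L. f i v = 0} + dim (f i ` L)"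
    by (rule dim_kernel_image[OF fi L(1)])
  moreover have "dim (f i ` L) \<le> dim (W i)" using insert.prems by (intro dim_subset) auto
  ultimately show ?case unfolding eq using L(2) insert.hyps by simp
qed

text \<open>The joint kernel of the other maps has at least the dimension of \<open>W i\<close>,
  because each map removes at most the dimension of its target. On this kernel \<open>f i\<close> is
  injective, hence onto \<open>W i\<close>.\<close>

lemma joint_surjective:
  fixes f :: "'i \<Rightarrow> 'a::euclidean_space \<Rightarrow> 'b::euclidean_space"
  assumes fin: "finite I" and lin: "\<And>i. i \<in> I \<Longrightarrow> linear (f i)" and W: "\<And>i v. i \<in> I \<Longrightarrow> f i v \<in> W i"
    and sW: "\<And>i. i \<in> I \<Longrightarrow> subspace (W i)" and K: "subspace K"
    and inj: "\<And>v. v \<in> K \<Longrightarrow> (\<And>i. i \<in> I \<Longrightarrow> f i v = 0) \<Longrightarrow> v = 0"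
    and dim: "(\<Sum>i\<in>I. dim (W i)) \<le> dim K" and i: "i \<in> I" and y: "y \<in> W i"
  shows "\<exists>v\<in>K. f i v = y \<and> (\<forall>j\<in>I - {i}. f j v = 0)"
proof -
  define L where "L = {v \<in> K. \<forall>j\<in>I - {i}. f j v = 0}"
  have L: "subspace L" "dim K \<le> dim L + (\<Sum>j\<in>I - {i}. dim (W j))"
    using joint_kernel[of "I - {i}" f W K] assms unfolding L_def by auto
  have "(\<Sum>j\<in>I. dim (W j)) = dim (W i) + (\<Sum>j\<in>I - {i}. dim (W j))"
    using fin i by (simp add: sum.remove)
  then have dL: "dim (W i) \<le> dim L" using dim L(2) by simp
  have "inj_on (f i) (span L)"
  proof (rule inj_onI)
    fix x y assume "x \<in> span L" "y \<in> span L" and eq: "f i x = f i y"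
    then have "x - y \<in> L" using L(1) by (metis span_eq_iff subspace_diff)
    moreover have "f i (x - y) = 0" using eq by (simp add: linear_diff[OF lin[OF i]])
    ultimately have "x - y = 0" by (intro inj) (auto simp: L_def)
    then show "x = y" by simp
  qed
  then have "dim (f i ` L) = dim L" using lin[OF i] by (intro dim_image_eq) auto
  then have "f i ` L = W i"
    using dL by (intro subspace_dim_equal linear_subspace_image[OF lin[OF i] L(1)] sW[OF i]) (auto simp: W i)
  then have "y \<in> f i ` L" using y by simp
  then obtain v where "v \<in> L" "f i v = y" by (elim imageE) simp
  then show ?thesis by (auto simp: L_def)
qed

lemma card_Basis_cspace: "card (Basis \<inter> (cspace B :: (complex^'n::finite) set)) = 2 * card B"
proof -
  have "Basis \<inter> (cspace B :: (complex^'n) set) = (\<lambda>(i, a). axis i a) ` (B \<times> {1, \<i>})"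
  proof (intro set_eqI iffI)
    fix e :: "complex^'n" assume e: "e \<in> Basis \<inter> cspace B"
    then obtain i a where ia: "e = axis i a" "a \<in> Basis" by (auto simp: Basis_vec_def)
    then have a: "a \<in> {1, \<i>}" by (simp add: Basis_complex_def)
    then have "axis i a $ i \<noteq> 0" by auto
    then have "i \<in> B" using e ia by (auto simp: cspace_def)
    with ia a show "e \<in> (\<lambda>(i, a). axis i a) ` (B \<times> {1, \<i>})" by auto
  next
    fix e :: "complex^'n" assume "e \<in> (\<lambda>(i, a). axis i a) ` (B \<times> {1, \<i>})"
    then obtain i a where ia: "e = axis i a" "i \<in> B" "a \<in> {1, \<i>}" by auto
    then have "e \<in> cspace B" by (auto simp: cspace_def axis_def)
    moreover have "e \<in> Basis" using ia by (auto simp: Basis_vec_def Basis_complex_def)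
    ultimately show "e \<in> Basis \<inter> cspace B" by simp
  qed
  moreover have "inj_on (\<lambda>(i, a). axis i a :: complex^'n) (B \<times> {1, \<i>})"
    by (auto simp: inj_on_def axis_eq_axis)
  ultimately have "card (Basis \<inter> (cspace B :: (complex^'n) set)) = card (B \<times> {1, \<i>})"
    by (simp add: card_image)
  also have "\<dots> = 2 * card B"
    by (simp add: card_cartesian_product)
  finally show ?thesis .
qed

lemma dim_cspace: "dim (cspace B :: (complex^'n::finite) set) = 2 * card B"
proof -
  have c: "coord_subspace (cspace B :: (complex^'n) set)" by simp
  have "independent (Basis \<inter> (cspace B :: (complex^'n) set))"
    using independent_Basis independent_mono by blast
  moreover have "cspace B \<subseteq> span (Basis \<inter> (cspace B :: (complex^'n) set))"
  proof
    fix v :: "complex^'n" assume v: "v \<in> cspace B"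
    have "proj (cspace B) v \<in> span (Basis \<inter> cspace B)"
      unfolding proj_def by (intro span_sum span_scale span_base)
    then show "v \<in> span (Basis \<inter> cspace B)" using proj_eq[OF c v] by simp
  qed
  ultimately have "dim (cspace B :: (complex^'n) set) = card (Basis \<inter> (cspace B :: (complex^'n) set))"
    by (intro dim_unique[OF _ _ _ refl]) auto
  then show ?thesis by (simp add: card_Basis_cspace)
qed

lemma tr_id_cspace: "tr (cspace B :: (complex^'n::finite) set) (\<lambda>v. v) = 2 * real (card B)"
  by (simp add: tr_id card_Basis_cspace)

lemma scale_complex: "c *s v = Re c *\<^sub>R v + Im c *\<^sub>R J v" for v :: "complex^'n::finite"
  by (simp add: vec_eq_iff complex_eq_iff)

lemma linear_on_tr_rank_one:
  fixes f :: "'a::euclidean_space \<Rightarrow> real"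
  assumes "linear_on UNIV f"
  shows "tr UNIV (\<lambda>w. f w *\<^sub>R e) = f e"
  using linear_on_expand[OF coord_subspace_UNIV assms, of e] by (simp add: tr_def inner_commute mult.commute)

text \<open>The factor 2 compares real and complex traces: the parts of the map along
  \<open>e\<close> and along \<open>J e\<close> each contribute
  \<open>Re (\<phi> e)\<close>.\<close>

lemma tr_complex_rank_one:
  fixes \<phi> :: "complex^'n::finite \<Rightarrow> complex"
  assumes lin: "linear_on UNIV \<phi>" and J: "\<And>v. \<phi> (J v) = \<i> * \<phi> v"
  shows "tr UNIV (\<lambda>w. \<phi> w *s e) = 2 * Re (\<phi> e)"
proof -
  have l: "linear_on UNIV (\<lambda>w. Re (\<phi> w))" "linear_on UNIV (\<lambda>w. Im (\<phi> w))"
    using lin by (simp_all add: linear_on_def)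
  have "tr UNIV (\<lambda>w. \<phi> w *s e) = tr UNIV (\<lambda>w. Re (\<phi> w) *\<^sub>R e) + tr UNIV (\<lambda>w. Im (\<phi> w) *\<^sub>R J e)"
    unfolding tr_add[symmetric] by (rule tr_cong, rule scale_complex)
  also have "\<dots> = Re (\<phi> e) + Im (\<phi> (J e))"
    unfolding linear_on_tr_rank_one[OF l(1)] linear_on_tr_rank_one[OF l(2)] by simp
  finally show ?thesis by (simp add: J)
qed

text \<open>Positivity at \<open>u0\<close> comes with a lower bound \<open>m\<close> on unit
  vectors, and a form whose coefficients differ by less than \<open>m\<close> in total is still
  positive.\<close>

lemma pos_on_open:
  fixes V :: "'a::euclidean_space set" and b :: "'c::real_normed_vector \<Rightarrow> 'a \<Rightarrow> 'a \<Rightarrow> real"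
  assumes V: "coord_subspace V" and DS: "rel_open D S" and u0: "u0 \<in> S"
    and bil: "\<And>u. u \<in> S \<Longrightarrow> bilinear_on V (b u)" and pos: "pos_on V (b u0)"
    and cont: "\<And>v w. v \<in> V \<Longrightarrow> w \<in> V \<Longrightarrow> continuous_on S (\<lambda>u. b u v w)"
  shows "\<exists>T. u0 \<in> T \<and> T \<subseteq> S \<and> rel_open D T \<and> (\<forall>u\<in>T. pos_on V (b u))"
proof -
  obtain m where m: "m > 0" "\<And>z. z \<in> V \<Longrightarrow> b u0 z z \<ge> m * (norm z)\<^sup>2"
    using pos_on_lower_bound[OF V bil[OF u0] pos] by blast
  define Q where "Q u = (\<Sum>e\<in>Basis \<inter> V. \<Sum>f\<in>Basis \<inter> V. \<bar>b u e f - b u0 e f\<bar>)" for u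
  define T where "T = S \<inter> Q -` {..<m}"
  have "continuous_on S Q"
    unfolding Q_def by (intro continuous_intros cont) auto
  then have "openin (top_of_set S) T"
    unfolding T_def by (rule continuous_openin_preimage_gen) simp
  moreover have "openin (top_of_set D) S" using DS by (simp add: rel_open_def)
  ultimately have "rel_open D T" using DS openin_trans by (auto simp: rel_open_def)
  moreover have "pos_on V (b u)" if "u \<in> T" for u
    unfolding pos_on_def
  proof (intro ballI impI)
    fix d assume d: "d \<in> V" "d \<noteq> 0"
    have u: "u \<in> S" "Q u < m" using that by (auto simp: T_def)
    have lin2: "linear_on V (\<lambda>w. b u d w - b u0 d w)" "\<And>e. e \<in> V \<Longrightarrow> linear_on V (\<lambda>w. b u w e - b u0 w e)"
      using bilinear_onD[OF bil[OF u(1)]] bilinear_onD[OF bil[OF u0]] d by (auto simp: linear_on_def algebra_simps)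
    have "\<bar>b u d d - b u0 d d\<bar> \<le> norm d * (\<Sum>f\<in>Basis \<inter> V. \<bar>b u d f - b u0 d f\<bar>)"
      by (rule linear_on_bound[OF V lin2(1) d(1)])
    also have "\<dots> \<le> norm d * (\<Sum>f\<in>Basis \<inter> V. norm d * (\<Sum>e\<in>Basis \<inter> V. \<bar>b u e f - b u0 e f\<bar>))"
      by (intro mult_left_mono sum_mono linear_on_bound[OF V lin2(2) d(1)]) auto
    also have "\<dots> = (norm d)\<^sup>2 * Q u"
      unfolding Q_def by (subst sum.swap) (simp add: sum_distrib_left power2_eq_square mult.assoc)
    also have "\<dots> < (norm d)\<^sup>2 * m" using u d by (intro mult_strict_left_mono) auto
    finally show "b u d d > 0" using m(2)[OF d(1)] by (simp add: mult.commute)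
  qed
  moreover have "u0 \<in> T" using u0 m by (simp add: T_def Q_def)
  ultimately show ?thesis by (intro exI[of _ T]) (auto simp: T_def)
qed

section \<open>Exterior derivatives\<close>

lemma ext_deriv1_cong:
  assumes "rel_open V S" "u \<in> S" "v \<in> V" "w \<in> V" "\<And>x y. x \<in> S \<Longrightarrow> y \<in> V \<Longrightarrow> \<alpha> x y = \<beta> x y"
  shows "ext_deriv1 \<alpha> u v w = ext_deriv1 \<beta> u v w"
  unfolding ext_deriv1_def
  using dird_cong[OF assms(1-3), of "\<lambda>u. \<alpha> u w" "\<lambda>u. \<beta> u w"] dird_cong[OF assms(1,2,4), of "\<lambda>u. \<alpha> u v" "\<lambda>u. \<beta> u v"] assms
  by simp

context
  fixes V S :: "(complex^'n::finite) set"
  assumes VS: "rel_open V S"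
begin

lemma ext_deriv1_add:
  assumes "\<And>y. y \<in> V \<Longrightarrow> smooth_on V S (\<lambda>x. \<alpha> x y)" "\<And>y. y \<in> V \<Longrightarrow> smooth_on V S (\<lambda>x. \<beta> x y)"
    and "u \<in> S" "v \<in> V" "w \<in> V"
  shows "ext_deriv1 (\<lambda>x y. \<alpha> x y + \<beta> x y) u v w = ext_deriv1 \<alpha> u v w + ext_deriv1 \<beta> u v w"
proof -
  have "dird (\<lambda>x. \<alpha> x y + \<beta> x y) u a = dird (\<lambda>x. \<alpha> x y) u a + dird (\<lambda>x. \<beta> x y) u a" if "y \<in> V" "a \<in> V" for y a
    by (intro has_dird_dird has_dird_add smooth_on_has_dird[OF assms(1) assms(3)] smooth_on_has_dird[OF assms(2) assms(3)] that)
  then show ?thesis using assms(4,5) by (simp add: ext_deriv1_def)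
qed

lemma ext_deriv1_sum:
  assumes "finite I" "\<And>i y. i \<in> I \<Longrightarrow> y \<in> V \<Longrightarrow> smooth_on V S (\<lambda>x. \<alpha> i x y)"
    and "u \<in> S" "v \<in> V" "w \<in> V"
  shows "ext_deriv1 (\<lambda>x y. \<Sum>i\<in>I. \<alpha> i x y) u v w = (\<Sum>i\<in>I. ext_deriv1 (\<alpha> i) u v w)"
proof -
  have "dird (\<lambda>x. \<Sum>i\<in>I. \<alpha> i x y) u a = (\<Sum>i\<in>I. dird (\<lambda>x. \<alpha> i x y) u a)" if "y \<in> V" "a \<in> V" for y a
    by (intro has_dird_dird has_dird_sum smooth_on_has_dird[OF assms(2) assms(3)] that)
  then show ?thesis using assms(4,5) by (simp add: ext_deriv1_def sum_subtractf)
qed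

lemma ext_deriv1_scale:
  assumes f: "smooth_on V S f" and "\<And>y. y \<in> V \<Longrightarrow> smooth_on V S (\<lambda>x. \<alpha> x y)"
    and "u \<in> S" "v \<in> V" "w \<in> V"
  shows "ext_deriv1 (\<lambda>x y. f x * \<alpha> x y) u v w =
    dird f u v * \<alpha> u w - dird f u w * \<alpha> u v + f u * ext_deriv1 \<alpha> u v w"
proof -
  have "dird (\<lambda>x. f x * \<alpha> x y) u a = f u * dird (\<lambda>x. \<alpha> x y) u a + dird f u a * \<alpha> u y" if "y \<in> V" "a \<in> V" for y a
    by (intro has_dird_dird has_dird_mult smooth_on_has_dird[OF assms(2) assms(3)] smooth_on_has_dird[OF f assms(3)] that)
  then show ?thesis using assms(4,5) by (simp add: ext_deriv1_def algebra_simps)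
qed

lemma ext_deriv2_ext_deriv1:
  assumes V: "coord_subspace V" and \<alpha>: "\<And>y. y \<in> V \<Longrightarrow> smooth_on V S (\<lambda>x. \<alpha> x y)"
    and u: "u \<in> S" and vs: "v \<in> V" "w \<in> V" "z \<in> V"
  shows "ext_deriv2 (ext_deriv1 \<alpha>) u v w z = 0"
proof -
  have 1: "dird (\<lambda>u. ext_deriv1 \<alpha> u b c) u a =
      dird (\<lambda>x. dird (\<lambda>x. \<alpha> x c) x b) u a - dird (\<lambda>x. dird (\<lambda>x. \<alpha> x b) x c) u a"
    if "a \<in> V" "b \<in> V" "c \<in> V" for a b c
    unfolding ext_deriv1_def
    by (intro has_dird_dird has_dird_diff smooth_on_has_dird[OF smooth_on_dird[OF \<alpha>] u] that)
  have 2: "dird (\<lambda>x. dird (\<lambda>x. \<alpha> x c) x b) u a = dird (\<lambda>x. dird (\<lambda>x. \<alpha> x c) x a) u b"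
    if "a \<in> V" "b \<in> V" "c \<in> V" for a b c
    by (rule smooth_on_dird_commute[OF V VS \<alpha>[OF that(3)] u that(2,1)])
  show ?thesis
    unfolding ext_deriv2_def using vs 2[of v w z] 2[of w z v] 2[of z v w] by (simp add: 1)
qed

context
  fixes W T :: "(complex^'n) set" and z :: "complex^'n \<Rightarrow> complex^'n"
  assumes V: "coord_subspace V" and W: "coord_subspace W" and WT: "rel_open W T"
    and z: "smooth_on V S z" "\<And>x. x \<in> S \<Longrightarrow> z x \<in> T"
begin

lemma dird_pullback_in: "u \<in> S \<Longrightarrow> v \<in> V \<Longrightarrow> dird z u v \<in> W"
  by (rule has_dird_in[OF W VS _ _ _ smooth_on_has_dird[OF z(1)]])
    (use z(2) rel_open_subset[OF WT] in auto)

lemma dird2_pullback_in: "u \<in> S \<Longrightarrow> v \<in> V \<Longrightarrow> w \<in> V \<Longrightarrow> dird (\<lambda>x. dird z x v) u w \<in> W"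
  by (rule has_dird_in[OF W VS dird_pullback_in _ _ smooth_on_has_dird[OF smooth_on_dird[OF z(1)]]]) auto

lemma dird_pullback_commute: "u \<in> S \<Longrightarrow> v \<in> V \<Longrightarrow> w \<in> V \<Longrightarrow>
    dird (\<lambda>x. dird z x v) u w = dird (\<lambda>x. dird z x w) u v"
  by (rule smooth_on_dird_commute[OF V VS z(1)])

lemma has_dird_pullback0:
  "smooth_on W T f \<Longrightarrow> u \<in> S \<Longrightarrow> a \<in> V \<Longrightarrow> has_dird (\<lambda>x. f (z x)) u a (dird f (z u) (dird z u a))"
  by (rule has_dird_compose[OF W WT _ VS z(2) _ _ smooth_on_has_dird[OF z(1)] dird_pullback_in]) auto

lemma has_dird_pullback1:
  assumes \<alpha>: "\<And>y. y \<in> T \<Longrightarrow> linear_on W (\<alpha> y)" "\<And>w. w \<in> W \<Longrightarrow> smooth_on W T (\<lambda>y. \<alpha> y w)"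
    and u: "u \<in> S" and v: "v \<in> V" and a: "a \<in> V"
  shows "has_dird (\<lambda>x. \<alpha> (z x) (dird z x v)) u a
     (dird (\<lambda>y. \<alpha> y (dird z u v)) (z u) (dird z u a) + \<alpha> (z u) (dird (\<lambda>x. dird z x v) u a))"
proof (rule has_dird_apply[where A="\<lambda>w. dird (\<lambda>y. \<alpha> y w) (z u) (dird z u a)", OF W VS _ _ dird_pullback_in[OF _ v] smooth_on_has_dird[OF smooth_on_dird[OF z(1) v] u a] u a])
  show "has_dird (\<lambda>x. \<alpha> (z x) y) u a (dird (\<lambda>x. \<alpha> x y) (z u) (dird z u a))" if "y \<in> W" for y
    by (rule has_dird_pullback0[OF \<alpha>(2)[OF that] u a])
qed (use \<alpha>(1) z(2) in auto)

text \<open>The second derivatives of \<open>z\<close> enter symmetrically and cancel under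
  antisymmetrization.\<close>

lemma ext_deriv1_pullback:
  fixes \<alpha> :: "complex^'n \<Rightarrow> complex^'n \<Rightarrow> real"
  assumes \<alpha>: "\<And>y. y \<in> T \<Longrightarrow> linear_on W (\<alpha> y)" "\<And>w. w \<in> W \<Longrightarrow> smooth_on W T (\<lambda>y. \<alpha> y w)"
    and u: "u \<in> S" and v: "v \<in> V" and w: "w \<in> V"
  shows "ext_deriv1 (\<lambda>x v. \<alpha> (z x) (dird z x v)) u v w = ext_deriv1 \<alpha> (z u) (dird z u v) (dird z u w)"
  unfolding ext_deriv1_def
  using has_dird_dird[OF has_dird_pullback1[OF \<alpha> u w v]] has_dird_dird[OF has_dird_pullback1[OF \<alpha> u v w]]
    dird_pullback_commute[OF u v w] by simp

lemma smooth_on_pullback1: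
  assumes \<alpha>: "\<And>y. y \<in> T \<Longrightarrow> linear_on W (\<alpha> y)" "\<And>w. w \<in> W \<Longrightarrow> smooth_on W T (\<lambda>y. \<alpha> y w)"
    and v: "v \<in> V"
  shows "smooth_on V S (\<lambda>x. \<alpha> (z x) (dird z x v))"
proof (rule smooth_on_apply[OF W VS _ _ dird_pullback_in[OF _ v] smooth_on_dird[OF z(1) v]])
  show "smooth_on V S (\<lambda>x. \<alpha> (z x) y)" if "y \<in> W" for y
    by (rule smooth_on_compose_on[OF W WT \<alpha>(2)[OF that] VS z(2) z(1)])
qed (use \<alpha>(1) z(2) in auto)

lemma smooth_on_pullback2:
  assumes b: "\<And>y. y \<in> T \<Longrightarrow> bilinear_on W (b y)" "\<And>v w. v \<in> W \<Longrightarrow> w \<in> W \<Longrightarrow> smooth_on W T (\<lambda>y. b y v w)"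
    and v: "v \<in> V" and w: "w \<in> V"
  shows "smooth_on V S (\<lambda>x. b (z x) (dird z x v) (dird z x w))"
proof (rule smooth_on_apply2[OF W VS _ _ dird_pullback_in[OF _ v] smooth_on_dird[OF z(1) v] dird_pullback_in[OF _ w] smooth_on_dird[OF z(1) w]])
  show "smooth_on V S (\<lambda>x. b (z x) y y')" if "y \<in> W" "y' \<in> W" for y y'
    by (rule smooth_on_compose_on[OF W WT b(2)[OF that] VS z(2) z(1)])
qed (use b(1) z(2) in auto)

lemma has_dird_pullback2:
  assumes b: "\<And>y. y \<in> T \<Longrightarrow> bilinear_on W (b y)" "\<And>v w. v \<in> W \<Longrightarrow> w \<in> W \<Longrightarrow> smooth_on W T (\<lambda>y. b y v w)"
    and u: "u \<in> S" and v: "v \<in> V" and w: "w \<in> V" and a: "a \<in> V"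
  shows "has_dird (\<lambda>x. b (z x) (dird z x v) (dird z x w)) u a
     (dird (\<lambda>y. b y (dird z u v) (dird z u w)) (z u) (dird z u a)
       + b (z u) (dird (\<lambda>x. dird z x v) u a) (dird z u w) + b (z u) (dird z u v) (dird (\<lambda>x. dird z x w) u a))"
proof (rule has_dird_apply2[where B="\<lambda>v w. dird (\<lambda>y. b y v w) (z u) (dird z u a)", OF W VS _ _
       dird_pullback_in[OF _ v] smooth_on_has_dird[OF smooth_on_dird[OF z(1) v] u a]
       dird_pullback_in[OF _ w] smooth_on_has_dird[OF smooth_on_dird[OF z(1) w] u a] u a])
  show "has_dird (\<lambda>x. b (z x) y y') u a (dird (\<lambda>x. b x y y') (z u) (dird z u a))"
    if "y \<in> W" "y' \<in> W" for y y'
    by (rule has_dird_pullback0[OF b(2)[OF that] u a])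
qed (use b(1) z(2) in auto)

text \<open>Terms with second derivatives of \<open>z\<close> cancel in pairs: the derivatives are
  symmetric while \<open>b\<close> is antisymmetric.\<close>

lemma ext_deriv2_pullback:
  assumes b: "\<And>y. y \<in> T \<Longrightarrow> bilinear_on W (b y)" "\<And>v w. v \<in> W \<Longrightarrow> w \<in> W \<Longrightarrow> smooth_on W T (\<lambda>y. b y v w)"
    and anti: "\<And>y v w. y \<in> T \<Longrightarrow> v \<in> W \<Longrightarrow> w \<in> W \<Longrightarrow> b y v w = - b y w v"
    and u: "u \<in> S" and vs: "v \<in> V" "w \<in> V" "x \<in> V"
  shows "ext_deriv2 (\<lambda>x v w. b (z x) (dird z x v) (dird z x w)) u v w x =
    ext_deriv2 b (z u) (dird z u v) (dird z u w) (dird z u x)"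
  unfolding ext_deriv2_def
  using has_dird_dird[OF has_dird_pullback2[OF b u vs(2,3,1)]]
    has_dird_dird[OF has_dird_pullback2[OF b u vs(3,1,2)]]
    has_dird_dird[OF has_dird_pullback2[OF b u vs(1,2,3)]]
    dird_pullback_commute[OF u vs(1,2)] dird_pullback_commute[OF u vs(2,3)] dird_pullback_commute[OF u vs(3,1)]
    anti[OF z(2)[OF u] dird2_pullback_in[OF u vs(2,1)] dird_pullback_in[OF u vs(3)]]
    anti[OF z(2)[OF u] dird2_pullback_in[OF u vs(3,2)] dird_pullback_in[OF u vs(1)]]
    anti[OF z(2)[OF u] dird2_pullback_in[OF u vs(1,3)] dird_pullback_in[OF u vs(2)]]
  by simp

end

end

lemma smooth_on_real_derivative:
  fixes f :: "real \<Rightarrow> real"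
  assumes T: "open T" and f: "smooth_on UNIV T f" and s: "s \<in> T"
  shows "(f has_real_derivative deriv f s) (at s)" "dird f s v = v * deriv f s"
proof -
  have h: "(f has_derivative dird f s) (at s)"
    by (rule smooth_on_has_derivative[OF T f s])
  interpret bounded_linear "dird f s" using h by (rule has_derivative_bounded_linear)
  define c where "c = dird f s 1"
  have eq: "dird f s v = v * c" for v using scaleR[of v 1] by (simp add: c_def)
  then have "dird f s = (*) c" by (auto simp: mult.commute)
  then have *: "(f has_real_derivative c) (at s)"
    using h unfolding has_field_derivative_def by simp
  then have "deriv f s = c" by (rule DERIV_imp_deriv)
  then show "(f has_real_derivative deriv f s) (at s)" "dird f s v = v * deriv f s"
    using * eq by auto
qed

lemma smooth_on_deriv:
  fixes f :: "real \<Rightarrow> real"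
  assumes T: "open T" and f: "smooth_on UNIV T f"
  shows "smooth_on UNIV T (deriv f)"
proof -
  have T': "rel_open UNIV T" using T by (simp add: rel_open_UNIV)
  have "smooth_on UNIV T (\<lambda>s. dird f s 1)" by (rule smooth_on_dird[OF f]) simp
  then show ?thesis
    using smooth_on_cong[OF T', of "deriv f" "\<lambda>s. dird f s 1"] smooth_on_real_derivative(2)[OF T f] by simp
qed

lemma has_dird_compose_real:
  fixes f :: "real \<Rightarrow> real" and X :: "'a::euclidean_space \<Rightarrow> real"
  assumes "open T" "smooth_on UNIV T f" "X u \<in> T" "has_dird X u v d"
  shows "has_dird (\<lambda>x. f (X x)) u v (deriv f (X u) * d)"
  using has_dird_chain[OF smooth_on_has_derivative[OF assms(1-3)] assms(4)]
    smooth_on_real_derivative(2)[OF assms(1-3)] by (simp add: mult.commute)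

section \<open>Curvature of the Calabi ansatz\<close>

text \<open>The ansatz on a coordinate domain where every projection lands in a single chart of its
  factor: \<open>z i\<close> is the projection, \<open>X\<close> the orbit parameter, \<Theta> the
  connection form and \<xi> the generator, with holomorphic components. The axiom \<open>dX\<close>
  is the action of the complex structure on the fibre directions.\<close>

locale calabi_chart = kahler_chart "UNIV :: 'n::finite set" U G for U G +
  fixes I :: "'i set" and Bs :: "'i \<Rightarrow> 'n set" and Ss :: "'i \<Rightarrow> (complex^'n) set"
    and gs :: "'i \<Rightarrow> complex^'n \<Rightarrow> complex^'n \<Rightarrow> complex^'n \<Rightarrow> real"
    and z :: "'i \<Rightarrow> complex^'n \<Rightarrow> complex^'n"
    and b a :: "'i \<Rightarrow> real" and T :: "real set" and h :: "real \<Rightarrow> real"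
    and X :: "complex^'n \<Rightarrow> real" and \<Theta> :: "complex^'n \<Rightarrow> complex^'n \<Rightarrow> real" and \<xi> :: "complex^'n \<Rightarrow> complex^'n"
  assumes finI: "finite I"
    and K: "\<And>i. i \<in> I \<Longrightarrow> kahler_chart (Bs i) (Ss i) (gs i)"
    and einstein: "\<And>i y v w. i \<in> I \<Longrightarrow> y \<in> Ss i \<Longrightarrow> v \<in> cspace (Bs i) \<Longrightarrow> w \<in> cspace (Bs i) \<Longrightarrow>
       ricci (cspace (Bs i)) (gs i) y v w = gs i y v w"
    and z_smooth: "\<And>i. i \<in> I \<Longrightarrow> smooth_on UNIV U (z i)"
    and z_in: "\<And>i u. i \<in> I \<Longrightarrow> u \<in> U \<Longrightarrow> z i u \<in> Ss i"
    and z_J: "\<And>i u v. i \<in> I \<Longrightarrow> u \<in> U \<Longrightarrow> dird (z i) u (J v) = J (dird (z i) u v)"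
    and X_smooth: "smooth_on UNIV U X" and X_in: "\<And>u. u \<in> U \<Longrightarrow> X u \<in> T"
    and T: "open T" and h_smooth: "smooth_on UNIV T h" and h_pos: "\<And>s. s \<in> T \<Longrightarrow> h s > 0"
    and A_pos: "\<And>i s. i \<in> I \<Longrightarrow> s \<in> T \<Longrightarrow> b i * s + a i > 0"
    and \<Theta>_lin: "\<And>u. u \<in> U \<Longrightarrow> linear_on UNIV (\<Theta> u)"
    and \<Theta>_smooth: "\<And>v. smooth_on UNIV U (\<lambda>u. \<Theta> u v)"
    and d\<Theta>: "\<And>u v w. u \<in> U \<Longrightarrow>
       ext_deriv1 \<Theta> u v w = (\<Sum>i\<in>I. b i * gs i (z i u) (J (dird (z i) u v)) (dird (z i) u w))"
    and \<xi>_smooth: "smooth_on UNIV U \<xi>" and \<xi>_J: "\<And>u v. u \<in> U \<Longrightarrow> dird \<xi> u (J v) = J (dird \<xi> u v)"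
    and \<Theta>_\<xi>: "\<And>u. u \<in> U \<Longrightarrow> \<Theta> u (\<xi> u) = 1" and \<Theta>_J\<xi>: "\<And>u. u \<in> U \<Longrightarrow> \<Theta> u (J (\<xi> u)) = 0"
    and z_\<xi>: "\<And>i u. i \<in> I \<Longrightarrow> u \<in> U \<Longrightarrow> dird (z i) u (\<xi> u) = 0"
    and dX: "\<And>u v. u \<in> U \<Longrightarrow> dird X u v = h (X u) * \<Theta> u (J v)"
    and G_eq: "\<And>u v w. u \<in> U \<Longrightarrow> G u v w = 1 / h (X u) * dird X u v * dird X u w + h (X u) * \<Theta> u v * \<Theta> u w +
       (\<Sum>i\<in>I. (b i * X u + a i) * gs i (z i u) (dird (z i) u v) (dird (z i) u w))"
    and dims: "CARD('n) = 1 + (\<Sum>i\<in>I. card (Bs i))"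
begin

abbreviation "W i \<equiv> cspace (Bs i)"
abbreviation "dz i u v \<equiv> dird (z i) u v"

text \<open>The form of type (1,0) with real part \<open>dX / h\<close> and imaginary part \<Theta>.
  Together with the \<open>dz i\<close> it is a complex coframe, in which \<open>e\<close> is the
  vector dual to \<open>lam\<close>.\<close>

definition "lam u v = Complex (\<Theta> u (J v)) (\<Theta> u v)"
definition "e u = - J (\<xi> u)"

lemma rU: "rel_open UNIV U" using openS by simp

lemma W: "coord_subspace (W i)" by simp

lemma rW: "i \<in> I \<Longrightarrow> rel_open (W i) (Ss i)" using kahler_chart.openS[OF K] .

lemma dz_in: "i \<in> I \<Longrightarrow> u \<in> U \<Longrightarrow> dz i u v \<in> W i"
  by (rule dird_pullback_in[OF rU _ W rW z_smooth z_in]) auto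

lemma dz_lin: "i \<in> I \<Longrightarrow> u \<in> U \<Longrightarrow> linear_on UNIV (dird (z i) u)"
  by (rule smooth_on_linear_dird[OF _ rU z_smooth]) auto

lemma dz_scale: "i \<in> I \<Longrightarrow> u \<in> U \<Longrightarrow> dz i u (c *s v) = c *s dz i u v"
  using dz_lin[of i u] unfolding scale_complex[of c]
  by (simp add: linear_on_add[OF subspace_UNIV] linear_on_scale[OF subspace_UNIV] z_J)

lemma dz_e: "i \<in> I \<Longrightarrow> u \<in> U \<Longrightarrow> dz i u (e u) = 0"
  unfolding e_def using linear_on_minus[OF subspace_UNIV dz_lin] by (simp add: z_J z_\<xi>)

lemma lam_lin: "u \<in> U \<Longrightarrow> linear_on UNIV (lam u)"
  using linear_onD[OF \<Theta>_lin]
  by (intro linear_onI) (simp add: lam_def complex_eq_iff J_add J_scaleR)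

lemma lam_zero: "u \<in> U \<Longrightarrow> lam u 0 = 0"
  by (rule linear_on_zero[OF subspace_UNIV lam_lin])

lemma lam_J: "u \<in> U \<Longrightarrow> lam u (J v) = \<i> * lam u v"
  using linear_on_minus[OF subspace_UNIV \<Theta>_lin] by (simp add: lam_def complex_eq_iff)

lemma lam_scale: "u \<in> U \<Longrightarrow> lam u (c *s v) = c * lam u v"
  using lam_lin[of u] unfolding scale_complex[of c]
  by (simp add: linear_on_add[OF subspace_UNIV] linear_on_scale[OF subspace_UNIV] lam_J complex_eq_iff)

lemma lam_e: "u \<in> U \<Longrightarrow> lam u (e u) = 1"
  using linear_on_minus[OF subspace_UNIV \<Theta>_lin, of u] 
  by (simp add: lam_def e_def J_minus \<Theta>_\<xi> \<Theta>_J\<xi> complex_eq_iff)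

lemma G_lam: "u \<in> U \<Longrightarrow> G u v w = h (X u) * (lam u v \<bullet> lam u w) +
    (\<Sum>i\<in>I. (b i * X u + a i) * gs i (z i u) (dz i u v) (dz i u w))"
  using h_pos[OF X_in, of u] by (simp add: G_eq dX lam_def inner_complex_def field_simps)

lemma frame_inj:
  assumes u: "u \<in> U" and 0: "lam u v = 0" "\<And>i. i \<in> I \<Longrightarrow> dz i u v = 0"
  shows "v = 0"
proof (rule ccontr)
  assume "v \<noteq> 0"
  then have "G u v v > 0" using pos[OF u] by (simp add: pos_on_def)
  moreover have "gs i (z i u) 0 0 = 0" if "i \<in> I" for i
    using linear_on_zero[OF kahler_chart.sV[OF K[OF that]] kahler_chart.G_lin1[OF K[OF that] z_in[OF that u]], of 0] subspace_0[OF kahler_chart.sV[OF K[OF that]]] by simp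
  then have "G u v v = 0" by (simp add: G_lam[OF u] 0)
  ultimately show False by simp
qed

lemma frame_eqI:
  assumes u: "u \<in> U" and "lam u v = lam u w" "\<And>i. i \<in> I \<Longrightarrow> dz i u v = dz i u w"
  shows "v = w"
proof -
  have "v - w = 0"
    by (rule frame_inj[OF u])
      (use assms linear_on_diff[OF subspace_UNIV lam_lin[OF u]] linear_on_diff[OF subspace_UNIV dz_lin[OF _ u]] in auto)
  then show ?thesis by simp
qed

text \<open>A dimension count: the kernel of \<open>lam u\<close> has real codimension at most 2,
  hence at least the total dimension of the factors, and the maps \<open>dz i\<close> are jointly
  injective on it.\<close>

lemma hor_exists:
  assumes u: "u \<in> U" and i: "i \<in> I" and y: "y \<in> W i"
  shows "\<exists>v. lam u v = 0 \<and> dz i u v = y \<and> (\<forall>j\<in>I - {i}. dz j u v = 0)"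
proof -
  have lin: "linear (lam u)" using lam_lin[OF u] by (simp add: linear_on_UNIV)
  define N where "N = {v. lam u v = 0}"
  have "subspace N" unfolding N_def by (rule linear_subspace_kernel[OF lin])
  moreover have "(\<Sum>i\<in>I. dim (W i)) \<le> dim N"
  proof -
    have "dim (UNIV :: (complex^'n) set) \<le> dim {v \<in> UNIV. lam u v = 0} + dim (lam u ` UNIV)"
      by (rule dim_kernel_image[OF lin subspace_UNIV])
    moreover have "dim (lam u ` UNIV) \<le> 2"
      using dim_subset_UNIV[of "lam u ` UNIV"] by simp
    moreover have "dim (UNIV :: (complex^'n) set) = 2 * CARD('n)" by simp
    ultimately show ?thesis using dims by (simp add: N_def dim_cspace sum_distrib_left)
  qed
  ultimately have "\<exists>v\<in>N. dz i u v = y \<and> (\<forall>j\<in>I - {i}. dz j u v = 0)"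
    using u i y dz_lin coord_subspaceD[OF W] frame_inj[OF u]
    by (intro joint_surjective[where f="\<lambda>i. dird (z i) u" and W=W] finI) (auto simp: linear_on_UNIV dz_in N_def)
  then show ?thesis by (auto simp: N_def)
qed

text \<open>The horizontal lift from factor \<open>i\<close> alone. The projection in it makes the
  lift linear on the whole coordinate space and not just on \<open>W i\<close>.\<close>

definition "hor u i y = (SOME v. lam u v = 0 \<and> dz i u v = proj (W i) y \<and> (\<forall>j\<in>I - {i}. dz j u v = 0))"

context
  fixes u assumes u: "u \<in> U"
begin

lemma hor: 
  assumes "i \<in> I"
  shows lam_hor: "lam u (hor u i y) = 0" and dz_hor': "j \<in> I \<Longrightarrow> dz j u (hor u i y) = (if j = i then proj (W i) y else 0)"
  using someI_ex[OF hor_exists[OF u assms proj_in[OF coord_subspaceD[OF W]], of y]] unfolding hor_def[symmetric] by auto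

lemma dz_hor: "i \<in> I \<Longrightarrow> j \<in> I \<Longrightarrow> y \<in> W i \<Longrightarrow> dz j u (hor u i y) = (if j = i then y else 0)"
  using dz_hor'[of i j y] proj_eq[OF W] by auto

lemma hor_lin:
  assumes i: "i \<in> I"
  shows "linear_on UNIV (hor u i)"
proof (rule linear_onI, rule frame_eqI[OF u])
  fix v w r
  show "lam u (hor u i (v + r *\<^sub>R w)) = lam u (hor u i v + r *\<^sub>R hor u i w)"
    by (simp add: lam_hor[OF i] linear_onD[OF lam_lin[OF u]])
  show "dz j u (hor u i (v + r *\<^sub>R w)) = dz j u (hor u i v + r *\<^sub>R hor u i w)" if "j \<in> I" for j
    using that by (simp add: dz_hor'[OF i] linear_onD[OF dz_lin[OF _ u]] proj_line)
qed

lemma hor_bl: "i \<in> I \<Longrightarrow> bounded_linear (hor u i)"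
  using hor_lin by (simp add: linear_on_UNIV linear_conv_bounded_linear)

lemma hor_J: "i \<in> I \<Longrightarrow> y \<in> W i \<Longrightarrow> hor u i (J y) = J (hor u i y)"
  by (rule frame_eqI[OF u]) (auto simp: lam_hor lam_J u dz_hor z_J J_cspace)

text \<open>The vector with prescribed components \<phi> and \<open>r i\<close> in the coframe
  \<open>lam\<close>, \<open>dz i\<close>; operators are described below by these
  components.\<close>

definition "blk \<phi> r w = \<phi> w *s e u + (\<Sum>i\<in>I. hor u i (r i w))"

lemma lam_blk: "lam u (blk \<phi> r w) = \<phi> w"
proof -
  have "lam u (\<Sum>i\<in>I. hor u i (r i w)) = 0"
    using linear_on_sum[OF subspace_UNIV lam_lin[OF u], of I "\<lambda>i. hor u i (r i w)" "\<lambda>_. 1"] by (simp add: lam_hor)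
  then show ?thesis
    by (simp add: blk_def linear_on_add[OF subspace_UNIV lam_lin[OF u]] lam_scale u lam_e)
qed

lemma dz_blk:
  assumes i: "i \<in> I" and r: "\<And>j. j \<in> I \<Longrightarrow> r j w \<in> W j"
  shows "dz i u (blk \<phi> r w) = r i w"
proof -
  have "dz i u (\<Sum>j\<in>I. hor u j (r j w)) = (\<Sum>j\<in>I. dz i u (hor u j (r j w)))"
    using linear_on_sum[OF subspace_UNIV dz_lin[OF i u], of I "\<lambda>i. hor u i (r i w)" "\<lambda>_. 1"] by simp
  also have "\<dots> = (\<Sum>j\<in>I. if j = i then r i w else 0)"
    using i r by (intro sum.cong refl) (auto simp: dz_hor)
  also have "\<dots> = r i w" using i finI by (simp add: sum.delta)
  finally show ?thesis
    using i by (simp add: blk_def linear_on_add[OF subspace_UNIV dz_lin[OF i u]] dz_scale u dz_e)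
qed

lemma blk_unique:
  assumes "lam u v = \<phi> w" "\<And>i. i \<in> I \<Longrightarrow> dz i u v = r i w"
  shows "v = blk \<phi> r w"
  by (rule frame_eqI[OF u]) (use assms dz_in[OF _ u] in \<open>auto simp: lam_blk dz_blk simp flip: assms(2)\<close>)

lemma blk_lin:
  assumes \<phi>: "linear_on UNIV \<phi>" and r: "\<And>i. i \<in> I \<Longrightarrow> linear_on UNIV (r i)"
  shows "linear_on UNIV (blk \<phi> r)"
proof (rule linear_onI)
  fix v w k
  have "hor u i (r i (v + k *\<^sub>R w)) = hor u i (r i v) + k *\<^sub>R hor u i (r i w)" if "i \<in> I" for i
    using that by (simp add: linear_onD[OF r] linear_onD[OF hor_lin])
  moreover have "\<phi> (v + k *\<^sub>R w) *s e u = \<phi> v *s e u + k *\<^sub>R (\<phi> w *s e u)"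
    by (simp add: linear_onD[OF \<phi>] vec_eq_iff algebra_simps)
  ultimately show "blk \<phi> r (v + k *\<^sub>R w) = blk \<phi> r v + k *\<^sub>R blk \<phi> r w"
    by (simp add: blk_def sum.distrib scaleR_sum_right scaleR_add_right)
qed

text \<open>Cyclicity moves the trace of each block \<open>hor u i \<circ> r i\<close> to the factor
  \<open>W i\<close>, where only the diagonal part of \<open>r i\<close> contributes.\<close>

lemma tr_blk:
  assumes \<phi>: "linear_on UNIV \<phi>" "\<And>v. \<phi> (J v) = \<i> * \<phi> v"
    and r: "\<And>i. i \<in> I \<Longrightarrow> linear_on UNIV (r i)" "\<And>i v. i \<in> I \<Longrightarrow> r i v \<in> W i"
  shows "tr UNIV (blk \<phi> r) = 2 * Re (\<phi> (e u)) + (\<Sum>i\<in>I. tr (W i) (\<lambda>y. r i (hor u i y)))"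
proof -
  have "tr UNIV (blk \<phi> r) = tr UNIV (\<lambda>w. \<phi> w *s e u) + (\<Sum>i\<in>I. tr UNIV (\<lambda>w. hor u i (r i w)))"
    unfolding blk_def tr_add tr_sum ..
  also have "tr UNIV (\<lambda>w. \<phi> w *s e u) = 2 * Re (\<phi> (e u))" by (rule tr_complex_rank_one[OF \<phi>])
  also have "(\<Sum>i\<in>I. tr UNIV (\<lambda>w. hor u i (r i w))) = (\<Sum>i\<in>I. tr (W i) (\<lambda>y. r i (hor u i y)))"
  proof (rule sum.cong[OF refl])
    fix i assume i: "i \<in> I"
    show "tr UNIV (\<lambda>w. hor u i (r i w)) = tr (W i) (\<lambda>y. r i (hor u i y))"
      by (rule tr_commute[OF coord_subspace_UNIV W r(1)[OF i] r(2)[OF i]])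
        (use linear_onD[OF hor_lin[OF i]] in \<open>auto simp: linear_on_def\<close>)
  qed
  finally show ?thesis .
qed

end

end

section \<open>The trace of the connection in the adapted frame\<close>

context calabi_chart
begin

definition "d2 i u p v = dird (\<lambda>x. dird (z i) x v) u p"

text \<open>With \<open>p\<close> the product of the powers
  \<open>(b i * s + a i) ^ card (Bs i)\<close>, this is \<open>(p h)' / p\<close>.\<close>

definition "psi s = deriv h s + h s * (\<Sum>i\<in>I. real (card (Bs i)) * b i / (b i * s + a i))"

abbreviation "tau i \<equiv> kahler_chart.\<tau> (Bs i) (gs i)"

abbreviation "chr i \<equiv> christoffel (W i) (gs i)"

lemma lam_smooth: "smooth_on UNIV U (\<lambda>u. lam u v)"
  unfolding lam_def Complex_eq
  by (intro smooth_on_add[OF rU] smooth_on_mult[OF rU] smooth_on_const[OF rU]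
      smooth_on_bounded_linear[OF rU bounded_linear_of_real] \<Theta>_smooth)

lemma e_smooth: "smooth_on UNIV U e"
  unfolding e_def
  by (intro smooth_on_minus[OF rU] smooth_on_bounded_linear[OF rU bounded_linear_J] \<xi>_smooth)

lemma psi_smooth: "smooth_on UNIV T psi"
proof -
  have rT: "rel_open UNIV T" using T by (simp add: rel_open_UNIV)
  have nz: "b i * s + a i \<noteq> 0" if "i \<in> I" "s \<in> T" for i s using A_pos[OF that] by simp
  show ?thesis
    unfolding psi_def[abs_def]
    by (intro smooth_on_add[OF rT] smooth_on_mult[OF rT] smooth_on_sum[OF rT] smooth_on_divide[OF rT]
        smooth_on_const[OF rT] smooth_on_id[OF rT] smooth_on_deriv[OF T] h_smooth nz)
qed

context
  fixes u assumes u: "u \<in> U"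
begin

lemma has_dird_dz: "i \<in> I \<Longrightarrow> has_dird (\<lambda>x. dird (z i) x v) u p (d2 i u p v)"
  unfolding d2_def by (rule smooth_on_has_dird[OF smooth_on_dird[OF z_smooth] u]) auto

lemma d2_in: "i \<in> I \<Longrightarrow> d2 i u p v \<in> W i"
  unfolding d2_def by (rule dird2_pullback_in[OF rU _ W rW z_smooth z_in u]) auto

lemma d2_lin: "i \<in> I \<Longrightarrow> linear_on UNIV (d2 i u p)"
  by (rule has_dird_linear_on[OF coord_subspace_UNIV rU dz_lin has_dird_dz u]) auto

lemma d2_sym: "i \<in> I \<Longrightarrow> d2 i u p v = d2 i u v p"
  unfolding d2_def by (rule smooth_on_dird_commute[OF coord_subspace_UNIV rU z_smooth u]) auto

lemma d2_J2: 
  assumes i: "i \<in> I"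
  shows "d2 i u p (J v) = J (d2 i u p v)"
proof -
  have "has_dird (\<lambda>x. dird (z i) x (J v)) u p (J (d2 i u p v))"
    by (rule has_dird_cong_imp[OF rU u _ _ has_dird_bounded_linear[OF bounded_linear_J has_dird_dz[OF i]]])
      (use z_J[OF i] in auto)
  then show ?thesis unfolding d2_def by (rule has_dird_dird)
qed

lemma d2_J1: "i \<in> I \<Longrightarrow> d2 i u (J p) v = J (d2 i u p v)"
  using d2_sym[of i "J p" v] d2_J2[of i v p] d2_sym[of i p v] by simp

lemma has_dird_lam: "has_dird (\<lambda>x. lam x v) u p (dird (\<lambda>x. lam x v) u p)"
  by (rule smooth_on_has_dird[OF lam_smooth u]) simp

lemma dlam_lin: "linear_on UNIV (\<lambda>v. dird (\<lambda>x. lam x v) u p)"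
  by (rule has_dird_linear_on[OF coord_subspace_UNIV rU lam_lin has_dird_lam u]) auto

lemma dlam_J: "dird (\<lambda>x. lam x (J v)) u p = \<i> * dird (\<lambda>x. lam x v) u p"
  by (rule has_dird_dird, rule has_dird_cong_imp[OF rU u _ _ has_dird_bounded_linear[OF bounded_linear_mult_right has_dird_lam]])
    (use lam_J in auto)

lemma has_dird_e: "has_dird e u p (dird e u p)"
  by (rule smooth_on_has_dird[OF e_smooth u]) simp

lemma e_J: "dird e u (J p) = J (dird e u p)"
proof -
  have "has_dird \<xi> u p (dird \<xi> u p)" for p by (rule smooth_on_has_dird[OF \<xi>_smooth u]) simp
  then have "has_dird e u p (- J (dird \<xi> u p))" for p
    unfolding e_def by (intro has_dird_minus has_dird_bounded_linear[OF bounded_linear_J])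
  then have "dird e u p = - J (dird \<xi> u p)" for p by (rule has_dird_dird)
  then show ?thesis by (simp add: \<xi>_J u J_minus)
qed

lemma dlam_e: "dird (\<lambda>x. lam x (e u)) u p = - lam u (dird e u p)"
proof -
  have "has_dird (\<lambda>x. lam x (e x)) u p (dird (\<lambda>x. lam x (e u)) u p + lam u (dird e u p))"
    by (rule has_dird_apply[where A="\<lambda>y. dird (\<lambda>x. lam x y) u p", OF coord_subspace_UNIV rU lam_lin has_dird_lam _ has_dird_e u]) auto
  then have "has_dird (\<lambda>x. 1 :: complex) u p (dird (\<lambda>x. lam x (e u)) u p + lam u (dird e u p))"
    by (rule has_dird_cong_imp[OF rU u UNIV_I, rotated]) (simp add: lam_e)
  then have "dird (\<lambda>x. lam x (e u)) u p + lam u (dird e u p) = 0"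
    using has_dird_dird has_dird_const by metis
  then show ?thesis by (simp add: add_eq_0_iff2)
qed

lemma has_dird_X: "has_dird X u p (dird X u p)"
  by (rule smooth_on_has_dird[OF X_smooth u]) simp

end

text \<open>\<open>A0\<close> and \<open>A1\<close> are the components of an operator compatible
  with the metric in direction \<open>p\<close>: half the logarithmic derivative of the coefficient
  \<open>h\<close> or \<open>b i * X u + a i\<close>, the base connection, and the derivative of the
  coframe. It is built for \<open>\<tau>_eqI\<close>, which asks for the metric identity and not for
  vanishing torsion.\<close>

definition "A0 u p w = (deriv h (X u) / h (X u) / 2 * dird X u p) *\<^sub>R lam u w + dird (\<lambda>x. lam x w) u p"

definition "A1 u p i w = (b i / (b i * X u + a i) / 2 * dird X u p) *\<^sub>R dz i u w
   + chr i (z i u) (dz i u p) (dz i u w) + d2 i u p w"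

context
  fixes u assumes u: "u \<in> U"
begin

lemma A0_lin: "linear_on UNIV (A0 u p)"
  by (intro linear_onI)
    (simp add: A0_def linear_onD[OF lam_lin[OF u]] linear_onD[OF dlam_lin[OF u]] scaleR_add_right mult.commute)

lemma A0_J: "A0 u p (J v) = \<i> * A0 u p v"
  by (simp add: A0_def lam_J u dlam_J algebra_simps)

lemma A0_e: "A0 u p (e u) = of_real (deriv h (X u) / h (X u) / 2 * dird X u p) - lam u (dird e u p)"
  by (simp add: A0_def lam_e u dlam_e scaleR_conv_of_real)

lemma chr_lin: "i \<in> I \<Longrightarrow> v \<in> W i \<Longrightarrow> linear_on (W i) (chr i (z i u) v)"
  using kahler_chart.\<Gamma>_lin2[OF K z_in[OF _ u]] by blast

lemma chr_in: "i \<in> I \<Longrightarrow> v \<in> W i \<Longrightarrow> w \<in> W i \<Longrightarrow> chr i (z i u) v w \<in> W i"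
  using kahler_chart.\<Gamma>_in[OF K z_in[OF _ u]] by blast

lemma A1_lin: 
  assumes i: "i \<in> I"
  shows "linear_on UNIV (A1 u p i)"
  by (intro linear_onI)
    (simp add: A1_def linear_onD[OF dz_lin[OF i u]] linear_onD[OF d2_lin[OF u i]]
      linear_onD[OF chr_lin[OF i dz_in[OF i u]] dz_in[OF i u] dz_in[OF i u]] algebra_simps)

lemma A1_in:
  assumes i: "i \<in> I"
  shows "A1 u p i w \<in> W i"
  unfolding A1_def
  by (intro subspace_add[OF coord_subspaceD[OF W]] subspace_scale[OF coord_subspaceD[OF W]] dz_in[OF i u] d2_in[OF u i] chr_in[OF i])

lemma A0_inner: "h (X u) * (A0 u p w \<bullet> lam u y) + h (X u) * (lam u w \<bullet> A0 u p y) =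
    deriv h (X u) * dird X u p * (lam u w \<bullet> lam u y) +
    h (X u) * (dird (\<lambda>x. lam x w) u p \<bullet> lam u y + lam u w \<bullet> dird (\<lambda>x. lam x y) u p)"
proof -
  have "h (X u) \<noteq> 0" using h_pos[OF X_in[OF u]] by simp
  then show ?thesis
    by (simp add: A0_def inner_add_left inner_add_right) (simp add: field_simps)
qed

lemma A1_inner: 
  assumes i: "i \<in> I"
  shows "(b i * X u + a i) * gs i (z i u) (A1 u p i w) (dz i u y) + (b i * X u + a i) * gs i (z i u) (dz i u w) (A1 u p i y) =
    (b i * X u + a i) * (dird (\<lambda>x. gs i x (dz i u w) (dz i u y)) (z i u) (dz i u p)
       + gs i (z i u) (d2 i u p w) (dz i u y) + gs i (z i u) (dz i u w) (d2 i u p y))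
    + b i * dird X u p * gs i (z i u) (dz i u w) (dz i u y)"
proof -
  note k = K[OF i] and zi = z_in[OF i u] and dzi = dz_in[OF i u]
  note add = kahler_chart.G_add1[OF k zi] kahler_chart.G_add2[OF k zi] kahler_chart.G_scale1[OF k zi]
     kahler_chart.G_scale2[OF k zi]
  have sub: "c *\<^sub>R dz i u w + chr i (z i u) (dz i u p) (dz i u w) \<in> W i" "c *\<^sub>R dz i u w \<in> W i" for c w
    by (intro subspace_add[OF coord_subspaceD[OF W]] subspace_scale[OF coord_subspaceD[OF W]] dzi chr_in[OF i])+
  have m: "dird (\<lambda>x. gs i x (dz i u w) (dz i u y)) (z i u) (dz i u p) =
     gs i (z i u) (chr i (z i u) (dz i u p) (dz i u w)) (dz i u y) + gs i (z i u) (dz i u w) (chr i (z i u) (dz i u p) (dz i u y))"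
    using kahler_chart.\<Gamma>_metric[OF k zi dzi dzi dzi] unfolding kahler_chart.D_def[OF k] .
  define c where "c = b i * X u + a i"
  define q where "q = b i / c"
  have "c \<noteq> 0" using A_pos[OF i X_in[OF u]] by (simp add: c_def)
  then have q: "b i = c * q" by (simp add: q_def)
  have "c * gs i (z i u) (A1 u p i w) (dz i u y) + c * gs i (z i u) (dz i u w) (A1 u p i y) =
    c * (dird (\<lambda>x. gs i x (dz i u w) (dz i u y)) (z i u) (dz i u p)
       + gs i (z i u) (d2 i u p w) (dz i u y) + gs i (z i u) (dz i u w) (d2 i u p y))
    + c * q * dird X u p * gs i (z i u) (dz i u w) (dz i u y)"
    unfolding m A1_def c_def[symmetric] q_def[symmetric]
    by (simp add: add sub dzi chr_in[OF i] d2_in[OF u i]) (simp add: algebra_simps)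
  then show ?thesis unfolding c_def[symmetric] q[symmetric] .
qed

text \<open>The product rule for \<open>G_lam\<close>, with the derivative of each coefficient split
  evenly between the two arguments.\<close>

lemma D_G: "D u p w y = G u (blk u (A0 u p) (A1 u p) w) y + G u w (blk u (A0 u p) (A1 u p) y)"
proof -
  have 1: "has_dird (\<lambda>x. h (X x) * (lam x w \<bullet> lam x y)) u p
     (h (X u) * (lam u w \<bullet> dird (\<lambda>x. lam x y) u p + dird (\<lambda>x. lam x w) u p \<bullet> lam u y)
       + deriv h (X u) * dird X u p * (lam u w \<bullet> lam u y))"
    by (intro has_dird_mult has_dird_inner has_dird_lam u
        has_dird_compose_real[where X=X and u=u, OF T h_smooth X_in[OF u]] has_dird_X)
  have 2: "has_dird (\<lambda>x. (b i * X x + a i) * gs i (z i x) (dz i x w) (dz i x y)) u p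
      ((b i * X u + a i) * (dird (\<lambda>x. gs i x (dz i u w) (dz i u y)) (z i u) (dz i u p)
       + gs i (z i u) (d2 i u p w) (dz i u y) + gs i (z i u) (dz i u w) (d2 i u p y))
      + (b i * dird X u p + 0) * gs i (z i u) (dz i u w) (dz i u y))" if i: "i \<in> I" for i
    unfolding d2_def
    by (intro has_dird_mult has_dird_add has_dird_const has_dird_bounded_linear[OF bounded_linear_mult_right] has_dird_X u
         has_dird_pullback2[OF rU coord_subspace_UNIV W rW[OF i] z_smooth[OF i] z_in[OF i]
          kahler_chart.bil[OF K[OF i]] kahler_chart.smooth[OF K[OF i]]] UNIV_I)
  have "has_dird (\<lambda>x. G x w y) u p (h (X u) * (lam u w \<bullet> dird (\<lambda>x. lam x y) u p + dird (\<lambda>x. lam x w) u p \<bullet> lam u y)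
       + deriv h (X u) * dird X u p * (lam u w \<bullet> lam u y) +
       (\<Sum>i\<in>I. (b i * X u + a i) * (dird (\<lambda>x. gs i x (dz i u w) (dz i u y)) (z i u) (dz i u p)
       + gs i (z i u) (d2 i u p w) (dz i u y) + gs i (z i u) (dz i u w) (d2 i u p y))
      + (b i * dird X u p + 0) * gs i (z i u) (dz i u w) (dz i u y)))"
    by (rule has_dird_cong_imp[OF rU u UNIV_I G_lam[symmetric] has_dird_add[OF 1 has_dird_sum[OF 2]]])
  then have "D u p w y = h (X u) * (lam u w \<bullet> dird (\<lambda>x. lam x y) u p + dird (\<lambda>x. lam x w) u p \<bullet> lam u y)
       + deriv h (X u) * dird X u p * (lam u w \<bullet> lam u y) +
       (\<Sum>i\<in>I. (b i * X u + a i) * (dird (\<lambda>x. gs i x (dz i u w) (dz i u y)) (z i u) (dz i u p)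
       + gs i (z i u) (d2 i u p w) (dz i u y) + gs i (z i u) (dz i u w) (d2 i u p y))
      + (b i * dird X u p + 0) * gs i (z i u) (dz i u w) (dz i u y))"
    unfolding D_def by (rule has_dird_dird)
  also have "\<dots> = (h (X u) * (A0 u p w \<bullet> lam u y) + h (X u) * (lam u w \<bullet> A0 u p y)) +
     (\<Sum>i\<in>I. (b i * X u + a i) * gs i (z i u) (A1 u p i w) (dz i u y) + (b i * X u + a i) * gs i (z i u) (dz i u w) (A1 u p i y))"
  proof (rule arg_cong2[where f="(+)"])
    show "h (X u) * (lam u w \<bullet> dird (\<lambda>x. lam x y) u p + dird (\<lambda>x. lam x w) u p \<bullet> lam u y)
       + deriv h (X u) * dird X u p * (lam u w \<bullet> lam u y) =
      h (X u) * (A0 u p w \<bullet> lam u y) + h (X u) * (lam u w \<bullet> A0 u p y)"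
      unfolding A0_inner by (simp add: algebra_simps)
  qed (rule sum.cong[OF refl], simp only: A1_inner add_0_right)
  also have "\<dots> = G u (blk u (A0 u p) (A1 u p) w) y + G u w (blk u (A0 u p) (A1 u p) y)"
    by (simp add: G_lam u lam_blk dz_blk A1_in sum.distrib)
  finally show ?thesis .
qed

lemma \<tau>_blk: "\<tau> u v = tr UNIV (blk u (A0 u (J v)) (A1 u (J v)))"
  by (rule \<tau>_eqI[simplified, OF u])
    (use D_G blk_lin[OF u A0_lin A1_lin] in \<open>auto simp: endo_def\<close>)

text \<open>The diagonal blocks are traced in direction \<open>J v\<close>. There \<open>dX\<close>
  becomes \<open>- h \<Theta>\<close>, so the derivatives of the coefficients assemble to
  \<open>- psi (X u) * \<Theta> u v\<close>. The last bracket involves only the coframe and its dual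
  vectors; it is identified as the closed form \<open>kap\<close> below.\<close>

lemma \<tau>_frame: "\<tau> u v = - psi (X u) * \<Theta> u v + (\<Sum>i\<in>I. tau i (z i u) (dz i u v)) +
   ((\<Sum>i\<in>I. tr (W i) (\<lambda>y. d2 i u (J v) (hor u i y))) - 2 * Re (lam u (dird e u (J v))))"
proof -
  have dXJ: "dird X u (J v) = - h (X u) * \<Theta> u v"
    using linear_on_minus[OF subspace_UNIV \<Theta>_lin[OF u]] by (simp add: dX u)
  have h: "h (X u) \<noteq> 0" using h_pos[OF X_in[OF u]] by simp
  have 1: "tr (W i) (\<lambda>y. A1 u (J v) i (hor u i y)) =
    - (real (card (Bs i)) * b i / (b i * X u + a i)) * h (X u) * \<Theta> u v + tau i (z i u) (dz i u v)
      + tr (W i) (\<lambda>y. d2 i u (J v) (hor u i y))" if i: "i \<in> I" for i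
  proof -
    define q where "q = b i / (b i * X u + a i)"
    have "tr (W i) (\<lambda>y. A1 u (J v) i (hor u i y)) =
       tr (W i) (\<lambda>y. (b i / (b i * X u + a i) / 2 * dird X u (J v)) *\<^sub>R y
         + chr i (z i u) (dz i u (J v)) y + d2 i u (J v) (hor u i y))"
      by (rule tr_cong) (simp add: A1_def dz_hor u i)
    also have "\<dots> = (b i / (b i * X u + a i) / 2 * dird X u (J v)) * (2 * real (card (Bs i)))
       + tr (W i) (chr i (z i u) (dz i u (J v))) + tr (W i) (\<lambda>y. d2 i u (J v) (hor u i y))"
      by (simp add: tr_add tr_scale tr_id_cspace)
    also have "tr (W i) (chr i (z i u) (dz i u (J v))) = tau i (z i u) (dz i u v)"
      unfolding kahler_chart.\<tau>_def[OF K[OF i]] z_J[OF i u] ..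
    finally show ?thesis unfolding times_divide_eq_right[symmetric] q_def[symmetric] dXJ by simp
  qed
  have "\<tau> u v = 2 * Re (A0 u (J v) (e u)) + (\<Sum>i\<in>I. tr (W i) (\<lambda>y. A1 u (J v) i (hor u i y)))"
    unfolding \<tau>_blk by (rule tr_blk[OF u A0_lin A0_J A1_lin A1_in])
  also have "2 * Re (A0 u (J v) (e u)) = - deriv h (X u) * \<Theta> u v - 2 * Re (lam u (dird e u (J v)))"
    unfolding A0_e using h dXJ by simp
  also have "(\<Sum>i\<in>I. tr (W i) (\<lambda>y. A1 u (J v) i (hor u i y))) =
    (\<Sum>i\<in>I. - (real (card (Bs i)) * b i / (b i * X u + a i)) * h (X u) * \<Theta> u v) + (\<Sum>i\<in>I. tau i (z i u) (dz i u v))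
      + (\<Sum>i\<in>I. tr (W i) (\<lambda>y. d2 i u (J v) (hor u i y)))"
    unfolding sum.distrib[symmetric] by (rule sum.cong[OF refl 1])
  also have "(\<Sum>i\<in>I. - (real (card (Bs i)) * b i / (b i * X u + a i)) * h (X u) * \<Theta> u v) =
     - (h (X u) * (\<Sum>i\<in>I. real (card (Bs i)) * b i / (b i * X u + a i))) * \<Theta> u v"
    by (simp add: sum_negf sum_distrib_left sum_distrib_right algebra_simps)
  finally show ?thesis by (simp add: psi_def algebra_simps)
qed

end

end

section \<open>Ricci and scalar curvature at a point\<close>

locale calabi_point = calabi_chart U G I Bs Ss gs z b a T h X \<Theta> \<xi>
  for U :: "(complex^'n::finite) set" and G and I :: "'i set" and Bs Ss gs z b a T h X \<Theta> \<xi> +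
  fixes u0 :: "complex^'n"
  assumes u0: "u0 \<in> U"
begin

text \<open>A holomorphic replacement of the frame at \<open>u\<close>, normalized at \<open>u0\<close>.\<close>

definition "P u v = blk u0 (lam u0) (\<lambda>i. dird (z i) u) v"

definition "DP u p v = dird (\<lambda>x. P x v) u p"

lemma lam_P: "lam u0 (P u v) = lam u0 v"
  unfolding P_def by (rule lam_blk[OF u0])

lemma dz_P: "i \<in> I \<Longrightarrow> u \<in> U \<Longrightarrow> dz i u0 (P u v) = dz i u v"
  unfolding P_def by (rule dz_blk[OF u0]) (auto intro: dz_in)

lemma P_lin: "u \<in> U \<Longrightarrow> linear_on UNIV (P u)"
  unfolding P_def by (rule blk_lin[OF u0 lam_lin[OF u0] dz_lin])

lemma P_scale: "u \<in> U \<Longrightarrow> P u (c *s v) = c *s P u v"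
  by (rule frame_eqI[OF u0]) (auto simp: lam_P dz_P dz_scale lam_scale u0)

lemma P_J: "u \<in> U \<Longrightarrow> P u (J v) = J (P u v)"
  by (rule P_scale)

lemma P_u0: "P u0 v = v"
  unfolding P_def by (rule blk_unique[OF u0, symmetric]) auto

lemma P_eq: "P u v = lam u0 v *s e u0 + (\<Sum>i\<in>I. hor u0 i (dz i u v))"
  by (simp add: P_def blk_def[OF u0])

lemma P_smooth: "smooth_on UNIV U (\<lambda>u. P u v)"
  unfolding P_eq
  by (intro smooth_on_add[OF rU] smooth_on_const[OF rU] smooth_on_sum[OF rU] smooth_on_bounded_linear[OF rU hor_bl[OF u0]]
      smooth_on_dird[OF z_smooth]) auto

lemma has_dird_P: "u \<in> U \<Longrightarrow> has_dird (\<lambda>x. P x v) u p (DP u p v)"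
  unfolding DP_def by (rule smooth_on_has_dird[OF P_smooth]) auto

lemma DP_eq: 
  assumes u: "u \<in> U"
  shows "DP u p v = (\<Sum>i\<in>I. hor u0 i (d2 i u p v))"
proof -
  have "has_dird (\<lambda>x. P x v) u p (0 + (\<Sum>i\<in>I. hor u0 i (d2 i u p v)))"
    unfolding P_eq
    by (intro has_dird_add has_dird_const has_dird_sum has_dird_bounded_linear[OF hor_bl[OF u0]] has_dird_dz[OF u])
  then show ?thesis unfolding DP_def by (simp add: has_dird_dird)
qed

lemma DP_lin: "u \<in> U \<Longrightarrow> linear_on UNIV (DP u p)"
  by (rule has_dird_linear_on[OF coord_subspace_UNIV rU P_lin has_dird_P]) auto

lemma DP_J1: "u \<in> U \<Longrightarrow> DP u (J p) v = J (DP u p v)"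
  by (simp add: DP_eq d2_J1 hor_J[OF u0] d2_in J_sum)

lemma DP_J2: "u \<in> U \<Longrightarrow> DP u p (J v) = J (DP u p v)"
  by (simp add: DP_eq d2_J2 hor_J[OF u0] d2_in J_sum)

lemma dz_DP: 
  assumes "i \<in> I" and u: "u \<in> U"
  shows "dz i u0 (DP u p v) = d2 i u p v"
proof -
  have "DP u p v = blk u0 (\<lambda>_. 0) (\<lambda>i. d2 i u p) v"
    unfolding DP_eq[OF u] blk_def[OF u0] by simp
  then show ?thesis using dz_blk[OF u0 assms(1), of "\<lambda>i. d2 i u p" v] d2_in[OF u] by simp
qed

lemma DP_smooth: "smooth_on UNIV U (\<lambda>u. DP u p v)"
  unfolding DP_def by (rule smooth_on_dird[OF P_smooth]) simp

lemma DP_commute: "u \<in> U \<Longrightarrow> dird (\<lambda>x. DP x v y) u w = dird (\<lambda>x. DP x w y) u v"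
  unfolding DP_def by (rule smooth_on_dird_commute[OF coord_subspace_UNIV rU P_smooth]) auto

lemma bilinear_P: "u \<in> U \<Longrightarrow> bilinear_on UNIV (\<lambda>v w. P u v \<bullet> w)"
  unfolding bilinear_on_def
  by (auto simp: linear_on_def linear_onD[OF P_lin] inner_add_left inner_add_right)

lemma N_exists: "\<exists>N. u0 \<in> N \<and> N \<subseteq> U \<and> rel_open UNIV N \<and> (\<forall>u\<in>N. pos_on UNIV (\<lambda>v w. P u v \<bullet> w))"
proof (rule pos_on_open[OF coord_subspace_UNIV rU u0 bilinear_P])
  show "pos_on UNIV (\<lambda>v w. P u0 v \<bullet> w)" by (simp add: pos_on_def P_u0)
  show "continuous_on U (\<lambda>u. P u v \<bullet> w)" for v w
    by (intro continuous_intros smooth_on_continuous[OF P_smooth])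
qed

text \<open>A neighbourhood on which \<open>P u\<close> stays so close to the identity
  \<open>P u0\<close> that the form \<open>P u v \<bullet> w\<close> is positive; this makes
  \<open>P u\<close> invertible.\<close>

definition "N = (SOME N. u0 \<in> N \<and> N \<subseteq> U \<and> rel_open UNIV N \<and> (\<forall>u\<in>N. pos_on UNIV (\<lambda>v w. P u v \<bullet> w)))"

lemma N: "u0 \<in> N" "N \<subseteq> U" "rel_open UNIV N" "\<And>u. u \<in> N \<Longrightarrow> pos_on UNIV (\<lambda>v w. P u v \<bullet> w)"
  using someI_ex[OF N_exists] unfolding N_def[symmetric] by auto

lemma NU: "u \<in> N \<Longrightarrow> u \<in> U" using N(2) by blast

text \<open>The inverse of \<open>P u\<close>, expressed through \<open>sharp\<close> so that
  \<open>smooth_on_sharp\<close> yields its smoothness.\<close>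

definition "Q u y = sharp UNIV (\<lambda>v w. P u v \<bullet> w) (\<lambda>w. y \<bullet> w)"

lemma lin_inner: "linear_on UNIV (\<lambda>w. y \<bullet> w)"
  by (simp add: linear_on_def inner_add_right)

context
  fixes u assumes u: "u \<in> N"
begin

lemma PQ: "P u (Q u y) = y"
proof -
  have "P u (Q u y) \<bullet> w = y \<bullet> w" for w
    unfolding Q_def
    by (rule sharp_eq[OF coord_subspace_UNIV bilinear_P[OF NU[OF u]] N(4)[OF u] lin_inner]) simp
  then have "\<forall>w. P u (Q u y) \<bullet> w = y \<bullet> w" by (rule allI)
  then show ?thesis by (simp only: vector_eq_rdot)
qed

lemma P_eqI: "P u v = P u w \<Longrightarrow> v = w"
  by (rule nondegenerate[OF coord_subspace_UNIV bilinear_P[OF NU[OF u]] N(4)[OF u]]) auto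

lemma QP: "Q u (P u v) = v"
  by (rule P_eqI) (rule PQ)

lemma Q_lin: "linear_on UNIV (Q u)"
  by (rule linear_onI, rule P_eqI) (simp add: PQ linear_onD[OF P_lin[OF NU[OF u]]])

lemma Q_J: "Q u (J v) = J (Q u v)"
  by (rule P_eqI) (simp add: PQ P_J NU u)

lemma QDP_endo: "endo UNIV (\<lambda>w. Q u (DP u p w))"
  by (auto simp: endo_def linear_on_def linear_onD[OF Q_lin] linear_onD[OF DP_lin[OF NU[OF u]]])

end

lemma Q_smooth: "smooth_on UNIV N (\<lambda>u. Q u y)"
  unfolding Q_def
  by (rule smooth_on_sharp[OF coord_subspace_UNIV N(3) bilinear_P[OF NU] N(4) _ lin_inner smooth_on_const[OF N(3)]])
    (auto intro!: smooth_on_bounded_linear[OF N(3) bounded_linear_inner_left] smooth_on_subset[OF P_smooth N(2)])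

lemma has_dird_Q:
  assumes u: "u \<in> N"
  shows "has_dird (\<lambda>x. Q x y) u p (- Q u (DP u p (Q u y)))"
proof -
  define D where "D = dird (\<lambda>x. Q x y) u p"
  have d: "has_dird (\<lambda>x. Q x y) u p D"
    unfolding D_def by (rule smooth_on_has_dird[OF Q_smooth u]) simp
  have "has_dird (\<lambda>x. P x (Q x y)) u p (DP u p (Q u y) + P u D)"
    by (rule has_dird_apply[where A="DP u p", OF coord_subspace_UNIV N(3) P_lin[OF NU] has_dird_P[OF NU[OF u]] _ d u]) auto
  then have "has_dird (\<lambda>x. y) u p (DP u p (Q u y) + P u D)"
    by (rule has_dird_cong_imp[OF N(3) u UNIV_I, rotated]) (simp add: PQ)
  from has_dird_dird[OF this] have "DP u p (Q u y) + P u D = 0" by simp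
  then have "P u D = - DP u p (Q u y)" by (simp add: add_eq_0_iff)
  then have "D = Q u (- DP u p (Q u y))" using QP[OF u, of D] by simp
  then show ?thesis using d linear_on_minus[OF subspace_UNIV Q_lin[OF u]] by simp
qed

text \<open>The holomorphic factor by which \<open>P u (e u)\<close> differs from the fixed vector
  \<open>e u0\<close>, see \<open>P_e\<close>.\<close>

definition "mu u = lam u0 (e u)"

lemma lam0_bl: "bounded_linear (lam u0)"
  using lam_lin[OF u0] by (simp add: linear_on_UNIV linear_conv_bounded_linear)

lemma mu_smooth: "smooth_on UNIV U mu"
  unfolding mu_def by (rule smooth_on_bounded_linear[OF rU lam0_bl e_smooth])

lemma dmu: "u \<in> U \<Longrightarrow> dird mu u p = lam u0 (dird e u p)"
  unfolding mu_def by (rule has_dird_dird[OF has_dird_bounded_linear[OF lam0_bl has_dird_e]])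

lemma dmu_J: "u \<in> U \<Longrightarrow> dird mu u (J p) = \<i> * dird mu u p"
  by (simp add: dmu e_J lam_J u0)

lemma P_e: "u \<in> U \<Longrightarrow> P u (e u) = mu u *s e u0"
  by (rule frame_eqI[OF u0]) (auto simp: lam_P dz_P dz_scale lam_scale u0 mu_def lam_e dz_e)

lemma mu_nz: "u \<in> N \<Longrightarrow> mu u \<noteq> 0"
proof
  assume u: "u \<in> N" and "mu u = 0"
  then have "P u (e u) = P u 0"
    using P_e[OF NU[OF u]] linear_on_zero[OF subspace_UNIV P_lin[OF NU[OF u]]] by (simp add: vec_eq_iff)
  then have "e u = 0" by (rule P_eqI[OF u])
  then show False using lam_e[OF NU[OF u]] lam_zero[OF NU[OF u]] by simp
qed

text \<open>Differentiate \<open>P_e\<close> and apply the inverse \<open>Q u\<close>.\<close>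

lemma QDP_e:
  assumes u: "u \<in> N"
  shows "Q u (DP u p (e u)) = (dird mu u p / mu u) *s e u - dird e u p"
proof -
  note uU = NU[OF u]
  have "has_dird (\<lambda>x. P x (e x)) u p (DP u p (e u) + P u (dird e u p))"
    by (rule has_dird_apply[where A="DP u p", OF coord_subspace_UNIV rU P_lin has_dird_P[OF uU] _ has_dird_e[OF uU] uU]) auto
  moreover have "has_dird (\<lambda>x. P x (e x)) u p (dird mu u p *s e u0)"
  proof -
    have bl: "bounded_linear (\<lambda>c. c *s e u0)"
      unfolding linear_conv_bounded_linear[symmetric]
      by (auto intro!: linearI simp: vec_eq_iff algebra_simps)
    have "has_dird (\<lambda>x. mu x *s e u0) u p (dird mu u p *s e u0)"
      by (rule has_dird_bounded_linear[OF bl smooth_on_has_dird[OF mu_smooth uU]]) simp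
    then show ?thesis
      by (rule has_dird_cong_imp[OF rU uU UNIV_I, rotated]) (simp add: P_e)
  qed
  ultimately have "DP u p (e u) + P u (dird e u p) = dird mu u p *s e u0"
    using has_dird_dird by metis
  moreover have "P u ((dird mu u p / mu u) *s e u - dird e u p) = dird mu u p *s e u0 - P u (dird e u p)"
    using mu_nz[OF u] by (simp add: linear_on_diff[OF subspace_UNIV P_lin[OF uU]] P_scale P_e uU vector_smult_assoc)
  ultimately have "P u ((dird mu u p / mu u) *s e u - dird e u p) = DP u p (e u)"
    by (metis add_diff_cancel_right')
  then show ?thesis using QP[OF u] by metis
qed

text \<open>Since \<open>dz i u \<circ> Q u = dz i u0\<close>, the base components of the operator
  \<open>Q u \<circ> DP u p\<close> are the second derivatives \<open>d2 i u p\<close>. This links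
  its trace to the bracket in \<open>\<tau>_frame\<close>.\<close>

lemma tr_QDP:
  assumes u: "u \<in> N"
  shows "tr UNIV (\<lambda>w. Q u (DP u p w)) = 2 * Re (lam u (Q u (DP u p (e u)))) + (\<Sum>i\<in>I. tr (W i) (\<lambda>y. d2 i u p (hor u i y)))"
proof -
  note uU = NU[OF u]
  have "Q u (DP u p w) = blk u (\<lambda>w. lam u (Q u (DP u p w))) (\<lambda>i. d2 i u p) w" for w
  proof (rule blk_unique[OF uU])
    show "lam u (Q u (DP u p w)) = lam u (Q u (DP u p w))" ..
    fix i assume i: "i \<in> I"
    show "dz i u (Q u (DP u p w)) = d2 i u p w"
      using dz_P[OF i uU, of "Q u (DP u p w)"] PQ[OF u] dz_DP[OF i uU] by simp
  qed
  then have "tr UNIV (\<lambda>w. Q u (DP u p w)) = tr UNIV (blk u (\<lambda>w. lam u (Q u (DP u p w))) (\<lambda>i. d2 i u p))"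
    by (intro tr_cong)
  also have "\<dots> = 2 * Re (lam u (Q u (DP u p (e u)))) + (\<Sum>i\<in>I. tr (W i) (\<lambda>y. d2 i u p (hor u i y)))"
  proof (rule tr_blk[OF uU])
    show "linear_on UNIV (\<lambda>w. lam u (Q u (DP u p w)))"
      by (simp add: linear_on_def linear_onD[OF lam_lin[OF uU]] linear_onD[OF Q_lin[OF u]] linear_onD[OF DP_lin[OF uU]])
    show "lam u (Q u (DP u p (J v))) = \<i> * lam u (Q u (DP u p v))" for v
      by (simp add: DP_J2 uU Q_J u lam_J)
  qed (auto intro: d2_lin d2_in uU)
  finally show ?thesis .
qed

text \<open>The bracket of \<open>\<tau>_frame\<close> in holomorphic terms: a logarithmic
  derivative of the determinant of \<open>P\<close> minus one of \<open>mu\<close>, with the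
  direction \<open>J v\<close> traded for a factor \<open>J\<close> or \<open>\<i>\<close>.\<close>

definition "kap u v = tr UNIV (\<lambda>w. J (Q u (DP u v w))) - 2 * Re (\<i> * (dird mu u v * inverse (mu u)))"

lemma \<tau>_kap:
  assumes u: "u \<in> N"
  shows "\<tau> u v = - psi (X u) * \<Theta> u v + (\<Sum>i\<in>I. tau i (z i u) (dz i u v)) + kap u v"
proof -
  note uU = NU[OF u]
  have "lam u (Q u (DP u p (e u))) = dird mu u p / mu u - lam u (dird e u p)" for p
    unfolding QDP_e[OF u] by (simp add: linear_on_diff[OF subspace_UNIV lam_lin[OF uU]] lam_scale uU lam_e)
  then have "(\<Sum>i\<in>I. tr (W i) (\<lambda>y. d2 i u p (hor u i y))) - 2 * Re (lam u (dird e u p)) =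
      tr UNIV (\<lambda>w. Q u (DP u p w)) - 2 * Re (dird mu u p / mu u)" for p
    unfolding tr_QDP[OF u] by simp
  from this[of "J v"] show ?thesis
    unfolding \<tau>_frame[OF uU] kap_def by (simp add: DP_J1 uU Q_J u dmu_J divide_inverse mult.assoc)
qed

lemma kap_smooth: "smooth_on UNIV N (\<lambda>u. kap u v)"
  unfolding kap_def
proof (intro smooth_on_diff[OF N(3)] tr_smooth_on[OF coord_subspace_UNIV N(3)] smooth_on_mult[OF N(3)] smooth_on_const[OF N(3)]
    smooth_on_bounded_linear[OF N(3) bounded_linear_Re] smooth_on_bounded_linear[OF N(3) bounded_linear_J])
  show "smooth_on UNIV N (\<lambda>x. Q x (DP x v w))" for w
    by (rule smooth_on_apply[OF coord_subspace_UNIV N(3) Q_lin Q_smooth _ smooth_on_subset[OF DP_smooth N(2)]]) auto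
  have "smooth_on UNIV N mu" by (rule smooth_on_subset[OF mu_smooth N(2)])
  then show "smooth_on UNIV N (\<lambda>x. dird mu x v)" "smooth_on UNIV N (\<lambda>x. inverse (mu x))"
    using smooth_on_dird[of UNIV N mu v] smooth_on_inverse[OF N(3), of mu] mu_nz by auto
qed

text \<open>The first part is the logarithmic derivative of the determinant of a holomorphic frame.\<close>

lemma kap_closed:
  assumes u: "u \<in> N"
  shows "ext_deriv1 kap u v w = 0"
proof -
  note uU = NU[OF u]
  define R where "R p q = tr UNIV (\<lambda>y. J (- Q u (DP u p (Q u (DP u q y))) + Q u (dird (\<lambda>x. DP x q y) u p)))" for p q
  define M where "M p q = 2 * Re (\<i> * (dird mu u q * - (inverse (mu u) * dird mu u p * inverse (mu u)) + dird (\<lambda>x. dird mu x q) u p * inverse (mu u)))" for p q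
  have d: "has_dird (\<lambda>x. kap x q) u p (R p q - M p q)" for p q
    unfolding kap_def R_def M_def
  proof (intro has_dird_diff tr_has_dird[OF coord_subspace_UNIV N(3)] has_dird_bounded_linear[OF bounded_linear_J]
        has_dird_bounded_linear[OF bounded_linear_mult_right] has_dird_bounded_linear[OF bounded_linear_Re])
    show "has_dird (\<lambda>x. Q x (DP x q y)) u p (- Q u (DP u p (Q u (DP u q y))) + Q u (dird (\<lambda>x. DP x q y) u p))" for y
      by (rule has_dird_apply[where A="\<lambda>y. - Q u (DP u p (Q u y))", OF coord_subspace_UNIV N(3) Q_lin has_dird_Q[OF u] _
           smooth_on_has_dird[OF DP_smooth uU] u]) auto
    show "has_dird (\<lambda>x. dird mu x q * inverse (mu x)) u p (dird mu u q * - (inverse (mu u) * dird mu u p * inverse (mu u)) +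
         dird (\<lambda>x. dird mu x q) u p * inverse (mu u))"
      by (intro has_dird_mult has_dird_inverse mu_nz u smooth_on_has_dird[OF smooth_on_dird[OF mu_smooth] uU]
          smooth_on_has_dird[OF mu_smooth uU]) auto
  qed
  \<comment> \<open>What remains is symmetry in \<open>p\<close> and \<open>q\<close>. Second
    derivatives are symmetric in both parts; the quadratic terms are symmetric for \<open>M\<close>
    by commutativity and for \<open>R\<close> by cyclicity of the trace.\<close>
  have M: "M p q = M q p" for p q
    unfolding M_def using smooth_on_dird_commute[OF coord_subspace_UNIV rU mu_smooth uU, of p q] by (simp add: mult_ac)
  have R: "R p q = R q p" for p q
  proof -
    have "R p q = - tr UNIV (\<lambda>y. J (Q u (DP u p (Q u (DP u q y))))) + tr UNIV (\<lambda>y. J (Q u (dird (\<lambda>x. DP x q y) u p)))" for p q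
      unfolding R_def J_add tr_add J_minus tr_minus ..
    moreover have "tr UNIV (\<lambda>y. J (Q u (DP u p (Q u (DP u q y))))) = tr UNIV (\<lambda>y. J (Q u (DP u q (Q u (DP u p y)))))"
    proof -
      have "endo UNIV J" using endo_J[of UNIV] by simp
      then have "endo UNIV (\<lambda>y. J (Q u (DP u p y)))" by (rule endo_compose[OF _ QDP_endo[OF u]])
      then have "tr UNIV (\<lambda>y. J (Q u (DP u p (Q u (DP u q y))))) = tr UNIV (\<lambda>y. Q u (DP u q (J (Q u (DP u p y)))))"
        by (rule tr_endo_commute[OF coord_subspace_UNIV QDP_endo[OF u]])
      then show ?thesis by (simp add: DP_J2 uU Q_J u)
    qed
    ultimately show ?thesis by (simp add: DP_commute[OF uU, of p _ q])
  qed
  show ?thesis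
    unfolding ext_deriv1_def using has_dird_dird[OF d[of w v]] has_dird_dird[OF d[of v w]] M[of v w] R[of v w] by simp
qed

text \<open>Ricci is half the exterior derivative of \<tau> at \<open>v\<close> and
  \<open>J w\<close>. The closed form \<open>kap\<close> drops out. The term
  \<open>- psi \<Theta>\<close> gives the fibre part and, through \<open>d\<Theta>\<close>, the
  multiple \<open>- b i * psi\<close> of each base metric. The pulled back \<open>tau i\<close> give
  twice the base Ricci tensors, which are the base metrics by the Einstein condition.\<close>

lemma ric_calabi:
  "ric u0 v w = - (deriv psi (X u0) * h (X u0) / 2) * (lam u0 v \<bullet> lam u0 w) +
     (\<Sum>i\<in>I. (1 - b i * psi (X u0) / 2) * gs i (z i u0) (dz i u0 v) (dz i u0 w))"
proof -
  note sub = smooth_on_subset[OF _ N(2)]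
  have psiX: "smooth_on UNIV U (\<lambda>u. - psi (X u))"
    by (intro smooth_on_minus[OF rU] smooth_on_compose[OF rU T _ psi_smooth X_smooth]) (use X_in in auto)
  have s1: "smooth_on UNIV N (\<lambda>u. - psi (X u) * \<Theta> u y)" for y
    by (rule smooth_on_mult[OF N(3) sub[OF psiX] sub[OF \<Theta>_smooth]])
  have s2: "smooth_on UNIV U (\<lambda>u. tau i (z i u) (dz i u y))" if i: "i \<in> I" for i y
    by (rule smooth_on_pullback1[OF rU coord_subspace_UNIV W rW[OF i] z_smooth[OF i] z_in[OF i] kahler_chart.\<tau>_lin[OF K[OF i]]
          kahler_chart.\<tau>_smooth[OF K[OF i]]]) auto
  have s3: "smooth_on UNIV N (\<lambda>u. \<Sum>i\<in>I. tau i (z i u) (dz i u y))" for y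
    by (rule sub[OF smooth_on_sum[OF rU s2]])
  have 0: "ext_deriv1 \<tau> u0 v w = ext_deriv1 (\<lambda>u y. - psi (X u) * \<Theta> u y) u0 v w + (\<Sum>i\<in>I. ext_deriv1 (\<lambda>u y. tau i (z i u) (dz i u y)) u0 v w)" for w
  proof -
    have "ext_deriv1 \<tau> u0 v w = ext_deriv1 (\<lambda>u y. - psi (X u) * \<Theta> u y + (\<Sum>i\<in>I. tau i (z i u) (dz i u y)) + kap u y) u0 v w"
      by (rule ext_deriv1_cong[OF N(3,1)]) (auto simp: \<tau>_kap)
    also have "\<dots> = ext_deriv1 (\<lambda>u y. - psi (X u) * \<Theta> u y) u0 v w + ext_deriv1 (\<lambda>u y. \<Sum>i\<in>I. tau i (z i u) (dz i u y)) u0 v w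
        + ext_deriv1 kap u0 v w"
      using ext_deriv1_add[OF N(3) smooth_on_add[OF N(3) s1 s3] kap_smooth N(1), where v=v and w=w] ext_deriv1_add[OF N(3) s1 s3 N(1), where v=v and w=w] by simp
    finally show ?thesis
      using kap_closed[OF N(1)] ext_deriv1_sum[OF rU finI s2 u0, where v=v and w=w] by simp
  qed
  have 1: "ext_deriv1 (\<lambda>u y. - psi (X u) * \<Theta> u y) u0 v w =
     - (deriv psi (X u0) * dird X u0 v) * \<Theta> u0 w + deriv psi (X u0) * dird X u0 w * \<Theta> u0 v - psi (X u0) * ext_deriv1 \<Theta> u0 v w" for w
  proof -
    have "dird (\<lambda>u. - psi (X u)) u0 y = - (deriv psi (X u0) * dird X u0 y)" for y
      by (intro has_dird_dird has_dird_minus has_dird_compose_real[where X=X, OF T psi_smooth X_in[OF u0]] has_dird_X u0)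
    then show ?thesis
      using ext_deriv1_scale[OF rU psiX \<Theta>_smooth u0, where v=v and w=w] by simp
  qed
  have 2: "ext_deriv1 (\<lambda>u y. tau i (z i u) (dz i u y)) u0 v (J w) = 2 * gs i (z i u0) (dz i u0 v) (dz i u0 w)" if i: "i \<in> I" for w i
  proof -
    have "ext_deriv1 (\<lambda>u y. tau i (z i u) (dz i u y)) u0 v (J w) = ext_deriv1 (tau i) (z i u0) (dz i u0 v) (dz i u0 (J w))"
      by (rule ext_deriv1_pullback[OF rU coord_subspace_UNIV W rW[OF i] z_smooth[OF i] z_in[OF i] kahler_chart.\<tau>_lin[OF K[OF i]]
          kahler_chart.\<tau>_smooth[OF K[OF i]] u0]) auto
    also have "\<dots> = 2 * ricci (W i) (gs i) (z i u0) (dz i u0 v) (dz i u0 w)"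
      using kahler_chart.ric_eq[OF K[OF i] z_in[OF i u0] dz_in[OF i u0] dz_in[OF i u0], of v w] unfolding z_J[OF i u0] by simp
    finally show ?thesis using einstein[OF i z_in[OF i u0] dz_in[OF i u0] dz_in[OF i u0]] by simp
  qed
  have \<Theta>J: "\<Theta> u0 (- w) = - \<Theta> u0 w" by (rule linear_on_minus[OF subspace_UNIV \<Theta>_lin[OF u0]]) simp
  have d\<Theta>J: "ext_deriv1 \<Theta> u0 v (J w) = (\<Sum>i\<in>I. b i * gs i (z i u0) (dz i u0 v) (dz i u0 w))"
    unfolding d\<Theta>[OF u0]
    by (rule sum.cong[OF refl]) (simp add: z_J u0 kahler_chart.GJ[OF K z_in dz_in dz_in])
  have "2 * ric u0 v w = ext_deriv1 \<tau> u0 v (J w)" using ric_eq[OF u0, of v w] by simp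
  also have "\<dots> = - (deriv psi (X u0) * h (X u0)) * (lam u0 v \<bullet> lam u0 w)
     - psi (X u0) * (\<Sum>i\<in>I. b i * gs i (z i u0) (dz i u0 v) (dz i u0 w)) + (\<Sum>i\<in>I. 2 * gs i (z i u0) (dz i u0 v) (dz i u0 w))"
    unfolding 0 1 d\<Theta>J by (simp add: 2 dX u0 \<Theta>J lam_def inner_complex_def algebra_simps)
  also have "(\<Sum>i\<in>I. 2 * gs i (z i u0) (dz i u0 v) (dz i u0 w)) = 2 * (\<Sum>i\<in>I. gs i (z i u0) (dz i u0 v) (dz i u0 w))"
    by (rule sum_distrib_left[symmetric])
  finally have r: "2 * ric u0 v w = - (deriv psi (X u0) * h (X u0)) * (lam u0 v \<bullet> lam u0 w)
     - psi (X u0) * (\<Sum>i\<in>I. b i * gs i (z i u0) (dz i u0 v) (dz i u0 w)) + 2 * (\<Sum>i\<in>I. gs i (z i u0) (dz i u0 v) (dz i u0 w))" .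
  have "(\<Sum>i\<in>I. (1 - b i * psi (X u0) / 2) * gs i (z i u0) (dz i u0 v) (dz i u0 w)) =
     (\<Sum>i\<in>I. gs i (z i u0) (dz i u0 v) (dz i u0 w)) - psi (X u0) / 2 * (\<Sum>i\<in>I. b i * gs i (z i u0) (dz i u0 v) (dz i u0 w))"
    unfolding sum_distrib_left sum_subtractf[symmetric] by (rule sum.cong[OF refl]) (simp add: algebra_simps)
  then show ?thesis using r by (simp add: algebra_simps)
qed

lemma scalar_curvature_calabi:
  "scalar_curvature UNIV G u0 = - deriv psi (X u0) +
     (\<Sum>i\<in>I. (1 - b i * psi (X u0) / 2) * (2 * real (card (Bs i))) / (b i * X u0 + a i))"
proof -
  \<comment> \<open>Ricci and the metric are diagonal in the same coframe, so the eigenvalues of the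
    Ricci endomorphism are quotients of coefficients: \<open>p\<close> on the fibre block and
    \<open>q i\<close> on factor \<open>i\<close>.\<close>
  define p where "p = - (deriv psi (X u0) / 2)"
  define q where "q i = (1 - b i * psi (X u0) / 2) / (b i * X u0 + a i)" for i
  define E where "E = blk u0 (\<lambda>w. p *\<^sub>R lam u0 w) (\<lambda>i w. q i *\<^sub>R dz i u0 w)"
  have qin: "i \<in> I \<Longrightarrow> q i *\<^sub>R dz i u0 w \<in> W i" for i w
    by (intro subspace_scale[OF coord_subspaceD[OF W]] dz_in u0)
  have "sharp UNIV (G u0) (ric u0 v) = E v" for v
  proof (rule sharp_unique[OF coord_subspace_UNIV])
    show "bilinear_on UNIV (G u0)" "pos_on UNIV (G u0)" using bil[OF u0] pos[OF u0] by auto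
    fix y
    have "(b i * X u0 + a i) * gs i (z i u0) (q i *\<^sub>R dz i u0 v) (dz i u0 y) =
       (1 - b i * psi (X u0) / 2) * gs i (z i u0) (dz i u0 v) (dz i u0 y)" if i: "i \<in> I" for i
      using A_pos[OF i X_in[OF u0]] 
      by (simp add: q_def kahler_chart.G_scale1[OF K[OF i] z_in[OF i u0] dz_in[OF i u0] dz_in[OF i u0]])
    then show "G u0 (E v) y = ric u0 v y"
      unfolding G_lam[OF u0] ric_calabi E_def lam_blk[OF u0]
      by (simp add: dz_blk[OF u0] qin p_def)
  qed auto
  then have "scalar_curvature UNIV G u0 = tr UNIV E"
    by (simp add: scalar_curvature_def tr_def)
  also have "\<dots> = 2 * Re (p *\<^sub>R lam u0 (e u0)) + (\<Sum>i\<in>I. tr (W i) (\<lambda>y. q i *\<^sub>R dz i u0 (hor u0 i y)))"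
    unfolding E_def
    by (rule tr_blk[OF u0])
      (auto simp: linear_on_def linear_onD[OF lam_lin[OF u0]] linear_onD[OF dz_lin[OF _ u0]] algebra_simps lam_J u0
         intro!: subspace_scale[OF coord_subspaceD[OF W]] dz_in)
  also have "(\<Sum>i\<in>I. tr (W i) (\<lambda>y. q i *\<^sub>R dz i u0 (hor u0 i y))) = (\<Sum>i\<in>I. q i * (2 * real (card (Bs i))))"
  proof (rule sum.cong[OF refl])
    fix i assume i: "i \<in> I"
    have "tr (W i) (\<lambda>y. q i *\<^sub>R dz i u0 (hor u0 i y)) = tr (W i) (\<lambda>y. q i *\<^sub>R y)"
      by (rule tr_cong) (simp add: dz_hor u0 i)
    then show "tr (W i) (\<lambda>y. q i *\<^sub>R dz i u0 (hor u0 i y)) = q i * (2 * real (card (Bs i)))"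
      by (simp add: tr_scale tr_id_cspace)
  qed
  finally show ?thesis by (simp add: p_def q_def lam_e u0)
qed

end

section \<open>Momentum profiles\<close>

lemma Ck_on_real_SucI:
  fixes f :: "real \<Rightarrow> real"
  assumes S: "open S" and d: "\<And>s. s \<in> S \<Longrightarrow> (f has_real_derivative f' s) (at s)" and k: "Ck_on k UNIV S f'"
  shows "Ck_on (Suc k) UNIV S f"
proof (rule Ck_on_SucI[where D="\<lambda>s v. v * f' s"])
  show rS: "rel_open UNIV S" using S by (simp add: rel_open_UNIV)
  show "continuous_on S f"
    using d by (intro continuous_at_imp_continuous_on ballI) (auto intro: DERIV_isCont)
  show "has_dird f s v (v * f' s)" if "s \<in> S" for s v
  proof -
    have "(f has_derivative (*) (f' s)) (at ((\<lambda>x. x) s))" using d[OF that] by (simp add: has_field_derivative_def)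
    moreover have "has_dird (\<lambda>x. x) s v v" unfolding has_dird_def by (auto intro!: derivative_eq_intros)
    ultimately have "has_dird (\<lambda>x. f x) s v (f' s * v)" by (rule has_dird_chain)
    then show ?thesis by (simp add: mult.commute)
  qed
  show "Ck_on k UNIV S (\<lambda>s. v * f' s)" for v
    by (rule Ck_on_bounded_linear[OF rS bounded_linear_mult_right k])
qed

text \<open>For \<open>s \<noteq> 0\<close> this is the integral of \<open>r ^ j * f r\<close> from
  0 to \<open>s\<close>, divided by \<open>s ^ Suc j\<close>; scaling to the unit interval keeps it
  smooth at \<open>s = 0\<close>.\<close>

definition wint :: "nat \<Rightarrow> (real \<Rightarrow> real) \<Rightarrow> real \<Rightarrow> real" where
  "wint j f s = integral {0..1} (\<lambda>t. t ^ j * f (t * s))"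

context
  fixes c d :: real
  assumes cd: "c < 0" "0 < d"
begin

private lemma star: "s \<in> {c<..<d} \<Longrightarrow> t \<in> {0..1} \<Longrightarrow> t * s \<in> {c<..<d}"
proof -
  assume s: "s \<in> {c<..<d}" and t: "t \<in> {0..1}"
  have "\<bar>t * s\<bar> \<le> \<bar>s\<bar>" using t by (simp add: abs_mult mult_left_le_one_le)
  moreover have "t * s \<ge> 0 \<longleftrightarrow> s \<ge> 0 \<or> t = 0" using t by (auto simp: zero_le_mult_iff)
  ultimately show ?thesis using s cd by (auto simp: abs_if split: if_splits)
qed

lemma wint_integrable:
  assumes f: "continuous_on {c<..<d} f" and s: "s \<in> {c<..<d}"
  shows "(\<lambda>t. t ^ j * f (t * s)) integrable_on {0..1}"
  by (intro integrable_continuous_real continuous_intros continuous_on_compose2[OF f])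
    (use star[OF s] in auto)

lemma wint_DERIV:
  assumes f: "smooth_on UNIV {c<..<d} f" and s: "s \<in> {c<..<d}"
  shows "(wint j f has_real_derivative wint (Suc j) (deriv f) s) (at s)"
proof -
  have o: "open {c<..<d}" by simp
  have f': "continuous_on {c<..<d} f" "continuous_on {c<..<d} (deriv f)"
    using smooth_on_continuous[OF f] smooth_on_continuous[OF smooth_on_deriv[OF o f]] by auto
  have "((\<lambda>x. integral (cbox 0 1) (\<lambda>t. t ^ j * f (t * x))) has_field_derivative
      integral (cbox 0 1) (\<lambda>t. t ^ j * (deriv f (t * s) * t))) (at s within {c<..<d})"
  proof (rule leibniz_rule_field_derivative)
    show "((\<lambda>x. t ^ j * f (t * x)) has_field_derivative t ^ j * (deriv f (t * x) * t)) (at x within {c<..<d})"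
      if "x \<in> {c<..<d}" "t \<in> cbox 0 1" for x t
    proof -
      have "(f has_real_derivative deriv f (t * x)) (at (t * x))"
        using smooth_on_real_derivative(1)[OF o f star[OF that(1)]] that(2) by simp
      moreover have "((\<lambda>x. t * x) has_real_derivative t) (at x within {c<..<d})"
        by (auto intro!: derivative_eq_intros)
      ultimately have "((\<lambda>x. f (t * x)) has_real_derivative deriv f (t * x) * t) (at x within {c<..<d})"
        by (rule DERIV_chain2)
      then show ?thesis by (rule DERIV_cmult)
    qed
    show "(\<lambda>t. t ^ j * f (t * x)) integrable_on cbox 0 1" if "x \<in> {c<..<d}" for x
      using wint_integrable[OF f'(1) that] by simp
    have "continuous_on ({c<..<d} \<times> cbox 0 1) (\<lambda>p. deriv f (snd p * fst p))"
      by (rule continuous_on_compose2[OF f'(2)]) (use star in \<open>auto intro!: continuous_intros\<close>)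
    then show "continuous_on ({c<..<d} \<times> cbox 0 1) (\<lambda>(x, t). t ^ j * (deriv f (t * x) * t))"
      unfolding case_prod_beta by (intro continuous_intros)
  qed (use s in auto)
  then have "((\<lambda>x. integral (cbox 0 1) (\<lambda>t. t ^ j * f (t * x))) has_field_derivative
      integral (cbox 0 1) (\<lambda>t. t ^ j * (deriv f (t * s) * t))) (at s)"
    using at_within_open[OF s o] by simp
  then show ?thesis
    by (simp add: wint_def[abs_def] mult_ac)
qed

lemma wint_smooth:
  assumes "smooth_on UNIV {c<..<d} f"
  shows "smooth_on UNIV {c<..<d} (wint j f)"
proof -
  have o: "open {c<..<d}" by simp
  have "Ck_on k UNIV {c<..<d} (wint j f)" if "smooth_on UNIV {c<..<d} f" for k
    using that
  proof (induction k arbitrary: f j)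
    case 0
    show ?case
      unfolding Ck_on.simps
      by (intro continuous_at_imp_continuous_on ballI) (rule DERIV_isCont[OF wint_DERIV[OF 0]])
  next
    case (Suc k)
    show ?case
      by (rule Ck_on_real_SucI[OF o wint_DERIV[OF Suc.prems] Suc.IH[OF smooth_on_deriv[OF o Suc.prems]]])
  qed
  then show ?thesis using assms by (simp add: smooth_on_def)
qed

text \<open>The fundamental theorem of calculus for \<open>t ^ Suc j * f (t * s)\<close>. Together
  with \<open>wint_DERIV\<close> it says that \<open>s ^ Suc j * wint j f s\<close> has derivative
  \<open>s ^ j * f s\<close>, which is how the differential equations below are solved.\<close>

lemma wint_parts:
  assumes f: "smooth_on UNIV {c<..<d} f" and s: "s \<in> {c<..<d}"
  shows "real (Suc j) * wint j f s + s * wint (Suc j) (deriv f) s = f s"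
proof -
  have o: "open {c<..<d}" by simp
  have f': "continuous_on {c<..<d} f" "continuous_on {c<..<d} (deriv f)"
    using smooth_on_continuous[OF f] smooth_on_continuous[OF smooth_on_deriv[OF o f]] by auto
  have "((\<lambda>t. real (Suc j) * (t ^ j * f (t * s)) + s * (t ^ Suc j * deriv f (t * s))) has_integral
      (1 ^ Suc j * f (1 * s) - 0 ^ Suc j * f (0 * s))) {0..1}"
  proof (rule fundamental_theorem_of_calculus)
    fix t :: real assume t: "t \<in> {0..1}"
    have "(f has_real_derivative deriv f (t * s)) (at (t * s))"
      using smooth_on_real_derivative(1)[OF o f star[OF s t]] .
    moreover have "((\<lambda>t. t * s) has_real_derivative s) (at t within {0..1})"
      by (auto intro!: derivative_eq_intros)
    ultimately have "((\<lambda>t. f (t * s)) has_real_derivative deriv f (t * s) * s) (at t within {0..1})"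
      by (rule DERIV_chain2)
    moreover have "((\<lambda>t. t ^ Suc j) has_real_derivative real (Suc j) * t ^ j) (at t within {0..1})"
      using DERIV_pow[of "Suc j" t] by simp
    ultimately have "((\<lambda>t. t ^ Suc j * f (t * s)) has_real_derivative
        real (Suc j) * t ^ j * f (t * s) + deriv f (t * s) * s * t ^ Suc j) (at t within {0..1})"
      by (intro DERIV_mult)
    moreover have "real (Suc j) * t ^ j * f (t * s) + deriv f (t * s) * s * t ^ Suc j =
        real (Suc j) * (t ^ j * f (t * s)) + s * (t ^ Suc j * deriv f (t * s))"
      by (simp only: mult_ac)
    ultimately show "((\<lambda>t. t ^ Suc j * f (t * s)) has_vector_derivative
        real (Suc j) * (t ^ j * f (t * s)) + s * (t ^ Suc j * deriv f (t * s))) (at t within {0..1})"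
      by (simp only: has_real_derivative_iff_has_vector_derivative)
  qed simp
  moreover have "((\<lambda>t. real (Suc j) * (t ^ j * f (t * s)) + s * (t ^ Suc j * deriv f (t * s))) has_integral
      (real (Suc j) * wint j f s + s * wint (Suc j) (deriv f) s)) {0..1}"
    unfolding wint_def
    by (intro has_integral_add has_integral_mult_right integrable_integral wint_integrable f' s)
  ultimately have "1 ^ Suc j * f (1 * s) - 0 ^ Suc j * f (0 * s) = real (Suc j) * wint j f s + s * wint (Suc j) (deriv f) s"
    by (rule has_integral_unique)
  then show ?thesis by simp
qed

lemma hadamard0:
  assumes f: "smooth_on UNIV {c<..<d} f" and s: "s \<in> {c<..<d}" and 0: "f 0 = 0"
  shows "f s = s * wint 0 (deriv f) s"
proof -
  have o: "open {c<..<d}" by simp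
  have f': "continuous_on {c<..<d} (deriv f)"
    using smooth_on_continuous[OF smooth_on_deriv[OF o f]] by auto
  have "((\<lambda>t. s * (t ^ 0 * deriv f (t * s))) has_integral (f (1 * s) - f (0 * s))) {0..1}"
  proof (rule fundamental_theorem_of_calculus)
    fix t :: real assume t: "t \<in> {0..1}"
    have "(f has_real_derivative deriv f (t * s)) (at (t * s))"
      using smooth_on_real_derivative(1)[OF o f star[OF s t]] .
    moreover have "((\<lambda>t. t * s) has_real_derivative s) (at t within {0..1})"
      by (auto intro!: derivative_eq_intros)
    ultimately have "((\<lambda>t. f (t * s)) has_real_derivative deriv f (t * s) * s) (at t within {0..1})"
      by (rule DERIV_chain2)
    then show "((\<lambda>t. f (t * s)) has_vector_derivative s * (t ^ 0 * deriv f (t * s))) (at t within {0..1})"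
      by (simp add: has_real_derivative_iff_has_vector_derivative mult.commute)
  qed simp
  moreover have "((\<lambda>t. s * (t ^ 0 * deriv f (t * s))) has_integral (s * wint 0 (deriv f) s)) {0..1}"
    unfolding wint_def by (intro has_integral_mult_right integrable_integral wint_integrable f' s)
  ultimately have "f (1 * s) - f (0 * s) = s * wint 0 (deriv f) s" by (rule has_integral_unique)
  then show ?thesis using 0 by simp
qed

end

lemma smooth_on_reflect:
  fixes f :: "real \<Rightarrow> real"
  assumes "smooth_on UNIV {-\<epsilon><..<1+\<epsilon>} f"
  shows "smooth_on UNIV {-\<epsilon><..<1+\<epsilon>} (\<lambda>s. f (1 - s))"
proof -
  have r: "rel_open UNIV {-\<epsilon><..<1+\<epsilon>}" by (simp add: rel_open_UNIV)
  show ?thesis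
    by (rule smooth_on_compose[OF r _ _ assms smooth_on_diff[OF r smooth_on_const[OF r] smooth_on_id[OF r]]]) auto
qed

text \<open>Hadamard division at 0, and once more after the reflection
  \<open>s \<mapsto> 1 - s\<close>, under which the interval is invariant.\<close>

lemma hadamard01:
  fixes f :: "real \<Rightarrow> real"
  assumes e: "\<epsilon> > 0" and f: "smooth_on UNIV {-\<epsilon><..<1+\<epsilon>} f" and 0: "f 0 = 0" "f 1 = 0"
  obtains q where "smooth_on UNIV {-\<epsilon><..<1+\<epsilon>} q" "\<And>s. s \<in> {-\<epsilon><..<1+\<epsilon>} \<Longrightarrow> f s = s * (1 - s) * q s"
proof -
  have cd: "-\<epsilon> < 0" "0 < 1+\<epsilon>" using e by auto
  have o: "open {-\<epsilon><..<1+\<epsilon>}" by simp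
  define g where "g = wint 0 (deriv f)"
  have g: "smooth_on UNIV {-\<epsilon><..<1+\<epsilon>} g" "\<And>s. s \<in> {-\<epsilon><..<1+\<epsilon>} \<Longrightarrow> f s = s * g s"
    using wint_smooth[OF cd smooth_on_deriv[OF o f]] hadamard0[OF cd f _ 0(1)] by (auto simp: g_def)
  have "g 1 = 0" using g(2)[of 1] 0 e by simp
  define p where "p s = g (1 - s)" for s
  have p: "smooth_on UNIV {-\<epsilon><..<1+\<epsilon>} p" "p 0 = 0"
    using smooth_on_reflect[OF g(1)] \<open>g 1 = 0\<close> by (auto simp: p_def[abs_def])
  define q where "q s = wint 0 (deriv p) (1 - s)" for s
  have "smooth_on UNIV {-\<epsilon><..<1+\<epsilon>} q"
    unfolding q_def using smooth_on_reflect[OF wint_smooth[OF cd smooth_on_deriv[OF o p(1)]]] .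
  moreover have "f s = s * (1 - s) * q s" if s: "s \<in> {-\<epsilon><..<1+\<epsilon>}" for s
  proof -
    have "p (1 - s) = (1 - s) * wint 0 (deriv p) (1 - s)"
      by (rule hadamard0[OF cd p(1) _ p(2)]) (use s in auto)
    then show ?thesis using g(2)[OF s] by (simp add: p_def q_def)
  qed
  ultimately show ?thesis by (rule that)
qed

lemma open_01_interval:
  assumes "open S" "{0..1::real} \<subseteq> S"
  obtains \<epsilon> where "\<epsilon> > 0" "{-\<epsilon><..<1+\<epsilon>} \<subseteq> S"
proof -
  obtain a where a: "a > 0" "ball 0 a \<subseteq> S" using assms by (meson atLeastAtMost_iff openE order_refl subset_eq zero_le_one)
  obtain b where b: "b > 0" "ball 1 b \<subseteq> S" using assms by (meson atLeastAtMost_iff openE order_refl subset_eq zero_le_one)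
  have "s \<in> S" if "s \<in> {- min a b <..< 1 + min a b}" for s
  proof -
    consider "s \<in> {0..1}" | "s < 0" | "s > 1" by force
    then show ?thesis
    proof cases
      case 2 then have "s \<in> ball 0 a" using that by (auto simp: dist_real_def)
      then show ?thesis using a by blast
    next
      case 3 then have "s \<in> ball 1 b" using that by (auto simp: dist_real_def)
      then show ?thesis using b by blast
    qed (use assms in auto)
  qed
  then show ?thesis using a b by (intro that[of "min a b"]) auto
qed

lemma shrink_interval:
  fixes f :: "real \<Rightarrow> real"
  assumes "\<epsilon> > 0" "continuous_on {-\<epsilon><..<1+\<epsilon>} f" "\<And>s. s \<in> {0..1} \<Longrightarrow> f s > 0"
  obtains \<delta> where "\<delta> > 0" "\<delta> \<le> \<epsilon>" "\<And>s. s \<in> {-\<delta><..<1+\<delta>} \<Longrightarrow> f s > 0"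
proof -
  have "open ({-\<epsilon><..<1+\<epsilon>} \<inter> f -` {0<..})"
    using assms(2) by (intro continuous_open_preimage) auto
  moreover have "{0..1} \<subseteq> {-\<epsilon><..<1+\<epsilon>} \<inter> f -` {0<..}" using assms by auto
  ultimately obtain \<delta> where d: "\<delta> > 0" "{-\<delta><..<1+\<delta>} \<subseteq> {-\<epsilon><..<1+\<epsilon>} \<inter> f -` {0<..}"
    by (rule open_01_interval)
  show ?thesis
  proof (rule that[of "min \<delta> \<epsilon>"])
    show "f s > 0" if "s \<in> {- min \<delta> \<epsilon><..<1 + min \<delta> \<epsilon>}" for s
    proof -
      have "s \<in> {-\<delta><..<1+\<delta>}" using that by auto
      then show ?thesis using d(2) by auto
    qed
  qed (use d assms(1) in auto)
qed

definition profile :: "(real \<Rightarrow> real) \<Rightarrow> bool" where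
  "profile h \<longleftrightarrow> (\<exists>S. open S \<and> {0..1} \<subseteq> S \<and> smooth_on UNIV S h) \<and> (\<forall>s\<in>{0<..<1}. h s > 0) \<and>
     h 0 = 0 \<and> h 1 = 0 \<and> deriv h 0 = 2 \<and> deriv h 1 = -2"

text \<open>Both zeros are divided out; the slopes 2 and -2 then fix \<open>k 0 = k 1 = 2\<close>,
  and positivity of \<open>k\<close> on the closed unit interval spreads to a neighbourhood.\<close>

lemma profile_factor:
  assumes "profile h"
  obtains \<epsilon> k where "\<epsilon> > 0" "smooth_on UNIV {-\<epsilon><..<1+\<epsilon>} h" "smooth_on UNIV {-\<epsilon><..<1+\<epsilon>} k"
    "\<And>s. s \<in> {-\<epsilon><..<1+\<epsilon>} \<Longrightarrow> h s = s * (1 - s) * k s" "\<And>s. s \<in> {-\<epsilon><..<1+\<epsilon>} \<Longrightarrow> k s > 0" "k 0 = 2" "k 1 = 2"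
proof -
  obtain S where S: "open S" "{0..1} \<subseteq> S" "smooth_on UNIV S h" and h: "\<And>s. s \<in> {0<..<1} \<Longrightarrow> h s > 0"
    "h 0 = 0" "h 1 = 0" "deriv h 0 = 2" "deriv h 1 = -2" using assms by (auto simp: profile_def)
  obtain \<epsilon> where e: "\<epsilon> > 0" "{-\<epsilon><..<1+\<epsilon>} \<subseteq> S" using open_01_interval[OF S(1,2)] .
  have hs: "smooth_on UNIV {-\<epsilon><..<1+\<epsilon>} h" using smooth_on_subset[OF S(3) e(2)] .
  obtain k where k: "smooth_on UNIV {-\<epsilon><..<1+\<epsilon>} k" "\<And>s. s \<in> {-\<epsilon><..<1+\<epsilon>} \<Longrightarrow> h s = s * (1 - s) * k s"
    using hadamard01[OF e(1) hs h(2,3)] by blast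
  have d: "(h has_real_derivative (1 - 2 * s) * k s + s * (1 - s) * deriv k s) (at s)" if s: "s \<in> {-\<epsilon><..<1+\<epsilon>}" for s
  proof -
    have "(k has_real_derivative deriv k s) (at s)"
      by (rule smooth_on_real_derivative(1)[OF _ k(1) s]) simp
    then have "((\<lambda>s. s * (1 - s) * k s) has_real_derivative (1 - 2 * s) * k s + s * (1 - s) * deriv k s) (at s)"
      by (auto intro!: derivative_eq_intros simp: algebra_simps)
    then show ?thesis
      by (rule has_field_derivative_transform_within_open[of _ _ _ "{-\<epsilon><..<1+\<epsilon>}"]) (use s k in auto)
  qed
  have k01: "k 0 = 2" "k 1 = 2"
    using DERIV_imp_deriv[OF d[of 0]] DERIV_imp_deriv[OF d[of 1]] h e by auto
  have pos: "k s > 0" if "s \<in> {0..1}" for s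
  proof (cases "s = 0 \<or> s = 1")
    case True then show ?thesis using k01 by auto
  next
    case False
    then have "s * (1 - s) * k s > 0" using h(1)[of s] k(2)[of s] that e by auto
    moreover have "s * (1 - s) > 0" using False that by auto
    ultimately show ?thesis by (simp add: zero_less_mult_iff)
  qed
  obtain \<delta> where \<delta>: "\<delta> > 0" "\<delta> \<le> \<epsilon>" "\<And>s. s \<in> {-\<delta><..<1+\<delta>} \<Longrightarrow> k s > 0"
    using shrink_interval[OF e(1) smooth_on_continuous[OF k(1)] pos] by blast
  have sub: "{-\<delta><..<1+\<delta>} \<subseteq> {-\<epsilon><..<1+\<epsilon>}" using \<delta> by auto
  show ?thesis
    by (rule that[OF \<delta>(1) smooth_on_subset[OF hs sub] smooth_on_subset[OF k(1) sub] k(2) \<delta>(3) k01])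
      (use sub in auto)
qed

lemma smooth_on_exp: "smooth_on UNIV (UNIV :: real set) (exp :: real \<Rightarrow> real)"
proof -
  have "Ck_on k UNIV (UNIV :: real set) (exp :: real \<Rightarrow> real)" for k
  proof (induction k)
    case (Suc k)
    show ?case by (rule Ck_on_real_SucI[OF _ _ Suc]) (auto intro: DERIV_exp)
  qed (simp add: continuous_on_exp)
  then show ?thesis by (simp add: smooth_on_def)
qed

text \<open>Smoothness is bootstrapped from \<open>g' = 1 / f'(g)\<close>: each order of
  differentiability of \<open>g\<close> passes to the right-hand side and so raises the order by
  one.\<close>

lemma smooth_on_inverse_function:
  fixes f :: "real \<Rightarrow> real"
  assumes f: "smooth_on UNIV {c<..<d} f" and pos: "\<And>s. s \<in> {c<..<d} \<Longrightarrow> deriv f s > 0"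
  defines "g \<equiv> inv_into {c<..<d} f"
  shows "inj_on f {c<..<d}" "open (f ` {c<..<d})" "smooth_on UNIV (f ` {c<..<d}) g"
    "\<And>t. t \<in> f ` {c<..<d} \<Longrightarrow> (g has_real_derivative inverse (deriv f (g t))) (at t)"
proof -
  have o: "open {c<..<d}" by simp
  have df: "(f has_real_derivative deriv f s) (at s)" if "s \<in> {c<..<d}" for s
    by (rule smooth_on_real_derivative(1)[OF o f that])
  have mono: "f s < f t" if "s \<in> {c<..<d}" "t \<in> {c<..<d}" "s < t" for s t
  proof (rule DERIV_pos_imp_increasing[OF that(3)])
    fix x assume "s \<le> x" "x \<le> t"
    then have "x \<in> {c<..<d}" using that by auto
    then show "\<exists>y. (f has_real_derivative y) (at x) \<and> 0 < y" using df pos by blast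
  qed
  show inj: "inj_on f {c<..<d}"
  proof (rule inj_onI)
    fix x y assume "x \<in> {c<..<d}" "y \<in> {c<..<d}" "f x = f y"
    then show "x = y" using mono[of x y] mono[of y x] by (cases x y rule: linorder_cases) auto
  qed
  show op: "open (f ` {c<..<d})"
    by (rule invariance_of_domain[OF smooth_on_continuous[OF f] o inj])
  have gf: "g (f s) = s" if "s \<in> {c<..<d}" for s unfolding g_def by (rule inv_into_f_f[OF inj that])
  have fg: "f (g t) = t" "g t \<in> {c<..<d}" if "t \<in> f ` {c<..<d}" for t
    unfolding g_def using f_inv_into_f[OF that] inv_into_into[OF that] by auto
  show dg: "(g has_real_derivative inverse (deriv f (g t))) (at t)" if t: "t \<in> f ` {c<..<d}" for t
  proof -
    obtain r where r: "r > 0" "ball t r \<subseteq> f ` {c<..<d}" using op t unfolding open_contains_ball by blast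
    obtain q where q: "q > 0" "cball (g t) q \<subseteq> {c<..<d}" using o fg(2)[OF t] unfolding open_contains_cball by blast
    have "isCont g (f (g t))"
    proof (rule isCont_inverse_function[where x="g t" and f=f and g=g, OF q(1)])
      show "g (f y) = y" if "\<bar>y - g t\<bar> \<le> q" for y
        by (rule gf) (use q that in \<open>auto simp: cball_def dist_real_def abs_minus_commute subset_iff\<close>)
      show "isCont f y" if "\<bar>y - g t\<bar> \<le> q" for y
        by (rule DERIV_isCont[OF df]) (use q that in \<open>auto simp: cball_def dist_real_def abs_minus_commute subset_iff\<close>)
    qed
    then have cont: "isCont g t" using fg[OF t] by simp
    show ?thesis
    proof (rule DERIV_inverse_function[where a="t - r" and b="t + r"])
      show "(f has_real_derivative deriv f (g t)) (at (g t))" by (rule df[OF fg(2)[OF t]])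
      show "deriv f (g t) \<noteq> 0" using pos[OF fg(2)[OF t]] by simp
      show "f (g y) = y" if "t - r < y" "y < t + r" for y
        by (rule fg(1)) (use r that in \<open>auto simp: ball_def dist_real_def subset_iff\<close>)
    qed (use r cont in auto)
  qed
  have "Ck_on k UNIV (f ` {c<..<d}) g" for k
  proof (induction k)
    case 0
    show ?case
      unfolding Ck_on.simps by (intro continuous_at_imp_continuous_on ballI) (rule DERIV_isCont[OF dg])
  next
    case (Suc k)
    have rT: "rel_open UNIV (f ` {c<..<d})" using op by (simp add: rel_open_UNIV)
    have i: "smooth_on UNIV {c<..<d} (\<lambda>s. inverse (deriv f s))"
      by (rule smooth_on_inverse[OF _ smooth_on_deriv[OF o f]]) (use pos in \<open>force simp: rel_open_UNIV\<close>)+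
    have "Ck_on k UNIV (f ` {c<..<d}) (\<lambda>t. inverse (deriv f (g t)))"
      by (rule Ck_on_compose[OF rT o _ _ Suc, of "\<lambda>s. inverse (deriv f s)"]) (use i fg in \<open>auto simp: smooth_on_def\<close>)
    then show ?case by (rule Ck_on_real_SucI[OF op dg, rotated])
  qed
  then show "smooth_on UNIV (f ` {c<..<d}) g" by (simp add: smooth_on_def)
qed

text \<open>Every profile is conjugate to \<open>2s(1 - s)\<close>, by \<open>s e\<^sup>w / (1 - s + s e\<^sup>w)\<close> with
  \<open>w' = 2/h - 1/(s(1 - s))\<close>.\<close>

lemma profile_conjugate:
  assumes "profile h"
  obtains \<epsilon> k \<Psi> where "\<epsilon> > 0" "smooth_on UNIV {-\<epsilon><..<1+\<epsilon>} h" "smooth_on UNIV {-\<epsilon><..<1+\<epsilon>} k"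
    "\<And>s. s \<in> {-\<epsilon><..<1+\<epsilon>} \<Longrightarrow> h s = s * (1 - s) * k s" "\<And>s. s \<in> {-\<epsilon><..<1+\<epsilon>} \<Longrightarrow> k s > 0"
    "smooth_on UNIV {-\<epsilon><..<1+\<epsilon>} \<Psi>" "\<Psi> 0 = 0" "\<Psi> 1 = 1" "\<And>s. s \<in> {-\<epsilon><..<1+\<epsilon>} \<Longrightarrow> deriv \<Psi> s > 0"
    "\<And>s. s \<in> {-\<epsilon><..<1+\<epsilon>} \<Longrightarrow> h s * deriv \<Psi> s = 2 * \<Psi> s * (1 - \<Psi> s)"
proof -
  obtain \<delta> k where e: "\<delta> > 0" and hs: "smooth_on UNIV {-\<delta><..<1+\<delta>} h" and ks: "smooth_on UNIV {-\<delta><..<1+\<delta>} k"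
    and hk: "\<And>s. s \<in> {-\<delta><..<1+\<delta>} \<Longrightarrow> h s = s * (1 - s) * k s" and k: "\<And>s. s \<in> {-\<delta><..<1+\<delta>} \<Longrightarrow> k s > 0" "k 0 = 2" "k 1 = 2"
    using profile_factor[OF assms] by blast
  have o: "open {-\<delta><..<1+\<delta>}" and r: "rel_open UNIV {-\<delta><..<1+\<delta>}" by (auto simp: rel_open_UNIV)
  have cd: "-\<delta> < 0" "0 < 1+\<delta>" using e by auto
  \<comment> \<open>\<open>k\<close> equals 2 at both ends, so \<open>2 - k\<close> is divisible by
    \<open>s * (1 - s)\<close>. Hence \<open>l / k\<close> is the smooth form of
    \<open>2 / h - 1 / (s * (1 - s))\<close>.\<close>
  obtain l where l: "smooth_on UNIV {-\<delta><..<1+\<delta>} l" "\<And>s. s \<in> {-\<delta><..<1+\<delta>} \<Longrightarrow> 2 - k s = s * (1 - s) * l s"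
    using hadamard01[OF e smooth_on_diff[OF r smooth_on_const[OF r, of 2] ks]] k(2,3) by auto
  define p where "p = (\<lambda>s. l s / k s)"
  have ps: "smooth_on UNIV {-\<delta><..<1+\<delta>} p"
    unfolding p_def by (rule smooth_on_divide[OF r l(1) ks]) (use k in force)
  \<comment> \<open>The primitive of \<open>p\<close> that vanishes at 0.\<close>
  define w where "w = (\<lambda>s. s * wint 0 p s)"
  have ws: "smooth_on UNIV {-\<delta><..<1+\<delta>} w"
    unfolding w_def by (intro smooth_on_mult[OF r] smooth_on_id[OF r] wint_smooth[OF cd] ps)
  have dw: "(w has_real_derivative p s) (at s)" if s: "s \<in> {-\<delta><..<1+\<delta>}" for s
  proof -
    have "(w has_real_derivative s * wint (Suc 0) (deriv p) s + 1 * wint 0 p s) (at s)"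
      unfolding w_def by (rule DERIV_cong[OF DERIV_mult[OF DERIV_ident wint_DERIV[OF cd ps s]]]) simp
    then show ?thesis using wint_parts[OF cd ps s, of 0] by (simp add: add.commute)
  qed
  have es: "smooth_on UNIV {-\<delta><..<1+\<delta>} (\<lambda>s. exp (w s))"
    by (rule smooth_on_compose[OF r open_UNIV _ smooth_on_exp ws]) auto
  define den where "den = (\<lambda>s. (1 - s) + s * exp (w s))"
  have dens: "smooth_on UNIV {-\<delta><..<1+\<delta>} den"
    unfolding den_def
    by (intro smooth_on_add[OF r] smooth_on_diff[OF r] smooth_on_mult[OF r] smooth_on_const[OF r] smooth_on_id[OF r] es)
  have den01: "den s > 0" if "s \<in> {0..1}" for s
  proof (cases "s = 1")
    case False
    then show ?thesis using that by (simp add: den_def add_pos_nonneg)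
  qed (simp add: den_def)
  obtain \<epsilon> where ep: "\<epsilon> > 0" "\<epsilon> \<le> \<delta>" "\<And>s. s \<in> {-\<epsilon><..<1+\<epsilon>} \<Longrightarrow> den s > 0"
    using shrink_interval[OF e smooth_on_continuous[OF dens] den01] by blast
  have sub: "{-\<epsilon><..<1+\<epsilon>} \<subseteq> {-\<delta><..<1+\<delta>}" using ep by auto
  have r': "rel_open UNIV {-\<epsilon><..<1+\<epsilon>}" by (simp add: rel_open_UNIV)
  define \<Psi> where "\<Psi> = (\<lambda>s. s * exp (w s) / den s)"
  have \<Psi>s: "smooth_on UNIV {-\<epsilon><..<1+\<epsilon>} \<Psi>"
    unfolding \<Psi>_def
    by (rule smooth_on_divide[OF r' smooth_on_mult[OF r' smooth_on_id[OF r'] smooth_on_subset[OF es sub]] smooth_on_subset[OF dens sub]])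
      (use ep in force)
  have d\<Psi>: "deriv \<Psi> s = 2 * exp (w s) / (k s * (den s)\<^sup>2)" if s: "s \<in> {-\<epsilon><..<1+\<epsilon>}" for s
  proof -
    have s': "s \<in> {-\<delta><..<1+\<delta>}" using s sub by blast
    have nz: "den s \<noteq> 0" "k s \<noteq> 0" using ep(3)[OF s] k(1)[OF s'] by auto
    have 2: "((\<lambda>s. s * exp (w s)) has_real_derivative exp (w s) * (1 + s * p s)) (at s)"
      by (auto intro!: derivative_eq_intros dw[OF s'] simp: algebra_simps)
    have 3: "(den has_real_derivative exp (w s) * (1 + s * p s) - 1) (at s)"
      unfolding den_def by (auto intro!: derivative_eq_intros dw[OF s'] simp: algebra_simps)
    have "(\<Psi> has_real_derivative (exp (w s) * (1 + s * p s) * den s - s * exp (w s) * (exp (w s) * (1 + s * p s) - 1)) / (den s * den s)) (at s)"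
      unfolding \<Psi>_def by (rule DERIV_divide[OF 2 3 nz(1)])
    moreover have "exp (w s) * (1 + s * p s) * den s - s * exp (w s) * (exp (w s) * (1 + s * p s) - 1) = exp (w s) * (1 + s * (1 - s) * p s)"
      by (simp add: den_def algebra_simps)
    moreover have "1 + s * (1 - s) * p s = 2 / k s"
      using l(2)[OF s'] nz(2) by (simp add: p_def field_simps)
    ultimately have "(\<Psi> has_real_derivative (exp (w s) * (2 / k s)) / (den s * den s)) (at s)" by simp
    then have "deriv \<Psi> s = (exp (w s) * (2 / k s)) / (den s * den s)" by (rule DERIV_imp_deriv)
    then show ?thesis by (simp add: power2_eq_square mult.assoc)
  qed
  show ?thesis
  proof (rule that[OF ep(1) smooth_on_subset[OF hs sub] smooth_on_subset[OF ks sub] hk k(1) \<Psi>s])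
    fix s assume s: "s \<in> {-\<epsilon><..<1+\<epsilon>}"
    have s': "s \<in> {-\<delta><..<1+\<delta>}" using s sub by blast
    have nz: "den s > 0" "k s > 0" using ep(3)[OF s] k(1)[OF s'] by auto
    show "s \<in> {-\<delta><..<1+\<delta>}" "s \<in> {-\<delta><..<1+\<delta>}" by (fact s')+
    show "deriv \<Psi> s > 0" unfolding d\<Psi>[OF s] using nz by simp
    have "1 - \<Psi> s = (1 - s) / den s" using nz by (simp add: \<Psi>_def field_simps) (simp add: den_def)
    then show "h s * deriv \<Psi> s = 2 * \<Psi> s * (1 - \<Psi> s)"
      unfolding d\<Psi>[OF s] hk[OF s'] using nz by (simp add: \<Psi>_def power2_eq_square)
  qed (simp_all add: \<Psi>_def den_def)
qed

text \<open>Both profiles are conjugate to the same model, so \<open>F\<close> is the conjugation of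
  \<open>h0\<close> followed by the inverse conjugation of \<open>h\<close>. The quotient
  \<open>q\<close> is smooth because \<open>F s - s\<close> and \<open>h0\<close> share the factor
  \<open>s * (1 - s)\<close>, whose cofactor in \<open>h0\<close> is positive.\<close>

lemma profile_change:
  assumes "profile h0" "profile h"
  obtains S F q where "open S" "{0..1} \<subseteq> S" "smooth_on UNIV S F" "smooth_on UNIV S q" "F 0 = 0" "F 1 = 1"
    "\<And>s. s \<in> {0..1} \<Longrightarrow> deriv F s > 0" "\<And>s. s \<in> {0..1} \<Longrightarrow> deriv F s * h0 s = h (F s)"
    "\<And>s. s \<in> {0..1} \<Longrightarrow> q s * h0 s = F s - s"
proof -
  obtain \<epsilon>0 k0 \<Psi>0 where c0: "\<epsilon>0 > 0" "smooth_on UNIV {-\<epsilon>0<..<1+\<epsilon>0} h0" "smooth_on UNIV {-\<epsilon>0<..<1+\<epsilon>0} k0"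
    "\<And>s. s \<in> {-\<epsilon>0<..<1+\<epsilon>0} \<Longrightarrow> h0 s = s * (1 - s) * k0 s" "\<And>s. s \<in> {-\<epsilon>0<..<1+\<epsilon>0} \<Longrightarrow> k0 s > 0"
    "smooth_on UNIV {-\<epsilon>0<..<1+\<epsilon>0} \<Psi>0" "\<Psi>0 0 = 0" "\<Psi>0 1 = 1" "\<And>s. s \<in> {-\<epsilon>0<..<1+\<epsilon>0} \<Longrightarrow> deriv \<Psi>0 s > 0"
    "\<And>s. s \<in> {-\<epsilon>0<..<1+\<epsilon>0} \<Longrightarrow> h0 s * deriv \<Psi>0 s = 2 * \<Psi>0 s * (1 - \<Psi>0 s)"
    by (rule profile_conjugate[OF assms(1)]) (rule that; assumption)
  obtain \<epsilon> k \<Psi> where c: "\<epsilon> > 0" "smooth_on UNIV {-\<epsilon><..<1+\<epsilon>} h" "smooth_on UNIV {-\<epsilon><..<1+\<epsilon>} k"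
    "\<And>s. s \<in> {-\<epsilon><..<1+\<epsilon>} \<Longrightarrow> h s = s * (1 - s) * k s" "\<And>s. s \<in> {-\<epsilon><..<1+\<epsilon>} \<Longrightarrow> k s > 0"
    "smooth_on UNIV {-\<epsilon><..<1+\<epsilon>} \<Psi>" "\<Psi> 0 = 0" "\<Psi> 1 = 1" "\<And>s. s \<in> {-\<epsilon><..<1+\<epsilon>} \<Longrightarrow> deriv \<Psi> s > 0"
    "\<And>s. s \<in> {-\<epsilon><..<1+\<epsilon>} \<Longrightarrow> h s * deriv \<Psi> s = 2 * \<Psi> s * (1 - \<Psi> s)"
    by (rule profile_conjugate[OF assms(2)]) (rule that; assumption)
  define E0 where "E0 = {-\<epsilon>0<..<1+\<epsilon>0}"
  define E where "E = {-\<epsilon><..<1+\<epsilon>}"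
  have E: "open E0" "open E" "{0..1} \<subseteq> E0" "{0..1} \<subseteq> E" using c0(1) c(1) by (auto simp: E0_def E_def)
  define g where "g = inv_into E \<Psi>"
  have g: "inj_on \<Psi> E" "open (\<Psi> ` E)" "smooth_on UNIV (\<Psi> ` E) g"
    "\<And>t. t \<in> \<Psi> ` E \<Longrightarrow> (g has_real_derivative inverse (deriv \<Psi> (g t))) (at t)"
    using smooth_on_inverse_function[OF c(6,9)] by (auto simp: E_def g_def)
  have \<Psi>g: "\<Psi> (g t) = t" "g t \<in> E" if "t \<in> \<Psi> ` E" for t
    unfolding g_def using f_inv_into_f[OF that] inv_into_into[OF that] by auto
  have g\<Psi>: "g (\<Psi> s) = s" if "s \<in> E" for s unfolding g_def by (rule inv_into_f_f[OF g(1) that])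
  have im01: "t \<in> \<Psi> ` E" if "t \<in> {0..1}" for t
  proof -
    have "continuous_on {0..1} \<Psi>"
      using smooth_on_continuous[OF c(6)] E(4) by (auto simp: E_def intro: continuous_on_subset)
    then have "\<exists>s\<ge>0. s \<le> 1 \<and> \<Psi> s = t" using that c(7,8) by (intro IVT') auto
    then show ?thesis using E(4) by auto
  qed
  have mono0: "\<Psi>0 s \<le> \<Psi>0 t" if "0 \<le> s" "s \<le> t" "t \<le> 1" for s t
  proof (rule DERIV_nonneg_imp_nondecreasing[OF that(2)])
    fix x assume "s \<le> x" "x \<le> t"
    then have x: "x \<in> E0" using that E(3) by auto
    have "(\<Psi>0 has_real_derivative deriv \<Psi>0 x) (at x)"
      using smooth_on_real_derivative(1)[OF _ c0(6)] x by (simp add: E0_def)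
    then show "\<exists>y. (\<Psi>0 has_real_derivative y) (at x) \<and> 0 \<le> y"
      using c0(9)[of x] x by (intro exI[of _ "deriv \<Psi>0 x"]) (simp add: E0_def less_imp_le)
  qed
  have \<Psi>01: "\<Psi>0 s \<in> {0..1}" if "s \<in> {0..1}" for s
    using mono0[of 0 s] mono0[of s 1] that c0(7,8) by auto
  define S where "S = E0 \<inter> \<Psi>0 -` (\<Psi> ` E)"
  define F where "F = (\<lambda>s. g (\<Psi>0 s))"
  have S: "open S" "{0..1} \<subseteq> S"
    unfolding S_def using smooth_on_continuous[OF c0(6)] E g(2) \<Psi>01 im01
    by (auto intro!: continuous_open_preimage simp: E0_def)
  have rS: "rel_open UNIV S" using S by (simp add: rel_open_UNIV)
  have Fs: "smooth_on UNIV S F"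
    unfolding F_def
    by (rule smooth_on_compose[OF rS g(2) _ g(3) smooth_on_subset[OF c0(6)]]) (auto simp: S_def E0_def)
  have "0 \<in> E" "1 \<in> E" using E(4) by auto
  then have F01: "F 0 = 0" "F 1 = 1" using g\<Psi>[of 0] g\<Psi>[of 1] c0(7,8) c(7,8) E(4) by (auto simp: F_def)
  have dF: "deriv F s = inverse (deriv \<Psi> (F s)) * deriv \<Psi>0 s" if s: "s \<in> S" for s
  proof (rule DERIV_imp_deriv)
    have 1: "(g has_real_derivative inverse (deriv \<Psi> (g (\<Psi>0 s)))) (at (\<Psi>0 s))" using g(4) s by (simp add: S_def)
    have 2: "(\<Psi>0 has_real_derivative deriv \<Psi>0 s) (at s)"
      using smooth_on_real_derivative(1)[OF _ c0(6)] s by (simp add: S_def E0_def)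
    show "(F has_real_derivative inverse (deriv \<Psi> (F s)) * deriv \<Psi>0 s) (at s)"
      unfolding F_def by (rule DERIV_chain2[OF 1 2])
  qed
  have FE: "F s \<in> E" if "s \<in> S" for s using \<Psi>g(2)[of "\<Psi>0 s"] that by (simp add: F_def S_def)
  have pos: "deriv \<Psi> (F s) > 0" "deriv \<Psi>0 s > 0" if "s \<in> S" for s
    using c(9)[of "F s"] c0(9)[of s] FE[OF that] that by (auto simp: E_def E0_def S_def)
  have ode: "deriv F s * h0 s = h (F s)" if s: "s \<in> S" for s
  proof -
    have "h (F s) * deriv \<Psi> (F s) = 2 * \<Psi>0 s * (1 - \<Psi>0 s)"
      using c(10)[of "F s"] FE[OF s] \<Psi>g(1)[of "\<Psi>0 s"] s by (simp add: E_def F_def S_def)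
    also have "\<dots> = h0 s * deriv \<Psi>0 s" using c0(10)[of s] s by (simp add: S_def E0_def)
    finally show ?thesis using pos[OF s] unfolding dF[OF s] by (simp add: field_simps)
  qed
  obtain \<delta> where \<delta>: "\<delta> > 0" "{-\<delta><..<1+\<delta>} \<subseteq> S" using open_01_interval[OF S] .
  have r: "rel_open UNIV {-\<delta><..<1+\<delta>}" by (simp add: rel_open_UNIV)
  have F\<delta>: "smooth_on UNIV {-\<delta><..<1+\<delta>} F" by (rule smooth_on_subset[OF Fs \<delta>(2)])
  obtain f where f: "smooth_on UNIV {-\<delta><..<1+\<delta>} f" "\<And>s. s \<in> {-\<delta><..<1+\<delta>} \<Longrightarrow> F s - s = s * (1 - s) * f s"
    using hadamard01[OF \<delta>(1) smooth_on_diff[OF r F\<delta> smooth_on_id[OF r]]] F01 by auto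
  have sub: "{-\<delta><..<1+\<delta>} \<subseteq> E0" using \<delta>(2) by (auto simp: S_def)
  have k0: "smooth_on UNIV {-\<delta><..<1+\<delta>} k0" "\<And>s. s \<in> {-\<delta><..<1+\<delta>} \<Longrightarrow> k0 s > 0"
    using smooth_on_subset[OF c0(3)] c0(5) sub by (auto simp: E0_def)
  have in\<delta>: "s \<in> {-\<delta><..<1+\<delta>}" if "s \<in> {0..1}" for s using that \<delta>(1) by auto
  show ?thesis
  proof (rule that[of "{-\<delta><..<1+\<delta>}" F "\<lambda>s. f s / k0 s"])
    show "smooth_on UNIV {-\<delta><..<1+\<delta>} (\<lambda>s. f s / k0 s)"
      by (rule smooth_on_divide[OF r f(1) k0(1)]) (use k0(2) in force)
    fix s :: real assume s: "s \<in> {0..1}"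
    then have s': "s \<in> S" using S by auto
    show "deriv F s > 0" using pos[OF s'] by (simp add: dF[OF s'])
    show "deriv F s * h0 s = h (F s)" by (rule ode[OF s'])
    have "k0 s \<noteq> 0" using k0(2)[OF in\<delta>[OF s]] by simp
    moreover have "s \<in> {-\<epsilon>0<..<1+\<epsilon>0}" using s' by (simp add: S_def E0_def)
    ultimately show "f s / k0 s * h0 s = F s - s"
      using f(2)[OF in\<delta>[OF s]] c0(4)[of s] by simp
  qed (use \<delta>(1) F\<delta> F01 in auto)
qed

section \<open>Solving the extremal equation\<close>

lemma inverse_affine_convex:
  fixes b a :: real
  assumes "b * s0 + a > 0" "b * s2 + a > 0" "0 \<le> t" "t \<le> 1"
  shows "1 / (b * ((1 - t) * s0 + t * s2) + a) \<le> (1 - t) * (1 / (b * s0 + a)) + t * (1 / (b * s2 + a))"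
proof -
  have "convex_on {0<..} (inverse :: real \<Rightarrow> real)" by (intro convex_on_inverse) auto
  then have "inverse ((1 - t) *\<^sub>R (b * s0 + a) + t *\<^sub>R (b * s2 + a)) \<le> (1 - t) * inverse (b * s0 + a) + t * inverse (b * s2 + a)"
    by (rule convex_onD) (use assms in auto)
  moreover have "(1 - t) *\<^sub>R (b * s0 + a) + t *\<^sub>R (b * s2 + a) = b * ((1 - t) * s0 + t * s2) + a"
    by (simp add: algebra_simps)
  ultimately show ?thesis by (simp add: divide_inverse)
qed

text \<open>The integral of \<open>t ^ N * q t\<close> times the square of \<open>t - c\<close> is
  positive for every \<open>c\<close>. For the minimizing \<open>c\<close> it equals the difference
  of the two sides divided by the moment of order \<open>N\<close>.\<close>

lemma wint_moment_cauchy_schwarz: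
  fixes q :: "real \<Rightarrow> real"
  assumes q: "continuous_on {0..1} q" and pos: "\<And>t. t \<in> {0..1} \<Longrightarrow> q t > 0"
  shows "(integral {0..1} (\<lambda>t. t ^ Suc N * q t))\<^sup>2 < integral {0..1} (\<lambda>t. t ^ N * q t) * integral {0..1} (\<lambda>t. t ^ Suc (Suc N) * q t)"
proof -
  define m where "m k = integral {0..1} (\<lambda>t. t ^ k * q t)" for k
  have int: "((\<lambda>t. t ^ k * q t) has_integral m k) {0..1}" for k
    unfolding m_def by (intro integrable_integral integrable_continuous_real continuous_intros q)
  have posint: "I > 0" if "(f has_integral I) {0..1}" "continuous_on {0..1} f" "\<And>t. t \<in> {0..1} \<Longrightarrow> f t \<ge> 0"
    "t \<in> {0<..<1}" "f t > 0" for f :: "real \<Rightarrow> real" and I t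
  proof -
    have "I \<ge> 0" using has_integral_nonneg[OF that(1,3)] by simp
    moreover have "I \<noteq> 0"
    proof
      assume "I = 0"
      then have "f t = 0"
        using has_integral_0_cbox_imp_0[of 0 1 f t] that by (auto simp: less_imp_le)
      then show False using that by simp
    qed
    ultimately show ?thesis by simp
  qed
  have m: "m N > 0"
    by (rule posint[OF int, of _ "1/2"]) (use pos in \<open>auto intro!: continuous_intros q simp: less_imp_le\<close>)
  define c where "c = m (Suc N) / m N"
  define f where "f t = t ^ N * q t * (t - c)\<^sup>2" for t
  have "(f has_integral (m (Suc (Suc N)) - 2 * c * m (Suc N) + c\<^sup>2 * m N)) {0..1}"
  proof -
    have "((\<lambda>t. t ^ Suc (Suc N) * q t - 2 * c * (t ^ Suc N * q t) + c\<^sup>2 * (t ^ N * q t)) has_integral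
      (m (Suc (Suc N)) - 2 * c * m (Suc N) + c\<^sup>2 * m N)) {0..1}"
      by (intro has_integral_add has_integral_diff has_integral_mult_right int)
    moreover have "(\<lambda>t. t ^ Suc (Suc N) * q t - 2 * c * (t ^ Suc N * q t) + c\<^sup>2 * (t ^ N * q t)) = f"
      by (auto simp: f_def power2_eq_square algebra_simps)
    ultimately show ?thesis by simp
  qed
  moreover have "continuous_on {0..1} f" unfolding f_def by (intro continuous_intros q)
  moreover have "\<And>t. t \<in> {0..1} \<Longrightarrow> f t \<ge> 0" using pos by (simp add: f_def less_imp_le)
  \<comment> \<open>A point of the open interval different from \<open>c\<close>, so that the
    integrand is positive there.\<close>
  moreover have "(if c = 1/2 then 1/3 else 1/2) \<in> {0<..<1::real}" by simp
  moreover have "f (if c = 1/2 then 1/3 else 1/2) > 0" using pos by (auto simp: f_def intro!: mult_pos_pos)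
  ultimately have "m (Suc (Suc N)) - 2 * c * m (Suc N) + c\<^sup>2 * m N > 0" by (rule posint)
  then have "m N * (m (Suc (Suc N)) - 2 * c * m (Suc N) + c\<^sup>2 * m N) > 0" using m by simp
  moreover have "m N * (m (Suc (Suc N)) - 2 * c * m (Suc N) + c\<^sup>2 * m N) = m N * m (Suc (Suc N)) - (m (Suc N))\<^sup>2"
    using m by (simp add: c_def power2_eq_square field_simps)
  ultimately show ?thesis by (simp add: m_def)
qed

lemma linear_system_2x2:
  fixes p q r s x y :: real
  assumes "p * s - q * r \<noteq> 0"
  obtains u v where "u * p + v * q = x" "u * r + v * s = y"
proof (rule that)
  define d where "d = p * s - q * r"
  have d: "d \<noteq> 0" using assms by (simp add: d_def)
  show "(x * s - q * y) / d * p + (p * y - x * r) / d * q = x"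
    using d by (simp add: field_simps) (simp add: d_def algebra_simps)
  show "(x * s - q * y) / d * r + (p * y - x * r) / d * s = y"
    using d by (simp add: field_simps) (simp add: d_def algebra_simps)
qed

context
  fixes I :: "'i set" and k :: 'i and n :: "'i \<Rightarrow> nat" and b a :: "'i \<Rightarrow> real" and M :: nat
  assumes fin: "finite I" and k: "k \<in> I" and n: "\<And>i. i \<in> I \<Longrightarrow> n i > 0"
    and M: "n k = Suc M" and ak: "a k = 0" and bk: "b k = 1 / (real (n k) + 1)"
    and pos: "\<And>i s. i \<in> I - {k} \<Longrightarrow> s \<in> {0..1} \<Longrightarrow> b i * s + a i > 0"
begin

text \<open>The factor \<open>k\<close> is the one collapsing at 0, whence \<open>a k = 0\<close>.
  With \<open>p\<close> the product of all \<open>(b i * s + a i) ^ n i\<close>, this is the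
  positive cofactor in \<open>p s = s ^ n k * wq s\<close>.\<close>

definition "wq s = b k ^ n k * (\<Prod>i\<in>I - {k}. (b i * s + a i) ^ n i)"

text \<open>The required second derivative of \<open>p h\<close>, divided by \<open>s ^ M\<close>.
  One power of \<open>s\<close> in \<open>p\<close> is kept back to absorb the pole at 0 of the
  summand of index \<open>k\<close>.\<close>

definition "wR \<alpha> \<beta> s = 2 * real (n k) / b k * wq s + s * (wq s * (\<Sum>i\<in>I - {k}. 2 * real (n i) / (b i * s + a i)) - (\<alpha> * s + \<beta>) * wq s)"

text \<open>The solution for which \<open>p h\<close> and its first derivative vanish at 0: the
  integral of \<open>(s - r) * r ^ M * wR \<alpha> \<beta> r\<close> over \<open>r\<close> from 0 to
  \<open>s\<close>, divided by \<open>p s\<close>, with the powers of \<open>s\<close>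
  cancelled.\<close>

definition "wh \<alpha> \<beta> s = s * (wint M (wR \<alpha> \<beta>) s - wint (Suc M) (wR \<alpha> \<beta>) s) / wq s"

lemma bk_pos: "b k > 0" by (simp add: bk)

lemma extremal_domain:
  obtains \<epsilon> where "\<epsilon> > 0" "\<And>i s. i \<in> I - {k} \<Longrightarrow> s \<in> {-\<epsilon><..<1+\<epsilon>} \<Longrightarrow> b i * s + a i > 0"
proof -
  have "open (\<Inter>i\<in>I - {k}. {s. b i * s + a i > 0})"
    using fin by (intro open_INT ballI open_Collect_less continuous_intros) auto
  moreover have "{0..1} \<subseteq> (\<Inter>i\<in>I - {k}. {s. b i * s + a i > 0})" using pos by auto
  ultimately obtain \<epsilon> where "\<epsilon> > 0" "{-\<epsilon><..<1+\<epsilon>} \<subseteq> (\<Inter>i\<in>I - {k}. {s. b i * s + a i > 0})"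
    by (rule open_01_interval)
  then show ?thesis by (intro that) auto
qed

context
  fixes \<epsilon> \<alpha> \<beta> :: real
  assumes e: "\<epsilon> > 0" and A: "\<And>i s. i \<in> I - {k} \<Longrightarrow> s \<in> {-\<epsilon><..<1+\<epsilon>} \<Longrightarrow> b i * s + a i > 0"
begin

private abbreviation "E \<equiv> {-\<epsilon><..<1+\<epsilon>}"

private lemma r: "rel_open UNIV E" and cd: "-\<epsilon> < 0" "0 < 1 + \<epsilon>" using e by (auto simp: rel_open_UNIV)

lemma wq_pos: "s \<in> E \<Longrightarrow> wq s > 0"
  unfolding wq_def using bk_pos A by (intro mult_pos_pos prod_pos) auto

lemma wq_smooth: "smooth_on UNIV E wq"
  unfolding wq_def[abs_def]
  by (intro smooth_on_mult[OF r] smooth_on_prod[OF r] smooth_on_power[OF r] smooth_on_add[OF r] smooth_on_const[OF r] smooth_on_id[OF r])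

lemma wR_smooth: "smooth_on UNIV E (wR \<alpha> \<beta>)"
proof -
  have "b i * s + a i \<noteq> 0" if "i \<in> I - {k}" "s \<in> E" for i s using A[OF that] by simp
  then show ?thesis
    unfolding wR_def[abs_def]
    by (intro smooth_on_mult[OF r] smooth_on_sum[OF r] smooth_on_add[OF r] smooth_on_diff[OF r] smooth_on_divide[OF r]
        smooth_on_const[OF r] smooth_on_id[OF r] wq_smooth)
qed

lemma wh_smooth: "smooth_on UNIV E (wh \<alpha> \<beta>)"
proof -
  have "wq s \<noteq> 0" if "s \<in> E" for s using wq_pos[OF that] by simp
  then show ?thesis
    unfolding wh_def[abs_def]
    by (intro smooth_on_mult[OF r] smooth_on_diff[OF r] smooth_on_divide[OF r] smooth_on_id[OF r] wq_smooth wint_smooth[OF cd] wR_smooth)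
qed

private definition "k1 s = s ^ Suc M * wint M (wR \<alpha> \<beta>) s"
private definition "p s = s ^ Suc M * wq s"

private lemma k1_DERIV:
  assumes s: "s \<in> E"
  shows "(k1 has_real_derivative s ^ M * wR \<alpha> \<beta> s) (at s)"
proof -
  have "((\<lambda>s. s ^ Suc M) has_real_derivative real (Suc M) * s ^ M) (at s)"
    using DERIV_pow[of "Suc M" s] by simp
  from DERIV_mult[OF this wint_DERIV[OF cd wR_smooth s, of M]]
  have "(k1 has_real_derivative (real (Suc M) * s ^ M * wint M (wR \<alpha> \<beta>) s + wint (Suc M) (deriv (wR \<alpha> \<beta>)) s * s ^ Suc M)) (at s)"
    by (simp only: k1_def[abs_def])
  moreover have "real (Suc M) * s ^ M * wint M (wR \<alpha> \<beta>) s + wint (Suc M) (deriv (wR \<alpha> \<beta>)) s * s ^ Suc M =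
     s ^ M * (real (Suc M) * wint M (wR \<alpha> \<beta>) s + s * wint (Suc M) (deriv (wR \<alpha> \<beta>)) s)"
    by (simp add: algebra_simps)
  ultimately show ?thesis by (simp only: wint_parts[OF cd wR_smooth s, of M])
qed

private lemma ph: 
  assumes s: "s \<in> E"
  shows "p s * wh \<alpha> \<beta> s = s * k1 s - s ^ Suc (Suc M) * wint (Suc M) (wR \<alpha> \<beta>) s"
  using wq_pos[OF s] by (simp add: p_def wh_def k1_def field_simps)

private lemma ph_DERIV:
  assumes s: "s \<in> E"
  shows "((\<lambda>s. p s * wh \<alpha> \<beta> s) has_real_derivative k1 s) (at s)"
proof -
  have "((\<lambda>s. s ^ Suc (Suc M)) has_real_derivative real (Suc (Suc M)) * s ^ Suc M) (at s)"
    using DERIV_pow[of "Suc (Suc M)" s] by simp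
  from DERIV_mult[OF this wint_DERIV[OF cd wR_smooth s, of "Suc M"]]
  have "((\<lambda>s. s ^ Suc (Suc M) * wint (Suc M) (wR \<alpha> \<beta>) s) has_real_derivative
    (real (Suc (Suc M)) * s ^ Suc M * wint (Suc M) (wR \<alpha> \<beta>) s + wint (Suc (Suc M)) (deriv (wR \<alpha> \<beta>)) s * s ^ Suc (Suc M))) (at s)" .
  moreover have "real (Suc (Suc M)) * s ^ Suc M * wint (Suc M) (wR \<alpha> \<beta>) s + wint (Suc (Suc M)) (deriv (wR \<alpha> \<beta>)) s * s ^ Suc (Suc M) =
     s ^ Suc M * (real (Suc (Suc M)) * wint (Suc M) (wR \<alpha> \<beta>) s + s * wint (Suc (Suc M)) (deriv (wR \<alpha> \<beta>)) s)"
    by (simp add: algebra_simps)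
  ultimately have 2: "((\<lambda>s. s ^ Suc (Suc M) * wint (Suc M) (wR \<alpha> \<beta>) s) has_real_derivative s ^ Suc M * wR \<alpha> \<beta> s) (at s)"
    by (simp only: wint_parts[OF cd wR_smooth s, of "Suc M"])
  have "((\<lambda>s. s * k1 s - s ^ Suc (Suc M) * wint (Suc M) (wR \<alpha> \<beta>) s) has_real_derivative
     (1 * k1 s + (s ^ M * wR \<alpha> \<beta> s) * s) - s ^ Suc M * wR \<alpha> \<beta> s) (at s)"
    by (intro DERIV_diff DERIV_mult DERIV_ident k1_DERIV s 2)
  then have "((\<lambda>s. s * k1 s - s ^ Suc (Suc M) * wint (Suc M) (wR \<alpha> \<beta>) s) has_real_derivative k1 s) (at s)"
    by (simp add: mult_ac)
  then show ?thesis
    by (rule has_field_derivative_transform_within_open[of _ _ _ E]) (use s ph in auto)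
qed

private lemma p_pos: "s \<in> E \<Longrightarrow> s > 0 \<Longrightarrow> p s > 0"
  using wq_pos by (simp add: p_def)

private lemma dh: "s \<in> E \<Longrightarrow> (wh \<alpha> \<beta> has_real_derivative deriv (wh \<alpha> \<beta>) s) (at s)"
  by (rule smooth_on_real_derivative(1)[OF _ wh_smooth]) auto

private lemma p_eq: "p s = (\<Prod>i\<in>I. (b i * s + a i) ^ n i)"
  using fin k by (simp add: p_def wq_def prod.remove ak M power_mult_distrib mult_ac)

private lemma A_pos: "i \<in> I \<Longrightarrow> s \<in> E \<Longrightarrow> s > 0 \<Longrightarrow> b i * s + a i > 0"
  using A[of i s] bk_pos ak by (cases "i = k") auto

private lemma p_DERIV:
  assumes s: "s \<in> E" "s > 0"
  shows "(p has_real_derivative p s * (\<Sum>i\<in>I. real (n i) * b i / (b i * s + a i))) (at s)"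
proof -
  have "((\<lambda>s. \<Prod>i\<in>J. (b i * s + a i) ^ n i) has_real_derivative
     (\<Prod>i\<in>J. (b i * s + a i) ^ n i) * (\<Sum>i\<in>J. real (n i) * b i / (b i * s + a i))) (at s)" if "finite J" "J \<subseteq> I" for J
    using that
  proof (induction J rule: finite_induct)
    case (insert i J)
    have pos: "b i * s + a i > 0" using A_pos[OF _ s] insert by auto
    obtain l where l: "n i = Suc l" using n[of i] insert gr0_implies_Suc by auto
    have "((\<lambda>s. b i * s + a i) has_real_derivative b i) (at s)" by (auto intro!: derivative_eq_intros)
    from DERIV_chain2[OF DERIV_pow this, of "n i"]
    have "((\<lambda>s. (b i * s + a i) ^ n i) has_real_derivative real (n i) * (b i * s + a i) ^ l * b i) (at s)"
      by (simp add: l)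
    moreover have "real (n i) * (b i * s + a i) ^ l * b i = (b i * s + a i) ^ n i * (real (n i) * b i / (b i * s + a i))"
      using pos by (simp add: l field_simps)
    ultimately have "((\<lambda>s. (b i * s + a i) ^ n i) has_real_derivative (b i * s + a i) ^ n i * (real (n i) * b i / (b i * s + a i))) (at s)" by simp
    from DERIV_mult[OF this insert.IH] insert.prems
    have "((\<lambda>s. (b i * s + a i) ^ n i * (\<Prod>i\<in>J. (b i * s + a i) ^ n i)) has_real_derivative
      (b i * s + a i) ^ n i * (real (n i) * b i / (b i * s + a i)) * (\<Prod>i\<in>J. (b i * s + a i) ^ n i) +
      (\<Prod>i\<in>J. (b i * s + a i) ^ n i) * (\<Sum>i\<in>J. real (n i) * b i / (b i * s + a i)) * (b i * s + a i) ^ n i) (at s)" by simp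
    then show ?case
      using insert.hyps by (simp add: algebra_simps)
  qed simp
  from this[OF fin order_refl] show ?thesis unfolding p_eq[symmetric] by (simp add: p_eq[abs_def])
qed

private definition "\<rho> s = (\<Sum>i\<in>I. 2 * real (n i) / (b i * s + a i)) - (\<alpha> * s + \<beta>)"

private lemma R_\<rho>: 
  assumes s: "s \<in> E" "s > 0"
  shows "s ^ M * wR \<alpha> \<beta> s = p s * \<rho> s"
proof -
  define c where "c = (\<Sum>i\<in>I - {k}. 2 * real (n i) / (b i * s + a i))"
  have "(\<Sum>i\<in>I. 2 * real (n i) / (b i * s + a i)) = 2 * real (n k) / (b k * s) + c"
    using fin k by (simp add: sum.remove ak c_def)
  then have 1: "\<rho> s = 2 * real (n k) / (b k * s) + c - (\<alpha> * s + \<beta>)" by (simp add: \<rho>_def)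
  have 2: "wR \<alpha> \<beta> s = 2 * real (n k) / b k * wq s + s * (wq s * c - (\<alpha> * s + \<beta>) * wq s)"
    by (simp add: wR_def c_def)
  show ?thesis
    unfolding 1 2 p_def using s bk_pos by (simp add: field_simps)
qed

text \<open>Since \<open>\<psi> = (p h)' / p\<close>, one has
  \<open>\<psi>' + \<psi> * p' / p = (p h)'' / p\<close>. The equation thus prescribes the second
  derivative of \<open>p h\<close>, and \<open>wR\<close> was chosen accordingly.\<close>

lemma wh_ode:
  assumes s: "s \<in> {0<..<1}"
  defines "\<psi> \<equiv> \<lambda>s. deriv (wh \<alpha> \<beta>) s + wh \<alpha> \<beta> s * (\<Sum>i\<in>I. real (n i) * b i / (b i * s + a i))"
  shows "- deriv \<psi> s + (\<Sum>i\<in>I. (1 - b i * \<psi> s / 2) * (2 * real (n i)) / (b i * s + a i)) = \<alpha> * s + \<beta>"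
proof -
  have sE: "s \<in> E" "s > 0" and sub: "{0<..<1} \<subseteq> E" using s e by auto
  define \<sigma> where "\<sigma> s = (\<Sum>i\<in>I. real (n i) * b i / (b i * s + a i))" for s
  have \<psi>: "\<psi> s = k1 s / p s" if "s \<in> {0<..<1}" for s
  proof -
    have sE: "s \<in> E" "s > 0" using that sub by auto
    have "((\<lambda>s. p s * wh \<alpha> \<beta> s) has_real_derivative p s * \<sigma> s * wh \<alpha> \<beta> s + deriv (wh \<alpha> \<beta>) s * p s) (at s)"
      using DERIV_mult[OF p_DERIV[OF sE] dh[OF sE(1)]] by (simp add: \<sigma>_def)
    then have "p s * \<sigma> s * wh \<alpha> \<beta> s + deriv (wh \<alpha> \<beta>) s * p s = k1 s"
      using ph_DERIV[OF sE(1)] DERIV_unique by blast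
    then show ?thesis using p_pos[OF sE] by (simp add: \<psi>_def \<sigma>_def field_simps)
  qed
  have "((\<lambda>s. k1 s / p s) has_real_derivative ((s ^ M * wR \<alpha> \<beta> s) * p s - k1 s * (p s * \<sigma> s)) / (p s * p s)) (at s)"
    unfolding \<sigma>_def using p_pos[OF sE] by (intro DERIV_divide k1_DERIV p_DERIV sE) auto
  then have "(\<psi> has_real_derivative ((s ^ M * wR \<alpha> \<beta> s) * p s - k1 s * (p s * \<sigma> s)) / (p s * p s)) (at s)"
    by (rule has_field_derivative_transform_within_open[of _ _ _ "{0<..<1}"]) (use s \<psi> in auto)
  then have "deriv \<psi> s = ((s ^ M * wR \<alpha> \<beta> s) * p s - k1 s * (p s * \<sigma> s)) / (p s * p s)" by (rule DERIV_imp_deriv)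
  also have "\<dots> = \<rho> s - \<psi> s * \<sigma> s"
    unfolding R_\<rho>[OF sE] \<psi>[OF s] using p_pos[OF sE] by (simp add: field_simps)
  finally have 1: "deriv \<psi> s = \<rho> s - \<psi> s * \<sigma> s" .
  have "(\<Sum>i\<in>I. (1 - b i * \<psi> s / 2) * (2 * real (n i)) / (b i * s + a i)) =
     (\<Sum>i\<in>I. 2 * real (n i) / (b i * s + a i)) - \<psi> s * \<sigma> s"
    unfolding \<sigma>_def sum_distrib_left sum_subtractf[symmetric]
    by (rule sum.cong[OF refl]) (simp add: algebra_simps add_divide_distrib diff_divide_distrib)
  then show ?thesis using 1 by (simp add: \<rho>_def)
qed

text \<open>At 0 the integrals \<open>wint\<close> reduce to the value of \<open>wR\<close> over
  \<open>Suc j\<close>, where \<alpha> and \<beta> drop out. The value \<open>1 / (n k + 1)\<close>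
  of \<open>b k\<close> is exactly what makes the slope 2.\<close>

lemma wh_boundary_0: "wh \<alpha> \<beta> 0 = 0" "deriv (wh \<alpha> \<beta>) 0 = 2"
proof -
  show "wh \<alpha> \<beta> 0 = 0" by (simp add: wh_def)
  have 0: "0 \<in> E" using e by auto
  have w0: "wint j f 0 = f 0 / real (Suc j)" for j f
  proof -
    have "wint j f 0 = integral {0..1} (\<lambda>t. t ^ j) * f 0" by (simp add: wint_def)
    also have "integral {0..1} (\<lambda>t::real. t ^ j) = 1 / real (Suc j)"
    proof (rule integral_unique)
      have "((\<lambda>t::real. t ^ j) has_integral (1 ^ Suc j / real (Suc j) - 0 ^ Suc j / real (Suc j))) {0..1}"
      proof (rule fundamental_theorem_of_calculus)
        fix t :: real
        have "((\<lambda>t. t ^ Suc j / real (Suc j)) has_real_derivative real (Suc j) * t ^ j / real (Suc j)) (at t within {0..1})"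
          using DERIV_cdivide[OF DERIV_pow[of "Suc j" t "{0..1}"], of "real (Suc j)"] by simp
        moreover have "real (Suc j) * t ^ j / real (Suc j) = t ^ j" by (rule nonzero_mult_div_cancel_left) simp
        ultimately show "((\<lambda>t. t ^ Suc j / real (Suc j)) has_vector_derivative t ^ j) (at t within {0..1})"
          by (simp only: has_real_derivative_iff_has_vector_derivative)
      qed simp
      then show "((\<lambda>t::real. t ^ j) has_integral 1 / real (Suc j)) {0..1}" by simp
    qed
    finally show ?thesis by simp
  qed
  define K where "K s = (wint M (wR \<alpha> \<beta>) s - wint (Suc M) (wR \<alpha> \<beta>) s) / wq s" for s
  have Ks: "smooth_on UNIV E K"
    unfolding K_def
    by (intro smooth_on_divide[OF r] smooth_on_diff[OF r] wint_smooth[OF cd] wR_smooth wq_smooth)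
      (use wq_pos in force)
  have "((\<lambda>s. s * K s) has_real_derivative 1 * K 0 + deriv K 0 * 0) (at 0)"
    by (intro DERIV_mult DERIV_ident smooth_on_real_derivative(1)[OF _ Ks 0]) simp
  moreover have "(\<lambda>s. s * K s) = wh \<alpha> \<beta>" by (auto simp: K_def wh_def)
  ultimately have "deriv (wh \<alpha> \<beta>) 0 = K 0" by (auto intro: DERIV_imp_deriv)
  moreover have "wR \<alpha> \<beta> 0 = 2 * (real M + 1) * (real M + 2) * wq 0"
    by (simp add: wR_def bk M field_simps)
  then have "wint M (wR \<alpha> \<beta>) 0 = 2 * (real M + 2) * wq 0" "wint (Suc M) (wR \<alpha> \<beta>) 0 = 2 * (real M + 1) * wq 0"
    by (simp_all add: w0 divide_eq_eq algebra_simps)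
  then have "K 0 = (2 * wq 0) / wq 0" by (simp add: K_def algebra_simps)
  then have "K 0 = 2" using wq_pos[OF 0] by simp
  ultimately show "deriv (wh \<alpha> \<beta>) 0 = 2" by simp
qed

context
  assumes b1: "wint M (wR \<alpha> \<beta>) 1 = - 2 * wq 1" "wint (Suc M) (wR \<alpha> \<beta>) 1 = - 2 * wq 1"
begin

text \<open>Equality of the two integrals gives the zero of \<open>h\<close> at 1. Their common
  value says that \<open>p h\<close> has derivative \<open>- 2 * p\<close> there, and at a zero of
  \<open>h\<close> this is a condition on its slope.\<close>

lemma wh_boundary_1: "wh \<alpha> \<beta> 1 = 0" "deriv (wh \<alpha> \<beta>) 1 = -2"
proof -
  have 1: "1 \<in> E" "(1::real) > 0" using e by auto
  show h1: "wh \<alpha> \<beta> 1 = 0" by (simp add: wh_def b1)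
  have "((\<lambda>s. p s * wh \<alpha> \<beta> s) has_real_derivative p 1 * (\<Sum>i\<in>I. real (n i) * b i / (b i * 1 + a i)) * wh \<alpha> \<beta> 1 + deriv (wh \<alpha> \<beta>) 1 * p 1) (at 1)"
    using DERIV_mult[OF p_DERIV[OF 1] dh[OF 1(1)]] by simp
  then have "deriv (wh \<alpha> \<beta>) 1 * p 1 = k1 1"
    using DERIV_unique[OF _ ph_DERIV[OF 1(1)]] h1 by fastforce
  then have "(deriv (wh \<alpha> \<beta>) 1 + 2) * wq 1 = 0"
    by (simp add: p_def k1_def b1 distrib_right)
  then show "deriv (wh \<alpha> \<beta>) 1 = -2"
    using wq_pos[OF 1(1)] by simp
qed

text \<open>If the profile were nonpositive somewhere, the second derivative of \<open>p h\<close>, which is \<open>p\<close> times a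
  convex function, would take the signs \<open>-, +, -\<close> in this order.\<close>

lemma wh_pos:
  assumes s1: "s1 \<in> {0<..<1}"
  shows "wh \<alpha> \<beta> s1 > 0"
proof (rule ccontr)
  assume neg: "\<not> wh \<alpha> \<beta> s1 > 0"
  have in_E: "s \<in> E" if "0 \<le> s" "s \<le> 1" for s using that e by auto
  define \<phi> where "\<phi> s = p s * wh \<alpha> \<beta> s" for s
  have d\<phi>: "(\<phi> has_real_derivative k1 s) (at s)" if "0 \<le> s" "s \<le> 1" for s
    using ph_DERIV[OF in_E[OF that]] by (simp add: \<phi>_def[abs_def])
  have \<phi>1: "\<phi> s1 \<le> 0" using neg p_pos[of s1] s1 in_E[of s1] by (simp add: \<phi>_def mult_le_0_iff)
  obtain d where d: "d > 0" "\<And>t. t > 0 \<Longrightarrow> t < d \<Longrightarrow> wh \<alpha> \<beta> t > 0"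
    using DERIV_pos_inc_right[OF dh[of 0]] wh_boundary_0 in_E[of 0] by auto
  obtain d' where d': "d' > 0" "\<And>t. t > 0 \<Longrightarrow> t < d' \<Longrightarrow> wh \<alpha> \<beta> (1 - t) > 0"
    using DERIV_neg_dec_left[OF dh[of 1]] wh_boundary_1 in_E[of 1] by auto
  define t where "t = min (d / 2) (s1 / 2)"
  have t: "0 < t" "t < s1" "wh \<alpha> \<beta> t > 0" using d s1 by (auto simp: t_def)
  define t' where "t' = min (d' / 2) ((1 - s1) / 2)"
  have t': "0 < t'" "s1 < 1 - t'" "wh \<alpha> \<beta> (1 - t') > 0" using d' s1 by (auto simp: t'_def min_def field_simps)
  have \<phi>t: "\<phi> t > 0" "\<phi> (1 - t') > 0"
    using t t' s1 p_pos[of t] p_pos[of "1 - t'"] in_E[of t] in_E[of "1 - t'"] by (auto simp: \<phi>_def)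
  obtain x where x: "t < x" "x < s1" "\<phi> s1 - \<phi> t = (s1 - t) * k1 x"
    using MVT2[of t s1 \<phi> k1] t s1 d\<phi> by auto
  have kx: "k1 x < 0" using x \<phi>1 \<phi>t(1) t by (smt (verit) mult_nonneg_nonneg)
  obtain y where y: "s1 < y" "y < 1 - t'" "\<phi> (1 - t') - \<phi> s1 = (1 - t' - s1) * k1 y"
    using MVT2[of s1 "1 - t'" \<phi> k1] t' s1 d\<phi> by auto
  have ky: "k1 y > 0" using y \<phi>1 \<phi>t(2) t' by (smt (verit) mult_nonneg_nonpos)
  \<comment> \<open>So \<open>k1\<close>, the derivative of \<open>p h\<close>, is zero at 0,
    negative at \<open>x\<close>, positive at \<open>y\<close> and negative at 1; the mean value
    theorem on the three intervals gives the three signs of the second derivative.\<close>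
  have k0: "k1 0 = 0" by (simp add: k1_def)
  have k1': "k1 1 < 0" using wq_pos[of 1] in_E[of 1] by (simp add: k1_def b1)
  have dk: "(k1 has_real_derivative s ^ M * wR \<alpha> \<beta> s) (at s)" if "0 \<le> s" "s \<le> 1" for s
    by (rule k1_DERIV[OF in_E[OF that]])
  have sgn: "\<rho> s > 0 \<longleftrightarrow> s ^ M * wR \<alpha> \<beta> s > 0" "\<rho> s < 0 \<longleftrightarrow> s ^ M * wR \<alpha> \<beta> s < 0" if "0 < s" "s \<le> 1" for s
  proof -
    have "s \<in> E" "s > 0" using that in_E[of s] by auto
    then show "\<rho> s > 0 \<longleftrightarrow> s ^ M * wR \<alpha> \<beta> s > 0" "\<rho> s < 0 \<longleftrightarrow> s ^ M * wR \<alpha> \<beta> s < 0"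
      unfolding R_\<rho>[OF \<open>s \<in> E\<close> \<open>s > 0\<close>] using p_pos[of s] by (auto simp: zero_less_mult_iff mult_less_0_iff)
  qed
  obtain z0 where z0: "0 < z0" "z0 < x" "k1 x - k1 0 = (x - 0) * (z0 ^ M * wR \<alpha> \<beta> z0)"
    using MVT2[of 0 x k1 "\<lambda>s. s ^ M * wR \<alpha> \<beta> s"] dk x t s1 by auto
  have "\<rho> z0 < 0"
    using sgn(2)[of z0] z0 x s1 kx k0 t by (auto simp: mult_less_0_iff)
  obtain z1 where z1: "x < z1" "z1 < y" "k1 y - k1 x = (y - x) * (z1 ^ M * wR \<alpha> \<beta> z1)"
    using MVT2[of x y k1 "\<lambda>s. s ^ M * wR \<alpha> \<beta> s"] dk x y t t' s1 by auto
  have "(y - x) * (z1 ^ M * wR \<alpha> \<beta> z1) > 0" using z1(3) kx ky by linarith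
  then have "\<rho> z1 > 0"
    using sgn(1)[of z1] z1 x y s1 t t' by (auto simp: zero_less_mult_iff)
  obtain z2 where z2: "y < z2" "z2 < 1" "k1 1 - k1 y = (1 - y) * (z2 ^ M * wR \<alpha> \<beta> z2)"
    using MVT2[of y 1 k1 "\<lambda>s. s ^ M * wR \<alpha> \<beta> s"] dk y t' s1 by auto
  have "(1 - y) * (z2 ^ M * wR \<alpha> \<beta> z2) < 0" using z2(3) k1' ky by linarith
  then have "\<rho> z2 < 0"
    using sgn(2)[of z2] z2 y s1 t' by (auto simp: mult_less_0_iff)
  define u where "u = (z1 - z0) / (z2 - z0)"
  have ord: "0 < z0" "z0 < z1" "z1 < z2" "z2 < 1" using z0 z1 z2 by auto
  then have u: "0 \<le> u" "u \<le> 1" by (auto simp: u_def)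
  have "u * (z2 - z0) = z1 - z0" using ord by (simp add: u_def)
  then have u3: "z1 = (1 - u) * z0 + u * z2" by (simp add: algebra_simps)
  have "\<rho> z1 \<le> (1 - u) * \<rho> z0 + u * \<rho> z2"
  proof -
    have c: "2 * real (n i) / (b i * z1 + a i) \<le> (1 - u) * (2 * real (n i) / (b i * z0 + a i)) + u * (2 * real (n i) / (b i * z2 + a i))"
      if "i \<in> I" for i
    proof -
      have "b i * z0 + a i > 0" "b i * z2 + a i > 0"
        using A_pos[OF that, of z0] A_pos[OF that, of z2] in_E[of z0] in_E[of z2] ord by auto
      from inverse_affine_convex[OF this u]
      have "2 * real (n i) * (1 / (b i * z1 + a i)) \<le> 2 * real (n i) * ((1 - u) * (1 / (b i * z0 + a i)) + u * (1 / (b i * z2 + a i)))"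
        unfolding u3[symmetric] by (intro mult_left_mono) auto
      then show ?thesis by (simp add: algebra_simps)
    qed
    have "(\<Sum>i\<in>I. 2 * real (n i) / (b i * z1 + a i)) \<le> (1 - u) * (\<Sum>i\<in>I. 2 * real (n i) / (b i * z0 + a i)) + u * (\<Sum>i\<in>I. 2 * real (n i) / (b i * z2 + a i))"
      unfolding sum_distrib_left sum.distrib[symmetric] by (rule sum_mono[OF c])
    then show ?thesis unfolding \<rho>_def u3 by (simp add: algebra_simps)
  qed
  moreover have "(1 - u) * \<rho> z0 \<le> 0" "u * \<rho> z2 \<le> 0"
    using u \<open>\<rho> z0 < 0\<close> \<open>\<rho> z2 < 0\<close> by (auto simp: mult_le_0_iff)
  ultimately show False using \<open>\<rho> z1 > 0\<close> by linarith
qed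

end

text \<open>\<open>wR\<close> is affine in \<alpha> and \<beta>, so the conditions at 1 form a
  linear system whose coefficients are moments of \<open>wq\<close>.\<close>

lemma wh_coefficients:
  "wint j (wR \<alpha> \<beta>) 1 = wint j (wR 0 0) 1 - \<alpha> * integral {0..1} (\<lambda>t. t ^ Suc (Suc j) * wq t) - \<beta> * integral {0..1} (\<lambda>t. t ^ Suc j * wq t)"
proof -
  have wq: "continuous_on {0..1} wq"
    by (rule continuous_on_subset[OF smooth_on_continuous[OF wq_smooth]]) (use e in auto)
  have i: "(\<lambda>t. t ^ m * wq t) integrable_on {0..1}" for m
    by (intro integrable_continuous_real continuous_intros wq)
  have "continuous_on {0..1} (wR 0 0)"
  proof -
    have "b i * t + a i \<noteq> 0" if "i \<in> I - {k}" "t \<in> {0..1}" for i t using pos[OF that] by simp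
    then show ?thesis unfolding wR_def[abs_def] by (intro continuous_intros wq) auto
  qed
  then have i0: "(\<lambda>t. t ^ j * wR 0 0 t) integrable_on {0..1}"
    by (intro integrable_continuous_real continuous_intros)
  have "wint j (wR \<alpha> \<beta>) 1 = integral {0..1} (\<lambda>t. t ^ j * wR 0 0 t - \<alpha> * (t ^ Suc (Suc j) * wq t) - \<beta> * (t ^ Suc j * wq t))"
    unfolding wint_def by (rule arg_cong[where f="integral {0..1}"]) (auto simp: wR_def algebra_simps)
  also have "\<dots> = wint j (wR 0 0) 1 - \<alpha> * integral {0..1} (\<lambda>t. t ^ Suc (Suc j) * wq t) - \<beta> * integral {0..1} (\<lambda>t. t ^ Suc j * wq t)"
  proof (rule integral_unique)
    show "((\<lambda>t. t ^ j * wR 0 0 t - \<alpha> * (t ^ Suc (Suc j) * wq t) - \<beta> * (t ^ Suc j * wq t)) has_integral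
      wint j (wR 0 0) 1 - \<alpha> * integral {0..1} (\<lambda>t. t ^ Suc (Suc j) * wq t) - \<beta> * integral {0..1} (\<lambda>t. t ^ Suc j * wq t)) {0..1}"
      using integrable_integral[OF i0] unfolding wint_def
      by (intro has_integral_diff has_integral_mult_right integrable_integral i) simp
  qed
  finally show ?thesis .
qed

end

lemma extremal_profile:
  obtains h \<alpha> \<beta> where "profile h"
    "\<And>s. s \<in> {0<..<1} \<Longrightarrow>
       - deriv (\<lambda>s. deriv h s + h s * (\<Sum>i\<in>I. real (n i) * b i / (b i * s + a i))) s +
       (\<Sum>i\<in>I. (1 - b i * (deriv h s + h s * (\<Sum>i\<in>I. real (n i) * b i / (b i * s + a i))) / 2) * (2 * real (n i)) / (b i * s + a i)) = \<alpha> * s + \<beta>"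
proof -
  obtain \<epsilon> where e: "\<epsilon> > 0" "\<And>i s. i \<in> I - {k} \<Longrightarrow> s \<in> {-\<epsilon><..<1+\<epsilon>} \<Longrightarrow> b i * s + a i > 0"
    using extremal_domain by blast
  define m where "m j = integral {0..1} (\<lambda>t. t ^ j * wq t)" for j
  \<comment> \<open>The determinant of the system for \<alpha> and \<beta> is a Hankel determinant
    of moments, which the strict inequality keeps away from zero.\<close>
  have "(m (Suc (Suc M)))\<^sup>2 < m (Suc M) * m (Suc (Suc (Suc M)))"
    unfolding m_def
  proof (rule wint_moment_cauchy_schwarz)
    show "continuous_on {0..1} wq"
      by (rule continuous_on_subset[OF smooth_on_continuous[OF wq_smooth[OF e]]]) (use e in auto)
    show "wq t > 0" if "t \<in> {0..1}" for t using wq_pos[OF e, of t] that e by auto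
  qed
  then have "m (Suc (Suc M)) * m (Suc (Suc M)) - m (Suc M) * m (Suc (Suc (Suc M))) \<noteq> 0"
    by (simp add: power2_eq_square)
  then obtain \<alpha> \<beta> where ab: "\<alpha> * m (Suc (Suc M)) + \<beta> * m (Suc M) = wint M (wR 0 0) 1 + 2 * wq 1"
    "\<alpha> * m (Suc (Suc (Suc M))) + \<beta> * m (Suc (Suc M)) = wint (Suc M) (wR 0 0) 1 + 2 * wq 1"
    by (rule linear_system_2x2)
  have b1: "wint M (wR \<alpha> \<beta>) 1 = - 2 * wq 1" "wint (Suc M) (wR \<alpha> \<beta>) 1 = - 2 * wq 1"
    using ab wh_coefficients[OF e, of M \<alpha> \<beta>] wh_coefficients[OF e, of "Suc M" \<alpha> \<beta>] by (simp_all add: m_def)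
  have "profile (wh \<alpha> \<beta>)"
    unfolding profile_def
  proof (intro conjI exI[of _ "{-\<epsilon><..<1+\<epsilon>}"] ballI)
    show "wh \<alpha> \<beta> s > 0" if "s \<in> {0<..<1}" for s by (rule wh_pos[OF e b1 that])
  qed (use e wh_smooth[OF e] wh_boundary_0[OF e] wh_boundary_1[OF e b1] in auto)
  then show ?thesis using wh_ode[OF e] by (rule that)
qed

end

section \<open>Charts\<close>

lemma rel_open_model: "openin (top_of_set (cspace B :: (complex^'n::finite) set)) S \<longleftrightarrow> rel_open (cspace B) S"
  using coord_subspaceD[OF coord_subspace_cspace] by (auto simp: rel_open_def)

lemma kahler_chart_subset:
  assumes "kahler_chart B S G" "rel_open (cspace B) T" "T \<subseteq> S"
  shows "kahler_chart B T G"
proof -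
  interpret kahler_chart B S G by fact
  show ?thesis
  proof
    show "smooth_on (cspace B) T (\<lambda>u. G u v w)" if "v \<in> cspace B" "w \<in> cspace B" for v w
      by (rule smooth_on_subset[OF smooth[OF that] assms(3)])
  qed (use assms(2,3) bil sym pos GJ closed in blast)+
qed

locale cman =
  fixes M :: "('p, 'n::finite) cmanifold"
  assumes cm: "complex_manifold M"
begin

lemma pts_eq: "pts M = (\<Union>c\<in>charts M. fst c)"
  and chart_openin: "c \<in> charts M \<Longrightarrow> openin (mtop M) (fst c)"
  and img_openin: "c \<in> charts M \<Longrightarrow> openin (top_of_set (model M)) (img c)"
  and chart_homeo: "c \<in> charts M \<Longrightarrow> homeomorphic_map (subtopology (mtop M) (fst c)) (top_of_set (img c)) (snd c)"
  and transition: "c \<in> charts M \<Longrightarrow> c' \<in> charts M \<Longrightarrow>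
        holo_on ((*s) \<i>) (model M) (snd c ` (fst c \<inter> fst c')) (snd c' \<circ> cinv c)"
  using cm unfolding complex_manifold_def by auto

lemma img_open: "c \<in> charts M \<Longrightarrow> rel_open (model M) (img c)"
  using img_openin by (simp add: rel_open_model)

lemma chart_sub: "c \<in> charts M \<Longrightarrow> fst c \<subseteq> pts M"
  using chart_openin openin_subset by blast

lemma chart_inj: 
  assumes "c \<in> charts M"
  shows "inj_on (snd c) (fst c)"
proof -
  have "topspace (subtopology (mtop M) (fst c)) = fst c"
    using chart_sub[OF assms] by (simp add: Int_absorb1)
  then show ?thesis using homeomorphic_imp_injective_map[OF chart_homeo[OF assms]] by simp
qed

lemma cinv_snd: "c \<in> charts M \<Longrightarrow> p \<in> fst c \<Longrightarrow> cinv c (snd c p) = p"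
  by (rule inv_into_f_f[OF chart_inj])

lemma snd_cinv: "u \<in> img c \<Longrightarrow> snd c (cinv c u) = u"
  by (rule f_inv_into_f)

lemma cinv_in: "u \<in> img c \<Longrightarrow> cinv c u \<in> fst c"
  by (rule inv_into_into)

lemma open_image:
  assumes c: "c \<in> charts M" and W: "openin (mtop M) W"
  shows "rel_open (model M) (snd c ` (fst c \<inter> W))"
proof -
  have "openin (subtopology (mtop M) (fst c)) (fst c \<inter> W)"
    using W by (simp add: openin_subtopology_Int2)
  then have "openin (top_of_set (img c)) (snd c ` (fst c \<inter> W))"
    using homeomorphic_imp_open_map[OF chart_homeo[OF c]] by (simp add: open_map_def)
  then show ?thesis using img_openin[OF c] openin_trans rel_open_model by blast
qed

lemma image_iff_cinv: 
  assumes "c \<in> charts M"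
  shows "u \<in> snd c ` (fst c \<inter> W) \<longleftrightarrow> u \<in> img c \<and> cinv c u \<in> W"
proof
  assume "u \<in> snd c ` (fst c \<inter> W)"
  then obtain p where "p \<in> fst c" "p \<in> W" "u = snd c p" by auto
  then show "u \<in> img c \<and> cinv c u \<in> W" using cinv_snd[OF assms] by auto
next
  assume "u \<in> img c \<and> cinv c u \<in> W"
  then have "u = snd c (cinv c u)" "cinv c u \<in> fst c \<inter> W" using cinv_in[of u c] snd_cinv[of u c] by auto
  then show "u \<in> snd c ` (fst c \<inter> W)" by (rule image_eqI)
qed

lemma in_chart: "p \<in> pts M \<Longrightarrow> \<exists>c\<in>charts M. p \<in> fst c"
  using pts_eq by auto

lemma chart_at: "p \<in> pts M \<Longrightarrow> chart_at M p \<in> charts M \<and> p \<in> fst (chart_at M p)"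
  unfolding chart_at_def by (rule someI_ex) (use in_chart in blast)

lemma J_model: "v \<in> model M \<Longrightarrow> J v \<in> model M"
  by (rule J_cspace)

lemma kahler_chart:
  assumes g: "kahler_metric M g" and c: "c \<in> charts M"
  shows "kahler_chart (coords M) (img c) (loc c g)"
proof
  have R: "riemannian_metric M g" using g by (simp add: kahler_metric_def)
  have lin: "g c p (v + r *\<^sub>R w) z = g c p v z + r * g c p w z" and sym: "g c p v w = g c p w v"
    and pos: "v \<noteq> 0 \<Longrightarrow> g c p v v > 0"
    if "p \<in> fst c" "v \<in> model M" "w \<in> model M" "z \<in> model M" for p v w z r
    using R c that unfolding riemannian_metric_def by blast+
  show "rel_open (model M) (img c)" by (rule img_open[OF c])
  have sV: "subspace (model M)" by (rule coord_subspaceD) simp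
  show "bilinear_on (model M) (loc c g u)" if "u \<in> img c" for u
    unfolding bilinear_on_def
  proof (intro ballI conjI linear_onI)
    fix z v w :: "complex^'n" and r :: real assume z: "z \<in> model M" and vw: "v \<in> model M" "w \<in> model M"
    have p: "cinv c u \<in> fst c" by (rule cinv_in[OF that])
    have vw': "v + r *\<^sub>R w \<in> model M" using vw sV by (simp add: subspace_add subspace_scale)
    show "loc c g u (v + r *\<^sub>R w) z = loc c g u v z + r *\<^sub>R loc c g u w z"
      using lin[OF p vw z] by (simp add: loc_def)
    then show "loc c g u z (v + r *\<^sub>R w) = loc c g u z v + r *\<^sub>R loc c g u z w"
      using sym[OF p z vw' z] sym[OF p z vw(1) z] sym[OF p z vw(2) z] by (simp add: loc_def)
  qed
  show "loc c g u v w = loc c g u w v" if "u \<in> img c" "v \<in> model M" "w \<in> model M" for u v w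
    using sym[OF cinv_in[OF that(1)] that(2,3,2)] by (simp add: loc_def)
  show "pos_on (model M) (loc c g u)" if "u \<in> img c" for u
    using pos[OF cinv_in[OF that]] by (simp add: pos_on_def loc_def)
  show "loc c g u (J v) (J w) = loc c g u v w" if "u \<in> img c" "v \<in> model M" "w \<in> model M" for u v w
    using g c cinv_in[OF that(1)] that unfolding kahler_metric_def loc_def by blast
  show "smooth_on (model M) (img c) (\<lambda>u. loc c g u v w)" if "v \<in> model M" "w \<in> model M" for v w
    using R c that unfolding riemannian_metric_def loc_def by blast
  show "ext_deriv2 (\<lambda>u v w. loc c g u (J v) w) u v w z = 0"
    if "u \<in> img c" "v \<in> model M" "w \<in> model M" "z \<in> model M" for u v w z
  proof -
    have "ext_deriv2 (loc c (kahler_form g)) u v w z = 0"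
      using g c that unfolding kahler_metric_def by blast
    then show ?thesis unfolding loc_def kahler_form_def .
  qed
qed

end

locale holo = M: cman M + N: cman N
  for M :: "('p, 'n::finite) cmanifold" and N :: "('q, 'n) cmanifold" +
  fixes W :: "'p set" and f :: "'p \<Rightarrow> 'q"
  assumes W: "openin (mtop M) W" and f: "holo_map M W N f"
begin

definition "hdom c c' = snd c ` (fst c \<inter> W \<inter> f -` fst c')"

lemma f_in: "p \<in> W \<Longrightarrow> f p \<in> pts N"
  using f openin_subset[OF W] unfolding holo_map_def continuous_map_def
  by (auto simp: topspace_subtopology Int_absorb1 Pi_iff)

lemma open_preimage: "openin (mtop N) T \<Longrightarrow> openin (mtop M) (W \<inter> f -` T)"
proof -
  assume T: "openin (mtop N) T"
  have "openin (subtopology (mtop M) W) {x \<in> topspace (subtopology (mtop M) W). f x \<in> T}"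
    using f T unfolding holo_map_def by (intro openin_continuous_map_preimage) auto
  moreover have "{x \<in> topspace (subtopology (mtop M) W). f x \<in> T} = W \<inter> f -` T"
    using openin_subset[OF W] by auto
  ultimately show ?thesis using W openin_trans_full by fastforce
qed

context
  fixes c c' assumes c: "c \<in> charts M" and c': "c' \<in> charts N"
begin

abbreviation "z \<equiv> snd c' \<circ> f \<circ> cinv c"

lemma hdom_open: "rel_open (model M) (hdom c c')"
  unfolding hdom_def Int_assoc by (rule M.open_image[OF c open_preimage[OF N.chart_openin[OF c']]])

lemma hdom_iff: "u \<in> hdom c c' \<longleftrightarrow> u \<in> img c \<and> cinv c u \<in> W \<and> f (cinv c u) \<in> fst c'"
  unfolding hdom_def Int_assoc M.image_iff_cinv[OF c] by simp

lemma z_smooth: "smooth_on (model M) (hdom c c') z"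
  and z_J: "u \<in> hdom c c' \<Longrightarrow> v \<in> model M \<Longrightarrow> dird z u (J v) = J (dird z u v)"
  using f c c' unfolding holo_map_def holo_on_def hdom_def by blast+

lemma z_in: "u \<in> hdom c c' \<Longrightarrow> z u \<in> img c'"
  by (simp add: hdom_iff)

lemma dz_in: "u \<in> hdom c c' \<Longrightarrow> v \<in> model M \<Longrightarrow> dird z u v \<in> model N"
  by (rule dird_pullback_in[OF hdom_open coord_subspace_cspace coord_subspace_cspace N.img_open[OF c'] z_smooth z_in])

lemma dmap_eq: "u \<in> img c \<Longrightarrow> dmap c c' f (cinv c u) v = dird z u v"
  by (simp add: dmap_def M.snd_cinv)

end

text \<open>The chain rule through a second chart of the target; it makes \<open>pullback\<close>
  independent of the choice made by \<open>chart_at\<close>.\<close>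

lemma dmap_change:
  assumes c: "c \<in> charts M" and c': "c' \<in> charts N" and c'': "c'' \<in> charts N"
    and p: "p \<in> fst c" "p \<in> W" "f p \<in> fst c'" "f p \<in> fst c''" and v: "v \<in> model M"
  shows "dmap c c'' f p v = dmap c' c'' id (f p) (dmap c c' f p v)"
proof -
  define D where "D = snd c ` (fst c \<inter> (W \<inter> f -` (fst c' \<inter> fst c'')))"
  have D: "rel_open (model M) D"
    unfolding D_def by (intro M.open_image[OF c] open_preimage openin_Int N.chart_openin c' c'')
  define u where "u = snd c p"
  have u: "u \<in> D" "u \<in> img c" "cinv c u = p" using p M.cinv_snd[OF c] by (auto simp: u_def D_def)
  have DD: "x \<in> hdom c c'" "(snd c' \<circ> f \<circ> cinv c) x \<in> snd c' ` (fst c' \<inter> fst c'')"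
    "(snd c'' \<circ> cinv c') ((snd c' \<circ> f \<circ> cinv c) x) = (snd c'' \<circ> f \<circ> cinv c) x" if "x \<in> D" for x
    using that M.cinv_snd[OF c] N.cinv_snd[OF c'] unfolding D_def hdom_def by auto
  have u': "u \<in> hdom c c'" by (rule DD(1)[OF u(1)])
  have h: "has_dird (\<lambda>x. (snd c'' \<circ> cinv c') ((snd c' \<circ> f \<circ> cinv c) x)) u v
     (dird (snd c'' \<circ> cinv c') ((snd c' \<circ> f \<circ> cinv c) u) (dird (snd c' \<circ> f \<circ> cinv c) u v))"
  proof (rule has_dird_compose[OF coord_subspace_cspace N.open_image[OF c' N.chart_openin[OF c'']] _ D])
    show "smooth_on (model N) (snd c' ` (fst c' \<inter> fst c'')) (snd c'' \<circ> cinv c')"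
      using N.transition[OF c' c''] by (simp add: holo_on_def)
    show "has_dird (snd c' \<circ> f \<circ> cinv c) u v (dird (snd c' \<circ> f \<circ> cinv c) u v)"
      by (rule smooth_on_has_dird[OF z_smooth[OF c c'] u' v])
    show "dird (snd c' \<circ> f \<circ> cinv c) u v \<in> model N" by (rule dz_in[OF c c' u' v])
  qed (use DD u v in auto)
  have "has_dird (snd c'' \<circ> f \<circ> cinv c) u v
     (dird (snd c'' \<circ> cinv c') ((snd c' \<circ> f \<circ> cinv c) u) (dird (snd c' \<circ> f \<circ> cinv c) u v))"
    by (rule has_dird_cong_imp[OF D u(1) v DD(3) h])
  then have "dird (snd c'' \<circ> f \<circ> cinv c) u v = dird (snd c'' \<circ> cinv c') ((snd c' \<circ> f \<circ> cinv c) u) (dird (snd c' \<circ> f \<circ> cinv c) u v)"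
    by (rule has_dird_dird)
  then show ?thesis
    using u by (simp add: dmap_def u_def[symmetric])
qed

lemma pullback_eq:
  assumes g: "\<And>c c' q v w. c \<in> charts N \<Longrightarrow> c' \<in> charts N \<Longrightarrow> q \<in> fst c \<Longrightarrow> q \<in> fst c' \<Longrightarrow> v \<in> model N \<Longrightarrow> w \<in> model N \<Longrightarrow>
      g c q v w = g c' q (dmap c c' id q v) (dmap c c' id q w)"
    and c: "c \<in> charts M" and c': "c' \<in> charts N"
    and u: "u \<in> hdom c c'" and v: "v \<in> model M" and w: "w \<in> model M"
  shows "pullback N f g c (cinv c u) v w = loc c' g ((snd c' \<circ> f \<circ> cinv c) u) (dird (snd c' \<circ> f \<circ> cinv c) u v) (dird (snd c' \<circ> f \<circ> cinv c) u w)"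
proof -
  define p where "p = cinv c u"
  have p: "p \<in> fst c" "p \<in> W" "f p \<in> fst c'" "u \<in> img c"
    using u M.cinv_in[of u c] unfolding p_def hdom_iff[OF c c'] by simp_all
  define d where "d = chart_at N (f p)"
  have d: "d \<in> charts N" "f p \<in> fst d" using N.chart_at[OF f_in[OF p(2)]] by (auto simp: d_def)
  have ud: "u \<in> hdom c d" using p d(2) by (simp add: hdom_iff[OF c d(1)] p_def)
  have in': "dmap c d f p v \<in> model N" "dmap c d f p w \<in> model N"
    unfolding p_def dmap_eq[OF c d(1) p(4)] using dz_in[OF c d(1) ud] v w by auto
  have "pullback N f g c p v w = g d (f p) (dmap c d f p v) (dmap c d f p w)"
    by (simp add: pullback_def d_def Let_def)
  also have "\<dots> = g c' (f p) (dmap d c' id (f p) (dmap c d f p v)) (dmap d c' id (f p) (dmap c d f p w))"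
    by (rule g[OF d(1) c' d(2) p(3) in'])
  also have "\<dots> = g c' (f p) (dmap c c' f p v) (dmap c c' f p w)"
    using dmap_change[OF c d(1) c' p(1,2) d(2) p(3)] v w by simp
  finally show ?thesis
    unfolding p_def dmap_eq[OF c c' p(4)] using p(3) by (simp add: loc_def p_def N.cinv_snd[OF c'])
qed

end

lemma riemannian_transform:
  assumes "riemannian_metric N g" "c \<in> charts N" "c' \<in> charts N" "q \<in> fst c" "q \<in> fst c'" "v \<in> model N" "w \<in> model N"
  shows "g c q v w = g c' q (dmap c c' id q v) (dmap c c' id q w)"
  using assms unfolding riemannian_metric_def by blast

section \<open>Cohomogeneity-one manifolds in charts\<close>

lemma holo_map_subset:
  assumes "holo_map M W N f" "W' \<subseteq> W"
  shows "holo_map M W' N f"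
  unfolding holo_map_def
proof (intro conjI ballI)
  show "continuous_map (subtopology (mtop M) W') (mtop N) f"
    using assms continuous_map_from_subtopology_mono unfolding holo_map_def by blast
  fix c c' assume "c \<in> charts M" "c' \<in> charts N"
  then have h: "holo_on ((*s) \<i>) (model M) (snd c ` (fst c \<inter> W \<inter> f -` fst c')) (snd c' \<circ> f \<circ> cinv c)"
    using assms by (simp add: holo_map_def)
  have sub: "snd c ` (fst c \<inter> W' \<inter> f -` fst c') \<subseteq> snd c ` (fst c \<inter> W \<inter> f -` fst c')" using assms by blast
  show "holo_on ((*s) \<i>) (model M) (snd c ` (fst c \<inter> W' \<inter> f -` fst c')) (snd c' \<circ> f \<circ> cinv c)"
    using h sub smooth_on_subset[OF _ sub] unfolding holo_on_def by blast
qed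

locale toric_manifold =
  fixes m :: nat and N :: "nat \<Rightarrow> ('q, 'n::finite) cmanifold" and gN :: "nat \<Rightarrow> ('q, 'n) bilinear_field"
    and b :: "nat \<Rightarrow> real" and M :: "('p, 'n) cmanifold" and E0 E1 :: "'p set"
    and \<rho> :: "real \<Rightarrow> 'p \<Rightarrow> 'p" and \<pi> :: "nat \<Rightarrow> 'p \<Rightarrow> 'q" and \<theta> :: "('p, 'n) one_form"
  assumes ftm: "fiberwise_toric_manifold m N gN b M E0 E1 \<rho> \<pi> \<theta>"
begin

definition "M0 = pts M - E0 - E1"

context
begin

private lemma F:
  shows "1 \<le> m"
    and "\<forall>i\<in>{1..m}. closed_complex_manifold (N i) \<and> kahler_metric (N i) (gN i) \<and> einstein_metric 1 (N i) (gN i)"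
    and "b 1 = 2 / (real (real_dim (N 1)) + 2)"
    and "closed_complex_manifold M"
    and "coords M = UNIV"
    and "real_dim M = 2 + (\<Sum>i=1..m. real_dim (N i))"
    and "\<forall>i\<in>{2..m}. holo_map M (pts M) (N i) (\<pi> i)"
    and "holo_map M (pts M - E0) (N 1) (\<pi> 1)"
    and "closedin (mtop M) E0" "closedin (mtop M) E1" "E0 \<inter> E1 = {}"
    and "(mtop M) closure_of M0 = pts M"
    and "circle_action M \<rho>"
    and "\<forall>t. \<forall>p \<in> E0 \<union> E1. \<rho> t p = p"
    and "\<forall>p\<in>M0. \<forall>t. \<forall>i\<in>{1..m}. \<pi> i (\<rho> t p) = \<pi> i p"
    and "smooth_one_form M M0 \<theta>"
    and "\<forall>c\<in>charts M. \<forall>p \<in> fst c \<inter> M0. \<theta> c p (generator \<rho> c p) = 1"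
    and "\<forall>c\<in>charts M. \<forall>p \<in> fst c \<inter> M0. \<forall>v\<in>model M. \<forall>w\<in>model M.
         ext_deriv1 (loc c \<theta>) (snd c p) v w =
           (\<Sum>i=1..m. b i * pullback (N i) (\<pi> i) (kahler_form (gN i)) c p v w)"
  by (insert ftm[unfolded fiberwise_toric_manifold_def Let_def projective_bundle_def, folded M0_def], elim conjE, assumption)+

lemma m: "1 \<le> m"
  and N_closed: "i \<in> {1..m} \<Longrightarrow> closed_complex_manifold (N i)"
  and N_kahler: "i \<in> {1..m} \<Longrightarrow> kahler_metric (N i) (gN i)"
  and N_einstein: "i \<in> {1..m} \<Longrightarrow> einstein_metric 1 (N i) (gN i)"
  and b1: "b 1 = 2 / (real (real_dim (N 1)) + 2)"
  and M_closed: "closed_complex_manifold M"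
  and coordsM [simp]: "coords M = UNIV"
  and dimM: "real_dim M = 2 + (\<Sum>i=1..m. real_dim (N i))"
  and holo_bundle: "i \<in> {2..m} \<Longrightarrow> holo_map M (pts M) (N i) (\<pi> i)"
  and holo_1: "holo_map M (pts M - E0) (N 1) (\<pi> 1)"
  and E_closed: "closedin (mtop M) E0" "closedin (mtop M) E1" and E_disj: "E0 \<inter> E1 = {}"
  and dense: "(mtop M) closure_of M0 = pts M"
  and action: "circle_action M \<rho>"
  and fixed: "p \<in> E0 \<union> E1 \<Longrightarrow> \<rho> t p = p"
  and orbit_\<pi>: "p \<in> M0 \<Longrightarrow> i \<in> {1..m} \<Longrightarrow> \<pi> i (\<rho> t p) = \<pi> i p"
  and \<theta>_form: "smooth_one_form M M0 \<theta>"
  and \<theta>_gen: "c \<in> charts M \<Longrightarrow> p \<in> fst c \<inter> M0 \<Longrightarrow> \<theta> c p (generator \<rho> c p) = 1"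
  and d\<theta>: "c \<in> charts M \<Longrightarrow> p \<in> fst c \<inter> M0 \<Longrightarrow>
     ext_deriv1 (loc c \<theta>) (snd c p) v w = (\<Sum>i=1..m. b i * pullback (N i) (\<pi> i) (kahler_form (gN i)) c p v w)"
  using F(1) F(2)[THEN bspec, of i] F(3-6) F(7)[THEN bspec, of i] F(8-13) F(14)[THEN spec, THEN bspec, of p t] F(15)[THEN bspec, THEN spec, THEN bspec, of p i t]
    F(16) F(17)[THEN bspec, THEN bspec, of c p] F(18)[THEN bspec, THEN bspec, THEN bspec, THEN bspec, of c p v w]
  by (simp_all del: One_nat_def)

end

sublocale cman M
  by unfold_locales (use M_closed in \<open>simp add: closed_complex_manifold_def\<close>)

lemma N_cman: "i \<in> {1..m} \<Longrightarrow> cman (N i)"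
  by unfold_locales (use N_closed in \<open>auto simp: closed_complex_manifold_def\<close>)

lemma M0_open: "openin (mtop M) M0"
  unfolding M0_def by (intro openin_diff E_closed) simp

lemma M0_sub: "M0 \<subseteq> pts M" by (auto simp: M0_def)

lemma holo_M0: 
  assumes i: "i \<in> {1..m}"
  shows "holo M (N i) M0 (\<pi> i)"
proof -
  interpret cman "N i" by (rule N_cman[OF i])
  have "holo_map M M0 (N i) (\<pi> i)"
  proof (cases "i = 1")
    case True
    then show ?thesis using holo_map_subset[OF holo_1, of M0] by (auto simp: M0_def)
  next
    case False
    then show ?thesis using holo_map_subset[OF holo_bundle, of i M0] i M0_sub by auto
  qed
  then show ?thesis using M0_open by unfold_locales
qed

lemma holo_M:
  assumes i: "i \<in> {2..m}"
  shows "holo M (N i) (pts M) (\<pi> i)"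
proof -
  interpret cman "N i" by (rule N_cman) (use i in auto)
  show ?thesis using holo_bundle[OF i] by unfold_locales auto
qed

definition "U0 c = snd c ` (fst c \<inter> M0)"

context
  fixes c assumes c: "c \<in> charts M"
begin

lemma img_open': "open (img c)"
  using img_open[OF c] by (simp add: rel_open_UNIV)

lemma U0_open: "open (U0 c)"
  using open_image[OF c M0_open] by (simp add: rel_open_UNIV U0_def)

lemma U0_iff: "u \<in> U0 c \<longleftrightarrow> u \<in> img c \<and> cinv c u \<in> M0"
  unfolding U0_def by (rule image_iff_cinv[OF c])

lemma U0_sub: "U0 c \<subseteq> img c" using U0_iff by blast

text \<open>Density of the principal orbits, transported to the coordinate domain by the
  chart.\<close>

lemma dense_meets:
  assumes O': "open O'" "O' \<subseteq> img c" "u \<in> O'"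
  obtains y where "y \<in> O'" "y \<in> U0 c"
proof -
  have "continuous_map (subtopology (mtop M) (fst c)) (top_of_set (img c)) (snd c)"
    by (rule homeomorphic_imp_continuous_map[OF chart_homeo[OF c]])
  then have "openin (subtopology (mtop M) (fst c)) {p \<in> topspace (subtopology (mtop M) (fst c)). snd c p \<in> O'}"
    by (rule openin_continuous_map_preimage) (simp add: openin_open_eq[OF img_open'], simp add: O')
  moreover have "{p \<in> topspace (subtopology (mtop M) (fst c)). snd c p \<in> O'} = {p \<in> fst c. snd c p \<in> O'}"
    using chart_sub[OF c] by auto
  ultimately have op: "openin (mtop M) {p \<in> fst c. snd c p \<in> O'}"
    using chart_openin[OF c] openin_trans_full by fastforce
  have u: "u \<in> img c" using O' by blast
  have "cinv c u \<in> {p \<in> fst c. snd c p \<in> O'}" using u O'(3) cinv_in[OF u] snd_cinv[OF u] by auto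
  then have "{p \<in> fst c. snd c p \<in> O'} \<inter> pts M \<noteq> {}" using chart_sub[OF c] by auto
  then have "{p \<in> fst c. snd c p \<in> O'} \<inter> M0 \<noteq> {}"
    using openin_Int_closure_of_eq_empty[OF op, of M0] dense by simp
  then obtain p where "p \<in> fst c" "p \<in> M0" "snd c p \<in> O'" by auto
  then show thesis by (intro that[of "snd c p"]) (auto simp: U0_def)
qed

context
  fixes D assumes D: "open D" "D \<subseteq> img c"
begin

text \<open>The set where \<phi> is negative is open, so it would contain a point of a principal
  orbit.\<close>

lemma dense_ge_on:
  assumes \<phi>: "continuous_on D (\<phi> :: _ \<Rightarrow> real)" and ge: "\<And>u. u \<in> D \<Longrightarrow> u \<in> U0 c \<Longrightarrow> \<phi> u \<ge> 0" and u: "u \<in> D"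
  shows "\<phi> u \<ge> 0"
proof (rule ccontr)
  assume neg: "\<not> \<phi> u \<ge> 0"
  have "open (D \<inter> \<phi> -` {..<0})" using \<phi> D(1) by (intro continuous_open_preimage) auto
  then obtain y where "y \<in> D \<inter> \<phi> -` {..<0}" "y \<in> U0 c"
    by (rule dense_meets[of _ u]) (use neg u D(2) in auto)
  then show False using ge[of y] by auto
qed

lemma dense_eq_on:
  fixes \<phi> \<psi> :: "_ \<Rightarrow> 'b::real_normed_vector"
  assumes \<phi>: "continuous_on D \<phi>" "continuous_on D \<psi>" and eq: "\<And>u. u \<in> D \<Longrightarrow> u \<in> U0 c \<Longrightarrow> \<phi> u = \<psi> u" and u: "u \<in> D"
  shows "\<phi> u = \<psi> u"
proof -
  have "continuous_on D (\<lambda>u. - norm (\<phi> u - \<psi> u))" by (intro continuous_intros \<phi>)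
  from dense_ge_on[OF this _ u] show ?thesis using eq by simp
qed

end

lemmas dense_ge = dense_ge_on[OF img_open' subset_refl]
lemmas dense_eq = dense_eq_on[OF img_open' subset_refl]

subsection \<open>The generator of the circle action\<close>

definition "xi u = generator \<rho> c (cinv c u)"

definition "flow = (\<lambda>(t, u). snd c (\<rho> t (cinv c u)))"

definition "flow_dom = {(t, u). u \<in> img c \<and> \<rho> t (cinv c u) \<in> fst c}"

lemma action_0: "p \<in> pts M \<Longrightarrow> \<rho> 0 p = p"
  and action_add: "p \<in> pts M \<Longrightarrow> \<rho> (s + t) p = \<rho> s (\<rho> t p)"
  and action_holo: "holo_map M (pts M) M (\<rho> t)"
  and action_cont: "continuous_map (prod_topology euclideanreal (mtop M)) (mtop M) (\<lambda>(t, p). \<rho> t p)"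
  using action unfolding circle_action_def by auto

lemma flow_smooth: "smooth_on UNIV flow_dom flow"
  using action c unfolding circle_action_def flow_def flow_dom_def by (simp add: UNIV_Times_UNIV[symmetric] del: UNIV_Times_UNIV)

lemma cinv_continuous: "continuous_map (top_of_set (img c)) (mtop M) (cinv c)"
  unfolding continuous_map_def
proof (intro conjI allI impI)
  show "cinv c \<in> topspace (top_of_set (img c)) \<rightarrow> topspace (mtop M)"
    using cinv_in[of _ c] chart_sub[OF c] by (auto simp: Pi_iff)
  fix W assume W: "openin (mtop M) W"
  have "{u \<in> topspace (top_of_set (img c)). cinv c u \<in> W} = snd c ` (fst c \<inter> W)"
    using image_iff_cinv[OF c] by auto
  moreover have "open (snd c ` (fst c \<inter> W))" using open_image[OF c W] by (simp add: rel_open_UNIV)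
  ultimately show "openin (top_of_set (img c)) {u \<in> topspace (top_of_set (img c)). cinv c u \<in> W}"
    using openin_open_eq[OF img_open'] by auto
qed

lemma flow_dom_open: "open flow_dom"
proof -
  define T where "T = prod_topology euclideanreal (top_of_set (img c))"
  have T: "T = top_of_set (UNIV \<times> img c)"
    unfolding T_def using prod_topology_subtopology_eu[of UNIV "img c"] by simp
  have "continuous_map T (mtop M) (\<lambda>q. cinv c (snd q))"
    unfolding T_def using continuous_map_compose[OF continuous_map_snd cinv_continuous] by (simp add: o_def)
  moreover have "continuous_map T euclideanreal fst" unfolding T_def by (rule continuous_map_fst)
  ultimately have "continuous_map T (prod_topology euclideanreal (mtop M)) (\<lambda>q. (fst q, cinv c (snd q)))"
    by (simp add: continuous_map_pairedI)
  from continuous_map_compose[OF this action_cont]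
  have "continuous_map T (mtop M) (\<lambda>q. \<rho> (fst q) (cinv c (snd q)))" by (simp add: o_def)
  from openin_continuous_map_preimage[OF this chart_openin[OF c]]
  have "openin T {q \<in> topspace T. \<rho> (fst q) (cinv c (snd q)) \<in> fst c}" .
  moreover have "{q \<in> topspace T. \<rho> (fst q) (cinv c (snd q)) \<in> fst c} = flow_dom"
    by (auto simp: T flow_dom_def)
  moreover have "open (UNIV \<times> img c :: (real \<times> (complex, 'n) vec) set)" by (intro open_Times img_open') simp
  ultimately show ?thesis unfolding T by (simp add: openin_open_eq)
qed

lemma cinv_pts: "u \<in> img c \<Longrightarrow> cinv c u \<in> pts M"
  using cinv_in[of u c] chart_sub[OF c] by blast

lemma flow_0: "u \<in> img c \<Longrightarrow> (0, u) \<in> flow_dom" "u \<in> img c \<Longrightarrow> flow (0, u) = u"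
  using cinv_in[of u c] snd_cinv[of u c] cinv_pts[of u] by (auto simp: flow_dom_def flow_def action_0)

lemma flow_in: "(t, u) \<in> flow_dom \<Longrightarrow> flow (t, u) \<in> img c" "(t, u) \<in> flow_dom \<Longrightarrow> cinv c (flow (t, u)) = \<rho> t (cinv c u)"
  using cinv_snd[OF c] by (auto simp: flow_dom_def flow_def)

lemma rf: "rel_open UNIV flow_dom" using flow_dom_open by (simp add: rel_open_UNIV)

lemma xi_eq: "xi u = dird flow (0, u) (1, 0)"
  by (simp add: xi_def generator_def dird_def flow_def)

lemma xi_smooth: "smooth_on UNIV (img c) xi"
  unfolding xi_eq[abs_def]
proof (rule smooth_on_compose[OF _ flow_dom_open _ smooth_on_dird[OF flow_smooth]])
  show r: "rel_open UNIV (img c)" using img_open' by (simp add: rel_open_UNIV)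
  show "smooth_on UNIV (img c) (\<lambda>u. (0, u))"
    by (intro smooth_on_Pair[OF r] smooth_on_const[OF r] smooth_on_id[OF r])
qed (use flow_0 in auto)

lemma flow_J: 
  assumes "(t, u) \<in> flow_dom"
  shows "dird flow (t, u) (0, J v) = J (dird flow (t, u) (0, v))"
proof -
  have "u \<in> snd c ` (fst c \<inter> pts M \<inter> \<rho> t -` fst c)"
    unfolding Int_assoc image_iff_cinv[OF c] using assms cinv_pts by (auto simp: flow_dom_def)
  then have "dird (snd c \<circ> \<rho> t \<circ> cinv c) u (J v) = J (dird (snd c \<circ> \<rho> t \<circ> cinv c) u v)"
    using action_holo[of t] c unfolding holo_map_def holo_on_def coordsM cspace_UNIV by blast
  moreover have "dird flow (t, u) (0, v) = dird (snd c \<circ> \<rho> t \<circ> cinv c) u v" for v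
    by (simp add: dird_def flow_def)
  ultimately show ?thesis by simp
qed

text \<open>Every map of the flow is holomorphic, and the derivative in time commutes with the
  derivative in space.\<close>

lemma xi_J:
  assumes u: "u \<in> img c"
  shows "dird xi u (J v) = J (dird xi u v)"
proof -
  note u0 = flow_0(1)[OF u]
  have comm: "dird (\<lambda>q. dird flow q (1, 0)) (0, u) (0, w) = dird (\<lambda>q. dird flow q (0, w)) (0, u) (1, 0)" for w
    by (rule smooth_on_dird_commute[OF coord_subspace_UNIV rf flow_smooth u0]) auto
  have d: "dird xi u w = dird (\<lambda>q. dird flow q (1, 0)) (0, u) (0, w)" for w
    unfolding xi_eq[abs_def] by (simp add: dird_def)
  have h: "has_dird (\<lambda>q. dird flow q (0, v)) (0, u) (1, 0) (dird (\<lambda>q. dird flow q (0, v)) (0, u) (1, 0))"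
    by (rule smooth_on_has_dird[OF smooth_on_dird[OF flow_smooth] u0]) auto
  have "has_dird (\<lambda>q. dird flow q (0, J v)) (0, u) (1, 0) (J (dird (\<lambda>q. dird flow q (0, v)) (0, u) (1, 0)))"
    by (rule has_dird_cong_imp[OF rf u0 UNIV_I _ has_dird_bounded_linear[OF bounded_linear_J h]])
      (use flow_J in auto)
  then have "dird (\<lambda>q. dird flow q (0, J v)) (0, u) (1, 0) = J (dird (\<lambda>q. dird flow q (0, v)) (0, u) (1, 0))"
    by (rule has_dird_dird)
  then show ?thesis unfolding d comm .
qed

text \<open>The function \<open>t \<mapsto> \<Phi> (flow (t, u))\<close> is differentiated at 0. The
  orbit is certain to stay in the domain only for small times, hence the argument with an eventual
  equality.\<close>

lemma dird_invariant:
  fixes \<Phi> :: "complex^'n \<Rightarrow> 'b::real_normed_vector"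
  assumes D: "open D" and \<Phi>: "smooth_on UNIV D \<Phi>" and u: "u \<in> img c" "u \<in> D"
    and inv: "\<And>t. (t, u) \<in> flow_dom \<Longrightarrow> flow (t, u) \<in> D \<Longrightarrow> \<Phi> (flow (t, u)) = \<Phi> u"
  shows "dird \<Phi> u (xi u) = 0"
proof -
  have "has_dird flow (0, u) (1, 0) (xi u)"
    unfolding xi_eq by (rule smooth_on_has_dird[OF flow_smooth flow_0(1)[OF u(1)]]) simp
  moreover have "(\<Phi> has_derivative dird \<Phi> u) (at (flow (0, u)))"
    unfolding flow_0(2)[OF u(1)] by (rule smooth_on_has_derivative[OF D \<Phi> u(2)])
  ultimately have h: "has_dird (\<lambda>q. \<Phi> (flow q)) (0, u) (1, 0) (dird \<Phi> u (xi u))"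
    by (rule has_dird_chain[rotated])
  have "rel_open UNIV (flow_dom \<inter> flow -` D)"
    using continuous_open_preimage[OF smooth_on_continuous[OF flow_smooth] flow_dom_open D] by (simp add: rel_open_UNIV)
  from rel_open_line[OF this, of "(0, u)" "(1, 0)"]
  have "\<forall>\<^sub>F t in nhds 0. (t, u) \<in> flow_dom \<inter> flow -` D" using flow_0[OF u(1)] u(2) by simp
  then have ev: "\<forall>\<^sub>F t in nhds 0. \<Phi> (flow (t, u)) = \<Phi> u"
    by eventually_elim (use inv in auto)
  have "((\<lambda>t. \<Phi> (flow (t, u))) has_vector_derivative dird \<Phi> u (xi u)) (at 0)"
    using h by (simp add: has_dird_def)
  moreover have "((\<lambda>t. \<Phi> (flow (t, u))) has_vector_derivative D') (at 0) \<longleftrightarrow> ((\<lambda>t. \<Phi> u) has_vector_derivative D') (at 0)" for D'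
    by (rule has_vector_derivative_cong_ev) (use ev flow_0[OF u(1)] in \<open>auto elim: eventually_mono\<close>)
  ultimately have "((\<lambda>t::real. \<Phi> u) has_vector_derivative dird \<Phi> u (xi u)) (at 0)" by simp
  then show ?thesis using has_vector_derivative_const vector_derivative_unique_at by blast
qed

text \<open>If the orbit met a special orbit, the point reached would be fixed, and flowing back
  would put \<open>p\<close> itself there.\<close>

lemma action_M0: 
  assumes p: "p \<in> M0"
  shows "\<rho> t p \<in> M0"
proof -
  have pM: "p \<in> pts M" using p M0_sub by blast
  have q: "\<rho> t p \<in> pts M"
    using action_holo[of t] pM unfolding holo_map_def continuous_map_def by (auto simp: Pi_iff)
  have "\<rho> t p \<notin> E0 \<union> E1"
  proof
    assume "\<rho> t p \<in> E0 \<union> E1"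
    then have "\<rho> (- t) (\<rho> t p) = \<rho> t p" by (rule fixed)
    then have "p = \<rho> t p" using action_add[OF pM, of "- t" t] action_0[OF pM] by simp
    then show False using \<open>\<rho> t p \<in> E0 \<union> E1\<close> p by (auto simp: M0_def)
  qed
  then show ?thesis using q by (auto simp: M0_def)
qed

lemma \<Theta>_lin: 
  assumes "u \<in> U0 c"
  shows "linear_on UNIV (loc c \<theta> u)"
proof -
  have "\<forall>p \<in> fst c \<inter> M0. \<forall>v w r. \<theta> c p (v + r *\<^sub>R w) = \<theta> c p v + r * \<theta> c p w"
    using \<theta>_form c unfolding smooth_one_form_def coordsM cspace_UNIV by blast
  moreover have "cinv c u \<in> fst c \<inter> M0" using assms cinv_in[of u c] by (simp add: U0_iff)
  ultimately show ?thesis by (intro linear_onI) (simp add: loc_def)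
qed

lemma \<Theta>_smooth: "smooth_on UNIV (U0 c) (\<lambda>u. loc c \<theta> u v)"
  using \<theta>_form c unfolding smooth_one_form_def U0_def loc_def coordsM cspace_UNIV by blast

lemma \<Theta>_xi: "u \<in> U0 c \<Longrightarrow> loc c \<theta> u (xi u) = 1"
  using \<theta>_gen[OF c, of "cinv c u"] by (auto simp: loc_def xi_def U0_iff cinv_in)

end

end

section \<open>Smoothness of the curvature\<close>

context kahler_chart
begin

lemma ric_smooth:
  assumes w: "w \<in> V" and z: "z \<in> V"
  shows "smooth_on V S (\<lambda>u. ric u w z)"
proof -
  have \<Gamma>\<Gamma>: "smooth_on V S (\<lambda>u. \<Gamma> u v (\<Gamma> u w z))" if "v \<in> V" "w \<in> V" "z \<in> V" for v w z
    by (rule smooth_on_apply[OF V openS \<Gamma>_lin2 \<Gamma>_smooth \<Gamma>_in \<Gamma>_smooth]) (use that in auto)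
  have "smooth_on V S (\<lambda>u. tr V (\<lambda>e. R u e w z))"
    unfolding R_def D\<Gamma>_def
    by (intro tr_smooth_on[OF V openS] smooth_on_add[OF openS] smooth_on_diff[OF openS] \<Gamma>\<Gamma> smooth_on_dird \<Gamma>_smooth w z)
  then show ?thesis
    using smooth_on_cong[OF openS, of "\<lambda>u. ric u w z" "\<lambda>u. tr V (\<lambda>e. R u e w z)"] ric_tr by simp
qed

lemma ric_lin:
  assumes u: "u \<in> S" and w: "w \<in> V"
  shows "linear_on V (ric u w)"
  unfolding linear_on_def ric_tr[OF u]
  using linear_onD[OF R_lin3[OF u _ w]] by (auto simp flip: tr_add tr_scale intro!: tr_cong)

text \<open>Needed to extend the formula for the scalar curvature from the principal orbits by
  continuity.\<close>

lemma scalar_curvature_smooth: "smooth_on V S (scalar_curvature V G)"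
  unfolding scalar_curvature_def
  by (intro smooth_on_sum[OF openS] smooth_on_bounded_linear[OF openS bounded_linear_inner_left]
      smooth_on_sharp[OF V openS bil pos smooth] ric_smooth ric_lin) auto

end

context toric_manifold
begin

context
  fixes c assumes c: "c \<in> charts M"
begin

definition "dpi i u = dmap c (chart_at (N i) (\<pi> i (cinv c u))) (\<pi> i) (cinv c u)"

definition "pb i u v w = pullback (N i) (\<pi> i) (gN i) c (cinv c u) v w"

context
  fixes i u assumes i: "i \<in> {1..m}" and u: "u \<in> U0 c"
begin

interpretation holo M "N i" M0 "\<pi> i" by (rule holo_M0[OF i])

abbreviation "ci \<equiv> chart_at (N i) (\<pi> i (cinv c u))"

lemma ci: "ci \<in> charts (N i)" "u \<in> hdom c ci"
proof -
  have p: "u \<in> img c" "cinv c u \<in> M0" using u by (auto simp: U0_iff[OF c])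
  have *: "ci \<in> charts (N i)" "\<pi> i (cinv c u) \<in> fst ci"
    using N.chart_at[OF f_in[OF p(2)]] by auto
  then show "ci \<in> charts (N i)" "u \<in> hdom c ci" using p hdom_iff[OF c] by auto
qed

lemma dpi_eq: "dpi i u v = dird (snd ci \<circ> \<pi> i \<circ> cinv c) u v"
  unfolding dpi_def by (rule dmap_eq[OF c ci(1)]) (use u U0_iff[OF c] in simp)

lemma dpi_lin: "linear_on UNIV (dpi i u)"
  unfolding dpi_eq[abs_def]
  using smooth_on_linear_dird[OF coord_subspace_cspace hdom_open[OF c ci(1)] z_smooth[OF c ci(1)] ci(2)] by simp

lemma dpi_J: "dpi i u (J v) = J (dpi i u v)"
  unfolding dpi_eq by (rule z_J[OF c ci]) simp

lemma dpi_in: "dpi i u v \<in> model (N i)"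
  unfolding dpi_eq by (rule dz_in[OF c ci]) simp

lemma pb_eq: "pb i u v w = gN i ci (\<pi> i (cinv c u)) (dpi i u v) (dpi i u w)"
  by (simp add: pb_def dpi_def pullback_def Let_def)

private lemma kc: "kahler_chart (coords (N i)) (img ci) (loc ci (gN i))" "snd ci (\<pi> i (cinv c u)) \<in> img ci"
    "loc ci (gN i) (snd ci (\<pi> i (cinv c u))) = gN i ci (\<pi> i (cinv c u))"
proof -
  show "kahler_chart (coords (N i)) (img ci) (loc ci (gN i))"
    by (rule N.kahler_chart[OF N_kahler[OF i] ci(1)])
  have "\<pi> i (cinv c u) \<in> fst ci" using ci(2) hdom_iff[OF c ci(1)] by simp
  then show "snd ci (\<pi> i (cinv c u)) \<in> img ci" "loc ci (gN i) (snd ci (\<pi> i (cinv c u))) = gN i ci (\<pi> i (cinv c u))"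
    using N.cinv_snd[OF ci(1)] by (auto simp: loc_def)
qed

lemma pb_bilinear: "bilinear_on UNIV (pb i u)"
  using linear_onD[OF kahler_chart.G_lin1[OF kc(1,2)]] linear_onD[OF kahler_chart.G_lin2[OF kc(1,2)]]
  unfolding bilinear_on_def linear_on_def by (simp add: pb_eq kc(3) linear_onD[OF dpi_lin] dpi_in)

lemma pb_sym: "pb i u v w = pb i u w v"
  using kahler_chart.sym[OF kc(1,2)] by (simp add: pb_eq kc(3) dpi_in)

lemma pb_J: "pb i u (J v) (J w) = pb i u v w"
  using kahler_chart.GJ[OF kc(1,2)] by (simp add: pb_eq kc(3) dpi_in dpi_J)

lemma pb_pos: "dpi i u v \<noteq> 0 \<Longrightarrow> pb i u v v > 0"
  using kahler_chart.pos[OF kc(1,2)] by (simp add: pos_on_def pb_eq kc(3) dpi_in)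

lemma pb_zero: "dpi i u v = 0 \<Longrightarrow> pb i u v w = 0"
  using linear_on_zero[OF kahler_chart.sV[OF kc(1)] kahler_chart.G_lin1[OF kc(1,2)], of "dpi i u w"] dpi_in[of w]
  by (simp add: pb_eq kc(3))

lemma pb_nonneg: "pb i u v v \<ge> 0"
  using pb_pos[of v] pb_zero[of v v] by (cases "dpi i u v = 0") auto

lemma dpi_xi: "dpi i u (xi c u) = 0"
  unfolding dpi_eq
proof (rule dird_invariant[OF c])
  show "open (hdom c ci)" using hdom_open[OF c ci(1)] by (simp add: rel_open_UNIV)
  show "smooth_on UNIV (hdom c ci) (snd ci \<circ> \<pi> i \<circ> cinv c)" using z_smooth[OF c ci(1)] by simp
  show "u \<in> img c" "u \<in> hdom c ci" using ci u by (auto simp: U0_iff[OF c])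
  show "(snd ci \<circ> \<pi> i \<circ> cinv c) (flow c (t, u)) = (snd ci \<circ> \<pi> i \<circ> cinv c) u" if "(t, u) \<in> flow_dom c" for t
    using flow_in(2)[OF c that] orbit_\<pi>[OF _ i] u by (simp add: U0_iff[OF c])
qed

end

definition "pdom i c' = snd c ` (fst c \<inter> M0 \<inter> \<pi> i -` fst c')"

definition "zc i c' = snd c' \<circ> \<pi> i \<circ> cinv c"

text \<open>In fixed charts of \<open>M\<close> and of the factor, the pullback is taken along a
  smooth map \<open>zc\<close> between coordinate domains, so the calculus on such domains
  applies.\<close>

lemma pb_chart:
  assumes i: "i \<in> {1..m}" and c': "c' \<in> charts (N i)"
  shows pdom_open: "open (pdom i c')" and pdom_sub: "pdom i c' \<subseteq> U0 c"
    and zc_smooth: "smooth_on UNIV (pdom i c') (zc i c')"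
    and zc_in: "u \<in> pdom i c' \<Longrightarrow> zc i c' u \<in> img c'"
    and zc_J: "u \<in> pdom i c' \<Longrightarrow> dird (zc i c') u (J v) = J (dird (zc i c') u v)"
    and zc_xi: "u \<in> pdom i c' \<Longrightarrow> dird (zc i c') u (xi c u) = 0"
    and pb_zc: "u \<in> pdom i c' \<Longrightarrow> pb i u v w = loc c' (gN i) (zc i c' u) (dird (zc i c') u v) (dird (zc i c') u w)"
    and pb_kahler: "u \<in> pdom i c' \<Longrightarrow> ext_deriv2 (\<lambda>u v w. pb i u (J v) w) u v w y = 0"
proof -
  interpret holo M "N i" M0 "\<pi> i" by (rule holo_M0[OF i])
  have pdom: "pdom i c' = hdom c c'" by (simp add: pdom_def hdom_def)
  show op: "open (pdom i c')" using hdom_open[OF c c'] by (simp add: rel_open_UNIV pdom)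
  have r: "rel_open UNIV (pdom i c')" using op by (simp add: rel_open_UNIV)
  show sub: "pdom i c' \<subseteq> U0 c" by (auto simp: pdom_def U0_def)
  show sm: "smooth_on UNIV (pdom i c') (zc i c')" using z_smooth[OF c c'] by (simp add: pdom zc_def)
  show zin: "zc i c' u \<in> img c'" if "u \<in> pdom i c'" for u using z_in[OF c c'] that by (simp add: pdom zc_def)
  show zJ: "dird (zc i c') u (J v) = J (dird (zc i c') u v)" if "u \<in> pdom i c'" for u v
    using z_J[OF c c', of u v] that by (simp add: pdom zc_def)
  show "dird (zc i c') u (xi c u) = 0" if u: "u \<in> pdom i c'"
  proof (rule dird_invariant[OF c op sm _ u])
    show "u \<in> img c" using u sub U0_sub[OF c] by blast
    have "u \<in> U0 c" using u sub by blast
    then show "zc i c' (flow c (t, u)) = zc i c' u" if "(t, u) \<in> flow_dom c" for t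
      unfolding zc_def using flow_in(2)[OF c that] orbit_\<pi>[OF _ i] by (simp add: U0_iff[OF c])
  qed
  show pb: "pb i u v w = loc c' (gN i) (zc i c' u) (dird (zc i c') u v) (dird (zc i c') u w)" if "u \<in> pdom i c'" for u v w
    unfolding pb_def zc_def
    by (rule pullback_eq[OF _ c c'])
      (use riemannian_transform N_kahler[OF i] that in \<open>auto simp: kahler_metric_def pdom\<close>)
  show "ext_deriv2 (\<lambda>u v w. pb i u (J v) w) u v w y = 0" if u: "u \<in> pdom i c'"
  proof -
    have kc: "kahler_chart (coords (N i)) (img c') (loc c' (gN i))" by (rule N.kahler_chart[OF N_kahler[OF i] c'])
    interpret k: kahler_chart "coords (N i)" "img c'" "loc c' (gN i)" by (rule kc)
    \<comment> \<open>The Kaehler form is pulled back and not the metric, because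
      \<open>ext_deriv2_pullback\<close> relies on antisymmetry; \<open>J\<close> passes through the
      differential of \<open>zc\<close> by holomorphy.\<close>
    define \<omega> where "\<omega> y v w = loc c' (gN i) y (J v) w" for y v w
    have bil: "bilinear_on (model (N i)) (\<omega> y)" if "y \<in> img c'" for y
      using linear_onD[OF k.G_lin1[OF that]] linear_onD[OF k.G_lin2[OF that]]
      unfolding bilinear_on_def linear_on_def \<omega>_def by (simp add: J_add J_scaleR N.J_model)
    have d: "dird (\<lambda>u. pb i u (J v) w) u y = dird (\<lambda>x. \<omega> (zc i c' x) (dird (zc i c') x v) (dird (zc i c') x w)) u y" for v w y
      by (rule dird_cong[OF r u]) (auto simp: pb zJ \<omega>_def)
    have "ext_deriv2 (\<lambda>u v w. pb i u (J v) w) u v w y = ext_deriv2 (\<lambda>x v w. \<omega> (zc i c' x) (dird (zc i c') x v) (dird (zc i c') x w)) u v w y"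
      unfolding ext_deriv2_def d ..
    also have "\<dots> = ext_deriv2 \<omega> (zc i c' u) (dird (zc i c') u v) (dird (zc i c') u w) (dird (zc i c') u y)"
    proof (rule ext_deriv2_pullback[OF r coord_subspace_UNIV coord_subspace_cspace k.openS sm zin bil])
      show "smooth_on (model (N i)) (img c') (\<lambda>y. \<omega> y v w)" if "v \<in> model (N i)" "w \<in> model (N i)" for v w
        unfolding \<omega>_def using that by (intro k.smooth N.J_model)
      show "\<omega> y v w = - \<omega> y w v" if "y \<in> img c'" "v \<in> model (N i)" "w \<in> model (N i)" for y v w
        unfolding \<omega>_def k.GJ1[OF that] using k.sym[OF that(1) that(2), of "J w"] N.J_model[OF that(3)] by simp
    qed (use u in auto)
    also have "\<dots> = 0"
    proof -
      have in': "dird (zc i c') u v \<in> model (N i)" for v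
        by (rule dird_pullback_in[OF r coord_subspace_UNIV coord_subspace_cspace k.openS sm zin u]) auto
      show ?thesis unfolding \<omega>_def[abs_def] by (rule k.closed[OF zin[OF u] in' in' in'])
    qed
    finally show ?thesis .
  qed
qed

lemma d\<Theta>: "u \<in> U0 c \<Longrightarrow> ext_deriv1 (loc c \<theta>) u v w = (\<Sum>i=1..m. b i * pb i u (J v) w)"
proof -
  assume u: "u \<in> U0 c"
  have p: "cinv c u \<in> fst c \<inter> M0" "snd c (cinv c u) = u"
    using u cinv_in[of u c] snd_cinv[of u c] by (auto simp: U0_iff[OF c])
  have "ext_deriv1 (loc c \<theta>) u v w = (\<Sum>i=1..m. b i * pullback (N i) (\<pi> i) (kahler_form (gN i)) c (cinv c u) v w)"
    using d\<theta>[OF c p(1), of v w] p(2) by simp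
  also have "\<dots> = (\<Sum>i=1..m. b i * pb i u (J v) w)"
  proof (rule sum.cong[OF refl])
    fix i assume i: "i \<in> {1..m}"
    have "pullback (N i) (\<pi> i) (kahler_form (gN i)) c (cinv c u) v w = pb i u (J v) w"
      unfolding pb_eq[OF i u] dpi_J[OF i u] by (simp add: pullback_def Let_def kahler_form_def dpi_def)
    then show "b i * pullback (N i) (\<pi> i) (kahler_form (gN i)) c (cinv c u) v w = b i * pb i u (J v) w" by simp
  qed
  finally show ?thesis .
qed

end

end

section \<open>Identities on the principal orbits\<close>

locale toric_metric = toric_manifold m N gN b M E0 E1 \<rho> \<pi> \<theta>
  for m and N :: "nat \<Rightarrow> ('q, 'n::finite) cmanifold" and gN b and M :: "('p, 'n) cmanifold" and E0 E1 \<rho> \<pi> \<theta> +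
  fixes x :: "'p \<Rightarrow> real" and h :: "real \<Rightarrow> real" and a :: "nat \<Rightarrow> real" and g :: "('p, 'n) bilinear_field"
  assumes ftmet: "fiberwise_toric_metric m N gN b M E0 E1 \<rho> \<pi> \<theta> x h a g"
begin

lemma metric_facts:
  shows g_kahler: "kahler_metric M g"
    and x_smooth: "smooth_fun M (pts M) x"
    and x_M0': "\<forall>p\<in>M0. 0 < x p \<and> x p < 1" and x_E0': "\<forall>p\<in>E0. x p = 0" and x_E1': "\<forall>p\<in>E1. x p = 1"
    and x_surj: "\<forall>s\<in>{0<..<1}. \<forall>y \<in> (\<Pi>\<^sub>E i\<in>{1..m}. pts (N i)). \<exists>p\<in>M0. x p = s \<and> (\<forall>i\<in>{1..m}. \<pi> i p = y i)"
    and orbits: "\<forall>p\<in>M0. \<forall>q\<in>M0. (\<exists>t. q = \<rho> t p) \<longleftrightarrow> x p = x q \<and> (\<forall>i\<in>{1..m}. \<pi> i p = \<pi> i q)"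
    and h1: "\<exists>S. open S \<and> {0..1} \<subseteq> S \<and> smooth_on UNIV S h"
    and h2: "\<forall>s\<in>{0<..<1}. h s > 0" and h3: "h 0 = 0" and h4: "h 1 = 0" and h5: "deriv h 0 = 2" and h6: "deriv h 1 = -2"
    and a_param: "a \<in> parameters m b"
    and J_cond: "\<forall>c\<in>charts M. \<forall>p \<in> fst c \<inter> M0. \<forall>v\<in>model M.
         (dfun c x p v = 1 \<and> \<theta> c p v = 0 \<and> (\<forall>i\<in>{1..m}. dmap c (chart_at (N i) (\<pi> i p)) (\<pi> i) p v = 0) \<longrightarrow>
            \<i> *s v = (1 / h (x p)) *\<^sub>R generator \<rho> c p) \<and>
         (dfun c x p v = 0 \<and> \<theta> c p v = 0 \<longrightarrow>
            dfun c x p (\<i> *s v) = 0 \<and> \<theta> c p (\<i> *s v) = 0 \<and>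
            (\<forall>i\<in>{1..m}. dmap c (chart_at (N i) (\<pi> i p)) (\<pi> i) p (\<i> *s v) = \<i> *s dmap c (chart_at (N i) (\<pi> i p)) (\<pi> i) p v))"
    and g_eq': "\<forall>c\<in>charts M. \<forall>p \<in> fst c \<inter> M0. \<forall>v\<in>model M. \<forall>w\<in>model M.
         g c p v w =
           1 / h (x p) * dfun c x p v * dfun c x p w
           + h (x p) * \<theta> c p v * \<theta> c p w
           + (\<Sum>i=1..m. fibre_scale b a i (x p) * pullback (N i) (\<pi> i) (gN i) c p v w)"
  by (insert ftmet[unfolded fiberwise_toric_metric_def Let_def, folded M0_def], elim conjE, assumption)+

lemma h_profile: "profile h"
  unfolding profile_def using h1 h2 h3 h4 h5 h6 by blast

abbreviation "A i s \<equiv> fibre_scale b a i s"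

lemma b1_pos: "b 1 > 0"
  unfolding b1 by simp

lemma A_pos: 
  assumes i: "i \<in> {1..m}" and s: "s \<in> {0<..<1}"
  shows "A i s > 0"
proof (cases "i = 1")
  case True
  then show ?thesis using b1_pos s by (simp add: fibre_scale_def)
next
  case False
  then have "i \<in> {2..m}" using i by auto
  moreover have "s \<in> {0..1}" using s by auto
  ultimately show ?thesis using a_param unfolding parameters_def by blast
qed

context
  fixes c assumes c: "c \<in> charts M"
begin

definition "X u = x (cinv c u)"

lemma X_smooth: "smooth_on UNIV (img c) X"
proof -
  have "smooth_on (model M) (snd c ` (fst c \<inter> pts M)) (x \<circ> cinv c)"
    using x_smooth c unfolding smooth_fun_def by blast
  moreover have "fst c \<inter> pts M = fst c" using chart_sub[OF c] by auto
  ultimately show ?thesis by (simp add: X_def[abs_def] o_def)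
qed

lemma dX_eq: "u \<in> img c \<Longrightarrow> dfun c x (cinv c u) v = dird X u v"
  by (simp add: dfun_def X_def[abs_def] o_def snd_cinv)

lemma K: "kahler_chart UNIV (img c) (loc c g)"
  using kahler_chart[OF g_kahler c] by simp

context
  fixes u assumes u: "u \<in> U0 c"
begin

lemma u_facts: "u \<in> img c" "cinv c u \<in> M0" "cinv c u \<in> fst c \<inter> M0" "snd c (cinv c u) = u"
  using u cinv_in[of u c] snd_cinv[of u c] by (auto simp: U0_iff[OF c])

lemma X_in: "X u \<in> {0<..<1}"
  using x_M0' u_facts(2) by (simp add: X_def)

lemma h_pos: "h (X u) > 0"
  using h2 X_in by blast

lemma G_eq: "loc c g u v w = 1 / h (X u) * dird X u v * dird X u w + h (X u) * loc c \<theta> u v * loc c \<theta> u w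
    + (\<Sum>i=1..m. A i (X u) * pb c i u v w)"
  using g_eq'[THEN bspec, OF c, THEN bspec, OF u_facts(3), THEN bspec, THEN bspec, of v w] dX_eq[OF u_facts(1)]
  by (simp add: loc_def X_def pb_def[OF c])

lemma dX_lin: "linear_on UNIV (dird X u)"
  by (rule smooth_on_linear_dird[OF coord_subspace_UNIV kahler_chart.openS[OF K, simplified] X_smooth u_facts(1)])

lemma dX_xi: "dird X u (xi c u) = 0"
proof (rule dird_invariant[OF c img_open'[OF c] X_smooth u_facts(1) u_facts(1)])
  fix t assume t: "(t, u) \<in> flow_dom c"
  have "\<rho> t (cinv c u) \<in> M0" by (rule action_M0[OF c u_facts(2)])
  then have "x (cinv c u) = x (\<rho> t (cinv c u))" using orbits u_facts(2) by blast
  then show "X (flow c (t, u)) = X u" by (simp add: X_def flow_in(2)[OF c t])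
qed

text \<open>The generator is killed by \<open>dX\<close> and by all differentials of the
  projections, so only the \<theta> term remains. The left side makes sense on the special orbits
  too and stands in for \<open>h \<theta>\<close> there.\<close>

lemma G_xi: "loc c g u (xi c u) v = h (X u) * loc c \<theta> u v"
  by (simp add: G_eq dX_xi \<Theta>_xi[OF c u] pb_zero[OF c _ u] dpi_xi[OF c _ u])

lemma G_xi2: "loc c g u v (xi c u) = h (X u) * loc c \<theta> u v"
  using G_xi[of v] kahler_chart.sym[OF K u_facts(1), of v "xi c u"] by simp

text \<open>\<open>J\<close> is an isometry with square -1, so \<open>J \<xi>\<close> is orthogonal
  to \<xi>, and pairing with \<xi> is \<open>h \<theta>\<close>.\<close>

lemma \<Theta>_Jxi: "loc c \<theta> u (J (xi c u)) = 0"
proof -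
  have "loc c g u (J (xi c u)) (xi c u) = - loc c g u (xi c u) (J (xi c u))"
    using kahler_chart.GJ1[OF K u_facts(1), of "xi c u" "xi c u"] by simp
  then show ?thesis using G_xi[of "J (xi c u)"] G_xi2[of "J (xi c u)"] h_pos by simp
qed

lemma dpi_Jxi: "i \<in> {1..m} \<Longrightarrow> dpi c i u (J (xi c u)) = 0"
  by (simp add: dpi_J[OF c _ u] dpi_xi[OF c _ u])

text \<open>The length of \<open>J \<xi>\<close> fixes \<open>dx(J \<xi>)\<close> up to sign, and the condition on \<open>J\<close> fixes the sign.\<close>

lemma dX_Jxi: "dird X u (J (xi c u)) = - h (X u)"
proof -
  define l where "l = dird X u (J (xi c u))"
  have "loc c g u (J (xi c u)) (J (xi c u)) = h (X u)"
    using kahler_chart.GJ[OF K u_facts(1), of "xi c u" "xi c u"] G_xi[of "xi c u"] \<Theta>_xi[OF c u] by simp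
  then have "l * l = h (X u) * h (X u)"
    using h_pos by (simp add: G_eq \<Theta>_Jxi pb_zero[OF c _ u] dpi_Jxi l_def field_simps)
  then have l: "l \<noteq> 0" using h_pos by auto
  define v where "v = (1 / l) *\<^sub>R J (xi c u)"
  have 1: "dird X u v = 1"
    using l linear_on_scale[OF subspace_UNIV dX_lin] by (simp add: v_def l_def[symmetric])
  have 2: "loc c \<theta> u v = 0"
    using linear_on_scale[OF subspace_UNIV \<Theta>_lin[OF c u]] by (simp add: v_def \<Theta>_Jxi)
  have 3: "dpi c i u v = 0" if "i \<in> {1..m}" for i
    using linear_on_scale[OF subspace_UNIV dpi_lin[OF c that u]] that by (simp add: v_def dpi_Jxi)
  have "J v = (1 / h (X u)) *\<^sub>R xi c u"
    using J_cond[THEN bspec, OF c, THEN bspec, OF u_facts(3), THEN bspec, of v] 1 2 3 dX_eq[OF u_facts(1), of v]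
    by (simp add: loc_def X_def dpi_def[OF c] xi_def[OF c])
  then have "- (1 / l) *\<^sub>R xi c u = (1 / h (X u)) *\<^sub>R xi c u" by (simp add: v_def J_scaleR)
  then have "loc c \<theta> u (- (1 / l) *\<^sub>R xi c u) = loc c \<theta> u ((1 / h (X u)) *\<^sub>R xi c u)" by simp
  then have "- (1 / l) = 1 / h (X u)"
    using linear_on_scale[OF subspace_UNIV \<Theta>_lin[OF c u]] \<Theta>_xi[OF c u]
    by (metis UNIV_I mult.right_neutral real_scaleR_def)
  then have "l = - h (X u)" using l h_pos by (simp add: field_simps)
  then show ?thesis by (simp add: l_def)
qed

lemma G_Jxi: "loc c g u (J (xi c u)) v = - dird X u v"
  using h_pos by (simp add: G_eq \<Theta>_Jxi pb_zero[OF c _ u] dpi_Jxi dX_Jxi)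

text \<open>Pairing with \<open>J \<xi>\<close> is \<open>- dX\<close>, pairing with \<xi> is
  \<open>h \<theta>\<close>, and \<open>J\<close> is skew for the metric.\<close>

lemma dX_J: "dird X u v = h (X u) * loc c \<theta> u (J v)"
  using G_Jxi[of v] kahler_chart.GJ1[OF K u_facts(1), of "xi c u" v] G_xi[of "J v"] by simp

end

lemma img_rel: "rel_open UNIV (img c)"
  using kahler_chart.openS[OF K] by simp

text \<open>Both sides are continuous on the whole chart, and on the principal orbits the identity
  is \<open>G_Jxi\<close>.\<close>

lemma grad_X:
  assumes u: "u \<in> img c"
  shows "dird X u v = - loc c g u (J (xi c u)) v"
proof (rule dense_eq[OF c _ _ _ u])
  show "continuous_on (img c) (\<lambda>u. dird X u v)"
    by (rule smooth_on_continuous[OF smooth_on_dird[OF X_smooth]]) simp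
  have "smooth_on UNIV (img c) (\<lambda>u. loc c g u (J (xi c u)) v)"
    by (rule smooth_on_apply2[OF coord_subspace_UNIV img_rel kahler_chart.bil[OF K, simplified] kahler_chart.smooth[OF K, simplified] _
          smooth_on_bounded_linear[OF img_rel bounded_linear_J xi_smooth[OF c]] _ smooth_on_const[OF img_rel]]) auto
  then show "continuous_on (img c) (\<lambda>u. - loc c g u (J (xi c u)) v)"
    by (intro continuous_intros smooth_on_continuous)
qed (simp add: G_Jxi)

end

end

section \<open>Affine scalar curvature gives an extremal metric\<close>

context toric_metric
begin

text \<open>The value from \<open>scalar_curvature_calabi\<close>, as a function of the orbit
  parameter alone.\<close>

definition "scal s = - deriv (\<lambda>s. deriv h s + h s * (\<Sum>i=1..m. real (card (coords (N i))) * b i / A i s)) s +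
   (\<Sum>i=1..m. (1 - b i * (deriv h s + h s * (\<Sum>i=1..m. real (card (coords (N i))) * b i / A i s)) / 2) *
      (2 * real (card (coords (N i)))) / A i s)"

context
  fixes c assumes c: "c \<in> charts M"
begin

lemma scalar_curvature_U0:
  assumes u0: "u0 \<in> U0 c"
  shows "scalar_curvature UNIV (loc c g) u0 = scal (X c u0)"
proof -
  define C where "C i = chart_at (N i) (\<pi> i (cinv c u0))" for i
  \<comment> \<open>The domain is shrunk until each projection stays in one chart of its factor, as
    \<open>calabi_chart\<close> requires.\<close>
  define D where "D = U0 c \<inter> (\<Inter>i\<in>{1..m}. pdom c i (C i))"
  have C: "C i \<in> charts (N i)" "u0 \<in> pdom c i (C i)" if "i \<in> {1..m}" for i
  proof -
    have "\<pi> i (cinv c u0) \<in> pts (N i)" by (rule holo.f_in[OF holo_M0[OF that] u_facts(2)[OF c u0]])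
    then have *: "C i \<in> charts (N i) \<and> \<pi> i (cinv c u0) \<in> fst (C i)"
      unfolding C_def by (rule cman.chart_at[OF N_cman[OF that]])
    have "u0 \<in> snd c ` (fst c \<inter> (M0 \<inter> \<pi> i -` fst (C i)))"
      unfolding image_iff_cinv[OF c] using * u_facts[OF c u0] by auto
    then show "C i \<in> charts (N i)" "u0 \<in> pdom c i (C i)" using * by (simp_all add: pdom_def[OF c] Int_assoc)
  qed
  have op: "open D" unfolding D_def using U0_open[OF c] pdom_open[OF c _ C(1)] by (intro open_Int open_INT) auto
  have sub: "D \<subseteq> U0 c" "D \<subseteq> img c" using U0_sub[OF c] by (auto simp: D_def)
  have subi: "u \<in> pdom c i (C i)" if "i \<in> {1..m}" "u \<in> D" for i u using that by (auto simp: D_def)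
  have A: "A i s = b i * s + (if i = 1 then 0 else a i)" for i s by (simp add: fibre_scale_def)
  have zeq: "pb c i u v w = loc (C i) (gN i) (zc c i (C i) u) (dird (zc c i (C i)) u v) (dird (zc c i (C i)) u w)"
    if "i \<in> {1..m}" "u \<in> D" for i u v w by (rule pb_zc[OF c that(1) C(1)[OF that(1)] subi[OF that]])
  have zJ: "dird (zc c i (C i)) u (J v) = J (dird (zc c i (C i)) u v)" if "i \<in> {1..m}" "u \<in> D" for i u v
    by (rule zc_J[OF c that(1) C(1)[OF that(1)] subi[OF that]])
  obtain S where S: "{0..1} \<subseteq> S" "smooth_on UNIV S h" using h1 by blast
  have KD: "kahler_chart UNIV D (loc c g)"
    by (rule kahler_chart_subset[OF K[OF c] _ sub(2)]) (use op in \<open>simp add: rel_open_UNIV\<close>)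
  interpret calabi_point D "loc c g" "{1..m}" "\<lambda>i. coords (N i)" "\<lambda>i. img (C i)" "\<lambda>i. loc (C i) (gN i)"
    "\<lambda>i. zc c i (C i)" b "\<lambda>i. if i = 1 then 0 else a i" "{0<..<1}" h "X c" "loc c \<theta>" "xi c" u0
  proof (intro calabi_point.intro calabi_chart.intro calabi_chart_axioms.intro calabi_point_axioms.intro KD)
    show "kahler_chart (coords (N i)) (img (C i)) (loc (C i) (gN i))" if "i \<in> {1..m}" for i
      by (rule cman.kahler_chart[OF N_cman[OF that] N_kahler[OF that] C(1)[OF that]])
    show "ricci (cspace (coords (N i))) (loc (C i) (gN i)) y v w = loc (C i) (gN i) y v w"
      if "i \<in> {1..m}" "y \<in> img (C i)" "v \<in> model (N i)" "w \<in> model (N i)" for i y v w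
      using N_einstein[OF that(1)] C(1)[OF that(1)] that(2-) unfolding einstein_metric_def mult_1 by blast
    show "smooth_on UNIV D (zc c i (C i))" if "i \<in> {1..m}" for i
      by (rule smooth_on_subset[OF zc_smooth[OF c that C(1)[OF that]]]) (use subi[OF that] in blast)
    show "zc c i (C i) u \<in> img (C i)" if "i \<in> {1..m}" "u \<in> D" for i u
      by (rule zc_in[OF c that(1) C(1)[OF that(1)] subi[OF that]])
    show "dird (zc c i (C i)) u (xi c u) = 0" if "i \<in> {1..m}" "u \<in> D" for i u
      by (rule zc_xi[OF c that(1) C(1)[OF that(1)] subi[OF that]])
    show "smooth_on UNIV D (X c)" by (rule smooth_on_subset[OF X_smooth[OF c] sub(2)])
    show "X c u \<in> {0<..<1}" if "u \<in> D" for u using X_in[OF c] that sub by blast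
    show "smooth_on UNIV {0<..<1} h" by (rule smooth_on_subset[OF S(2)]) (use S(1) in force)
    show "h s > 0" if "s \<in> {0<..<1}" for s using h2 that by blast
    show "b i * s + (if i = 1 then 0 else a i) > 0" if "i \<in> {1..m}" "s \<in> {0<..<1}" for i s
      using A_pos[OF that] unfolding A .
    show "linear_on UNIV (loc c \<theta> u)" if "u \<in> D" for u using \<Theta>_lin[OF c] that sub by blast
    show "smooth_on UNIV D (\<lambda>u. loc c \<theta> u v)" for v by (rule smooth_on_subset[OF \<Theta>_smooth[OF c] sub(1)])
    show "smooth_on UNIV D (xi c)" by (rule smooth_on_subset[OF xi_smooth[OF c] sub(2)])
    show "dird (xi c) u (J v) = J (dird (xi c) u v)" if "u \<in> D" for u v using xi_J[OF c] that sub by blast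
    show "loc c \<theta> u (xi c u) = 1" if "u \<in> D" for u using \<Theta>_xi[OF c] that sub by blast
    show "loc c \<theta> u (J (xi c u)) = 0" if "u \<in> D" for u using \<Theta>_Jxi[OF c] that sub by blast
    show "dird (X c) u v = h (X c u) * loc c \<theta> u (J v)" if "u \<in> D" for u v using dX_J[OF c] that sub by blast
    show "ext_deriv1 (loc c \<theta>) u v w = (\<Sum>i=1..m. b i * loc (C i) (gN i) (zc c i (C i) u) (J (dird (zc c i (C i)) u v)) (dird (zc c i (C i)) u w))"
      if "u \<in> D" for u v w
      using d\<Theta>[OF c, of u v w] that sub by (auto simp: zeq zJ intro!: sum.cong)
    show "loc c g u v w = 1 / h (X c u) * dird (X c) u v * dird (X c) u w + h (X c u) * loc c \<theta> u v * loc c \<theta> u w +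
       (\<Sum>i=1..m. (b i * X c u + (if i = 1 then 0 else a i)) * loc (C i) (gN i) (zc c i (C i) u) (dird (zc c i (C i)) u v) (dird (zc c i (C i)) u w))"
      if "u \<in> D" for u v w
      using G_eq[OF c, of u v w] that sub by (auto simp: zeq A intro!: sum.cong)
    have "CARD('n) * 2 = (1 + (\<Sum>i=1..m. card (coords (N i)))) * 2"
      using dimM by (simp add: sum_distrib_left mult.commute)
    then show "CARD('n) = 1 + (\<Sum>i=1..m. card (coords (N i)))"
      by (rule mult_right_cancel[THEN iffD1, rotated]) simp
    show "u0 \<in> D" using u0 C(2) by (auto simp: D_def)
    show "dird (zc c i (C i)) u (J v) = J (dird (zc c i (C i)) u v)" if "i \<in> {1..m}" "u \<in> D" for i u v by (rule zJ[OF that])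
  qed auto
  have "psi = (\<lambda>s. deriv h s + h s * (\<Sum>i=1..m. real (card (coords (N i))) * b i / A i s))"
    unfolding fun_eq_iff psi_def A by (rule allI) (rule refl)
  then show ?thesis
    using scalar_curvature_calabi unfolding scal_def A[symmetric] by simp
qed

lemma holo_gradient:
  assumes ode: "\<And>s. s \<in> {0<..<1} \<Longrightarrow> scal s = \<alpha> * s + \<beta>"
  shows "holo_on J UNIV (img c) (gradient UNIV (loc c g) (scalar_curvature UNIV (loc c g)))"
proof -
  interpret k: kahler_chart UNIV "img c" "loc c g" by (rule K[OF c])
  note r = img_rel[OF c]
  have sm: "smooth_on UNIV (img c) (scalar_curvature UNIV (loc c g))" using k.scalar_curvature_smooth by simp
  have lin: "smooth_on UNIV (img c) (\<lambda>u. \<alpha> * X c u + \<beta>)"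
    by (intro smooth_on_add[OF r] smooth_on_mult[OF r] smooth_on_const[OF r] X_smooth[OF c])
  \<comment> \<open>The formula is known on the principal orbits only; since both sides are smooth
    on the chart, it extends to the special orbits.\<close>
  have S: "scalar_curvature UNIV (loc c g) u = \<alpha> * X c u + \<beta>" if "u \<in> img c" for u
    by (rule dense_eq[OF c smooth_on_continuous[OF sm] smooth_on_continuous[OF lin] _ that])
      (use scalar_curvature_U0 X_in[OF c] ode in auto)
  define f where "f u = - \<alpha> *\<^sub>R J (xi c u)" for u
  have grad: "gradient UNIV (loc c g) (scalar_curvature UNIV (loc c g)) u = f u" if u: "u \<in> img c" for u
    unfolding gradient_def
  proof (rule sharp_unique[OF coord_subspace_UNIV k.bil[OF u, simplified] k.pos[OF u, simplified]])
    fix y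
    have "dird (scalar_curvature UNIV (loc c g)) u y = dird (\<lambda>u. \<alpha> * X c u + \<beta>) u y"
      by (rule dird_cong[OF r u]) (use S in auto)
    also have "\<dots> = \<alpha> * dird (X c) u y"
      using smooth_on_has_dird[OF X_smooth[OF c] u, of y]
      by (intro has_dird_dird) (auto simp: has_dird_def intro!: derivative_eq_intros)
    also have "\<dots> = loc c g u (f u) y"
      using grad_X[OF c u, of y] k.G_scale1[OF u, of "J (xi c u)" y "- \<alpha>"] by (simp add: f_def)
    finally show "loc c g u (f u) y = dird (scalar_curvature UNIV (loc c g)) u y" by simp
  qed auto
  have fs: "smooth_on UNIV (img c) f"
    unfolding f_def by (intro smooth_on_scaleR[OF r] smooth_on_const[OF r] smooth_on_bounded_linear[OF r bounded_linear_J xi_smooth[OF c]])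
  have df: "dird f u w = - \<alpha> *\<^sub>R J (dird (xi c) u w)" if u: "u \<in> img c" for u w
    unfolding f_def
    by (intro has_dird_dird has_dird_bounded_linear[OF bounded_linear_scaleR_right] has_dird_bounded_linear[OF bounded_linear_J]
        smooth_on_has_dird[OF xi_smooth[OF c] u]) auto
  show ?thesis
    unfolding holo_on_def
  proof (intro conjI ballI)
    show "smooth_on UNIV (img c) (gradient UNIV (loc c g) (scalar_curvature UNIV (loc c g)))"
      using smooth_on_cong[OF r grad] fs by simp
    fix u v assume u: "u \<in> img c"
    have "dird (gradient UNIV (loc c g) (scalar_curvature UNIV (loc c g))) u w = dird f u w" for w
      by (rule dird_cong[OF r u]) (use grad in auto)
    then show "dird (gradient UNIV (loc c g) (scalar_curvature UNIV (loc c g))) u (J v) =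
        J (dird (gradient UNIV (loc c g) (scalar_curvature UNIV (loc c g))) u v)"
      by (simp only: df[OF u] xi_J[OF c u] J_scaleR)
  qed
qed

end

lemma extremal:
  assumes "\<And>s. s \<in> {0<..<1} \<Longrightarrow> scal s = \<alpha> * s + \<beta>"
  shows "extremal_kahler_metric M g"
  unfolding extremal_kahler_metric_def coordsM cspace_UNIV
  by (intro conjI ballI g_kahler holo_gradient[OF _ assms])

end

section \<open>Changing the profile and the parameters\<close>

lemma ext_deriv2_cong:
  assumes "rel_open V S" "u \<in> S" "v \<in> V" "w \<in> V" "z \<in> V" "\<And>x y y'. x \<in> S \<Longrightarrow> \<alpha> x y y' = \<beta> x y y'"
  shows "ext_deriv2 \<alpha> u v w z = ext_deriv2 \<beta> u v w z"
proof -
  have "dird (\<lambda>x. \<alpha> x y y') u t = dird (\<lambda>x. \<beta> x y y') u t" if "t \<in> V" for t y y'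
    by (rule dird_cong[OF assms(1,2) that assms(6)])
  then show ?thesis using assms(3-5) by (simp add: ext_deriv2_def)
qed

lemma ext_deriv2_combination:
  assumes "\<And>y z. smooth_on V S (\<lambda>x. \<alpha> x y z)" "\<And>y z. smooth_on V S (\<lambda>x. \<beta> x y z)" "\<And>i y z. i \<in> I \<Longrightarrow> smooth_on V S (\<lambda>x. \<gamma> i x y z)"
    and u: "u \<in> S" and vs: "v \<in> V" "w \<in> V" "z \<in> V"
  shows "ext_deriv2 (\<lambda>x y z. \<alpha> x y z + \<beta> x y z + (\<Sum>i\<in>I. k i * \<gamma> i x y z)) u v w z =
    ext_deriv2 \<alpha> u v w z + ext_deriv2 \<beta> u v w z + (\<Sum>i\<in>I. k i * ext_deriv2 (\<gamma> i) u v w z)"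
proof -
  have "dird (\<lambda>x. \<alpha> x y z + \<beta> x y z + (\<Sum>i\<in>I. k i * \<gamma> i x y z)) u t =
    dird (\<lambda>x. \<alpha> x y z) u t + dird (\<lambda>x. \<beta> x y z) u t + (\<Sum>i\<in>I. k i * dird (\<lambda>x. \<gamma> i x y z) u t)"
    if "t \<in> V" for t y z
    by (intro has_dird_dird has_dird_add has_dird_sum has_dird_bounded_linear[OF bounded_linear_mult_right]
        smooth_on_has_dird[OF assms(1) u] smooth_on_has_dird[OF assms(2) u] smooth_on_has_dird[OF assms(3) u] that)
  then show ?thesis
    using vs by (simp add: ext_deriv2_def distrib_left sum.distrib)
qed

lemma continuous_pos_bound:
  fixes f :: "real \<Rightarrow> real"
  assumes "continuous_on {0..1} f" "\<And>s. s \<in> {0..1} \<Longrightarrow> f s > 0"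
  obtains k where "k > 0" "\<And>s. s \<in> {0..1} \<Longrightarrow> k \<le> f s"
proof -
  obtain t where "t \<in> {0..1}" "\<forall>s\<in>{0..1}. f t \<le> f s"
    using continuous_attains_inf[OF _ _ assms(1)] by auto
  then show thesis using assms(2) by (intro that[of "f t"]) auto
qed

lemma finite_uniform_pos:
  fixes P :: "'i \<Rightarrow> real \<Rightarrow> bool"
  assumes "finite I" "\<And>i. i \<in> I \<Longrightarrow> \<exists>k>0. P i k" "\<And>i k l. i \<in> I \<Longrightarrow> P i k \<Longrightarrow> 0 < l \<Longrightarrow> l \<le> k \<Longrightarrow> P i l"
  shows "\<exists>k>0. \<forall>i\<in>I. P i k"
  using assms
proof (induction I rule: finite_induct)
  case empty
  show ?case by (intro exI[of _ 1]) simp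
next
  case (insert i I)
  have "\<exists>k>0. \<forall>i\<in>I. P i k" by (rule insert.IH[OF insert.prems(1) insert.prems(2)]) auto
  then obtain k where k: "k > 0" "\<forall>i\<in>I. P i k" by auto
  obtain l where l: "l > 0" "P i l" using insert.prems(1)[of i] by auto
  have "P j (min k l)" if "j \<in> insert i I" for j
  proof (cases "j = i")
    case True
    show ?thesis by (rule insert.prems(2)[of j l]) (use True k l in auto)
  next
    case False
    show ?thesis by (rule insert.prems(2)[of j k]) (use False that k l in auto)
  qed
  then show ?case using k l by (intro exI[of _ "min k l"]) auto
qed

lemma (in holo) dmap_source:
  assumes c: "c \<in> charts M" and d: "d \<in> charts M" and e: "e \<in> charts N"
    and p: "p \<in> fst c" "p \<in> fst d" "p \<in> W" "f p \<in> fst e" and v: "v \<in> model M"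
  shows "dmap c e f p v = dmap d e f p (dmap c d id p v)"
proof -
  define D where "D = snd c ` (fst c \<inter> (fst d \<inter> (W \<inter> f -` fst e)))"
  have D: "rel_open (model M) D"
    unfolding D_def by (intro M.open_image[OF c] openin_Int M.chart_openin[OF d] open_preimage N.chart_openin e)
  define u where "u = snd c p"
  have u: "u \<in> D" using p by (auto simp: u_def D_def)
  have DD: "x \<in> snd c ` (fst c \<inter> fst d)" "(snd d \<circ> cinv c) x \<in> hdom d e"
    "(snd e \<circ> f \<circ> cinv d) ((snd d \<circ> cinv c) x) = (snd e \<circ> f \<circ> cinv c) x" if "x \<in> D" for x
    using that M.cinv_snd[OF c] M.cinv_snd[OF d] unfolding D_def hdom_def by auto
  have tr: "smooth_on (model M) (snd c ` (fst c \<inter> fst d)) (snd d \<circ> cinv c)"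
    using M.transition[OF c d] by (simp add: holo_on_def)
  have trD: "smooth_on (model M) D (snd d \<circ> cinv c)"
    by (rule smooth_on_subset[OF tr]) (use DD(1) in blast)
  have h: "has_dird (\<lambda>x. (snd e \<circ> f \<circ> cinv d) ((snd d \<circ> cinv c) x)) u v
     (dird (snd e \<circ> f \<circ> cinv d) ((snd d \<circ> cinv c) u) (dird (snd d \<circ> cinv c) u v))"
  proof (rule has_dird_compose[OF coord_subspace_cspace hdom_open[OF d e] z_smooth[OF d e] D])
    show "has_dird (snd d \<circ> cinv c) u v (dird (snd d \<circ> cinv c) u v)"
      by (rule smooth_on_has_dird[OF trD u v])
    show "dird (snd d \<circ> cinv c) u v \<in> model M"
      by (rule dird_pullback_in[OF D coord_subspace_cspace coord_subspace_cspace hdom_open[OF d e] trD DD(2) u v])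
  qed (use DD u v in auto)
  have "has_dird (snd e \<circ> f \<circ> cinv c) u v
     (dird (snd e \<circ> f \<circ> cinv d) ((snd d \<circ> cinv c) u) (dird (snd d \<circ> cinv c) u v))"
    by (rule has_dird_cong_imp[OF D u v DD(3) h])
  then have "dird (snd e \<circ> f \<circ> cinv c) u v = dird (snd e \<circ> f \<circ> cinv d) ((snd d \<circ> cinv c) u) (dird (snd d \<circ> cinv c) u v)"
    by (rule has_dird_dird)
  then show ?thesis
    using M.cinv_snd[OF c p(1)] by (simp add: dmap_def u_def)
qed

context toric_manifold
begin

lemma pullback_transform:
  assumes i: "i \<in> {1..m}" and c: "c \<in> charts M" and d: "d \<in> charts M" and p: "p \<in> fst c" "p \<in> fst d" "p \<in> M0"
  shows "pullback (N i) (\<pi> i) (gN i) c p v w = pullback (N i) (\<pi> i) (gN i) d p (dmap c d id p v) (dmap c d id p w)"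
proof -
  interpret holo M "N i" M0 "\<pi> i" by (rule holo_M0[OF i])
  have "dmap c (chart_at (N i) (\<pi> i p)) (\<pi> i) p v = dmap d (chart_at (N i) (\<pi> i p)) (\<pi> i) p (dmap c d id p v)" for v
    using N.chart_at[OF f_in[OF p(3)]] by (intro dmap_source[OF c d _ p]) auto
  then show ?thesis by (simp add: pullback_def Let_def)
qed

context
  fixes c i assumes c: "c \<in> charts M" and i: "i \<in> {2..m}"
begin

text \<open>For \<open>i \<ge> 2\<close> the projection is defined on all of \<open>M\<close>, so
  the pullback is smooth across the special orbits too. Smoothness is local, and locally the
  pullback runs between fixed charts.\<close>

lemma pb_smooth: "smooth_on UNIV (img c) (\<lambda>u. pb c i u v w)"
proof (rule smooth_on_locally)
  interpret holo M "N i" "pts M" "\<pi> i" by (rule holo_M[OF i])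
  have i': "i \<in> {1..m}" using i by auto
  have gN: "riemannian_metric (N i) (gN i)" using N_kahler[OF i'] by (simp add: kahler_metric_def)
  show "rel_open UNIV (img c)" using img_open'[OF c] by (simp add: rel_open_UNIV)
  fix u assume u: "u \<in> img c"
  define e where "e = chart_at (N i) (\<pi> i (cinv c u))"
  have e: "e \<in> charts (N i)" "u \<in> hdom c e"
    using N.chart_at[OF f_in[OF cinv_pts[OF c u]]] u cinv_pts[OF c u] hdom_iff[OF c, of e] by (auto simp: e_def)
  interpret k: kahler_chart "coords (N i)" "img e" "loc e (gN i)" by (rule N.kahler_chart[OF N_kahler[OF i'] e(1)])
  have r: "rel_open UNIV (hdom c e)" using hdom_open[OF c e(1)] by simp
  have "smooth_on UNIV (hdom c e) (\<lambda>u. loc e (gN i) ((snd e \<circ> \<pi> i \<circ> cinv c) u)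
      (dird (snd e \<circ> \<pi> i \<circ> cinv c) u v) (dird (snd e \<circ> \<pi> i \<circ> cinv c) u w))"
    by (rule smooth_on_pullback2[OF r coord_subspace_UNIV coord_subspace_cspace k.openS z_smooth[OF c e(1), simplified]
          z_in[OF c e(1)] k.bil k.smooth]) auto
  then have "smooth_on UNIV (hdom c e) (\<lambda>u. pb c i u v w)"
    unfolding pb_def[OF c]
    using smooth_on_cong[OF r pullback_eq[where g="gN i" and v=v and w=w, OF riemannian_transform[OF gN] c e(1)]] by simp
  then show "\<exists>T. u \<in> T \<and> T \<subseteq> img c \<and> rel_open UNIV T \<and> smooth_on UNIV T (\<lambda>u. pb c i u v w)"
    using e(2) r hdom_iff[OF c e(1)] by (intro exI[of _ "hdom c e"]) auto
qed

text \<open>Closedness is \<open>pb_kahler\<close> on the principal orbits; the exterior derivative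
  is continuous on the whole chart.\<close>

lemma pb_closed:
  assumes u: "u \<in> img c"
  shows "ext_deriv2 (\<lambda>u v w. pb c i u (J v) w) u v w y = 0"
proof (rule dense_eq[OF c _ continuous_on_const _ u, where \<phi>="\<lambda>u. ext_deriv2 (\<lambda>u v w. pb c i u (J v) w) u v w y"])
  show "continuous_on (img c) (\<lambda>u. ext_deriv2 (\<lambda>u v w. pb c i u (J v) w) u v w y)"
    unfolding ext_deriv2_def
    by (intro continuous_on_add smooth_on_continuous[OF smooth_on_dird[OF pb_smooth]] UNIV_I)
  fix u assume u: "u \<in> U0 c"
  have i': "i \<in> {1..m}" using i by auto
  have p: "u \<in> img c" "cinv c u \<in> M0" using u by (auto simp: U0_iff[OF c])
  have "\<pi> i (cinv c u) \<in> pts (N i)" by (rule holo.f_in[OF holo_M0[OF i'] p(2)])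
  then have *: "chart_at (N i) (\<pi> i (cinv c u)) \<in> charts (N i)" "\<pi> i (cinv c u) \<in> fst (chart_at (N i) (\<pi> i (cinv c u)))"
    using cman.chart_at[OF N_cman[OF i']] by auto
  have "u \<in> snd c ` (fst c \<inter> (M0 \<inter> \<pi> i -` fst (chart_at (N i) (\<pi> i (cinv c u)))))"
    unfolding image_iff_cinv[OF c] using * p by auto
  then have "u \<in> pdom c i (chart_at (N i) (\<pi> i (cinv c u)))" by (simp add: pdom_def[OF c] Int_assoc)
  then show "ext_deriv2 (\<lambda>u v w. pb c i u (J v) w) u v w y = 0" by (rule pb_kahler[OF c i' *(1)])
qed

end

end

section \<open>The deformed metric\<close>

locale toric_change = toric_metric m N gN b M E0 E1 \<rho> \<pi> \<theta> x h a g
  for m and N :: "nat \<Rightarrow> ('q, 'n::finite) cmanifold" and gN b and M :: "('p, 'n) cmanifold" and E0 E1 \<rho> \<pi> \<theta> x h a g +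
  fixes h' :: "real \<Rightarrow> real" and a' :: "nat \<Rightarrow> real" and S :: "real set" and F q :: "real \<Rightarrow> real"
  assumes h': "profile h'" and a': "a' \<in> parameters m b" and S: "open S" "{0..1} \<subseteq> S"
    and F_smooth: "smooth_on UNIV S F" and q_smooth: "smooth_on UNIV S q" and F0: "F 0 = 0" and F1: "F 1 = 1"
    and F_deriv: "\<And>s. s \<in> {0..1} \<Longrightarrow> deriv F s > 0" and F_h: "\<And>s. s \<in> {0..1} \<Longrightarrow> deriv F s * h s = h' (F s)"
    and q_h: "\<And>s. s \<in> {0..1} \<Longrightarrow> q s * h s = F s - s"
begin

lemma F_has: "s \<in> {0..1} \<Longrightarrow> (F has_real_derivative deriv F s) (at s)"
  by (rule smooth_on_real_derivative(1)[OF S(1) F_smooth]) (use S(2) in auto)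

lemma F_cont: "continuous_on {0..1} F"
  by (rule continuous_on_subset[OF smooth_on_continuous[OF F_smooth] S(2)])

lemma F_mono: 
  assumes "0 \<le> s" "s < t" "t \<le> 1"
  shows "F s < F t"
proof (rule DERIV_pos_imp_increasing[OF assms(2)])
  show "\<exists>y. (F has_real_derivative y) (at r) \<and> 0 < y" if "s \<le> r" "r \<le> t" for r
    using F_has[of r] F_deriv[of r] assms that by (intro exI[of _ "deriv F r"]) auto
qed

lemma F_in: "s \<in> {0<..<1} \<Longrightarrow> F s \<in> {0<..<1}"
  using F_mono[of 0 s] F_mono[of s 1] F0 F1 by auto

lemma F_in': "s \<in> {0..1} \<Longrightarrow> F s \<in> {0..1}"
  using F_in[of s] F0 F1 by (cases "s = 0 \<or> s = 1") auto

lemma F_inj: "s \<in> {0<..<1} \<Longrightarrow> t \<in> {0<..<1} \<Longrightarrow> F s = F t \<Longrightarrow> s = t"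
  using F_mono[of s t] F_mono[of t s] by (cases s t rule: linorder_cases) auto

lemma F_surj: 
  assumes t: "t \<in> {0<..<1}"
  obtains s where "s \<in> {0<..<1}" "F s = t"
proof -
  obtain s where s: "0 \<le> s" "s \<le> 1" "F s = t" using IVT'[of F 0 t 1] F0 F1 F_cont t by auto
  then have "s \<noteq> 0" "s \<noteq> 1" using F0 F1 t by auto
  then show thesis using s by (intro that[of s]) auto
qed

abbreviation "A' i s \<equiv> fibre_scale b a' i s"

lemma A'_eq: "A' i (F s) = A i s + (F s - s) * b i + (if i = 1 then 0 else a' i - a i)"
  by (simp add: fibre_scale_def algebra_simps)

text \<open>Supplies the constant for the uniform lower bound of the new metric by the old one in
  \<open>gn_pos\<close>.\<close>

lemma comparison:
  obtains k where "k > 0" "\<And>s. s \<in> {0..1} \<Longrightarrow> k \<le> deriv F s"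
    "\<And>i s. i \<in> {1..m} \<Longrightarrow> s \<in> {0<..<1} \<Longrightarrow> k * A i s \<le> A' i (F s)"
proof -
  have "continuous_on {0..1} (deriv F)"
    by (rule continuous_on_subset[OF smooth_on_continuous[OF smooth_on_deriv[OF S(1) F_smooth]] S(2)])
  from continuous_pos_bound[OF this F_deriv] obtain k1 where k1: "k1 > 0" "\<And>s. s \<in> {0..1} \<Longrightarrow> k1 \<le> deriv F s"
    by blast
  have "\<exists>k>0. \<forall>s\<in>{0<..<1}. k * A i s \<le> A' i (F s)" if i: "i \<in> {1..m}" for i
  proof (cases "i = 1")
    case True
    \<comment> \<open>\<open>A 1\<close> vanishes at 0, so the compactness argument used for the
      other quotients does not apply directly; the mean value theorem gives
      \<open>k1 * s \<le> F s\<close> instead.\<close>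
    have "k1 * A i s \<le> A' i (F s)" if s: "s \<in> {0<..<1}" for s
    proof -
      obtain t where t: "0 < t" "t < s" "F s - F 0 = (s - 0) * deriv F t"
        using MVT2[of 0 s F "deriv F"] F_has s by auto
      then have "k1 * s \<le> F s" using k1(2)[of t] s F0 by (simp add: mult.commute)
      then have "b 1 * (k1 * s) \<le> b 1 * F s" using b1_pos by (intro mult_left_mono) auto
      then show ?thesis using True by (simp add: fibre_scale_def mult_ac)
    qed
    then show ?thesis using k1(1) by blast
  next
    case False
    then have i2: "i \<in> {2..m}" using i by auto
    have pos: "A i s > 0" "A' i (F s) > 0" if "s \<in> {0..1}" for s
      using a_param a' i2 that F_in'[OF that] unfolding parameters_def by blast+
    have "continuous_on {0..1} (\<lambda>s. A' i (F s) / A i s)"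
      unfolding fibre_scale_def
      by (intro continuous_intros F_cont) (use pos(1) in \<open>force simp: fibre_scale_def\<close>)
    from continuous_pos_bound[OF this] pos obtain k where k: "k > 0" "\<And>s. s \<in> {0..1} \<Longrightarrow> k \<le> A' i (F s) / A i s"
      by (metis divide_pos_pos)
    have "k * A i s \<le> A' i (F s)" if "s \<in> {0<..<1}" for s
      using k(2)[of s] pos(1)[of s] that by (simp add: pos_le_divide_eq)
    then show ?thesis using k(1) by blast
  qed
  moreover have "\<forall>s\<in>{0<..<1}. l * A i s \<le> A' i (F s)"
    if "i \<in> {1..m}" "\<forall>s\<in>{0<..<1}. k * A i s \<le> A' i (F s)" "0 < l" "l \<le> k" for i k l
  proof
    fix s :: real assume s: "s \<in> {0<..<1}"
    have "l * A i s \<le> k * A i s" using A_pos[OF that(1) s] that(4) by (intro mult_right_mono) auto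
    then show "l * A i s \<le> A' i (F s)" using that(2) s by force
  qed
  ultimately have "\<exists>k>0. \<forall>i\<in>{1..m}. \<forall>s\<in>{0<..<1}. k * A i s \<le> A' i (F s)"
    by (intro finite_uniform_pos[OF finite_atLeastAtMost, of 1 m "\<lambda>i k. \<forall>s\<in>{0<..<1}. k * A i s \<le> A' i (F s)"])
  then obtain k2 where k2: "k2 > 0" "\<And>i s. i \<in> {1..m} \<Longrightarrow> s \<in> {0<..<1} \<Longrightarrow> k2 * A i s \<le> A' i (F s)" by blast
  show thesis
  proof (rule that[of "min k1 k2"])
    show "min k1 k2 * A i s \<le> A' i (F s)" if "i \<in> {1..m}" "s \<in> {0<..<1}" for i s
    proof -
      have "min k1 k2 * A i s \<le> k2 * A i s" using A_pos[OF that] by (intro mult_right_mono) auto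
      then show ?thesis using k2(2)[OF that] by linarith
    qed
  qed (use k1 k2 in force)+
qed

text \<open>On the principal orbits \<open>\<eta> = (F x - x) \<theta>\<close>; the contraction with the generator extends it smoothly
  over the special orbits.\<close>

definition "\<eta> c u y = q (X c u) * loc c g u (xi c u) y"

text \<open>The metric belonging to the modified Kaehler form. A form
  \<open>\<omega> v w = g (J v) w\<close> gives back its metric as \<open>\<omega> v (J w)\<close>,
  which explains the \<open>J\<close> in the exact term.\<close>

definition "gn c p v w = g c p v w + ext_deriv1 (\<eta> c) (snd c p) v (J w) + (\<Sum>i=2..m. (a' i - a i) * pb c i (snd c p) v w)"

context
  fixes c assumes c: "c \<in> charts M"
begin

interpretation k: kahler_chart UNIV "img c" "loc c g" by (rule K[OF c])

lemma X_01: 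
  assumes u: "u \<in> img c"
  shows "X c u \<in> {0..1}"
proof -
  have "cinv c u \<in> M0 \<or> cinv c u \<in> E0 \<or> cinv c u \<in> E1" using cinv_pts[OF c u] by (auto simp: M0_def)
  then show ?thesis using x_M0' x_E0' x_E1' unfolding X_def[OF c] by force
qed

lemma \<eta>_smooth: "smooth_on UNIV (img c) (\<lambda>u. \<eta> c u y)"
  unfolding \<eta>_def
proof (rule smooth_on_mult[OF img_rel[OF c]])
  show "smooth_on UNIV (img c) (\<lambda>u. q (X c u))"
    by (rule smooth_on_compose[OF img_rel[OF c] S(1) _ q_smooth X_smooth[OF c]]) (use X_01 S(2) in blast)
  show "smooth_on UNIV (img c) (\<lambda>u. loc c g u (xi c u) y)"
    by (rule smooth_on_apply2[OF coord_subspace_UNIV img_rel[OF c] k.bil[simplified] k.smooth[simplified] _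
          xi_smooth[OF c] _ smooth_on_const[OF img_rel[OF c]]]) auto
qed

lemma gn_loc: "u \<in> img c \<Longrightarrow> loc c gn u v w =
    loc c g u v w + ext_deriv1 (\<eta> c) u v (J w) + (\<Sum>i=2..m. (a' i - a i) * pb c i u v w)"
  by (simp add: loc_def gn_def snd_cinv)

lemma deta_smooth: "smooth_on UNIV (img c) (\<lambda>u. ext_deriv1 (\<eta> c) u v w)"
  unfolding ext_deriv1_def by (intro smooth_on_diff[OF img_rel[OF c]] smooth_on_dird[OF \<eta>_smooth]) auto

lemma gn_smooth: "smooth_on UNIV (img c) (\<lambda>u. loc c gn u v w)"
proof -
  have "smooth_on UNIV (img c) (\<lambda>u. loc c g u v w + ext_deriv1 (\<eta> c) u v (J w) + (\<Sum>i=2..m. (a' i - a i) * pb c i u v w))"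
    by (intro smooth_on_add[OF img_rel[OF c]] deta_smooth smooth_on_sum[OF img_rel[OF c]] smooth_on_mult[OF img_rel[OF c]]
        smooth_on_const[OF img_rel[OF c]] pb_smooth[OF c] k.smooth[simplified])
  then show ?thesis using smooth_on_cong[OF img_rel[OF c] gn_loc[where v=v and w=w]] by simp
qed

lemma gn_cont: "continuous_on (img c) (\<lambda>u. loc c gn u v w)"
  by (rule smooth_on_continuous[OF gn_smooth])

context
  fixes u assumes u: "u \<in> U0 c"
begin

text \<open>Here \<open>g (\<xi>, -) = h \<theta>\<close> and \<open>q h = F - id\<close> turn
  \<eta> into a multiple of \<theta>; what follows is the Leibniz rule and
  \<open>d\<Theta>\<close>.\<close>

lemma deta_U0: "ext_deriv1 (\<eta> c) u v w =
    (deriv F (X c u) - 1) * (dird (X c) u v * loc c \<theta> u w - dird (X c) u w * loc c \<theta> u v)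
     + (F (X c u) - X c u) * (\<Sum>i=1..m. b i * pb c i u (J v) w)"
proof -
  have r: "rel_open UNIV (U0 c)" using U0_open[OF c] by (simp add: rel_open_UNIV)
  note Xs = smooth_on_subset[OF X_smooth[OF c] U0_sub[OF c]]
  have XS: "X c y \<in> S" if "y \<in> U0 c" for y using X_01[of y] U0_sub[OF c] that S(2) by blast
  have FX: "smooth_on UNIV (U0 c) (\<lambda>u. F (X c u))"
    by (rule smooth_on_compose[OF r S(1) _ F_smooth Xs]) (use XS in blast)
  have sm: "smooth_on UNIV (U0 c) (\<lambda>u. F (X c u) - X c u)" by (rule smooth_on_diff[OF r FX Xs])
  have d: "dird (\<lambda>u. F (X c u) - X c u) u y = (deriv F (X c u) - 1) * dird (X c) u y" for y
    using has_dird_dird[OF has_dird_diff[OF has_dird_compose_real[OF S(1) F_smooth XS[OF u] smooth_on_has_dird[OF Xs u UNIV_I]]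
        smooth_on_has_dird[OF Xs u UNIV_I]], of y] by (simp add: algebra_simps)
  have "ext_deriv1 (\<eta> c) u v w = ext_deriv1 (\<lambda>u y. (F (X c u) - X c u) * loc c \<theta> u y) u v w"
  proof (rule ext_deriv1_cong[OF r u])
    fix y z assume y: "y \<in> U0 c"
    have "q (X c y) * h (X c y) = F (X c y) - X c y" using X_in[OF c y] by (intro q_h) auto
    then show "\<eta> c y z = (F (X c y) - X c y) * loc c \<theta> y z"
      unfolding \<eta>_def G_xi[OF c y] by (metis mult.assoc)
  qed auto
  also have "\<dots> = dird (\<lambda>u. F (X c u) - X c u) u v * loc c \<theta> u w - dird (\<lambda>u. F (X c u) - X c u) u w * loc c \<theta> u v +
      (F (X c u) - X c u) * ext_deriv1 (loc c \<theta>) u v w"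
    by (rule ext_deriv1_scale[OF r sm \<Theta>_smooth[OF c] u]) auto
  finally show ?thesis unfolding d d\<Theta>[OF c u] by (simp add: algebra_simps)
qed

lemma \<Theta>_J: "loc c \<theta> u (J v) = dird (X c) u v / h (X c u)"
  using dX_J[OF c u, of v] h_pos[OF c u] by simp

lemma dX_J': "dird (X c) u (J v) = - h (X c u) * loc c \<theta> u v"
  using dX_J[OF c u, of "J v"] linear_on_minus[OF subspace_UNIV \<Theta>_lin[OF c u]] by simp

text \<open>The form is of type (1,1): \<open>J\<close> rotates the pair \<open>dX / h\<close>,
  \<theta>, which preserves their wedge product, and the base forms are invariant.\<close>

lemma deta_J_U0: "ext_deriv1 (\<eta> c) u (J v) (J w) = ext_deriv1 (\<eta> c) u v w"
proof -
  have "pb c i u (J (J v)) (J w) = pb c i u (J v) w" if "i \<in> {1..m}" for i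
    by (rule pb_J[OF c that u])
  then have "(\<Sum>i=1..m. b i * pb c i u (J (J v)) (J w)) = (\<Sum>i=1..m. b i * pb c i u (J v) w)" by simp
  then show ?thesis
    unfolding deta_U0 \<Theta>_J dX_J' using h_pos[OF c u] by (simp add: field_simps)
qed

lemma deta_mixed: "ext_deriv1 (\<eta> c) u v (J w) =
    (deriv F (X c u) - 1) * (1 / h (X c u) * dird (X c) u v * dird (X c) u w + h (X c u) * loc c \<theta> u v * loc c \<theta> u w)
     + (F (X c u) - X c u) * (\<Sum>i=1..m. b i * pb c i u v w)"
proof -
  have "pb c i u (J v) (J w) = pb c i u v w" if "i \<in> {1..m}" for i
    by (rule pb_J[OF c that u])
  then have "(\<Sum>i=1..m. b i * pb c i u (J v) (J w)) = (\<Sum>i=1..m. b i * pb c i u v w)" by simp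
  then show ?thesis
    unfolding deta_U0 \<Theta>_J dX_J' using h_pos[OF c u] by (simp add: field_simps)
qed

text \<open>The exact term adds \<open>deriv F - 1\<close> times the fibre part of \<open>g\<close>
  and \<open>(F x - x) * b i\<close> to each base coefficient; \<open>A'_eq\<close> collects the
  base coefficients.\<close>

lemma gn_U0: "loc c gn u v w =
    deriv F (X c u) * (1 / h (X c u) * dird (X c) u v * dird (X c) u w + h (X c u) * loc c \<theta> u v * loc c \<theta> u w)
     + (\<Sum>i=1..m. A' i (F (X c u)) * pb c i u v w)"
proof -
  have "(\<Sum>i=2..m. (a' i - a i) * pb c i u v w) = (\<Sum>i=1..m. (if i = 1 then 0 else a' i - a i) * pb c i u v w)"
    by (rule sum.mono_neutral_cong_left) auto
  then have sum: "(F (X c u) - X c u) * (\<Sum>i=1..m. b i * pb c i u v w) + (\<Sum>i=2..m. (a' i - a i) * pb c i u v w) +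
      (\<Sum>i=1..m. A i (X c u) * pb c i u v w) = (\<Sum>i=1..m. A' i (F (X c u)) * pb c i u v w)"
    unfolding A'_eq by (simp add: distrib_right sum.distrib sum_distrib_left mult.assoc)
  define P where "P = 1 / h (X c u) * dird (X c) u v * dird (X c) u w + h (X c u) * loc c \<theta> u v * loc c \<theta> u w"
  have P: "(deriv F (X c u) - 1) * P = deriv F (X c u) * P - P" by (simp add: left_diff_distrib)
  have "u \<in> img c" using u U0_sub[OF c] by blast
  then show ?thesis
    unfolding gn_loc[OF \<open>u \<in> img c\<close>] deta_mixed G_eq[OF c u] P_def[symmetric] P using sum by simp
qed

text \<open>Only \<open>g\<close> and the pulled back metrics appear in this form, so linearity,
  invariance under \<open>J\<close> and independence of the chart follow from theirs.\<close>

lemma gn_U0': "loc c gn u v w = deriv F (X c u) * loc c g u v w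
     + (\<Sum>i=1..m. (A' i (F (X c u)) - deriv F (X c u) * A i (X c u)) * pb c i u v w)"
  unfolding gn_U0 G_eq[OF c u] by (simp add: algebra_simps sum.distrib sum_subtractf sum_distrib_left)

end

lemma gn_sym: "u \<in> img c \<Longrightarrow> loc c gn u v w = loc c gn u w v"
proof (rule dense_eq[OF c gn_cont gn_cont])
  show "loc c gn u v w = loc c gn u w v" if "u \<in> U0 c" for u
    unfolding gn_U0[OF that] by (simp add: pb_sym[OF c _ that, of _ v w])
qed

lemma gn_J: "u \<in> img c \<Longrightarrow> loc c gn u (J v) (J w) = loc c gn u v w"
proof (rule dense_eq[OF c gn_cont gn_cont])
  show "loc c gn u (J v) (J w) = loc c gn u v w" if "u \<in> img c" "u \<in> U0 c" for u
    unfolding gn_U0'[OF that(2)] using k.GJ[OF that(1)] by (simp add: pb_J[OF c _ that(2)])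
qed

lemma gn_lin: "u \<in> img c \<Longrightarrow> loc c gn u (v + r *\<^sub>R w) z = loc c gn u v z + r * loc c gn u w z"
proof (rule dense_eq[OF c gn_cont continuous_on_add[OF gn_cont continuous_on_mult_left[OF gn_cont]]])
  show "loc c gn u (v + r *\<^sub>R w) z = loc c gn u v z + r * loc c gn u w z" if "u \<in> img c" "u \<in> U0 c" for u
  proof -
    have "pb c i u (v + r *\<^sub>R w) z = pb c i u v z + r * pb c i u w z" if "i \<in> {1..m}" for i
      using linear_onD[OF bilinear_onD(1)[OF pb_bilinear[OF c that \<open>u \<in> U0 c\<close>]], of z v w r] by simp
    then show ?thesis
      unfolding gn_U0'[OF that(2)] using linear_onD[OF k.G_lin1[OF that(1)], of z v w r]
      by (simp add: algebra_simps sum.distrib sum_subtractf sum_distrib_left)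
  qed
qed

lemma gn_bilinear: "u \<in> img c \<Longrightarrow> bilinear_on UNIV (loc c gn u)"
  unfolding bilinear_on_def linear_on_def using gn_lin gn_sym by (metis real_scaleR_def)

text \<open>Density of the principal orbits alone would give only a nonnegative form. The inequality
  between \<open>gn\<close> and \<open>l\<close> times \<open>g\<close> with a uniform
  \<open>l > 0\<close> does pass to the closure, and \<open>g\<close> is positive
  everywhere.\<close>

lemma gn_pos:
  assumes u: "u \<in> img c" and v: "v \<noteq> 0"
  shows "loc c gn u v v > 0"
proof -
  obtain l where l: "l > 0" "\<And>s. s \<in> {0..1} \<Longrightarrow> l \<le> deriv F s"
    "\<And>i s. i \<in> {1..m} \<Longrightarrow> s \<in> {0<..<1} \<Longrightarrow> l * A i s \<le> A' i (F s)"
    using comparison by blast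
  have "loc c gn u v v - l * loc c g u v v \<ge> 0"
  proof (rule dense_ge[OF c _ _ u, where \<phi>="\<lambda>u. loc c gn u v v - l * loc c g u v v"])
    show "continuous_on (img c) (\<lambda>u. loc c gn u v v - l * loc c g u v v)"
      by (intro continuous_intros gn_cont smooth_on_continuous[OF k.smooth[simplified]])
    fix u assume u: "u \<in> U0 c"
    define Q where "Q = 1 / h (X c u) * dird (X c) u v * dird (X c) u v + h (X c u) * loc c \<theta> u v * loc c \<theta> u v"
    have X: "X c u \<in> {0<..<1}" by (rule X_in[OF c u])
    have "l * Q \<le> deriv F (X c u) * Q"
      using h_pos[OF c u] l(2)[of "X c u"] X by (intro mult_right_mono) (auto simp: Q_def mult.assoc)
    moreover have "(\<Sum>i=1..m. l * A i (X c u) * pb c i u v v) \<le> (\<Sum>i=1..m. A' i (F (X c u)) * pb c i u v v)"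
      by (intro sum_mono mult_right_mono l(3) pb_nonneg[OF c _ u] X)
    ultimately show "loc c gn u v v - l * loc c g u v v \<ge> 0"
      unfolding gn_U0[OF u] G_eq[OF c u] Q_def by (simp add: distrib_left sum_distrib_left mult.assoc)
  qed
  moreover have "loc c g u v v > 0" using k.pos[OF u] v by (simp add: pos_on_def)
  then have "l * loc c g u v v > 0" using l(1) by simp
  ultimately show ?thesis by linarith
qed

text \<open>The Kaehler form of \<open>gn\<close> is that of \<open>g\<close> plus an exact form
  plus multiples of closed pullbacks. The (1,1) property of the exact term, used to absorb both
  \<open>J\<close>, extends to the whole chart by density.\<close>

lemma gn_closed:
  assumes u: "u \<in> img c"
  shows "ext_deriv2 (loc c (kahler_form gn)) u v w z = 0"
proof -
  have eq: "loc c (kahler_form gn) y v w = loc c g y (J v) w + ext_deriv1 (\<eta> c) y v w + (\<Sum>i=2..m. (a' i - a i) * pb c i y (J v) w)"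
    if "y \<in> img c" for y v w
  proof -
    have "ext_deriv1 (\<eta> c) y (J v) (J w) = ext_deriv1 (\<eta> c) y v w"
      by (rule dense_eq[OF c smooth_on_continuous[OF deta_smooth] smooth_on_continuous[OF deta_smooth] deta_J_U0 that])
    then show ?thesis using gn_loc[OF that, of "J v" w] by (simp add: loc_def kahler_form_def)
  qed
  have "ext_deriv2 (loc c (kahler_form gn)) u v w z =
      ext_deriv2 (\<lambda>y v w. loc c g y (J v) w + ext_deriv1 (\<eta> c) y v w + (\<Sum>i=2..m. (a' i - a i) * pb c i y (J v) w)) u v w z"
    by (rule ext_deriv2_cong[OF img_rel[OF c] u]) (use eq in auto)
  also have "\<dots> = ext_deriv2 (\<lambda>y v w. loc c g y (J v) w) u v w z + ext_deriv2 (ext_deriv1 (\<eta> c)) u v w z +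
      (\<Sum>i=2..m. (a' i - a i) * ext_deriv2 (\<lambda>y v w. pb c i y (J v) w) u v w z)"
    by (rule ext_deriv2_combination[OF k.smooth[simplified] deta_smooth pb_smooth[OF c] u]) auto
  also have "\<dots> = 0"
    using k.closed[OF u, of v w z] ext_deriv2_ext_deriv1[OF img_rel[OF c] coord_subspace_UNIV \<eta>_smooth u, of v w z] pb_closed[OF c _ u]
    by simp
  finally show ?thesis .
qed

end

text \<open>\<eta> is written separately in each chart. Its transformation rule is bypassed: the two
  expressions \<open>gn_U0'\<close> are compared on the principal orbits, and density covers the
  rest of the overlap.\<close>

lemma gn_transform:
  assumes c: "c \<in> charts M" and d: "d \<in> charts M" and p: "p \<in> fst c" "p \<in> fst d"
  shows "gn c p v w = gn d p (dmap c d id p v) (dmap c d id p w)"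
proof -
  define D where "D = snd c ` (fst c \<inter> fst d)"
  define \<phi> where "\<phi> = snd d \<circ> cinv c"
  have r: "rel_open UNIV D" using open_image[OF c chart_openin[OF d]] by (simp add: D_def)
  then have D: "open D" "D \<subseteq> img c" by (auto simp: rel_open_UNIV D_def)
  have \<phi>: "smooth_on UNIV D \<phi>" using transition[OF c d] by (simp add: holo_on_def \<phi>_def D_def)
  have \<phi>_in: "\<phi> y \<in> img d" and \<phi>_cinv: "cinv d (\<phi> y) = cinv c y" and D_in: "cinv c y \<in> fst c" "cinv c y \<in> fst d"
    if "y \<in> D" for y
    using that cinv_snd[OF c] cinv_snd[OF d] by (auto simp: \<phi>_def D_def)
  define u where "u = snd c p"
  have u: "u \<in> D" "cinv c u = p" using p cinv_snd[OF c] by (auto simp: u_def D_def)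
  have dm: "dmap c d id (cinv c y) v = dird \<phi> y v" if "y \<in> D" for y v
    using that D(2) snd_cinv[of y c] by (auto simp: dmap_def \<phi>_def)
  have "loc c gn u v w = loc d gn (\<phi> u) (dird \<phi> u v) (dird \<phi> u w)"
  proof (rule dense_eq_on[OF c D _ _ _ u(1), where \<psi>="\<lambda>u. loc d gn (\<phi> u) (dird \<phi> u v) (dird \<phi> u w)"])
    show "continuous_on D (\<lambda>u. loc c gn u v w)" by (rule continuous_on_subset[OF gn_cont[OF c] D(2)])
    show "continuous_on D (\<lambda>u. loc d gn (\<phi> u) (dird \<phi> u v) (dird \<phi> u w))"
      by (rule smooth_on_continuous[OF smooth_on_pullback2[OF r coord_subspace_UNIV coord_subspace_UNIV img_rel[OF d] \<phi> \<phi>_in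
            gn_bilinear[OF d] gn_smooth[OF d]]]) auto
    fix y assume y: "y \<in> D" "y \<in> U0 c"
    have M: "cinv c y \<in> M0" using y(2) by (simp add: U0_iff[OF c])
    have y': "\<phi> y \<in> U0 d" using M \<phi>_in[OF y(1)] \<phi>_cinv[OF y(1)] by (simp add: U0_iff[OF d])
    have X: "X d (\<phi> y) = X c y" by (simp add: X_def[OF c] X_def[OF d] \<phi>_cinv[OF y(1)])
    have pb: "pb d i (\<phi> y) (dird \<phi> y v) (dird \<phi> y w) = pb c i y v w" if "i \<in> {1..m}" for i
      using pullback_transform[OF that c d D_in[OF y(1)] M, of v w]
      by (simp add: pb_def[OF c] pb_def[OF d] \<phi>_cinv[OF y(1)] dm[OF y(1)])
    have "riemannian_metric M g" using g_kahler by (simp add: kahler_metric_def)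
    from riemannian_transform[OF this c d D_in[OF y(1)], of v w]
    have "loc d g (\<phi> y) (dird \<phi> y v) (dird \<phi> y w) = loc c g y v w"
      by (simp add: loc_def \<phi>_cinv[OF y(1)] dm[OF y(1)])
    then show "loc c gn y v w = loc d gn (\<phi> y) (dird \<phi> y v) (dird \<phi> y w)"
      unfolding gn_U0'[OF c y(2)] gn_U0'[OF d y'] X using pb by simp
  qed
  then show ?thesis
    using u \<phi>_cinv[OF u(1)] dm[OF u(1)] by (simp add: loc_def)
qed

lemma loc_snd: "c \<in> charts M \<Longrightarrow> p \<in> fst c \<Longrightarrow> loc c T (snd c p) = T c p"
  by (simp add: loc_def cinv_snd)

lemma gn_kahler: "kahler_metric M gn"
  unfolding kahler_metric_def riemannian_metric_def coordsM cspace_UNIV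
proof (intro conjI ballI allI impI)
  fix c p v w assume c: "c \<in> charts M" and p: "p \<in> fst c"
  have u: "snd c p \<in> img c" using p by simp
  show "gn c p v w = gn c p w v" using gn_sym[OF c u, of v w] by (simp add: loc_snd[OF c p])
  show "gn c p (J v) (J w) = gn c p v w" using gn_J[OF c u, of v w] by (simp add: loc_snd[OF c p])
  show "gn c p (v + r *\<^sub>R w) z = gn c p v z + r * gn c p w z" for r z
    using gn_lin[OF c u, of v r w z] by (simp add: loc_snd[OF c p])
  show "v \<noteq> 0 \<Longrightarrow> gn c p v v > 0" using gn_pos[OF c u, of v] by (simp add: loc_snd[OF c p])
next
  show "gn c p v w = gn d p (dmap c d id p v) (dmap c d id p w)"
    if "c \<in> charts M" "d \<in> charts M" "p \<in> fst c \<inter> fst d" for c d p v w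
    using gn_transform that by blast
  show "smooth_on UNIV (img c) (\<lambda>u. gn c (cinv c u) v w)" if "c \<in> charts M" for c v w
    using gn_smooth[OF that, of v w] by (simp add: loc_def)
qed (rule gn_closed)

end

context toric_change
begin

lemma dfun_change:
  assumes c: "c \<in> charts M" and p: "p \<in> fst c \<inter> M0"
  shows "dfun c (F \<circ> x) p v = deriv F (x p) * dfun c x p v"
proof -
  have u: "snd c p \<in> img c" "cinv c (snd c p) = p" using p cinv_snd[OF c] by auto
  have "X c (snd c p) \<in> S" using X_01[OF c u(1)] S(2) by blast
  from has_dird_compose_real[OF S(1) F_smooth this smooth_on_has_dird[OF X_smooth[OF c] u(1) UNIV_I]]
  have "dird (\<lambda>u. F (X c u)) (snd c p) v = deriv F (X c (snd c p)) * dird (X c) (snd c p) v" by (rule has_dird_dird)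
  then show ?thesis using u(2) by (simp add: dfun_def o_def X_def[OF c, abs_def])
qed

lemma new_metric: "fiberwise_toric_metric m N gN b M E0 E1 \<rho> \<pi> \<theta> (F \<circ> x) h' a' gn"
proof -
  have hp: "\<exists>S. open S \<and> {0..1} \<subseteq> S \<and> smooth_on UNIV S h'" "\<forall>s\<in>{0<..<1}. h' s > 0" "h' 0 = 0" "h' 1 = 0"
    "deriv h' 0 = 2" "deriv h' 1 = -2" using h' unfolding profile_def by auto
  have xM0: "x p \<in> {0<..<1}" if "p \<in> M0" for p using x_M0' that by auto
  have smooth: "smooth_fun M (pts M) (F \<circ> x)"
    unfolding smooth_fun_def coordsM cspace_UNIV
  proof
    fix c assume c: "c \<in> charts M"
    have "smooth_on UNIV (img c) (\<lambda>u. F (X c u))"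
      by (rule smooth_on_compose[OF img_rel[OF c] S(1) _ F_smooth X_smooth[OF c]]) (use X_01[OF c] S(2) in blast)
    moreover have "fst c \<inter> pts M = fst c" using chart_sub[OF c] by auto
    ultimately show "smooth_on UNIV (snd c ` (fst c \<inter> pts M)) (F \<circ> x \<circ> cinv c)"
      by (simp add: X_def[OF c, abs_def] o_def)
  qed
  have surj: "\<exists>p\<in>M0. (F \<circ> x) p = s \<and> (\<forall>i\<in>{1..m}. \<pi> i p = y i)"
    if s: "s \<in> {0<..<1}" and y: "y \<in> (\<Pi>\<^sub>E i\<in>{1..m}. pts (N i))" for s y
  proof -
    obtain t where t: "t \<in> {0<..<1}" "F t = s" using F_surj[OF s] .
    then obtain p where "p \<in> M0" "x p = t" "\<forall>i\<in>{1..m}. \<pi> i p = y i" using x_surj y by blast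
    then show ?thesis using t by auto
  qed
  have orb: "(\<exists>t. r = \<rho> t p) \<longleftrightarrow> (F \<circ> x) p = (F \<circ> x) r \<and> (\<forall>i\<in>{1..m}. \<pi> i p = \<pi> i r)" if "p \<in> M0" "r \<in> M0" for p r
  proof -
    have "F (x p) = F (x r) \<longleftrightarrow> x p = x r" using F_inj[OF xM0[OF that(1)] xM0[OF that(2)]] by auto
    then show ?thesis using orbits that by auto
  qed
  have J1: "J v = (1 / h' ((F \<circ> x) p)) *\<^sub>R generator \<rho> c p"
    if c: "c \<in> charts M" and p: "p \<in> fst c \<inter> M0" and v: "dfun c (F \<circ> x) p v = 1 \<and> \<theta> c p v = 0 \<and>
        (\<forall>i\<in>{1..m}. dmap c (chart_at (N i) (\<pi> i p)) (\<pi> i) p v = 0)" for c p v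
  proof -
    define u where "u = snd c p"
    have up: "u \<in> img c" "cinv c u = p" using p cinv_snd[OF c] by (auto simp: u_def)
    then have u: "u \<in> U0 c" using p by (simp add: U0_iff[OF c])
    \<comment> \<open>A vector on which \<open>F \<circ> x\<close> has derivative 1 has
      \<open>dx = 1 / d\<close>, so the old condition on \<open>J\<close> applies to its multiple by
      \<open>d\<close>; then \<open>d * h (x p) = h' (F (x p))\<close> turns the factor into the new
      one.\<close>
    define d where "d = deriv F (x p)"
    have xp: "x p \<in> {0<..<1}" using xM0 p by auto
    then have d: "d > 0" "d * h (x p) = h' (F (x p))" using F_deriv[of "x p"] F_h[of "x p"] by (auto simp: d_def)
    have "dfun c x p (d *\<^sub>R v) = d * dfun c x p v"
      using linear_on_scale[OF subspace_UNIV dX_lin[OF c u], of v d] dX_eq[OF c up(1)] up(2) by simp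
    then have 1: "dfun c x p (d *\<^sub>R v) = 1" using dfun_change[OF c p, of v] v by (simp add: d_def)
    have 2: "\<theta> c p (d *\<^sub>R v) = 0"
      using linear_on_scale[OF subspace_UNIV \<Theta>_lin[OF c u], of v d] up(2) v by (simp add: loc_def)
    have 3: "dmap c (chart_at (N i) (\<pi> i p)) (\<pi> i) p (d *\<^sub>R v) = 0" if "i \<in> {1..m}" for i
      using linear_on_scale[OF subspace_UNIV dpi_lin[OF c that u], of v d] up(2) v that by (simp add: dpi_def[OF c])
    have "J (d *\<^sub>R v) = (1 / h (x p)) *\<^sub>R generator \<rho> c p"
      using J_cond[THEN bspec, OF c, THEN bspec, OF p, THEN bspec, of "d *\<^sub>R v"] 1 2 3 by simp
    then have "(1 / d) *\<^sub>R (d *\<^sub>R J v) = (1 / d) *\<^sub>R (1 / h (x p)) *\<^sub>R generator \<rho> c p" by (simp add: J_scaleR)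
    then show ?thesis using d(1) d(2)[symmetric] by simp
  qed
  have J2: "dfun c (F \<circ> x) p (J v) = 0 \<and> \<theta> c p (J v) = 0 \<and>
      (\<forall>i\<in>{1..m}. dmap c (chart_at (N i) (\<pi> i p)) (\<pi> i) p (J v) = J (dmap c (chart_at (N i) (\<pi> i p)) (\<pi> i) p v))"
    if c: "c \<in> charts M" and p: "p \<in> fst c \<inter> M0" and v: "dfun c (F \<circ> x) p v = 0 \<and> \<theta> c p v = 0" for c p v
  proof -
    have "deriv F (x p) > 0" using F_deriv[of "x p"] xM0[of p] p by auto
    then have "dfun c x p v = 0 \<and> \<theta> c p v = 0" using v dfun_change[OF c p, of v] by simp
    then show ?thesis
      using J_cond[THEN bspec, OF c, THEN bspec, OF p, THEN bspec, of v] dfun_change[OF c p, of "J v"] by simp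
  qed
  have G: "gn c p v w = 1 / h' ((F \<circ> x) p) * dfun c (F \<circ> x) p v * dfun c (F \<circ> x) p w + h' ((F \<circ> x) p) * \<theta> c p v * \<theta> c p w +
      (\<Sum>i=1..m. A' i ((F \<circ> x) p) * pullback (N i) (\<pi> i) (gN i) c p v w)"
    if c: "c \<in> charts M" and p: "p \<in> fst c \<inter> M0" for c p v w
  proof -
    define u where "u = snd c p"
    have up: "u \<in> img c" "cinv c u = p" using p cinv_snd[OF c] by (auto simp: u_def)
    then have u: "u \<in> U0 c" using p by (simp add: U0_iff[OF c])
    have xp: "x p \<in> {0<..<1}" using xM0 p by auto
    then have d: "deriv F (x p) > 0" "h' (F (x p)) = deriv F (x p) * h (x p)" "h (x p) > 0"
      using F_deriv[of "x p"] F_h[of "x p"] h2 by auto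
    show ?thesis
      unfolding dfun_change[OF c p] comp_apply d(2)
      using gn_U0[OF c u, of v w] dX_eq[OF c up(1)] d(1,3)
      by (simp add: loc_def up(2) X_def[OF c] pb_def[OF c] distrib_left)
  qed
  show ?thesis
    unfolding fiberwise_toric_metric_def Let_def M0_def[symmetric] coordsM cspace_UNIV
    by (intro conjI ballI impI gn_kahler smooth a' hp surj orb J1 J2 G)
      (use x_E0' x_E1' F0 F1 hp F_in xM0 in auto)
qed

end

section \<open>Different parameters give non-homothetic metrics\<close>

context toric_metric
begin

lemma G_factor:
  assumes c: "c \<in> charts M" and u: "u \<in> U0 c" and i: "i \<in> {1..m}" and v: "loc c \<theta> u v = 0" "loc c \<theta> u (J v) = 0"
    "\<And>j. j \<in> {1..m} - {i} \<Longrightarrow> dpi c j u v = 0"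
  shows "loc c g u v v = A i (X c u) * pb c i u v v"
proof -
  have "(\<Sum>j=1..m. A j (X c u) * pb c j u v v) = A i (X c u) * pb c i u v v + (\<Sum>j\<in>{1..m} - {i}. A j (X c u) * pb c j u v v)"
    by (rule sum.remove) (use i in auto)
  also have "(\<Sum>j\<in>{1..m} - {i}. A j (X c u) * pb c j u v v) = 0"
    by (rule sum.neutral) (use pb_zero[OF c _ u v(3)] in auto)
  finally show ?thesis by (simp add: G_eq[OF c u] dX_J[OF c u] v)
qed

text \<open>A dimension count leaves a nonzero vector killed by \<open>dX\<close>, \<theta> and the
  differentials of all other projections. Positivity of \<open>g\<close> then forces positive length
  in factor \<open>i\<close>. Such vectors isolate a single coefficient of the metric.\<close>

lemma factor_direction:
  assumes c: "c \<in> charts M" and u: "u \<in> U0 c" and i: "i \<in> {1..m}"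
  obtains v where "dird (X c) u v = 0" "loc c \<theta> u v = 0" "loc c \<theta> u (J v) = 0"
    "\<And>j. j \<in> {1..m} - {i} \<Longrightarrow> dpi c j u v = 0" "pb c i u v v > 0"
proof -
  define f where "f v = Complex (dird (X c) u v) (loc c \<theta> u v)" for v
  have lin: "linear f"
    unfolding f_def using linear_onD[OF dX_lin[OF c u]] linear_onD[OF \<Theta>_lin[OF c u]]
    by (intro linearI) (simp_all add: complex_eq_iff linear_on_add[OF subspace_UNIV dX_lin[OF c u]]
        linear_on_add[OF subspace_UNIV \<Theta>_lin[OF c u]] linear_on_scale[OF subspace_UNIV dX_lin[OF c u]]
        linear_on_scale[OF subspace_UNIV \<Theta>_lin[OF c u]])
  \<comment> \<open>A single map is passed to \<open>joint_kernel\<close> as a family over a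
    one-element index set; its target, the complex numbers, accounts for the dimensions of
    \<open>dX\<close> and \<theta> together.\<close>
  define Q where "Q = {v \<in> UNIV. \<forall>k\<in>{()}. f v = 0}"
  have Q: "subspace Q" "dim (UNIV :: (complex^'n) set) \<le> dim Q + (\<Sum>k\<in>{()}. dim (UNIV :: complex set))"
    unfolding Q_def using joint_kernel[of "{()}" "\<lambda>_. f" "\<lambda>_. UNIV" UNIV] lin by auto
  define L where "L = {v \<in> Q. \<forall>j\<in>{1..m} - {i}. dpi c j u v = 0}"
  have lind: "linear (dpi c j u)" if "j \<in> {1..m} - {i}" for j
    using dpi_lin[OF c _ u, of j] that
    by (intro linearI) (auto simp: linear_on_add[OF subspace_UNIV] linear_on_scale[OF subspace_UNIV])
  have L: "dim Q \<le> dim L + (\<Sum>j\<in>{1..m} - {i}. dim (model (N j)))"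
    unfolding L_def using joint_kernel[of "{1..m} - {i}" "\<lambda>j. dpi c j u" "\<lambda>j. model (N j)" Q] lind dpi_in[OF c _ u] Q(1) by auto
  have "dim (UNIV :: (complex^'n) set) = 2 + (\<Sum>j=1..m. dim (model (N j)))"
    using dimM dim_cspace[of "UNIV :: 'n set"] by (simp add: dim_cspace)
  also have "(\<Sum>j=1..m. dim (model (N j))) = dim (model (N i)) + (\<Sum>j\<in>{1..m} - {i}. dim (model (N j)))"
    by (rule sum.remove) (use i in auto)
  finally have "dim (model (N i)) \<le> dim L" using Q(2) L by (simp add: DIM_complex)
  moreover have "dim (model (N i)) > 0"
    using N_closed[OF i] by (simp add: dim_cspace closed_complex_manifold_def card_gt_0_iff)
  ultimately have "dim L \<noteq> 0" by linarith
  then have "\<not> L \<subseteq> {0}" unfolding dim_eq_0 .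
  then obtain v where v: "v \<in> L" "v \<noteq> 0" by auto
  have z: "dird (X c) u v = 0" "loc c \<theta> u v = 0" "\<And>j. j \<in> {1..m} - {i} \<Longrightarrow> dpi c j u v = 0"
    using v(1) by (auto simp: L_def Q_def f_def complex_eq_iff)
  have J: "loc c \<theta> u (J v) = 0" using dX_J[OF c u, of v] z(1) h_pos[OF c u] by simp
  have "pb c i u v v > 0"
  proof -
    have "loc c g u v v = A i (X c u) * pb c i u v v" by (rule G_factor[OF c u i z(2) J z(3)])
    moreover have "u \<in> img c" using u U0_sub[OF c] by blast
    then have "loc c g u v v > 0" using kahler_chart.pos[OF K[OF c]] v(2) by (simp add: pos_on_def)
    ultimately show ?thesis using A_pos[OF i X_in[OF c u]] by (simp add: zero_less_mult_iff)
  qed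
  then show thesis using that z J by blast
qed

end

lemma (in toric_manifold) not_homothetic:
  assumes 1: "fiberwise_toric_metric m N gN b M E0 E1 \<rho> \<pi> \<theta> x h a g"
    and 2: "fiberwise_toric_metric m N gN b M E0 E1 \<rho> \<pi> \<theta> x' h' a' g'"
    and hom: "homothetic M g g'"
  shows "a = a'"
proof -
  interpret T: toric_metric m N gN b M E0 E1 \<rho> \<pi> \<theta> x h a g by unfold_locales (rule 1)
  interpret T': toric_metric m N gN b M E0 E1 \<rho> \<pi> \<theta> x' h' a' g' by unfold_locales (rule 2)
  obtain k where k: "k > 0" "\<And>c p v w. c \<in> charts M \<Longrightarrow> p \<in> fst c \<Longrightarrow> g' c p v w = k * g c p v w"
    using hom unfolding homothetic_def coordsM cspace_UNIV by blast
  have A: "fibre_scale b a' i (x' p) = k * fibre_scale b a i (x p)" if i: "i \<in> {1..m}" and p: "p \<in> M0" for i p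
  proof -
    obtain c where c: "c \<in> charts M" "p \<in> fst c" using in_chart[of p] p M0_sub by blast
    define u where "u = snd c p"
    have up: "u \<in> img c" "cinv c u = p" using c cinv_snd[OF c(1)] by (auto simp: u_def)
    then have u: "u \<in> U0 c" using p by (simp add: U0_iff[OF c(1)])
    obtain v where v: "loc c \<theta> u v = 0" "loc c \<theta> u (J v) = 0" "\<And>j. j \<in> {1..m} - {i} \<Longrightarrow> dpi c j u v = 0" "pb c i u v v > 0"
      using T.factor_direction[OF c(1) u i] by blast
    have "loc c g' u v v = k * loc c g u v v" using k(2)[OF c, of v v] by (simp add: loc_def up(2))
    then show ?thesis
      using v(4) T.G_factor[OF c(1) u i v(1-3)] T'.G_factor[OF c(1) u i v(1-3)]
      by (simp add: T.X_def[OF c(1)] T'.X_def[OF c(1)] up(2))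
  qed
  have x: "x' p = k * x p" if "p \<in> M0" for p
    using A[of 1 p] that m T.b1_pos by (simp add: fibre_scale_def)
  \<comment> \<open>A base point in the product of the factors, needed to realize every value in
    \<open>(0,1)\<close> by \<open>x\<close> and by \<open>x'\<close>.\<close>
  have "\<forall>i\<in>{1..m}. \<exists>y. y \<in> pts (N i)" using N_closed unfolding closed_complex_manifold_def by blast
  then obtain y where "\<forall>i\<in>{1..m}. y i \<in> pts (N i)" by (rule bchoice[THEN exE])
  then have y: "restrict y {1..m} \<in> (\<Pi>\<^sub>E i\<in>{1..m}. pts (N i))" by auto
  have "\<not> k > 1"
  proof
    assume "k > 1"
    \<comment> \<open>The midpoint of \<open>1 / k\<close> and 1 is a value of \<open>x\<close>, and
      multiplication by \<open>k\<close> would carry it above 1.\<close>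
    then have "(1 + 1 / k) / 2 \<in> {0<..<1}" "k * ((1 + 1 / k) / 2) > 1" by (auto simp: field_simps)
    moreover obtain p where "p \<in> M0" "x p = (1 + 1 / k) / 2" using T.x_surj y calculation(1) by blast
    moreover have "x' p < 1" using T'.x_M0' \<open>p \<in> M0\<close> by blast
    moreover have "x' p = k * ((1 + 1 / k) / 2)" using x[OF \<open>p \<in> M0\<close>] \<open>x p = _\<close> by simp
    ultimately show False by linarith
  qed
  moreover have "\<not> k < 1"
  proof
    assume "k < 1"
    \<comment> \<open>The midpoint of \<open>k\<close> and 1 is a value of \<open>x'\<close>,
      although \<open>x' = k x\<close> stays below \<open>k\<close>.\<close>
    then have "(1 + k) / 2 \<in> {0<..<1}" "(1 + k) / 2 > k" using k(1) by auto
    moreover obtain p where "p \<in> M0" "x' p = (1 + k) / 2" using T'.x_surj y calculation(1) by blast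
    moreover have "x p < 1" using T.x_M0' \<open>p \<in> M0\<close> by blast
    then have "k * x p < k" using k(1) by simp
    ultimately show False using x[of p] by linarith
  qed
  ultimately have k1: "k = 1" by simp
  obtain p where p: "p \<in> M0" using T.x_surj[THEN bspec, of "1/2", THEN bspec, OF _ y] by auto
  have "a i = a' i" if "i \<in> {2..m}" for i
    using A[OF _ p, of i] that x[OF p] k1 by (auto simp: fibre_scale_def)
  moreover have "a \<in> {2..m} \<rightarrow>\<^sub>E UNIV" "a' \<in> {2..m} \<rightarrow>\<^sub>E UNIV"
    using T.a_param T'.a_param unfolding parameters_def by blast+
  ultimately show ?thesis by (intro PiE_ext) auto
qed

text \<open>\<open>b i * s + a i\<close> is affine in \<open>s\<close>, so positivity on the unit
  interval is positivity at both ends. The set is then a product of open half-lines, from which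
  openness is read off.\<close>

lemma parameters_eq: "parameters m b = (\<Pi>\<^sub>E i\<in>{2..m}. {max 0 (- b i)<..})"
proof -
  have "(\<forall>s\<in>{0..1}. fibre_scale b a i s > 0) \<longleftrightarrow> a i \<in> {max 0 (- b i)<..}" if "i \<in> {2..m}" for a i
  proof
    assume "\<forall>s\<in>{0..1}. fibre_scale b a i s > 0"
    then have "fibre_scale b a i 0 > 0" "fibre_scale b a i 1 > 0" by auto
    then show "a i \<in> {max 0 (- b i)<..}" using that by (simp add: fibre_scale_def)
  next
    assume a: "a i \<in> {max 0 (- b i)<..}"
    show "\<forall>s\<in>{0..1}. fibre_scale b a i s > 0"
    proof
      fix s :: real assume s: "s \<in> {0..1}"
      have "(1 - s) * a i + s * (b i + a i) > 0"
      proof (cases "s = 0")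
        case False
        then have "s * (b i + a i) > 0" using s a by (intro mult_pos_pos) auto
        moreover have "(1 - s) * a i \<ge> 0" using s a by (intro mult_nonneg_nonneg) auto
        ultimately show ?thesis by linarith
      qed (use a in auto)
      then show "fibre_scale b a i s > 0" using that by (simp add: fibre_scale_def algebra_simps)
    qed
  qed
  then have "(\<forall>i\<in>{2..m}. \<forall>s\<in>{0..1}. fibre_scale b a i s > 0) \<longleftrightarrow> (\<forall>i\<in>{2..m}. a i \<in> {max 0 (- b i)<..})" for a
    by (intro ball_cong refl)
  then show ?thesis unfolding parameters_def set_eq_iff mem_Collect_eq PiE_iff by (simp add: conj_commute)
qed

lemma (in toric_metric) extremal_exists:
  assumes a': "a' \<in> parameters m b"
  shows "\<exists>x' h' g'. fiberwise_toric_metric m N gN b M E0 E1 \<rho> \<pi> \<theta> x' h' a' g' \<and> extremal_kahler_metric M g'"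
proof -
  define n where "n i = card (coords (N i))" for i
  have n: "n i > 0" if "i \<in> {1..m}" for i
    using N_closed[OF that] by (simp add: n_def closed_complex_manifold_def card_gt_0_iff)
  have "n 1 > 0" using n m by simp
  then obtain M1 where M1: "n 1 = Suc M1" using gr0_implies_Suc by blast
  \<comment> \<open>\<open>fibre_scale\<close> has the zero constant of the collapsing factor built
    in; \<open>a1\<close> makes it explicit for \<open>extremal_profile\<close>.\<close>
  define a1 where "a1 i = (if i = 1 then 0 else a' i)" for i
  have fs: "b i * s + a1 i = fibre_scale b a' i s" for i s by (simp add: fibre_scale_def a1_def)
  have pos: "b i * s + a1 i > 0" if "i \<in> {1..m} - {1}" "s \<in> {0..1}" for i s
  proof -
    have "i \<in> {2..m}" using that(1) by auto
    then show ?thesis unfolding fs using a' that(2) unfolding parameters_def by blast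
  qed
  have b1': "b 1 = 1 / (real (n 1) + 1)" unfolding b1 n_def by (simp add: field_simps)
  obtain h' \<alpha> \<beta> where h': "profile h'" and ode: "\<And>s. s \<in> {0<..<1} \<Longrightarrow>
       - deriv (\<lambda>s. deriv h' s + h' s * (\<Sum>i=1..m. real (n i) * b i / (b i * s + a1 i))) s +
       (\<Sum>i=1..m. (1 - b i * (deriv h' s + h' s * (\<Sum>i=1..m. real (n i) * b i / (b i * s + a1 i))) / 2) * (2 * real (n i)) / (b i * s + a1 i)) = \<alpha> * s + \<beta>"
    by (rule extremal_profile[of "{1..m}" 1 n M1 a1 b]) (use n M1 m pos b1' in \<open>auto simp: a1_def\<close>)
  obtain S F q where ch: "open S" "{0..1} \<subseteq> S" "smooth_on UNIV S F" "smooth_on UNIV S q" "F 0 = 0" "F 1 = 1"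
    "\<And>s. s \<in> {0..1} \<Longrightarrow> deriv F s > 0" "\<And>s. s \<in> {0..1} \<Longrightarrow> deriv F s * h s = h' (F s)"
    "\<And>s. s \<in> {0..1} \<Longrightarrow> q s * h s = F s - s"
    using profile_change[OF h_profile h'] by metis
  interpret C: toric_change m N gN b M E0 E1 \<rho> \<pi> \<theta> x h a g h' a' S F q
    by unfold_locales (fact h' a' ch)+
  \<comment> \<open>The curvature results are applied a second time, now to the new metric with the
    profile just found.\<close>
  interpret T: toric_metric m N gN b M E0 E1 \<rho> \<pi> \<theta> "F \<circ> x" h' a' C.gn
    by unfold_locales (rule C.new_metric)
  have "extremal_kahler_metric M C.gn"
    by (rule T.extremal[of \<alpha> \<beta>]) (use ode in \<open>simp only: T.scal_def fs n_def\<close>)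
  then show ?thesis using C.new_metric by blast
qed

theorem theorem8p10:
  fixes m :: nat
    and N :: "nat \<Rightarrow> ('q, 'n::finite) cmanifold"
    and gN :: "nat \<Rightarrow> ('q, 'n) bilinear_field"
    and b :: "nat \<Rightarrow> real"
    and M :: "('p, 'n) cmanifold"
    and E0 E1 :: "'p set"
    and \<rho> :: "real \<Rightarrow> 'p \<Rightarrow> 'p"
    and \<pi> :: "nat \<Rightarrow> 'p \<Rightarrow> 'q"
    and \<theta> :: "('p, 'n) one_form"
    and x0 :: "'p \<Rightarrow> real"
    and h0 :: "real \<Rightarrow> real"
    and a0 :: "nat \<Rightarrow> real"
    and g0 :: "('p, 'n) bilinear_field"
  assumes "fiberwise_toric_manifold m N gN b M E0 E1 \<rho> \<pi> \<theta>"
    and "fiberwise_toric_metric m N gN b M E0 E1 \<rho> \<pi> \<theta> x0 h0 a0 g0"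
  shows "parameters m b \<noteq> {} \<and>
    openin (product_topology (\<lambda>_. euclideanreal) {2..m}) (parameters m b) \<and>
    (\<exists>(x :: (nat \<Rightarrow> real) \<Rightarrow> 'p \<Rightarrow> real) (h :: (nat \<Rightarrow> real) \<Rightarrow> real \<Rightarrow> real)
       (g :: (nat \<Rightarrow> real) \<Rightarrow> ('p, 'n) bilinear_field).
       (\<forall>a \<in> parameters m b.
          fiberwise_toric_metric m N gN b M E0 E1 \<rho> \<pi> \<theta> (x a) (h a) a (g a) \<and>
          extremal_kahler_metric M (g a)) \<and>
       (\<forall>a \<in> parameters m b. \<forall>a' \<in> parameters m b.
          a \<noteq> a' \<longrightarrow> \<not> homothetic M (g a) (g a')))"
proof -
  interpret toric_metric m N gN b M E0 E1 \<rho> \<pi> \<theta> x0 h0 a0 g0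
    by unfold_locales (fact assms)+
  \<comment> \<open>Orbit parameter, profile and metric are packed into one triple, so that a single
    choice per parameter keeps them compatible.\<close>
  have "\<forall>a\<in>parameters m b. \<exists>T. fiberwise_toric_metric m N gN b M E0 E1 \<rho> \<pi> \<theta> (fst T) (fst (snd T)) a (snd (snd T)) \<and>
      extremal_kahler_metric M (snd (snd T))"
    using extremal_exists by fastforce
  then obtain T where T: "\<And>a. a \<in> parameters m b \<Longrightarrow>
      fiberwise_toric_metric m N gN b M E0 E1 \<rho> \<pi> \<theta> (fst (T a)) (fst (snd (T a))) a (snd (snd (T a))) \<and>
      extremal_kahler_metric M (snd (snd (T a)))"
    by metis
  have "\<not> homothetic M (snd (snd (T a))) (snd (snd (T a')))"
    if "a \<in> parameters m b" "a' \<in> parameters m b" "a \<noteq> a'" for a a'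
    using not_homothetic T[OF that(1)] T[OF that(2)] that(3) by blast
  \<comment> \<open>The given metric provides a parameter.\<close>
  moreover have "parameters m b \<noteq> {}" using a_param by blast
  moreover have "openin (product_topology (\<lambda>_. euclideanreal) {2..m}) (parameters m b)"
    unfolding parameters_eq by (subst openin_PiE) auto
  ultimately show ?thesis
    using T by (intro conjI exI[of _ "\<lambda>a. fst (T a)"] exI[of _ "\<lambda>a. fst (snd (T a))"] exI[of _ "\<lambda>a. snd (snd (T a))"]) auto
qed

end
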